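(* Let $\rho_1\geq0$, $\rho_2>1$, and let $\psi\in(\mathcal{S}^{\rho_1}_{\rho_2})_0(\mathbb{R})$ be a $(\rho_1,\rho_2)$-regular orthonormal wavelet with associated scaling function $\phi\in\mathcal{S}^{\rho_1}_{\rho_2}(\mathbb{R})$. Set $\sigma=\rho_1+\rho_2-1$ and let $s>\sigma$ and $t>\sigma+1$. Then: (i) If $\varphi\in(\mathcal{S}^{s-\sigma}_{t-\sigma})_0(\mathbb{R}^d)$, then $\varphi=\sum_{\lambda\in\Lambda}c^\psi_\lambda(\varphi)\psi_\lambda$ with convergence in $(\mathcal{S}^s_t)_0(\mathbb{R}^d)$. (ii) If $f\in((\mathcal{S}^s_t)_0(\mathbb{R}^d))'$, then its wavelet series $\sum_{\lambda\in\Lambda}c^\psi_\lambda(f)\psi_\lambda$ converges to $f$ in the strong dual topology of $((\mathcal{S}^{s-\sigma}_{t-\sigma})_0(\mathbb{R}^d))'$. (iii) For any $f\in((\mathcal{S}^s_t)_0(\mathbb{R}^d))'$ and $\varphi\in(\mathcal{S}^{s-\sigma}_{t-\sigma})_0(\mathbb{R}^d)$, one has the Parseval identity $\langle f,\varphi\rangle=\sum_{\lambda\in\Lambda}c^\psi_\lambda(f)\,c^{\bar\psi}_\lambda(\varphi)$.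
   Context: For $\rho_1,\rho_2\geq 0$, $\mathcal{S}^{\rho_1}_{\rho_2}(\mathbb{R}^d)$ is the set of $\varphi\in\mathcal{S}(\mathbb{R}^d)$ for which there is $h>0$ with $p_h^{\rho_1,\rho_2}(\varphi)=\sup_{x,\alpha,\beta}\frac{h^{|\alpha+\beta|}}{\alpha!^{\rho_2}\beta!^{\rho_1}}|x^\alpha\partial^\beta\varphi(x)|<\infty$, with the inductive limit topology of these norms; $(\mathcal{S}^{\rho_1}_{\rho_2})_0(\mathbb{R}^d)$ is its closed subspace of functions with $\int x^\alpha\varphi(x)\,dx=0$ for all $\alpha\in\mathbb{N}^d$ (induced topology), and $((\mathcal{S}^{\rho_1}_{\rho_2})_0(\mathbb{R}^d))'$ its dual; $\langle\cdot,\cdot\rangle$ denotes the bilinear dual pairing. A multiresolution approximation (MRA) of $L^2(\mathbb{R})$ is an increasing sequence of closed subspaces $\{V_m\}_{m\in\mathbb{Z}}$ with $\bigcap V_m=\{0\}$, $\bigcup V_m$ dense, $f(x)\in V_m\iff f(2x)\in V_{m+1}$, $V_0$ invariant under integer translations, and a scaling function $\phi$ with $\{\phi(x-n)\}_{n\in\mathbb{Z}}$ an orthonormal basis of $V_0$; it is $(\rho_1,\rho_2)$-regular if it has a scaling function $\phi\in\mathcal{S}^{\rho_1}_{\rho_2}(\mathbb{R})$. An orthonormal wavelet is $\psi\in L^2(\mathbb{R})$ such that $\{2^{m/2}\psi(2^mx-n)\}_{m,n\in\mathbb{Z}}$ is an orthonormal basis of $L^2(\mathbb{R})$; it is $(\rho_1,\rho_2)$-regular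 if $\psi\in\mathcal{S}^{\rho_1}_{\rho_2}(\mathbb{R})$ and it is the wavelet associated to a $(\rho_1,\rho_2)$-regular MRA (with scaling function $\phi\in\mathcal{S}^{\rho_1}_{\rho_2}(\mathbb{R})$). Set $Q=\{0,1\}^d\setminus\{(0,\dots,0)\}$, $\Lambda=Q\times\mathbb{Z}\times\mathbb{Z}^d$, $\psi_0=\phi$, $\psi_1=\psi$, $\psi_\epsilon(x)=\psi_{\epsilon_1}(x_1)\cdots\psi_{\epsilon_d}(x_d)$ for $\epsilon\in Q$, and $\psi_\lambda(x)=2^{md/2}\psi_\epsilon(2^mx-n)$ for $\lambda=(\epsilon,m,n)\in\Lambda$; $\{\psi_\lambda\}$ is an orthonormal basis of $L^2(\mathbb{R}^d)$. The wavelet coefficients are $c^\psi_\lambda(f)=\langle f,\overline{\psi_\lambda}\rangle$. The coefficients $c^{\bar\psi}_\lambda$ are defined in the same way starting from the pair $(\bar\phi,\bar\psi)$ in place of $(\phi,\psi)$, so $c^{\bar\psi}_\lambda(\varphi)=\langle\varphi,\psi_\lambda\rangle$. *)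

theory Defs
  imports "HOL-Analysis.Analysis"
begin

text \<open>Multi-indices are functions from the basis vectors to nat; values off the
  Basis are irrelevant.\<close>

definition mabs :: "('a::euclidean_space \<Rightarrow> nat) \<Rightarrow> nat" where
  "mabs \<alpha> = (\<Sum>b\<in>Basis. \<alpha> b)"

definition mfact :: "('a::euclidean_space \<Rightarrow> nat) \<Rightarrow> real" where
  "mfact \<alpha> = (\<Prod>b\<in>Basis. fact (\<alpha> b))"

definition xpow :: "('a::euclidean_space \<Rightarrow> nat) \<Rightarrow> 'a \<Rightarrow> real" where
  "xpow \<alpha> x = (\<Prod>b\<in>Basis. (x \<bullet> b) ^ (\<alpha> b))"

definition partial :: "'a::euclidean_space \<Rightarrow> ('a \<Rightarrow> complex) \<Rightarrow> 'a \<Rightarrow> complex" where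
  "partial b f x = vector_derivative (\<lambda>t::real. f (x + t *\<^sub>R b)) (at 0)"

fun dlist :: "'a::euclidean_space list \<Rightarrow> ('a \<Rightarrow> complex) \<Rightarrow> 'a \<Rightarrow> complex" where
  "dlist [] f = f"
| "dlist (b # bs) f = partial b (dlist bs f)"

text \<open>Mixed derivative of multi-order beta (order of differentiation fixed by choice;
  irrelevant for the smooth functions considered).\<close>
definition Dmulti :: "('a::euclidean_space \<Rightarrow> nat) \<Rightarrow> ('a \<Rightarrow> complex) \<Rightarrow> 'a \<Rightarrow> complex" where
  "Dmulti \<beta> f = dlist (SOME l. set l \<subseteq> Basis \<and> (\<forall>b\<in>Basis. count_list l b = \<beta> b)) f"

definition schwartz :: "('a::euclidean_space \<Rightarrow> complex) \<Rightarrow> bool" where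
  "schwartz f \<longleftrightarrow>
     (\<forall>l. set l \<subseteq> Basis \<longrightarrow>
        continuous_on UNIV (dlist l f) \<and>
        (\<forall>x. \<forall>b\<in>Basis. (\<lambda>t::real. dlist l f (x + t *\<^sub>R b)) differentiable (at 0)) \<and>
        (\<forall>\<alpha>. bounded (range (\<lambda>x. of_real (xpow \<alpha> x) * dlist l f x))))"

definition gs_vals :: "real \<Rightarrow> real \<Rightarrow> real \<Rightarrow> ('a::euclidean_space \<Rightarrow> complex) \<Rightarrow> real set" where
  "gs_vals h r1 r2 f = {h ^ (mabs \<alpha> + mabs \<beta>) / (mfact \<alpha> powr r2 * mfact \<beta> powr r1)
        * cmod (of_real (xpow \<alpha> x) * Dmulti \<beta> f x) | x \<alpha> \<beta>. True}"

definition gs_bdd :: "real \<Rightarrow> real \<Rightarrow> real \<Rightarrow> ('a::euclidean_space \<Rightarrow> complex) \<Rightarrow> bool" where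
  "gs_bdd h r1 r2 f \<longleftrightarrow> bdd_above (gs_vals h r1 r2 f)"

text \<open>The norm p_h^{r1,r2} (meaningful when gs_bdd holds).\<close>
definition gs_norm :: "real \<Rightarrow> real \<Rightarrow> real \<Rightarrow> ('a::euclidean_space \<Rightarrow> complex) \<Rightarrow> real" where
  "gs_norm h r1 r2 f = Sup (gs_vals h r1 r2 f)"

text \<open>S^{r1}_{r2}: r1 weighs derivatives, r2 weighs powers of x.\<close>
definition GS :: "real \<Rightarrow> real \<Rightarrow> ('a::euclidean_space \<Rightarrow> complex) set" where
  "GS r1 r2 = {f. schwartz f \<and> (\<exists>h>0. gs_bdd h r1 r2 f)}"

definition GS0 :: "real \<Rightarrow> real \<Rightarrow> ('a::euclidean_space \<Rightarrow> complex) set" where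
  "GS0 r1 r2 = {f \<in> GS r1 r2. \<forall>\<alpha>. (LINT x|lborel. of_real (xpow \<alpha> x) * f x) = 0}"

text \<open>Continuous seminorms for the locally convex inductive limit topology of the
  Banach steps S_h = {f. p_h(f) < infinity}: seminorms on GS whose restriction to every
  step is continuous.\<close>
definition gs_cseminorm :: "real \<Rightarrow> real \<Rightarrow> (('a::euclidean_space \<Rightarrow> complex) \<Rightarrow> real) \<Rightarrow> bool" where
  "gs_cseminorm r1 r2 q \<longleftrightarrow>
     (\<forall>f\<in>GS r1 r2. \<forall>g\<in>GS r1 r2. q (\<lambda>x. f x + g x) \<le> q f + q g) \<and>
     (\<forall>f\<in>GS r1 r2. \<forall>c::complex. q (\<lambda>x. c * f x) = cmod c * q f) \<and>
     (\<forall>h>0. \<exists>C. \<forall>f\<in>GS r1 r2. gs_bdd h r1 r2 f \<longrightarrow> q f \<le> C * gs_norm h r1 r2 f)"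

text \<open>Convergence along a filter in S^{r1}_{r2} (equivalently in any subspace with the
  induced topology, e.g. (S^{r1}_{r2})_0).\<close>
definition gs_tendsto :: "real \<Rightarrow> real \<Rightarrow> ('i \<Rightarrow> 'a::euclidean_space \<Rightarrow> complex)
     \<Rightarrow> ('a \<Rightarrow> complex) \<Rightarrow> 'i filter \<Rightarrow> bool" where
  "gs_tendsto r1 r2 X a F \<longleftrightarrow>
     (\<forall>q. gs_cseminorm r1 r2 q \<longrightarrow> ((\<lambda>i. q (\<lambda>x. X i x - a x)) \<longlongrightarrow> 0) F)"

text \<open>Bounded subsets (bounded in S^{r1}_{r2}; for subsets of the closed subspace this is
  boundedness for the induced topology).\<close>
definition gs_bounded :: "real \<Rightarrow> real \<Rightarrow> ('a::euclidean_space \<Rightarrow> complex) set \<Rightarrow> bool" where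
  "gs_bounded r1 r2 B \<longleftrightarrow> B \<subseteq> GS r1 r2 \<and>
     (\<forall>q. gs_cseminorm r1 r2 q \<longrightarrow> bdd_above (q ` B))"

text \<open>The dual ((S^{r1}_{r2})_0)': linear functionals on (S^{r1}_{r2})_0 continuous for the
  induced topology, i.e. dominated by a continuous seminorm of S^{r1}_{r2}.\<close>
definition gs0_dual :: "real \<Rightarrow> real \<Rightarrow> (('a::euclidean_space \<Rightarrow> complex) \<Rightarrow> complex) \<Rightarrow> bool" where
  "gs0_dual r1 r2 T \<longleftrightarrow>
     (\<forall>f\<in>GS0 r1 r2. \<forall>g\<in>GS0 r1 r2. T (\<lambda>x. f x + g x) = T f + T g) \<and>
     (\<forall>f\<in>GS0 r1 r2. \<forall>c. T (\<lambda>x. c * f x) = c * T f) \<and>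
     (\<exists>q. gs_cseminorm r1 r2 q \<and> (\<forall>f\<in>GS0 r1 r2. cmod (T f) \<le> q f))"

definition sqint :: "(real \<Rightarrow> complex) \<Rightarrow> bool" where
  "sqint f \<longleftrightarrow> f \<in> borel_measurable lborel \<and> integrable lborel (\<lambda>x. (cmod (f x))\<^sup>2)"

definition l2inner :: "(real \<Rightarrow> complex) \<Rightarrow> (real \<Rightarrow> complex) \<Rightarrow> complex" where
  "l2inner f g = (LINT x|lborel. f x * cnj (g x))"

definition l2norm :: "(real \<Rightarrow> complex) \<Rightarrow> real" where
  "l2norm f = sqrt (LINT x|lborel. (cmod (f x))\<^sup>2)"

definition l2subspace :: "(real \<Rightarrow> complex) set \<Rightarrow> bool" where
  "l2subspace V \<longleftrightarrow> V \<subseteq> Collect sqint \<and> (\<lambda>x. 0) \<in> V \<and>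
     (\<forall>f\<in>V. \<forall>g\<in>V. (\<lambda>x. f x + g x) \<in> V) \<and> (\<forall>f\<in>V. \<forall>c. (\<lambda>x. c * f x) \<in> V)"

definition l2closed :: "(real \<Rightarrow> complex) set \<Rightarrow> bool" where
  "l2closed V \<longleftrightarrow> (\<forall>f. sqint f \<and> (\<forall>e>0. \<exists>g\<in>V. l2norm (\<lambda>x. f x - g x) < e) \<longrightarrow> f \<in> V)"

definition l2dense :: "(real \<Rightarrow> complex) set \<Rightarrow> bool" where
  "l2dense V \<longleftrightarrow> (\<forall>f. sqint f \<longrightarrow> (\<forall>e>0. \<exists>g\<in>V. l2norm (\<lambda>x. f x - g x) < e))"

definition l2_onb :: "('i \<Rightarrow> real \<Rightarrow> complex) \<Rightarrow> 'i set \<Rightarrow> (real \<Rightarrow> complex) set \<Rightarrow> bool" where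
  "l2_onb e I V \<longleftrightarrow> (\<forall>i\<in>I. e i \<in> V) \<and>
     (\<forall>i\<in>I. \<forall>j\<in>I. l2inner (e i) (e j) = (if i = j then 1 else 0)) \<and>
     (\<forall>f\<in>V. \<forall>e'>0. \<exists>F c. finite F \<and> F \<subseteq> I \<and>
         l2norm (\<lambda>x. f x - (\<Sum>i\<in>F. c i * e i x)) < e')"

definition is_mra :: "(int \<Rightarrow> (real \<Rightarrow> complex) set) \<Rightarrow> (real \<Rightarrow> complex) \<Rightarrow> bool" where
  "is_mra V \<phi> \<longleftrightarrow>
     (\<forall>m. l2subspace (V m) \<and> l2closed (V m)) \<and>
     (\<forall>m. V m \<subseteq> V (m + 1)) \<and>
     (\<forall>f. (\<forall>m. f \<in> V m) \<longrightarrow> l2norm f = 0) \<and>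
     l2dense (\<Union>m. V m) \<and>
     (\<forall>m f. f \<in> V m \<longleftrightarrow> (\<lambda>x. f (2 * x)) \<in> V (m + 1)) \<and>
     (\<forall>f\<in>V 0. \<forall>n::int. (\<lambda>x. f (x - of_int n)) \<in> V 0) \<and>
     l2_onb (\<lambda>n::int. \<lambda>x. \<phi> (x - of_int n)) UNIV (V 0)"

definition orthonormal_wavelet :: "(real \<Rightarrow> complex) \<Rightarrow> bool" where
  "orthonormal_wavelet \<psi> \<longleftrightarrow>
     l2_onb (\<lambda>(m::int, n::int). \<lambda>x. of_real (2 powr (of_int m / 2)) * \<psi> (2 powr of_int m * x - of_int n))
       UNIV (Collect sqint)"

definition assoc_wavelet :: "(int \<Rightarrow> (real \<Rightarrow> complex) set) \<Rightarrow> (real \<Rightarrow> complex) \<Rightarrow> bool" where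
  "assoc_wavelet V \<psi> \<longleftrightarrow>
     l2_onb (\<lambda>n::int. \<lambda>x. \<psi> (x - of_int n)) UNIV {f \<in> V 1. \<forall>g\<in>V 0. l2inner f g = 0}"

definition regular_wavelet :: "real \<Rightarrow> real \<Rightarrow> (real \<Rightarrow> complex) \<Rightarrow> (real \<Rightarrow> complex) \<Rightarrow> bool" where
  "regular_wavelet r1 r2 \<phi> \<psi> \<longleftrightarrow>
     orthonormal_wavelet \<psi> \<and> \<psi> \<in> GS r1 r2 \<and> \<phi> \<in> GS r1 r2 \<and>
     (\<exists>V. is_mra V \<phi> \<and> assoc_wavelet V \<psi>)"

definition wQ :: "('d::finite \<Rightarrow> bool) set" where
  "wQ = {\<epsilon>. \<epsilon> \<noteq> (\<lambda>_. False)}"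

definition wLambda :: "(('d::finite \<Rightarrow> bool) \<times> int \<times> ('d \<Rightarrow> int)) set" where
  "wLambda = wQ \<times> UNIV \<times> UNIV"

definition wpsi :: "(real \<Rightarrow> complex) \<Rightarrow> (real \<Rightarrow> complex)
     \<Rightarrow> ('d::finite \<Rightarrow> bool) \<times> int \<times> ('d \<Rightarrow> int) \<Rightarrow> real ^ 'd \<Rightarrow> complex" where
  "wpsi \<phi> \<psi> lam = (case lam of (\<epsilon>, m, n) \<Rightarrow> (\<lambda>x.
      of_real (2 powr (of_int m * real CARD('d) / 2)) *
      (\<Prod>i\<in>UNIV. (if \<epsilon> i then \<psi> else \<phi>) (2 powr of_int m * x $ i - of_int (n i)))))"

end

theory Submission
  imports Defs "HOL-Probability.Sinc_Integral"
begin

text \<open>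
  Taylor expansion against vanishing moments makes the coefficients of a test function in
  \<open>GS0 (s - \<sigma>) (t - \<sigma>)\<close> decay like \<open>exp (- c N)\<close>, where \<open>N\<close> combines suitable fractional powers of
  \<open>2 powr \<bar>m\<bar>\<close> and of the position \<open>2 powr - m * n\<close>: at fine scales the moments of \<open>\<psi>\<close> in a single
  coordinate are used, at coarse scales those of the test function. On the other hand, for every
  \<open>\<delta> > 0\<close> the norm \<open>gs_norm h s t\<close> of a wavelet is at most a multiple of \<open>exp (\<delta> N)\<close> once \<open>h\<close> is
  small. Hence the wavelet series converges absolutely in a single step of the inductive limit,
  uniformly over test functions bounded in a single step. Its sum is identified pointwise: the
  partial sums over scales telescope by the two-scale identity for the reproducing kernels of
  \<open>\<phi>\<close> and \<open>\<psi>\<close>, and the kernels of \<open>\<phi>\<close> have integral one because the spaces of the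
  multiresolution approximation are dense.

  Bounded sets lie in a single step, since weighting the derivatives and powers of order \<open>k\<close> by
  any sequence that beats every geometric one gives a continuous seminorm. Applying a functional to
  the expansion associated with the conjugate pair then yields the statements about the dual.
\<close>

subsection \<open>Stretched exponentials and factorial growth\<close>

text \<open>The loss \<sigma> is what makes two exponents meet. In the space with indices
  \<open>s\<close> and \<open>t\<close>, dilating a wavelet by X costs X^b / b!^(s - r1) in the
  derivatives and X^(-a) / a!^(t - r2) in the powers, that is, the exponential of a small multiple
  of X^(1/(s - r1)) + X^(-1/(t - r2)). In a coefficient, a Taylor expansion of order N contributes
  at fine scales N!^(s - \<sigma>) from the test function, N!^r2 from the powers absorbed by the
  wavelet and 1/N! from the remainder; at coarse scales it contributes N!^(t - \<sigma>), N!^r1 and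
  1/N!. The totals are N!^(s - r1) and N!^(t - r2), so that exploiting all N yields decay in exactly
  the same powers of X. The decay rate is fixed while the growth rate is as small as desired, hence
  part of the decay survives.

  L^2 theory is used on the line only, to turn the orthonormal bases into two identities between
  kernels. These survive conjugation and tensor products, so that completeness of the wavelets on
  the d-dimensional space is never invoked.\<close>

definition sexp :: "real \<Rightarrow> real \<Rightarrow> real \<Rightarrow> real" where
  "sexp r c x = exp (- c * \<bar>x\<bar> powr (1 / r))"

lemma sexp_pos [simp]: "sexp r c x > 0" and sexp_nonneg [simp]: "sexp r c x \<ge> 0"
  by (simp_all add: sexp_def)

lemma sexp_le_1: "c \<ge> 0 \<Longrightarrow> sexp r c x \<le> 1"
  by (simp add: sexp_def)

lemma sexp_add: "sexp r (c + d) x = sexp r c x * sexp r d x"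
  by (simp add: sexp_def exp_add [symmetric] algebra_simps)

lemma sexp_antimono: "c \<ge> 0 \<Longrightarrow> r > 0 \<Longrightarrow> \<bar>x\<bar> \<le> \<bar>y\<bar> \<Longrightarrow> sexp r c y \<le> sexp r c x"
  by (auto simp: sexp_def intro!: mult_left_mono powr_mono2)

lemma sexp_mono_rate: "c \<le> d \<Longrightarrow> sexp r d x \<le> sexp r c x"
  by (auto simp: sexp_def intro!: mult_right_mono)

lemma sexp_scale: "a \<ge> 0 \<Longrightarrow> sexp r c (a * x) = sexp r (c * a powr (1/r)) x"
  by (simp add: sexp_def abs_mult powr_mult)

lemma borel_measurable_sexp [measurable]: "sexp r c \<in> borel_measurable borel"
  unfolding sexp_def [abs_def] by measurable

lemma sums_exp_divide_fact: "(\<lambda>n. (x::real) ^ n / fact n) sums exp x"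
  using exp_converges [of x] by (simp add: divide_inverse mult.commute)

lemma power_le_fact_exp_real:
  assumes "w \<ge> (0::real)" shows "w ^ a \<le> fact a * exp w"
proof -
  note s = sums_exp_divide_fact [of w]
  have "(\<Sum>n\<in>{a}. w ^ n / fact n) \<le> exp w"
    using sum_le_suminf[of "\<lambda>n. w ^ n / fact n" "{a}"] s assms by (auto simp: sums_iff)
  thus ?thesis by (simp add: field_simps)
qed

text \<open>The case \<open>r = 1\<close> keeps one term of the exponential series. The general case
  applies it to \<open>z powr (1/r)\<close> and raises the result to the power
  \<open>r\<close>.\<close>

lemma power_le_fact_exp:
  assumes "z \<ge> (0::real)" "r > 0" shows "z ^ a \<le> fact a powr r * exp (r * z powr (1/r))"
proof (cases "z = 0")
  case True
  have "(1::real) \<le> fact a powr r" using assms by (simp add: ge_one_powr_ge_zero)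
  then show ?thesis using True by (cases a) auto
next
  case False
  define w where "w = z powr (1/r)"
  have "(w ^ a) powr r \<le> (fact a * exp w) powr r"
    by (rule powr_mono2) (use assms power_le_fact_exp_real[of w a] in \<open>auto simp: w_def\<close>)
  moreover have "(w ^ a) powr r = z ^ a"
    using assms False by (simp add: w_def powr_realpow [symmetric] powr_powr)
  ultimately show ?thesis by (simp add: powr_mult exp_powr_real w_def mult.commute)
qed

lemma power_sexp_le:
  assumes "c > 0" "r > 0"
  shows "\<bar>z\<bar> ^ a * sexp r c z \<le> ((r / c) powr r) ^ a * fact a powr r"
proof -
  \<comment> \<open>\<open>B\<close> is the scaling for which
    \<open>r * (\<bar>z\<bar> / B) powr (1/r)\<close> is exactly the exponent
    \<open>c * \<bar>z\<bar> powr (1/r)\<close> of \<open>sexp\<close>.\<close>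
  define B where "B = (r/c) powr r"
  have B: "B > 0" using assms by (simp add: B_def)
  have "(\<bar>z\<bar> / B) ^ a \<le> fact a powr r * exp (r * (\<bar>z\<bar> / B) powr (1/r))"
    by (rule power_le_fact_exp) (use assms B in auto)
  also have "r * (\<bar>z\<bar> / B) powr (1/r) = c * \<bar>z\<bar> powr (1/r)"
    using assms by (simp add: powr_divide powr_mult B_def powr_powr)
  finally have "\<bar>z\<bar> ^ a \<le> B ^ a * (fact a powr r * exp (c * \<bar>z\<bar> powr (1/r)))"
    using B by (simp add: power_divide field_simps)
  hence "\<bar>z\<bar> ^ a * sexp r c z \<le> B ^ a * (fact a powr r * exp (c * \<bar>z\<bar> powr (1/r))) * sexp r c z"
    by (rule mult_right_mono) simp
  also have "\<dots> = B ^ a * fact a powr r"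
    by (simp add: sexp_def exp_minus)
  finally show ?thesis by (simp add: B_def)
qed

text \<open>Converse of \<open>power_sexp_le\<close>: factorial control of all powers is stretched
  exponential decay. The \<open>r\<close>-th root of the hypothesis reads
  \<open>w ^ a * v powr (1/r) \<le> C powr (1/r) * fact a\<close>; dividing by
  \<open>2 ^ a * fact a\<close> and summing over \<open>a\<close> gives an exponential series
  against a geometric one. The halved rate and the factor \<open>2 powr r\<close> come from this
  geometric series.\<close>

lemma decay_of_moments:
  fixes x v C K r :: real
  assumes "r > 0" "K > 0" "v \<ge> 0" "x \<ge> 0"
    and m: "\<And>a. x ^ a * v \<le> C * K ^ a * fact a powr r"
  shows "v \<le> 2 powr r * C * sexp r (r / 2 * (1/K) powr (1/r)) x"
proof -
  have C: "C \<ge> 0" using m[of 0] assms by simp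
  define w where "w = (x / K) powr (1/r)"
  have w: "w \<ge> 0" by (simp add: w_def)
  have wa: "w ^ a * v powr (1/r) \<le> C powr (1/r) * fact a" for a
  proof -
    have "((x/K) ^ a * v) powr (1/r) \<le> (C * fact a powr r) powr (1/r)"
      by (rule powr_mono2) (use assms m[of a] in \<open>auto simp: power_divide field_simps\<close>)
    moreover have "((x/K) ^ a) powr (1/r) = w ^ a"
    proof (cases "x = 0")
      case True then show ?thesis by (cases a) (auto simp: w_def)
    next
      case False
      then show ?thesis using assms by (simp add: w_def powr_realpow [symmetric] powr_powr mult.commute)
    qed
    ultimately show ?thesis using assms C by (simp add: powr_mult powr_powr)
  qed
  have s1: "(\<lambda>n. (w/2) ^ n / fact n * v powr (1/r)) sums (exp (w/2) * v powr (1/r))"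
    by (rule sums_mult2 [OF sums_exp_divide_fact])
  have s2: "(\<lambda>n. C powr (1/r) * (1/2) ^ n) sums (C powr (1/r) * 2)"
    using sums_mult [OF geometric_sums [of "1/2::real"], of "C powr (1/r)"] by simp
  have "exp (w/2) * v powr (1/r) \<le> C powr (1/r) * 2"
  proof (rule sums_le [OF _ s1 s2])
    fix n
    have "(w/2) ^ n / fact n * v powr (1/r) = (w ^ n * v powr (1/r)) / (2^n * fact n)"
      by (simp add: power_divide)
    also have "\<dots> \<le> (C powr (1/r) * fact n) / (2^n * fact n)"
      by (rule divide_right_mono [OF wa]) auto
    also have "\<dots> = C powr (1/r) * (1/2) ^ n" by (simp add: power_divide)
    finally show "(w/2) ^ n / fact n * v powr (1/r) \<le> C powr (1/r) * (1/2) ^ n" .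
  qed
  hence "(exp (w/2) * v powr (1/r)) powr r \<le> (C powr (1/r) * 2) powr r"
    by (intro powr_mono2) (use assms in auto)
  hence "exp (w/2) powr r * v \<le> C * 2 powr r"
    using assms C by (simp add: powr_mult powr_powr)
  hence "exp (r/2 * w) * v \<le> 2 powr r * C" by (simp add: exp_powr_real mult_ac)
  moreover have "sexp r (r / 2 * (1/K) powr (1/r)) x = exp (- (r/2 * w))"
    using assms by (simp add: sexp_def w_def powr_divide)
  ultimately have "exp (r/2 * w) * v * exp (- (r/2*w)) \<le> 2 powr r * C * sexp r (r / 2 * (1/K) powr (1/r)) x"
    by (simp only:) (rule mult_right_mono, auto)
  moreover have "exp (r/2 * w) * v * exp (- (r/2*w)) = v" by (simp add: exp_minus field_simps)
  ultimately show ?thesis by (simp only:)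
qed

lemma sexp_mult_power_bounded:
  assumes "c > 0" "r > 0"
  obtains C where "C > 0" "\<And>x. sexp r c x * (1 + \<bar>x\<bar>) ^ k \<le> C"
proof
  let ?C = "2 ^ k * (1 + ((r / c) powr r) ^ k * fact k powr r)"
  show "?C > 0" by (simp add: add_pos_nonneg)
  fix x :: real
  have "(1 + \<bar>x\<bar>) ^ k \<le> (2 * max 1 \<bar>x\<bar>) ^ k" by (intro power_mono) auto
  also have "\<dots> \<le> 2 ^ k * (1 + \<bar>x\<bar> ^ k)" by (auto simp: power_mult_distrib max_def)
  finally have "sexp r c x * (1 + \<bar>x\<bar>) ^ k \<le> sexp r c x * (2 ^ k * (1 + \<bar>x\<bar> ^ k))"
    by (intro mult_left_mono) auto
  also have "\<dots> = 2 ^ k * (sexp r c x + \<bar>x\<bar> ^ k * sexp r c x)" by (simp add: algebra_simps)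
  also have "\<dots> \<le> ?C"
    using power_sexp_le[OF assms, of x k] sexp_le_1[of c r x] assms
    by (intro mult_left_mono add_mono) auto
  finally show "sexp r c x * (1 + \<bar>x\<bar>) ^ k \<le> ?C" .
qed

lemma powr_inverse_le:
  fixes z :: real assumes "z \<ge> 0" "0 < r" "r \<le> t" shows "z powr (1/t) \<le> 1 + z powr (1/r)"
proof (cases "z \<le> 1")
  case True
  have "z powr (1/t) \<le> 1" using assms True by (simp add: powr_le1)
  then show ?thesis by (smt (verit) powr_ge_zero)
next
  case False
  have "z powr (1/t) \<le> z powr (1/r)" using False assms by (intro powr_mono) (auto simp: field_simps)
  then show ?thesis by simp
qed

text \<open>A smaller index means faster decay at infinity; the factor \<open>exp c\<close> pays for
  the unit interval, where the comparison of the powers is reversed.\<close>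

lemma sexp_le_sexp:
  assumes "0 < r" "r \<le> t" "c \<ge> 0" shows "sexp r c x \<le> exp c * sexp t c x"
proof -
  have "- c * \<bar>x\<bar> powr (1/r) \<le> c + - c * \<bar>x\<bar> powr (1/t)"
    using mult_left_mono[OF powr_inverse_le[of "\<bar>x\<bar>" r t] assms(3)] assms by (simp add: algebra_simps)
  thus ?thesis by (simp add: sexp_def exp_add [symmetric])
qed

text \<open>With A = X^(1/(t-r)) and B = Y^(1/r) the left side is the weighted geometric mean of A
  and B, hence at most their maximum. It lets decay in the scale and decay of index \<open>r\<close>
  in the translation combine to decay of index \<open>t\<close> in their product.\<close>

lemma powr_mult_le_add:
  fixes X Y :: real assumes "X \<ge> 0" "Y \<ge> 0" "0 < r" "r < t"
  shows "(X * Y) powr (1/t) \<le> X powr (1/(t-r)) + Y powr (1/r)"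
proof (cases "X = 0 \<or> Y = 0")
  case True then show ?thesis by auto
next
  case False
  define A where "A = X powr (1/(t-r))"
  define B where "B = Y powr (1/r)"
  have AB: "A > 0" "B > 0" using False assms by (auto simp: A_def B_def)
  have X: "X = A powr (t-r)" and Y: "Y = B powr r"
    using False assms by (auto simp: A_def B_def powr_powr)
  have "(X * Y) powr (1/t) = A powr ((t-r)/t) * B powr (r/t)"
    using AB by (simp add: X Y powr_mult powr_powr)
  also have "\<dots> \<le> max A B powr ((t-r)/t) * max A B powr (r/t)"
    using assms AB by (intro mult_mono powr_mono2) auto
  also have "\<dots> = max A B" using assms AB by (simp add: powr_add [symmetric] add_divide_distrib [symmetric])
  finally show ?thesis using AB unfolding A_def [symmetric] B_def [symmetric] by linarith
qed

section \<open>Lattice sums and integrals of inverse squares\<close>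

lemma peetre: fixes u v :: real shows "1 + (u + v)\<^sup>2 \<le> 2 * (1 + u\<^sup>2) * (1 + v\<^sup>2)"
proof -
  have "(u - v)\<^sup>2 \<ge> 0" "(u * v)\<^sup>2 \<ge> 0" by simp_all
  thus ?thesis by (simp add: power2_eq_square algebra_simps)
qed

lemma summable_on_inverse_square_int: "(\<lambda>n::int. 1 / (1 + (real_of_int n)\<^sup>2)) summable_on UNIV"
proof -
  have n: "(\<lambda>n::nat. 1 / (1 + (real n)\<^sup>2)) summable_on UNIV"
  proof (subst summable_on_UNIV_nonneg_real_iff)
    have "summable (\<lambda>n. 1 / (real (Suc n))\<^sup>2)"
      using inverse_squares_sums by (simp add: sums_iff)
    hence s: "summable (\<lambda>n. 1 / (real n)\<^sup>2)" by (subst (asm) summable_Suc_iff)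
    show "summable (\<lambda>n. 1 / (1 + (real n)\<^sup>2))"
      by (rule summable_comparison_test'[OF s, of 1]) (auto intro!: divide_left_mono simp: add_pos_nonneg)
  qed auto
  have "(\<lambda>n::int. 1 / (1 + (real_of_int n)\<^sup>2)) summable_on (range int)"
    by (subst summable_on_reindex) (use n in \<open>auto simp: o_def\<close>)
  moreover have "(\<lambda>n::int. 1 / (1 + (real_of_int n)\<^sup>2)) summable_on (range (\<lambda>n. - int n))"
    by (subst summable_on_reindex) (use n in \<open>auto simp: o_def inj_on_def\<close>)
  ultimately have "(\<lambda>n::int. 1 / (1 + (real_of_int n)\<^sup>2)) summable_on (range int \<union> range (\<lambda>n. - int n))"
    by (rule summable_on_union)
  moreover have "range int \<union> range (\<lambda>n. - int n) = UNIV"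
    by (auto simp: image_iff) (metis int_cases2)
  ultimately show ?thesis by simp
qed

text \<open>The bound has to be uniform in \<open>x\<close>. Shifting the lattice by the integer
  part leaves an offset \<open>f\<close> in the unit interval, for which Peetre's inequality costs
  at most 2 * (1 + 1) = 4.\<close>

lemma summable_shifted_inverse_square:
  "(\<lambda>n::int. 1 / (1 + (x - real_of_int n)\<^sup>2)) summable_on UNIV" (is ?t1)
  and infsum_shifted_inverse_square: "(\<Sum>\<^sub>\<infinity>n::int. 1 / (1 + (x - real_of_int n)\<^sup>2))
    \<le> 4 * (\<Sum>\<^sub>\<infinity>n::int. 1 / (1 + (real_of_int n)\<^sup>2))" (is ?t2)
proof -
  define f where "f = frac x"
  define k where "k = \<lfloor>x\<rfloor>"
  have f: "0 \<le> f" "f < 1" "x = of_int k + f" by (auto simp: f_def k_def frac_lt_1) (simp add: frac_def)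
  have le: "1 / (1 + (x - real_of_int n)\<^sup>2) \<le> 4 * (1 / (1 + (real_of_int (n - k))\<^sup>2))" for n
  proof -
    have "1 + (real_of_int (n-k))\<^sup>2 \<le> 2 * (1 + (of_int n - x)\<^sup>2) * (1 + f\<^sup>2)"
      using peetre[of "of_int n - x" f] f by simp
    also have "\<dots> \<le> 2 * (1 + (of_int n - x)\<^sup>2) * (1 + 1)"
      using f by (intro mult_left_mono add_mono) (auto simp: power_le_one)
    finally have "1 + (real_of_int (n-k))\<^sup>2 \<le> 4 * (1 + (x - of_int n)\<^sup>2)"
      by (simp add: power2_commute)
    thus ?thesis by (simp add: divide_simps add_pos_nonneg)
  qed
  have bij: "bij (\<lambda>n::int. n - k)" by (rule bij_betw_byWitness[where f' = "\<lambda>n. n + k"]) auto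
  have s: "(\<lambda>n::int. 4 * (1 / (1 + (real_of_int (n - k))\<^sup>2))) summable_on UNIV"
    by (rule summable_on_cmult_right)
       (subst summable_on_reindex_bij_betw[OF bij, of "\<lambda>n. 1 / (1 + (real_of_int n)\<^sup>2)"],
          rule summable_on_inverse_square_int)
  show 1: ?t1 by (rule summable_on_comparison_test[OF s le]) auto
  have "(\<Sum>\<^sub>\<infinity>n::int. 1 / (1 + (x - real_of_int n)\<^sup>2)) \<le> (\<Sum>\<^sub>\<infinity>n::int. 4 * (1 / (1 + (real_of_int (n - k))\<^sup>2)))"
    by (rule infsum_mono[OF 1 s le])
  also have "\<dots> = 4 * (\<Sum>\<^sub>\<infinity>n::int. 1 / (1 + (real_of_int n)\<^sup>2))"
    by (subst infsum_cmult_right', subst infsum_reindex_bij_betw[OF bij, of "\<lambda>n. 1 / (1 + (real_of_int n)\<^sup>2)"]) simp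
  finally show ?t2 .
qed

lemma integrable_inverse_square: "integrable lborel (\<lambda>x::real. 1 / (1 + (x - a)\<^sup>2))"
proof -
  have "set_integrable lborel (einterval (-\<infinity>) \<infinity>) (\<lambda>x. inverse (1 + x^2))"
    by (rule integrable_inverse_1_plus_square)
  hence "integrable lborel (\<lambda>x::real. 1 / (1 + x\<^sup>2))"
    by (simp add: set_integrable_def divide_inverse)
  from lborel_integrable_real_affine[OF this, of 1 "-a"] show ?thesis by simp
qed

text \<open>\<open>f k\<close> plays the role of the \<open>k\<close>-th derivative. The induction
  hypothesis, applied to the shifted sequence, bounds the derivative of the remainder by that of
  \<open>B * x ^ Suc N / fact (Suc N)\<close>, and the mean value inequality for vector-valued
  functions integrates this bound.\<close>

lemma Taylor_remainder_bound:
  fixes f :: "nat \<Rightarrow> real \<Rightarrow> complex"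
  assumes "\<And>k \<theta>. \<theta> \<in> {0..1} \<Longrightarrow> (f k has_vector_derivative f (Suc k) \<theta>) (at \<theta>)"
    and "\<And>\<theta>. \<theta> \<in> {0..1} \<Longrightarrow> cmod (f N \<theta>) \<le> B" and "x \<in> {0..1}"
  shows "cmod (f 0 x - (\<Sum>k<N. of_real (x ^ k / fact k) * f k 0)) \<le> B * x ^ N / fact N"
  using assms
proof (induction N arbitrary: f x)
  case 0
  then show ?case by simp
next
  case (Suc N)
  define R where "R = (\<lambda>\<theta>. f 0 \<theta> - (\<Sum>k<Suc N. of_real (\<theta> ^ k / fact k) * f k 0))"
  define R' where "R' = (\<lambda>\<theta>. f 1 \<theta> - (\<Sum>k<N. of_real (\<theta> ^ k / fact k) * f (Suc k) 0))"
  have R': "(R has_vector_derivative R' \<theta>) (at \<theta>)" if "\<theta> \<in> {0..1}" for \<theta>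
  proof -
    have "((\<lambda>\<theta>. f 0 \<theta> - (\<Sum>k<Suc N. (\<theta> ^ k / fact k) *\<^sub>R f k 0)) has_vector_derivative
      f 1 \<theta> - (\<Sum>k<Suc N. (of_nat k * \<theta> ^ (k - 1) / fact k) *\<^sub>R f k 0)) (at \<theta>)"
      using Suc.prems(1)[OF that, of 0]
      by (auto intro!: derivative_eq_intros)
    also have "(\<Sum>k<Suc N. (of_nat k * \<theta> ^ (k - 1) / fact k) *\<^sub>R f k 0) =
       (\<Sum>k<N. (\<theta> ^ k / fact k) *\<^sub>R f (Suc k) 0)"
      by (subst sum.lessThan_Suc_shift) (simp add: field_simps del: of_nat_Suc)
    finally show ?thesis by (simp add: R_def R'_def scaleR_conv_of_real)
  qed
  have b: "cmod (R' \<theta>) \<le> B * \<theta> ^ N / fact N" if "\<theta> \<in> {0..1}" for \<theta>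
    using Suc.IH[of "\<lambda>k. f (Suc k)" \<theta>] Suc.prems that by (simp add: R'_def)
  have x: "0 \<le> x" "x \<le> 1" using Suc.prems by auto
  have "cmod (R x - R 0) \<le> B * x ^ Suc N / fact (Suc N) - B * 0 ^ Suc N / fact (Suc N)"
  proof (cases "x = 0")
    case False
    hence "0 < x" using x by simp
    thus ?thesis
    proof (rule differentiable_bound_general[where f = R and f' = R' and \<phi> = "\<lambda>x. B * x ^ Suc N / fact (Suc N)"
         and \<phi>' = "\<lambda>x. B * x ^ N / fact N"])
      show "continuous_on {0..x} R"
      proof (intro continuous_at_imp_continuous_on ballI)
        fix y assume "y \<in> {0..x}"
        thus "isCont R y" using has_vector_derivative_continuous[OF R'[of y]] x by auto
      qed
      show "continuous_on {0..x} (\<lambda>x. B * x ^ Suc N / fact (Suc N))" by (intro continuous_intros) auto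
      fix y assume "0 < y" "y < x"
      thus "(R has_vector_derivative R' y) (at y)" "cmod (R' y) \<le> B * y ^ N / fact N" using R' b x by auto
      have "((\<lambda>x. B * x ^ Suc N / fact (Suc N)) has_field_derivative B * (real (Suc N) * y ^ N) / fact (Suc N)) (at y)"
        by (rule DERIV_cdivide, rule DERIV_cmult, rule DERIV_cong[OF DERIV_pow]) simp
      also have "B * (real (Suc N) * y ^ N) / fact (Suc N) = B * y ^ N / fact N"
        by (simp add: field_simps del: of_nat_Suc)
      finally show "((\<lambda>x. B * x ^ Suc N / fact (Suc N)) has_vector_derivative B * y ^ N / fact N) (at y)"
        by (simp only: has_real_derivative_iff_has_vector_derivative)
    qed
  qed auto
  moreover have "R 0 = 0" by (simp add: R_def sum.lessThan_Suc_shift del: sum.lessThan_Suc)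
  ultimately show ?case by (simp add: R_def del: sum.lessThan_Suc)
qed

subsection \<open>Integration in coordinates\<close>

lemma measurable_vec_lambda [measurable]:
  "vec_lambda \<in> measurable (Pi\<^sub>M UNIV (\<lambda>_::'d::finite. lborel :: real measure)) (borel :: (real^'d) measure)"
proof (rule borel_measurable_euclidean_space[THEN iffD2], intro ballI)
  fix b :: "real^'d" assume "b \<in> Basis"
  then obtain i where "b = axis i 1" by (auto simp: Basis_vec_def)
  thus "(\<lambda>x. vec_lambda x \<bullet> b) \<in> borel_measurable (Pi\<^sub>M UNIV (\<lambda>_::'d. lborel :: real measure))"
    by (simp add: inner_axis)
qed

text \<open>Measures are compared on boxes. The representation as a product measure is the access to
  Fubini's theorem in the coordinates of a vector.\<close>

lemma lborel_vec: "(lborel :: (real^'d::finite) measure) = distr (Pi\<^sub>M UNIV (\<lambda>_. lborel)) borel vec_lambda"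
proof (rule lborel_eqI)
  interpret product_sigma_finite "\<lambda>_::'d. lborel :: real measure" ..
  fix l u :: "real^'d" assume le: "\<And>b. b \<in> Basis \<Longrightarrow> l \<bullet> b \<le> u \<bullet> b"
  have le': "l $ i \<le> u $ i" for i using le[of "axis i 1"] by (simp add: inner_axis)
  have "emeasure (distr (Pi\<^sub>M UNIV (\<lambda>_::'d. lborel :: real measure)) borel vec_lambda) (box l u) =
     emeasure (Pi\<^sub>M UNIV (\<lambda>_::'d. lborel)) (vec_lambda -` box l u \<inter> space (Pi\<^sub>M UNIV (\<lambda>_::'d. lborel)))"
    by (rule emeasure_distr) auto
  also have "vec_lambda -` box l u \<inter> space (Pi\<^sub>M UNIV (\<lambda>_::'d. lborel)) = (\<Pi>\<^sub>E i\<in>UNIV. {l $ i <..< u $ i})"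
    by (auto simp: mem_box_cart space_PiM PiE_UNIV_domain Pi_iff)
  also have "emeasure (Pi\<^sub>M UNIV (\<lambda>_::'d. lborel)) \<dots> = (\<Prod>i\<in>UNIV. emeasure lborel {l $ i <..< u $ i})"
    by (rule emeasure_PiM) auto
  also have "\<dots> = (\<Prod>i\<in>UNIV. ennreal (u $ i - l $ i))"
    using le' by simp
  also have "\<dots> = ennreal (\<Prod>i\<in>UNIV. u $ i - l $ i)"
    using le' by (intro prod_ennreal) auto
  also have "(\<Prod>i\<in>UNIV. u $ i - l $ i) = (\<Prod>b\<in>Basis. (u - l) \<bullet> b)"
  proof -
    have B: "(Basis :: (real^'d) set) = (\<lambda>i. axis i 1) ` UNIV" by (auto simp: Basis_vec_def)
    show ?thesis unfolding B by (subst prod.reindex) (auto simp: inj_on_def axis_eq_axis inner_axis)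
  qed
  finally show "emeasure (distr (Pi\<^sub>M UNIV (\<lambda>_::'d. lborel :: real measure)) borel vec_lambda) (box l u) =
     ennreal (\<Prod>b\<in>Basis. (u - l) \<bullet> b)" .
qed simp

lemma
  fixes f :: "'d::finite \<Rightarrow> real \<Rightarrow> 'a::{real_normed_field, banach, second_countable_topology}"
  assumes "\<And>i. integrable lborel (f i)"
  shows integrable_prod_vec: "integrable lborel (\<lambda>x::real^'d. \<Prod>i\<in>UNIV. f i (x $ i))"
    and integral_prod_vec: "(LINT x|lborel. (\<Prod>i\<in>UNIV. f i (x $ i))) = (\<Prod>i\<in>UNIV. LINT x|lborel. f i x)"
proof -
  interpret product_sigma_finite "\<lambda>_::'d. lborel :: real measure" ..
  have [measurable]: "f i \<in> borel_measurable borel" for i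
    using borel_measurable_integrable[OF assms[of i]] by simp
  show "integrable lborel (\<lambda>x::real^'d. \<Prod>i\<in>UNIV. f i (x $ i))"
    unfolding lborel_vec by (subst integrable_distr_eq) (use product_integrable_prod[OF _ assms, of UNIV] in auto)
  show "(LINT x|lborel. (\<Prod>i\<in>UNIV. f i ((x::real^'d) $ i))) = (\<Prod>i\<in>UNIV. LINT x|lborel. f i x)"
    unfolding lborel_vec by (subst integral_distr) (use product_integral_prod[OF _ assms, of UNIV] in auto)
qed

text \<open>Fubini's theorem with coordinate \<open>i\<close> innermost. It allows vanishing moments
  in a single coordinate to annihilate an integrand that depends on the other coordinates in an
  arbitrary way.\<close>

lemma integral_vec_coordinate_eq_0:
  fixes F :: "real^'d::finite \<Rightarrow> complex"
  assumes int: "integrable lborel F"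
    and z: "\<And>x. (LINT v|lborel. F (\<chi> j. if j = i then v else x $ j)) = 0"
  shows "(LINT x|lborel. F x) = 0"
proof -
  interpret product_sigma_finite "\<lambda>_::'d. lborel :: real measure" ..
  have [measurable]: "F \<in> borel_measurable borel" using int by (simp add: borel_measurable_integrable)
  have ins: "insert i (UNIV - {i}) = (UNIV :: 'd set)" by auto
  have "integrable (Pi\<^sub>M UNIV (\<lambda>_::'d. lborel :: real measure)) (\<lambda>g. F (vec_lambda g))"
    using int unfolding lborel_vec by (subst (asm) integrable_distr_eq) auto
  hence i2: "integrable (Pi\<^sub>M (insert i (UNIV - {i})) (\<lambda>_::'d. lborel :: real measure)) (\<lambda>g. F (vec_lambda g))"
    by (simp only: ins)
  have "(LINT x|lborel. F x) = (LINT g|Pi\<^sub>M (insert i (UNIV - {i})) (\<lambda>_::'d. lborel :: real measure). F (vec_lambda g))"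
    unfolding lborel_vec ins by (subst integral_distr) auto
  also have "\<dots> = (LINT x|Pi\<^sub>M (UNIV - {i}) (\<lambda>_. lborel). LINT v|lborel. F (vec_lambda (x(i := v))))"
    by (rule product_integral_insert[OF _ _ i2]) auto
  also have "\<dots> = (LINT x|Pi\<^sub>M (UNIV - {i}) (\<lambda>_::'d. lborel :: real measure). 0)"
  proof (intro Bochner_Integration.integral_cong refl)
    fix x :: "'d \<Rightarrow> real"
    have "vec_lambda (x(i := v)) = (\<chi> j. if j = i then v else vec_lambda x $ j)" for v
      by (simp add: vec_eq_iff)
    thus "(LINT v|lborel. F (vec_lambda (x(i := v)))) = 0" using z[of "vec_lambda x"] by simp
  qed
  finally show ?thesis by simp
qed

lemma integral_affine:
  fixes f :: "'a::euclidean_space \<Rightarrow> complex"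
  assumes c: "c \<noteq> 0" and f: "integrable lborel f"
  shows "(LINT y|lborel. f y) = \<bar>c\<bar> ^ DIM('a) *\<^sub>R (LINT u|lborel. f (t + c *\<^sub>R u))"
proof -
  have [measurable]: "f \<in> borel_measurable borel" using f by (simp add: borel_measurable_integrable)
  show ?thesis
    by (subst lborel_affine[OF c, of t]) (simp add: integral_density integral_distr)
qed

text \<open>Termwise integration for unordered sums. The index set is moved to the natural numbers
  by \<open>to_nat_on\<close> and padded by zero off its image \<open>J\<close>, which treats finite
  and infinite index sets alike.\<close>

lemma has_sum_integral:
  fixes f :: "'i \<Rightarrow> 'b \<Rightarrow> complex"
  assumes cA: "countable A"
    and int: "\<And>i. i \<in> A \<Longrightarrow> integrable M (f i)"
    and pt: "\<And>x. x \<in> space M \<Longrightarrow> (\<lambda>i. norm (f i x)) summable_on A"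
    and sm: "(\<lambda>i. LINT x|M. norm (f i x)) summable_on A"
  shows "((\<lambda>i. LINT x|M. f i x) has_sum (LINT x|M. (\<Sum>\<^sub>\<infinity>i\<in>A. f i x))) A"
proof -
  define J where "J = to_nat_on A ` A"
  define F where "F n = (if n \<in> J then f (from_nat_into A n) else (\<lambda>_. 0))" for n
  have inj: "inj_on (to_nat_on A) A" using cA by (rule inj_on_to_nat_on)
  have FA: "F (to_nat_on A i) = f i" if "i \<in> A" for i
    using that cA by (simp add: F_def J_def)
  have F0: "F n = (\<lambda>_. 0)" if "n \<notin> J" for n
    using that by (simp add: F_def)
  have tr: "(g has_sum s) A \<longleftrightarrow> (h has_sum s) UNIV"
    if "\<And>i. i \<in> A \<Longrightarrow> g i = h (to_nat_on A i)" "\<And>n. n \<notin> J \<Longrightarrow> h n = 0"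
    for g and h :: "nat \<Rightarrow> 'z::{comm_monoid_add, topological_space}" and s
  proof -
    have "(g has_sum s) A \<longleftrightarrow> (h \<circ> to_nat_on A has_sum s) A"
      using that by (intro has_sum_cong) auto
    also have "\<dots> \<longleftrightarrow> (h has_sum s) J"
      unfolding J_def by (rule has_sum_reindex[OF inj, symmetric])
    also have "\<dots> \<longleftrightarrow> (h has_sum s) UNIV"
      using that by (intro has_sum_cong_neutral) auto
    finally show ?thesis .
  qed
  have trs: "(\<lambda>i. norm (f i x)) summable_on A \<longleftrightarrow> (\<lambda>n. norm (F n x)) summable_on UNIV" for x
    unfolding summable_on_def by (subst tr[of _ "\<lambda>n. norm (F n x)"]) (auto simp: FA F0)
  have intF: "integrable M (F n)" for n
    using int cA by (auto simp: F_def J_def)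
  have sF: "summable (\<lambda>n. norm (F n x))" if "x \<in> space M" for x
    using pt[OF that] unfolding trs by (subst (asm) summable_on_UNIV_nonneg_real_iff) auto
  have "(\<lambda>n. LINT x|M. norm (F n x)) summable_on UNIV"
    using sm unfolding summable_on_def
    by (subst (asm) tr[of _ "\<lambda>n. LINT x|M. norm (F n x)"]) (auto simp: FA F0)
  hence sI: "summable (\<lambda>n. LINT x|M. norm (F n x))"
    by (subst (asm) summable_on_UNIV_nonneg_real_iff) auto
  have eq: "(\<Sum>n. F n x) = (\<Sum>\<^sub>\<infinity>i\<in>A. f i x)" if "x \<in> space M" for x
  proof -
    have "((\<lambda>n. F n x) has_sum (\<Sum>n. F n x)) UNIV"
      using sF[OF that] by (intro norm_summable_imp_has_sum) (auto intro: summable_norm_cancel)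
    hence "((\<lambda>i. f i x) has_sum (\<Sum>n. F n x)) A"
      by (subst tr[of _ "\<lambda>n. F n x"]) (auto simp: FA F0)
    thus ?thesis by (simp add: infsumI)
  qed
  have "(\<lambda>n. LINT x|M. F n x) sums (LINT x|M. (\<Sum>n. F n x))"
    by (rule sums_integral[OF intF _ sI]) (use sF in auto)
  moreover have "summable (\<lambda>n. norm (LINT x|M. F n x))"
    by (rule summable_comparison_test'[OF sI, of 0]) (auto intro: integral_norm_bound)
  ultimately have "((\<lambda>n. LINT x|M. F n x) has_sum (LINT x|M. (\<Sum>n. F n x))) UNIV"
    by (intro norm_summable_imp_has_sum)
  hence "((\<lambda>i. LINT x|M. f i x) has_sum (LINT x|M. (\<Sum>n. F n x))) A"
    by (subst tr[of _ "\<lambda>n. LINT x|M. F n x"]) (auto simp: FA F0)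
  also have "(LINT x|M. (\<Sum>n. F n x)) = (LINT x|M. (\<Sum>\<^sub>\<infinity>i\<in>A. f i x))"
    by (intro Bochner_Integration.integral_cong) (auto simp: eq)
  finally show "((\<lambda>i. LINT x|M. f i x) has_sum (LINT x|M. (\<Sum>\<^sub>\<infinity>i\<in>A. f i x))) A" .
qed

subsection \<open>Partial derivatives\<close>

lemma schwartz_dlist: "schwartz f \<Longrightarrow> set l \<subseteq> Basis \<Longrightarrow> continuous_on UNIV (dlist l f)"
  by (simp add: schwartz_def)

text \<open>\<open>schwartz\<close> speaks of the parameter 0 only, but for every base point; moving
  the base point along the line reaches every other parameter.\<close>

lemma dlist_has_vector_derivative:
  assumes "schwartz f" "set l \<subseteq> Basis" "b \<in> Basis"
  shows "((\<lambda>t. dlist l f (x + t *\<^sub>R b)) has_vector_derivative dlist (b # l) f (x + t *\<^sub>R b)) (at t)"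
proof -
  have "(\<lambda>u::real. dlist l f ((x + t *\<^sub>R b) + u *\<^sub>R b)) differentiable (at 0)"
    using assms by (simp add: schwartz_def)
  hence "((\<lambda>u::real. dlist l f ((x + t *\<^sub>R b) + u *\<^sub>R b)) has_vector_derivative dlist (b # l) f (x + t *\<^sub>R b)) (at 0)"
    by (simp add: partial_def vector_derivative_works)
  moreover have h: "((\<lambda>u. u - t) has_vector_derivative 1) (at t)"
    by (auto intro!: derivative_eq_intros)
  ultimately have "((\<lambda>u::real. dlist l f ((x + t *\<^sub>R b) + (u - t) *\<^sub>R b)) has_vector_derivative dlist (b # l) f (x + t *\<^sub>R b)) (at t)"
    using vector_diff_chain_at[of "\<lambda>u. u - t" 1 t "\<lambda>u. dlist l f ((x + t *\<^sub>R b) + u *\<^sub>R b)"]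
    by (simp add: o_def)
  thus ?thesis by (simp add: algebra_simps)
qed

lemma Basis_vec_axis: "(Basis :: (real^'d::finite) set) = (\<lambda>i. axis i 1) ` UNIV"
  by (auto simp: Basis_vec_def)

lemma inj_axis: "inj (\<lambda>i. axis i (1::real))"
  by (auto simp: inj_on_def axis_eq_axis)

lemma sum_Basis_vec: "(\<Sum>b\<in>(Basis::(real^'d::finite) set). F b) = (\<Sum>i\<in>UNIV. F (axis i 1))"
  unfolding Basis_vec_axis by (subst sum.reindex[OF inj_axis]) simp

lemma prod_Basis_vec: "(\<Prod>b\<in>(Basis::(real^'d::finite) set). F b) = (\<Prod>i\<in>UNIV. F (axis i 1))"
  unfolding Basis_vec_axis by (subst prod.reindex[OF inj_axis]) simp

lemma xpow_vec: "xpow \<alpha> (x :: real^'d::finite) = (\<Prod>i\<in>UNIV. (x $ i) ^ \<alpha> (axis i 1))"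
  by (simp add: xpow_def prod_Basis_vec inner_axis)

section \<open>Multi-indices and decay of axis derivatives\<close>

text \<open>The list chosen inside \<open>Dmulti\<close>, named so that its multiplicities can be
  used. No estimate below depends on the order of its entries.\<close>

definition mlist :: "('a::euclidean_space \<Rightarrow> nat) \<Rightarrow> 'a list" where
  "mlist \<beta> = (SOME l. set l \<subseteq> Basis \<and> (\<forall>b\<in>Basis. count_list l b = \<beta> b))"

lemma count_list_replicate: "count_list (replicate n a) b = (if a = b then n else 0)"
  by (induction n) auto

lemma mlist_exists:
  "\<exists>l. set l \<subseteq> (Basis :: 'a::euclidean_space set) \<and> (\<forall>b\<in>Basis. count_list l b = \<beta> b)"
proof -
  have "\<exists>l. set l \<subseteq> B \<and> (\<forall>b\<in>B. count_list l b = \<beta> b)" if "finite B" for B :: "'a set"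
    using that
  proof (induction B rule: finite_induct)
    case (insert x B)
    then obtain l where l: "set l \<subseteq> B" "\<forall>b\<in>B. count_list l b = \<beta> b" by auto
    hence "count_list l x = 0" using insert.hyps by (auto simp: count_list_0_iff)
    thus ?case using l insert.hyps
      by (intro exI[of _ "replicate (\<beta> x) x @ l"]) (auto simp: count_list_replicate)
  qed auto
  thus ?thesis by simp
qed

lemma mlist: "set (mlist \<beta>) \<subseteq> Basis" "b \<in> Basis \<Longrightarrow> count_list (mlist \<beta>) b = \<beta> b"
  using someI_ex[OF mlist_exists[of \<beta>]] by (auto simp: mlist_def)

lemma Dmulti_eq: "Dmulti \<beta> f = dlist (mlist \<beta>) f"
  by (simp add: Dmulti_def mlist_def)

text \<open>If only one direction occurs, the choice in \<open>Dmulti\<close> has no freedom left,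
  and the norms speak about plain iterated derivatives, as needed for Taylor expansions in one
  variable.\<close>

lemma Dmulti_single:
  assumes b: "b \<in> Basis" and \<beta>: "\<And>c. c \<in> Basis \<Longrightarrow> \<beta> c = (if c = b then N else 0)"
  shows "Dmulti \<beta> f = dlist (replicate N b) f"
proof -
  have "x = b" if "x \<in> set (mlist \<beta>)" for x
  proof (rule ccontr)
    assume "x \<noteq> b"
    have "x \<in> Basis" using that mlist(1) by auto
    hence "count_list (mlist \<beta>) x = 0" using mlist(2)[of x \<beta>] \<beta>[of x] \<open>x \<noteq> b\<close> by simp
    thus False using that by (simp add: count_list_0_iff)
  qed
  hence r: "mlist \<beta> = replicate (length (mlist \<beta>)) b"
    by (metis replicate_length_same)
  have "count_list (mlist \<beta>) b = length (mlist \<beta>)"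
    by (subst r) (simp add: count_list_replicate)
  hence "length (mlist \<beta>) = N" using mlist(2)[OF b, of \<beta>] \<beta>[OF b] by simp
  thus ?thesis using r by (simp add: Dmulti_eq)
qed

lemma gs_bdd_le:
  assumes "gs_bdd h r1 r2 f"
  shows "h ^ (mabs \<alpha> + mabs \<beta>) / (mfact \<alpha> powr r2 * mfact \<beta> powr r1)
        * cmod (of_real (xpow \<alpha> x) * Dmulti \<beta> f x) \<le> gs_norm h r1 r2 f"
  unfolding gs_norm_def by (rule cSup_upper) (use assms in \<open>auto simp: gs_bdd_def gs_vals_def\<close>)

lemma
  assumes "\<And>\<alpha> \<beta> x. h ^ (mabs \<alpha> + mabs \<beta>) / (mfact \<alpha> powr r2 * mfact \<beta> powr r1)
        * cmod (of_real (xpow \<alpha> x) * Dmulti \<beta> f x) \<le> B"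
  shows gs_bddI: "gs_bdd h r1 r2 f" and gs_norm_leI: "gs_norm h r1 r2 f \<le> B"
proof -
  have le: "v \<le> B" if "v \<in> gs_vals h r1 r2 f" for v
    using that assms by (auto simp: gs_vals_def)
  show "gs_bdd h r1 r2 f" unfolding gs_bdd_def by (rule bdd_aboveI[of _ B]) (rule le)
  show "gs_norm h r1 r2 f \<le> B" unfolding gs_norm_def
    by (rule cSup_least) (use le in \<open>auto simp: gs_vals_def\<close>)
qed

lemma mfact_pos: "mfact \<alpha> > 0" and mfact_ge_1: "mfact \<alpha> \<ge> 1"
  by (auto simp: mfact_def intro!: prod_pos prod_ge_1)

lemma gs_norm_nonneg:
  assumes "gs_bdd h r1 r2 f" "h > 0" shows "gs_norm h r1 r2 f \<ge> 0"
  by (rule order_trans[OF _ gs_bdd_le[OF assms(1), of "\<lambda>_. 0" "\<lambda>_. 0"]]) (use assms in auto)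

text \<open>The norm is tested on multi-indices supported on one axis each: powers of any coordinate
  \<open>b'\<close> give decay in all directions, derivatives along \<open>b\<close> feed the
  one-variable Taylor formula.\<close>

lemma gs_axis_moment:
  fixes f :: "'a::euclidean_space \<Rightarrow> complex"
  assumes bd: "gs_bdd h r1 r2 f" and h: "h > 0" and b: "b \<in> Basis" and b': "b' \<in> Basis"
  shows "\<bar>x \<bullet> b'\<bar> ^ a * cmod (dlist (replicate N b) f x) \<le>
     gs_norm h r1 r2 f * (1/h) ^ (a + N) * fact a powr r2 * fact N powr r1"
proof -
  define \<alpha> where "\<alpha> c = (if c = b' then a else 0)" for c :: 'a
  define \<beta> where "\<beta> c = (if c = b then N else 0)" for c :: 'a
  have [simp]: "mabs \<alpha> = a" "mabs \<beta> = N" "mfact \<alpha> = fact a" "mfact \<beta> = fact N"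
    using b b' by (simp_all add: mabs_def mfact_def \<alpha>_def \<beta>_def if_distrib[of fact] if_distrib[of "\<lambda>x. _ ^ x"] cong: if_cong)
  have [simp]: "xpow \<alpha> x = (x \<bullet> b') ^ a"
    using b' by (simp add: xpow_def \<alpha>_def if_distrib[of "\<lambda>n. _ ^ n"] cong: if_cong)
  have D: "Dmulti \<beta> f = dlist (replicate N b) f"
    by (rule Dmulti_single[OF b]) (simp add: \<beta>_def)
  have "h ^ (a + N) / (fact a powr r2 * fact N powr r1) * (\<bar>x \<bullet> b'\<bar> ^ a * cmod (dlist (replicate N b) f x))
      \<le> gs_norm h r1 r2 f"
    using gs_bdd_le[OF bd, of \<alpha> \<beta> x] by (simp add: D norm_mult norm_power)
  thus ?thesis using h by (simp add: field_simps)
qed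

text \<open>The smallest of the one-coordinate bounds is dominated by their geometric mean.\<close>
lemma sexp_coordinates:
  fixes x :: "real^'d::finite"
  assumes "\<And>j. v \<le> A * sexp r c (x $ j)" "A \<ge> 0" "c \<ge> 0"
  shows "v \<le> A * (\<Prod>j\<in>UNIV. sexp r (c / CARD('d)) (x $ j))"
proof -
  define M where "M = Max ((\<lambda>j. \<bar>x $ j\<bar> powr (1/r)) ` UNIV)"
  have "M \<in> (\<lambda>j. \<bar>x $ j\<bar> powr (1/r)) ` UNIV" unfolding M_def by (rule Max_in) auto
  then obtain j where j: "M = \<bar>x $ j\<bar> powr (1/r)" by auto
  have "(\<Sum>i\<in>UNIV. \<bar>x $ i\<bar> powr (1/r)) \<le> (\<Sum>i\<in>(UNIV::'d set). M)"
    by (rule sum_mono) (auto simp: M_def)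
  hence "(\<Sum>i\<in>UNIV. \<bar>x $ i\<bar> powr (1/r)) \<le> CARD('d) * M" by simp
  hence "c / CARD('d) * (\<Sum>i\<in>UNIV. \<bar>x $ i\<bar> powr (1/r)) \<le> c / CARD('d) * (CARD('d) * M)"
    using assms(3) by (intro mult_left_mono) auto
  hence "sexp r c (x $ j) \<le> (\<Prod>j\<in>UNIV. sexp r (c / CARD('d)) (x $ j))"
    by (simp add: sexp_def exp_sum [symmetric] sum_negf sum_distrib_left j)
  from mult_left_mono[OF this assms(2)] assms(1)[of j] show ?thesis by simp
qed

text \<open>\<open>decay_of_moments\<close> with \<open>K = 1/h\<close> turns the bounds on powers
  into decay in each coordinate separately; combining the coordinates by
  \<open>sexp_coordinates\<close> divides the rate by \<open>CARD('d)\<close>.\<close>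

lemma gs_axis_decay:
  fixes f :: "real^'d::finite \<Rightarrow> complex"
  assumes bd: "gs_bdd h r1 r2 f" and h: "h > 0" and r2: "r2 > 0"
  shows "cmod (dlist (replicate N (axis i 1)) f x) \<le>
     2 powr r2 * gs_norm h r1 r2 f * (1/h) ^ N * fact N powr r1 *
      (\<Prod>j\<in>UNIV. sexp r2 (r2 / 2 * h powr (1/r2) / CARD('d)) (x $ j))"
proof (rule sexp_coordinates)
  fix j
  have "cmod (dlist (replicate N (axis i 1)) f x) \<le> 2 powr r2 * (gs_norm h r1 r2 f * (1/h) ^ N * fact N powr r1) *
        sexp r2 (r2 / 2 * (1/(1/h)) powr (1/r2)) \<bar>x $ j\<bar>"
  proof (rule decay_of_moments[OF r2])
    fix a
    show "\<bar>x $ j\<bar> ^ a * cmod (dlist (replicate N (axis i 1)) f x)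
          \<le> gs_norm h r1 r2 f * (1 / h) ^ N * fact N powr r1 * (1 / h) ^ a * fact a powr r2"
      using gs_axis_moment[OF bd h, of "axis i 1" "axis j 1" x a N]
      by (simp add: axis_in_Basis_iff inner_axis power_add mult_ac)
  qed (use h in auto)
  thus "cmod (dlist (replicate N (axis i 1)) f x)
         \<le> 2 powr r2 * gs_norm h r1 r2 f * (1 / h) ^ N * fact N powr r1 *
            sexp r2 (r2 / 2 * h powr (1 / r2)) (x $ j)"
    by (simp add: sexp_def mult_ac)
qed (use gs_norm_nonneg[OF bd h] h r2 in auto)

lemma gs_real_decay:
  fixes f :: "real \<Rightarrow> complex"
  assumes "f \<in> GS r1 r2" "r2 > 0"
  obtains C K c where "C > 0" "K > 0" "c > 0"
    "\<And>k u. cmod (dlist (replicate k 1) f u) \<le> C * K ^ k * fact k powr r1 * sexp r2 c u"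
proof -
  from assms obtain h where h: "h > 0" and bd: "gs_bdd h r1 r2 f" by (auto simp: GS_def)
  have n0: "gs_norm h r1 r2 f \<ge> 0" by (rule gs_norm_nonneg[OF bd h])
  show ?thesis
  \<comment> \<open>The summand 1 makes the constant positive even when the norm vanishes.\<close>
  proof (rule that[of "2 powr r2 * (gs_norm h r1 r2 f + 1)" "1/h" "r2 / 2 * (1/(1/h)) powr (1/r2)"])
    fix k u
    have "cmod (dlist (replicate k 1) f u) \<le> 2 powr r2 * (gs_norm h r1 r2 f * (1/h) ^ k * fact k powr r1) *
        sexp r2 (r2 / 2 * (1/(1/h)) powr (1/r2)) \<bar>u\<bar>"
    proof (rule decay_of_moments)
      fix a
      show "\<bar>u\<bar> ^ a * cmod (dlist (replicate k 1) f u)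
          \<le> gs_norm h r1 r2 f * (1 / h) ^ k * fact k powr r1 * (1 / h) ^ a * fact a powr r2"
        using gs_axis_moment[OF bd h, of 1 1 u a k] by (simp add: power_add mult_ac)
    qed (use h assms in auto)
    also have "\<dots> \<le> 2 powr r2 * ((gs_norm h r1 r2 f + 1) * (1/h) ^ k * fact k powr r1) *
        sexp r2 (r2 / 2 * (1/(1/h)) powr (1/r2)) \<bar>u\<bar>"
      using h by (intro mult_right_mono mult_left_mono) auto
    finally show "cmod (dlist (replicate k 1) f u) \<le> 2 powr r2 * (gs_norm h r1 r2 f + 1) * (1/h) ^ k * fact k powr r1 *
        sexp r2 (r2 / 2 * (1/(1/h)) powr (1/r2)) u"
      by (simp add: sexp_def mult_ac)
  qed (use h n0 assms in auto)
qed

section \<open>Norms of dilated and translated tensor products\<close>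

text \<open>Shrinking \<open>h\<close> makes the rate of the exponential an arbitrary \<delta> > 0.
  This is the only source of the small growth rate in the norms of the wavelets.\<close>

lemma scaled_power_le_fact_exp:
  fixes z h :: real
  assumes "z \<ge> 0" "0 \<le> h" "r > 0" "\<delta> > 0" "h \<le> (\<delta>/r) powr r"
  shows "(h * z) ^ a \<le> fact a powr r * exp (\<delta> * z powr (1/r))"
proof -
  have "(h * z) ^ a \<le> ((\<delta>/r) powr r * z) ^ a"
    using assms by (intro power_mono mult_right_mono) auto
  also have "\<dots> \<le> fact a powr r * exp (r * ((\<delta>/r) powr r * z) powr (1/r))"
    by (rule power_le_fact_exp) (use assms in auto)
  also have "r * ((\<delta>/r) powr r * z) powr (1/r) = \<delta> * z powr (1/r)"
    using assms by (simp add: powr_mult powr_powr)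
  finally show ?thesis .
qed

lemma power_add_le: fixes p q :: real assumes "p \<ge> 0" "q \<ge> 0" shows "(p + q) ^ a \<le> 2 ^ a * (p ^ a + q ^ a)"
proof -
  have "(p + q) ^ a \<le> (2 * max p q) ^ a" using assms by (intro power_mono) auto
  also have "\<dots> = 2 ^ a * max p q ^ a" by (simp add: power_mult_distrib)
  also have "\<dots> \<le> 2 ^ a * (p ^ a + q ^ a)" using assms by (intro mult_left_mono) (auto simp: max_def)
  finally show ?thesis .
qed

text \<open>One coordinate of a wavelet. With \<open>u = X * x - n\<close> the power of
  \<open>x = (u + n) / X\<close> splits into a part in \<open>u\<close>, absorbed by the decay of
  \<open>f\<close> at the price \<open>fact a powr r2\<close>, and a part in \<open>n\<close>. What
  remains are powers of \<open>X\<close>, \<open>1/X\<close> and \<open>\<bar>n\<bar>/X\<close>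
  divided by factorials to the powers \<open>s - r1\<close>, \<open>t - r2\<close> and
  \<open>t\<close>; the three smallness conditions on \<open>h\<close> treat them in this
  order.\<close>

lemma dilated_moment_bound:
  fixes f :: "real \<Rightarrow> complex"
  assumes D: "\<And>k u. cmod (dlist (replicate k 1) f u) \<le> C * K ^ k * fact k powr r1 * sexp r2 c u"
    and pos: "C > 0" "K > 0" "c > 0" "r2 > 0" and s: "s > r1" and t: "t > r2" and \<delta>: "\<delta> > 0"
    and h: "h > 0" "h * K \<le> (\<delta>/(s-r1)) powr (s-r1)" "h * 2 * (r2/c) powr r2 \<le> (\<delta>/(t-r2)) powr (t-r2)"
      "h * 2 \<le> (\<delta>/t) powr t"
    and X: "X > 0"
  shows "h ^ (a + b) / (fact a powr t * fact b powr s) * (\<bar>x\<bar> ^ a * (X ^ b * cmod (dlist (replicate b 1) f (X * x - n))))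
     \<le> 2 * C * exp (\<delta> * (X powr (1/(s-r1)) + (1/X) powr (1/(t-r2)) + (\<bar>n\<bar>/X) powr (1/t)))"
proof -
  define B where "B = (r2/c) powr r2"
  define u where "u = X * x - n"
  have B: "B > 0" using pos by (simp add: B_def)
  have x: "x = (u + n) / X" using X by (simp add: u_def)
  have "\<bar>x\<bar> ^ a = (1/X) ^ a * \<bar>u + n\<bar> ^ a" using X by (simp add: x power_divide)
  also have "\<dots> \<le> (1/X) ^ a * (\<bar>u\<bar> + \<bar>n\<bar>) ^ a"
    using X by (intro mult_left_mono power_mono) auto
  also have "\<dots> \<le> (1/X) ^ a * (2 ^ a * (\<bar>u\<bar> ^ a + \<bar>n\<bar> ^ a))"
    using X by (intro mult_left_mono power_add_le) auto
  finally have xa: "\<bar>x\<bar> ^ a \<le> (1/X) ^ a * (2 ^ a * (\<bar>u\<bar> ^ a + \<bar>n\<bar> ^ a))" .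
  have "\<bar>x\<bar> ^ a * cmod (dlist (replicate b 1) f u) \<le>
      ((1/X) ^ a * (2 ^ a * (\<bar>u\<bar> ^ a + \<bar>n\<bar> ^ a))) * (C * K ^ b * fact b powr r1 * sexp r2 c u)"
    by (intro mult_mono xa D) (use X in auto)
  also have "\<dots> = C * K ^ b * fact b powr r1 * (2/X) ^ a * (\<bar>u\<bar> ^ a * sexp r2 c u + \<bar>n\<bar> ^ a * sexp r2 c u)"
    by (simp add: algebra_simps power_divide add_divide_distrib)
  also have "\<dots> \<le> C * K ^ b * fact b powr r1 * (2/X) ^ a * (B ^ a * fact a powr r2 + \<bar>n\<bar> ^ a * 1)"
    using pos X power_sexp_le[of c r2 u a] sexp_le_1[of c r2 u]
    by (intro mult_left_mono add_mono) (auto simp: B_def)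
  finally have 1: "\<bar>x\<bar> ^ a * cmod (dlist (replicate b 1) f u) \<le>
     C * K ^ b * fact b powr r1 * (2/X) ^ a * (B ^ a * fact a powr r2 + \<bar>n\<bar> ^ a)" by simp
  have "h ^ (a + b) / (fact a powr t * fact b powr s) * (\<bar>x\<bar> ^ a * (X ^ b * cmod (dlist (replicate b 1) f u)))
     = h ^ (a + b) * X ^ b / (fact a powr t * fact b powr s) * (\<bar>x\<bar> ^ a * cmod (dlist (replicate b 1) f u))"
    by simp
  also have "\<dots> \<le> h ^ (a + b) * X ^ b / (fact a powr t * fact b powr s) *
     (C * K ^ b * fact b powr r1 * (2/X) ^ a * (B ^ a * fact a powr r2 + \<bar>n\<bar> ^ a))"
    using h X by (intro mult_left_mono 1) auto
  also have "\<dots> = C * ((h * K * X) ^ b / fact b powr (s - r1)) *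
      ((h * 2 * B * (1/X)) ^ a / fact a powr (t - r2) + (h * 2 * (\<bar>n\<bar>/X)) ^ a / fact a powr t)"
    using X by (simp add: powr_diff power_add power_mult_distrib power_divide field_simps)
  also have "\<dots> \<le> C * exp (\<delta> * X powr (1/(s-r1))) *
     (exp (\<delta> * (1/X) powr (1/(t-r2))) + exp (\<delta> * (\<bar>n\<bar>/X) powr (1/t)))"
  proof (intro mult_mono add_mono mult_left_mono)
    show "(h * K * X) ^ b / fact b powr (s - r1) \<le> exp (\<delta> * X powr (1 / (s - r1)))"
      using scaled_power_le_fact_exp[of X "h * K" "s - r1" \<delta> b] assms by (simp add: field_simps)
    show "(h * 2 * B * (1 / X)) ^ a / fact a powr (t - r2) \<le> exp (\<delta> * (1 / X) powr (1 / (t - r2)))"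
      using scaled_power_le_fact_exp[of "1/X" "h * 2 * B" "t - r2" \<delta> a] assms B by (simp add: field_simps B_def)
    show "(h * 2 * (\<bar>n\<bar> / X)) ^ a / fact a powr t \<le> exp (\<delta> * (\<bar>n\<bar> / X) powr (1 / t))"
      using scaled_power_le_fact_exp[of "\<bar>n\<bar>/X" "h * 2" t \<delta> a] assms by (simp add: field_simps)
  qed (use pos h X B in auto)
  also have "\<dots> \<le> C * exp (\<delta> * X powr (1/(s-r1))) *
     (2 * (exp (\<delta> * (1/X) powr (1/(t-r2))) * exp (\<delta> * (\<bar>n\<bar>/X) powr (1/t))))"
  proof (intro mult_left_mono)
    have ge: "1 \<le> exp (\<delta> * (1/X) powr (1/(t-r2)))" "1 \<le> exp (\<delta> * (\<bar>n\<bar>/X) powr (1/t))" using \<delta> by auto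
    have *: "p + q \<le> 2 * (p * q)" if "1 \<le> p" "1 \<le> q" for p q :: real
    proof -
      have "p * 1 \<le> p * q" "1 * q \<le> p * q" using that by (intro mult_mono; simp)+
      thus ?thesis by simp
    qed
    show "exp (\<delta> * (1/X) powr (1/(t-r2))) + exp (\<delta> * (\<bar>n\<bar>/X) powr (1/t)) \<le>
       2 * (exp (\<delta> * (1/X) powr (1/(t-r2))) * exp (\<delta> * (\<bar>n\<bar>/X) powr (1/t)))"
      by (rule *[OF ge])
  qed (use pos in auto)
  finally show ?thesis by (simp add: u_def exp_add algebra_simps)
qed

lemma integrable_power_sexp:
  fixes f :: "real \<Rightarrow> complex"
  assumes [measurable]: "f \<in> borel_measurable borel" and "c > 0" "r > 0"
    and le: "\<And>u. cmod (f u) \<le> C * sexp r c u"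
  shows "integrable lborel (\<lambda>u. of_real (u ^ k) * f u)"
proof -
  obtain B where B: "B > 0" "\<And>x. sexp r c x * (1 + \<bar>x\<bar>) ^ (k + 2) \<le> B"
    using sexp_mult_power_bounded[OF assms(2,3)] by metis
  have C: "C \<ge> 0"
    using order_trans[OF norm_ge_zero le[of 0]] sexp_pos[of r c 0] by (simp add: zero_le_mult_iff)
  show ?thesis
  proof (rule Bochner_Integration.integrable_bound)
    show "integrable lborel (\<lambda>u::real. C * B * (1 / (1 + (u - 0)\<^sup>2)))"
      by (intro integrable_mult_right integrable_inverse_square)
    show "AE u in lborel. norm (of_real (u ^ k) * f u) \<le> norm (C * B * (1 / (1 + (u - 0)\<^sup>2)))"
    proof (rule AE_I2)
      fix u :: real
      have e: "(1 + \<bar>u\<bar>) ^ (k + 2) = (1 + \<bar>u\<bar>)\<^sup>2 * (1 + \<bar>u\<bar>) ^ k"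
        by (simp only: power_add mult.commute)
      have "(1 + (u - 0)\<^sup>2) * \<bar>u\<bar> ^ k \<le> (1 + \<bar>u\<bar>)\<^sup>2 * (1 + \<bar>u\<bar>) ^ k"
        by (intro mult_mono power_mono) (auto simp: power2_eq_square algebra_simps)
      hence "sexp r c u * ((1 + (u - 0)\<^sup>2) * \<bar>u\<bar> ^ k) \<le> sexp r c u * (1 + \<bar>u\<bar>) ^ (k + 2)"
        by (subst e) (rule mult_left_mono, simp_all)
      also have "\<dots> \<le> B" by (rule B)
      finally have 1: "\<bar>u\<bar> ^ k * sexp r c u \<le> B * (1 / (1 + (u - 0)\<^sup>2))"
        by (simp add: field_simps add_pos_nonneg)
      have "norm (of_real (u ^ k) * f u) \<le> \<bar>u\<bar> ^ k * (C * sexp r c u)"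
        using le[of u] by (simp add: norm_mult norm_power mult_left_mono)
      also have "\<dots> \<le> C * (B * (1 / (1 + (u - 0)\<^sup>2)))"
        using mult_left_mono[OF 1 C] by (simp add: mult_ac)
      finally show "norm (of_real (u ^ k) * f u) \<le> norm (C * B * (1 / (1 + (u - 0)\<^sup>2)))"
        using C B(1) by simp
    qed
  qed auto
qed

lemma dlist_real_has_vector_derivative:
  fixes f :: "real \<Rightarrow> complex"
  assumes "schwartz f"
  shows "(dlist (replicate k 1) f has_vector_derivative dlist (replicate (Suc k) 1) f u) (at u)"
proof -
  have "set (replicate k (1::real)) \<subseteq> Basis" by (auto simp: set_replicate_conv_if)
  from dlist_has_vector_derivative[OF assms this, of 1 0 u] show ?thesis by simp
qed

lemma dlist_real_affine:
  fixes f :: "real \<Rightarrow> complex"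
  assumes "schwartz f"
  shows "((\<lambda>v. dlist (replicate k 1) f (a * v + b)) has_vector_derivative
      of_real a * dlist (replicate (Suc k) 1) f (a * v + b)) (at v)"
proof -
  have "((\<lambda>v. a * v + b) has_vector_derivative a) (at v)" by (auto intro!: derivative_eq_intros)
  from vector_diff_chain_at[OF this dlist_real_has_vector_derivative[OF assms, of k "a * v + b"]]
  show ?thesis by (simp add: o_def scaleR_conv_of_real del: replicate.simps)
qed

text \<open>Closed form of the mixed derivatives of a dilated and translated tensor product:
  \<open>k i\<close> is the order in coordinate \<open>i\<close>, and each order contributes a
  factor \<open>X\<close>. For \<open>k = (\<lambda>_. 0)\<close> it is the product itself.\<close>

definition tder :: "('d::finite \<Rightarrow> real \<Rightarrow> complex) \<Rightarrow> real \<Rightarrow> ('d \<Rightarrow> real) \<Rightarrow> ('d \<Rightarrow> nat) \<Rightarrow> real^'d \<Rightarrow> complex" where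
  "tder f X c k x = (\<Prod>i\<in>UNIV. of_real (X ^ k i) * dlist (replicate (k i) 1) (f i) (X * x $ i - c i))"

lemma tder_has_vector_derivative:
  fixes x :: "real^'d::finite"
  assumes f: "\<And>i. schwartz (f i)"
  shows "((\<lambda>u. tder f X c k (x + u *\<^sub>R axis i 1)) has_vector_derivative tder f X c (k(i := Suc (k i))) x) (at 0)"
proof -
  define P where "P = (\<Prod>j\<in>UNIV-{i}. complex_of_real (X ^ k j) * dlist (replicate (k j) 1) (f j) (X * x $ j - c j))"
  define G where "G k v = complex_of_real (X ^ k) * dlist (replicate k 1) (f i) (X * v + (X * x $ i - c i))" for k v
  have 1: "tder f X c k (x + u *\<^sub>R axis i 1) = G (k i) u * P" for u
    unfolding tder_def by (subst prod.remove[of UNIV i]) (auto simp: G_def P_def axis_def algebra_simps intro!: prod.cong)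
  have 2: "tder f X c (k(i := Suc (k i))) x = G (Suc (k i)) 0 * P"
    unfolding tder_def by (subst prod.remove[of UNIV i]) (auto simp: G_def P_def intro!: prod.cong)
  have "(G (k i) has_vector_derivative G (Suc (k i)) 0) (at 0)"
    unfolding G_def using has_vector_derivative_mult_right[OF dlist_real_affine[OF f[of i], of "k i" X "X * x $ i - c i" 0], of "complex_of_real (X ^ k i)"]
    by (simp add: mult_ac del: replicate.simps)
  thus ?thesis unfolding 1 2 by (rule has_vector_derivative_mult_left)
qed

text \<open>Each differentiation raises one entry of the order, so that only the multiplicities in
  the list count. This disposes of the arbitrary order of differentiation for wavelets.\<close>

lemma dlist_tder:
  fixes f :: "'d::finite \<Rightarrow> real \<Rightarrow> complex"
  assumes f: "\<And>i. schwartz (f i)" and l: "set l \<subseteq> Basis"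
  shows "dlist l (\<lambda>x. \<kappa> * tder f X c (\<lambda>_. 0) x) = (\<lambda>x. \<kappa> * tder f X c (\<lambda>i. count_list l (axis i 1)) x)"
  using l
proof (induction l)
  case (Cons b l)
  then obtain i where b: "b = axis i 1" by (auto simp: Basis_vec_axis)
  have eq: "(\<lambda>j. count_list (b # l) (axis j 1)) = (\<lambda>i. count_list l (axis i 1))(i := Suc (count_list l (axis i 1)))"
    by (auto simp: b axis_eq_axis)
  show ?case
  proof
    fix x
    have "((\<lambda>u. \<kappa> * tder f X c (\<lambda>i. count_list l (axis i 1)) (x + u *\<^sub>R b)) has_vector_derivative
        \<kappa> * tder f X c (\<lambda>j. count_list (b # l) (axis j 1)) x) (at 0)"
      unfolding eq unfolding b by (rule has_vector_derivative_mult_right[OF tder_has_vector_derivative[OF f]])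
    thus "dlist (b # l) (\<lambda>x. \<kappa> * tder f X c (\<lambda>_. 0) x) x = \<kappa> * tder f X c (\<lambda>j. count_list (b # l) (axis j 1)) x"
      using Cons by (simp add: partial_def vector_derivative_at)
  qed
qed auto

lemma continuous_tder:
  assumes f: "\<And>i. schwartz (f i)" shows "continuous_on UNIV (tder f X c k)"
  unfolding tder_def
  by (intro continuous_intros continuous_on_compose2[OF schwartz_dlist[OF f]]) auto

text \<open>The quantity N of the overview, used with \<open>p = s - r1\<close> and
  \<open>q = t - r2\<close>. The factor \<open>CARD('d)\<close> appears because every
  one-dimensional factor contributes both scale terms.\<close>

definition wweight :: "real \<Rightarrow> real \<Rightarrow> real \<Rightarrow> int \<Rightarrow> ('d::finite \<Rightarrow> int) \<Rightarrow> real" where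
  "wweight p q t m n = CARD('d) * (2 powr (of_int m / p) + 2 powr (- of_int m / q))
      + (\<Sum>i\<in>UNIV. (\<bar>of_int (n i)\<bar> / 2 powr of_int m) powr (1/t))"

text \<open>Regularity and vanishing moments, which govern all size estimates; the algebraic side of
  the pair enters with \<open>wavelet_pair\<close>. The condition on \<open>t\<close> is t >
  \<sigma> + 1.\<close>

locale gs_pair =
  fixes \<phi> \<psi> :: "real \<Rightarrow> complex" and r1 r2 s t :: real
  assumes r1: "r1 \<ge> 0" and r2: "r2 > 1" and phi: "\<phi> \<in> GS r1 r2" and psi: "\<psi> \<in> GS0 r1 r2"
    and s: "s > r1 + r2 - 1" and t: "t > r1 + r2"
begin

definition wfac :: "bool \<Rightarrow> real \<Rightarrow> complex" where "wfac e = (if e then \<psi> else \<phi>)"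

lemma wfac_True: "wfac True = \<psi>" by (simp add: wfac_def)

lemma schwartz_wfac: "schwartz (wfac e)"
  using phi psi by (auto simp: wfac_def GS_def GS0_def)

lemma borel_measurable_wfac [measurable]: "wfac e \<in> borel_measurable borel"
  using schwartz_dlist[OF schwartz_wfac, of "[]" e] by (auto intro: borel_measurable_continuous_onI)

lemma wfac_decay:
  obtains C K c where "C > 0" "K > 0" "c > 0"
    "\<And>e k u. cmod (dlist (replicate k 1) (wfac e) u) \<le> C * K ^ k * fact k powr r1 * sexp r2 c u"
proof -
  have G: "wfac e \<in> GS r1 r2" for e using phi psi by (auto simp: wfac_def GS0_def)
  have r2': "r2 > 0" using r2 by simp
  obtain C1 K1 c1 where 1: "C1 > 0" "K1 > 0" "c1 > 0"
    "\<And>k u. cmod (dlist (replicate k 1) (wfac True) u) \<le> C1 * K1 ^ k * fact k powr r1 * sexp r2 c1 u"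
    using gs_real_decay[OF G[of True] r2'] by metis
  obtain C2 K2 c2 where 2: "C2 > 0" "K2 > 0" "c2 > 0"
    "\<And>k u. cmod (dlist (replicate k 1) (wfac False) u) \<le> C2 * K2 ^ k * fact k powr r1 * sexp r2 c2 u"
    using gs_real_decay[OF G[of False] r2'] by metis
  show ?thesis
  proof (rule that[of "max C1 C2" "max K1 K2" "min c1 c2"])
    fix e k u
    have 3: "C1 * K1 ^ k * fact k powr r1 * sexp r2 c1 u \<le> max C1 C2 * max K1 K2 ^ k * fact k powr r1 * sexp r2 (min c1 c2) u"
      using 1 2 by (intro mult_mono power_mono sexp_mono_rate) (auto simp: le_max_iff_disj)
    have 4: "C2 * K2 ^ k * fact k powr r1 * sexp r2 c2 u \<le> max C1 C2 * max K1 K2 ^ k * fact k powr r1 * sexp r2 (min c1 c2) u"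
      using 1 2 by (intro mult_mono power_mono sexp_mono_rate) (auto simp: le_max_iff_disj)
    show "cmod (dlist (replicate k 1) (wfac e) u) \<le> max C1 C2 * max K1 K2 ^ k * fact k powr r1 * sexp r2 (min c1 c2) u"
      by (cases e) (simp_all only: order_trans[OF 1(4) 3] order_trans[OF 2(4) 4])
  qed (use 1 2 in auto)
qed

lemma wpsi_eq_tder:
  "wpsi \<phi> \<psi> (\<epsilon>, m, n) = (\<lambda>x. of_real (2 powr (of_int m * real CARD('d) / 2)) *
     tder (\<lambda>i. wfac (\<epsilon> i)) (2 powr of_int m) (\<lambda>i. of_int (n i)) (\<lambda>_. 0) (x::real^'d::finite))"
  by (simp add: wpsi_def tder_def wfac_def)

lemma dlist_wpsi:
  assumes "set l \<subseteq> Basis"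
  shows "dlist l (wpsi \<phi> \<psi> (\<epsilon>, m, n)) = (\<lambda>x. of_real (2 powr (of_int m * real CARD('d) / 2)) *
     tder (\<lambda>i. wfac (\<epsilon> i)) (2 powr of_int m) (\<lambda>i. of_int (n i)) (\<lambda>i. count_list l (axis i 1)) (x::real^'d::finite))"
  unfolding wpsi_eq_tder by (rule dlist_tder[OF schwartz_wfac assms])

text \<open>A product of \<open>CARD('d)\<close> instances of \<open>dilated_moment_bound\<close>.
  It is stated for arbitrary lists of directions, because the Schwartz property and the termwise
  differentiation of the wavelet series need intermediate derivatives as well as those selected by
  \<open>Dmulti\<close>.\<close>

lemma wpsi_derivative_bound:
  assumes \<delta>: "\<delta> > 0"
  obtains C h0 where "C > 0" "h0 > 0"
    "\<And>h \<epsilon> m n (\<alpha> :: real^'d::finite \<Rightarrow> nat) l (x::real^'d::finite). 0 < h \<Longrightarrow> h \<le> h0 \<Longrightarrow> set l \<subseteq> Basis \<Longrightarrow>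
      h ^ (mabs \<alpha> + mabs (count_list l)) / (mfact \<alpha> powr t * mfact (count_list l) powr s) *
      cmod (of_real (xpow \<alpha> x) * dlist l (wpsi \<phi> \<psi> (\<epsilon>, m, n)) x) \<le>
      C * 2 powr (of_int m * real CARD('d) / 2) * exp (\<delta> * wweight (s - r1) (t - r2) t m n)"
proof -
  obtain C K c where D: "C > 0" "K > 0" "c > 0"
    "\<And>e k u. cmod (dlist (replicate k 1) (wfac e) u) \<le> C * K ^ k * fact k powr r1 * sexp r2 c u"
    using wfac_decay by metis
  \<comment> \<open>The three smallness conditions of \<open>dilated_moment_bound\<close>, solved
    for \<open>h\<close>; they do not involve the scale or the translation.\<close>
  define h0 where "h0 = min ((\<delta>/(s-r1)) powr (s-r1) / K) (min ((\<delta>/(t-r2)) powr (t-r2) / (2 * (r2/c) powr r2)) ((\<delta>/t) powr t / 2))"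
  have pos: "s - r1 > 0" "t - r2 > 0" "t > 0" "r2 > 0" using s t r1 r2 by auto
  show ?thesis
  proof (rule that[of "(2 * C) ^ CARD('d)" h0])
    show "(2 * C) ^ CARD('d) > 0" using D by simp
    show "h0 > 0" using D pos \<delta> by (simp add: h0_def)
    fix h \<epsilon> m l and n :: "'d \<Rightarrow> int" and x :: "real^'d" and \<alpha> :: "real^'d \<Rightarrow> nat"
    assume h: "0 < h" "h \<le> h0" and l: "set l \<subseteq> (Basis :: (real^'d) set)"
    define X where "X = 2 powr real_of_int m"
    have X: "X > 0" by (simp add: X_def)
    define a where "a i = \<alpha> (axis i 1)" for i :: 'd
    define b where "b i = count_list l (axis i 1)" for i :: 'd
    have "h ^ (mabs \<alpha> + mabs (count_list l)) / (mfact \<alpha> powr t * mfact (count_list l) powr s) *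
      cmod (of_real (xpow \<alpha> x) * dlist l (wpsi \<phi> \<psi> (\<epsilon>, m, n)) x)
     = 2 powr (of_int m * real CARD('d) / 2) * (\<Prod>i\<in>UNIV. h ^ (a i + b i) / (fact (a i) powr t * fact (b i) powr s) *
        (\<bar>x $ i\<bar> ^ a i * (X ^ b i * cmod (dlist (replicate (b i) 1) (wfac (\<epsilon> i)) (X * x $ i - of_int (n i))))))"
      unfolding dlist_wpsi[OF l] tder_def xpow_vec mabs_def mfact_def sum_Basis_vec prod_Basis_vec
        a_def [symmetric] b_def [symmetric] X_def [symmetric]
      using X by (simp add: norm_mult prod_norm [symmetric] norm_power prod.distrib power_add power_sum prod_powr_distrib
         prod_dividef)
    also have "\<dots> \<le> 2 powr (of_int m * real CARD('d) / 2) * (\<Prod>i\<in>(UNIV::'d set).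
       2 * C * exp (\<delta> * (X powr (1/(s-r1)) + (1/X) powr (1/(t-r2)) + (\<bar>of_int (n i)\<bar>/X) powr (1/t))))"
    proof (intro mult_left_mono prod_mono conjI dilated_moment_bound[where c = c and K = K])
      show "h * K \<le> (\<delta>/(s-r1)) powr (s-r1)" "h * 2 * (r2/c) powr r2 \<le> (\<delta>/(t-r2)) powr (t-r2)"
        "h * 2 \<le> (\<delta>/t) powr t"
        using h pos D by (auto simp: h0_def field_simps)
    qed (use D h X pos \<delta> in auto)
    also have "(\<Prod>i\<in>(UNIV::'d set).
       2 * C * exp (\<delta> * (X powr (1/(s-r1)) + (1/X) powr (1/(t-r2)) + (\<bar>of_int (n i)\<bar>/X) powr (1/t)))) =
       (2 * C) ^ CARD('d) * exp (\<delta> * wweight (s - r1) (t - r2) t m n)"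
      by (simp add: prod.distrib exp_sum [symmetric] wweight_def sum.distrib sum_distrib_left distrib_left X_def powr_powr
           powr_minus_divide [symmetric] add.assoc mult_ac)
    finally show "h ^ (mabs \<alpha> + mabs (count_list l)) / (mfact \<alpha> powr t * mfact (count_list l) powr s) *
      cmod (of_real (xpow \<alpha> x) * dlist l (wpsi \<phi> \<psi> (\<epsilon>, m, n)) x) \<le>
      (2 * C) ^ CARD('d) * 2 powr (of_int m * real CARD('d) / 2) * exp (\<delta> * wweight (s - r1) (t - r2) t m n)"
      by (simp add: mult_ac)
  qed
qed

lemma wpsi_gs_norm:
  assumes \<delta>: "\<delta> > 0"
  obtains C h0 where "C > 0" "h0 > 0"
    "\<And>h \<epsilon> m (n::'d::finite \<Rightarrow> int). 0 < h \<Longrightarrow> h \<le> h0 \<Longrightarrow> gs_bdd h s t (wpsi \<phi> \<psi> (\<epsilon>, m, n))"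
    "\<And>h \<epsilon> m (n::'d::finite \<Rightarrow> int). 0 < h \<Longrightarrow> h \<le> h0 \<Longrightarrow> gs_norm h s t (wpsi \<phi> \<psi> (\<epsilon>, m, n)) \<le>
      C * 2 powr (of_int m * real CARD('d) / 2) * exp (\<delta> * wweight (s - r1) (t - r2) t m n)"
proof -
  obtain C h0 where C: "C > 0" "h0 > 0"
    "\<And>h \<epsilon> m n (\<alpha> :: real^'d::finite \<Rightarrow> nat) l (x::real^'d::finite). 0 < h \<Longrightarrow> h \<le> h0 \<Longrightarrow> set l \<subseteq> Basis \<Longrightarrow>
      h ^ (mabs \<alpha> + mabs (count_list l)) / (mfact \<alpha> powr t * mfact (count_list l) powr s) *
      cmod (of_real (xpow \<alpha> x) * dlist l (wpsi \<phi> \<psi> (\<epsilon>, m, n)) x) \<le>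
      C * 2 powr (of_int m * real CARD('d) / 2) * exp (\<delta> * wweight (s - r1) (t - r2) t m n)"
    using wpsi_derivative_bound[OF \<delta>] by blast
  have eq: "mabs (count_list (mlist \<beta>)) = mabs \<beta>" "mfact (count_list (mlist \<beta>)) = mfact \<beta>" for \<beta> :: "real^'d \<Rightarrow> nat"
    by (simp_all add: mabs_def mfact_def mlist)
  have b: "h ^ (mabs \<alpha> + mabs \<beta>) / (mfact \<alpha> powr t * mfact \<beta> powr s)
        * cmod (of_real (xpow \<alpha> x) * Dmulti \<beta> (wpsi \<phi> \<psi> (\<epsilon>, m, n)) x) \<le>
       C * 2 powr (of_int m * real CARD('d) / 2) * exp (\<delta> * wweight (s - r1) (t - r2) t m n)"
    if "0 < h" "h \<le> h0" for h \<epsilon> m \<alpha> \<beta> and x :: "real^'d" and n :: "'d \<Rightarrow> int"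
    using C(3)[OF that mlist(1), of \<alpha> \<beta> x \<epsilon> m n] by (simp add: eq Dmulti_eq)
  show ?thesis by (rule that[OF C(1,2)]) (auto intro: gs_bddI gs_norm_leI b)
qed

lemma schwartz_wpsi: "schwartz (wpsi \<phi> \<psi> lam :: real^'d::finite \<Rightarrow> complex)"
proof -
  obtain \<epsilon> m n where lam: "lam = (\<epsilon>, m, n)" by (cases lam) auto
  obtain C h where C: "C > 0" "h > 0"
    "\<And>\<epsilon> m n (\<alpha> :: real^'d::finite \<Rightarrow> nat) l (x::real^'d::finite). set l \<subseteq> Basis \<Longrightarrow>
      h ^ (mabs \<alpha> + mabs (count_list l)) / (mfact \<alpha> powr t * mfact (count_list l) powr s) *
      cmod (of_real (xpow \<alpha> x) * dlist l (wpsi \<phi> \<psi> (\<epsilon>, m, n)) x) \<le>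
      C * 2 powr (of_int m * real CARD('d) / 2) * exp (1 * wweight (s - r1) (t - r2) t m n)"
    using wpsi_derivative_bound[of 1, where 'd = 'd] by (metis order_refl zero_less_one)
  show ?thesis unfolding lam schwartz_def
  proof (intro allI impI conjI ballI)
    fix l :: "(real^'d) list" assume l: "set l \<subseteq> Basis"
    show "continuous_on UNIV (dlist l (wpsi \<phi> \<psi> (\<epsilon>, m, n)))"
      unfolding dlist_wpsi[OF l] by (intro continuous_intros continuous_tder schwartz_wfac)
    fix x b :: "real^'d" assume "b \<in> Basis"
    then obtain i where b: "b = axis i 1" by (auto simp: Basis_vec_axis)
    show "(\<lambda>t. dlist l (wpsi \<phi> \<psi> (\<epsilon>, m, n)) (x + t *\<^sub>R b)) differentiable at 0"
      unfolding dlist_wpsi[OF l] b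
      by (rule differentiableI_vector[OF has_vector_derivative_mult_right[OF tder_has_vector_derivative[OF schwartz_wfac]]])
  next
    fix l :: "(real^'d) list" and \<alpha> :: "real^'d \<Rightarrow> nat" assume l: "set l \<subseteq> Basis"
    define q where "q = h ^ (mabs \<alpha> + mabs (count_list l)) / (mfact \<alpha> powr t * mfact (count_list l) powr s)"
    have q: "q > 0" using C mfact_pos[of \<alpha>] mfact_pos[of "count_list l"] by (simp add: q_def)
    show "bounded (range (\<lambda>x. of_real (xpow \<alpha> x) * dlist l (wpsi \<phi> \<psi> (\<epsilon>, m, n)) x))"
      unfolding bounded_iff
      using C(3)[OF l, of \<alpha> _ \<epsilon> m n] q unfolding q_def [symmetric]
      by (auto simp: field_simps intro!: exI[of _ "C * 2 powr (of_int m * real CARD('d) / 2) * exp (1 * wweight (s - r1) (t - r2) t m n) / q"])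
  qed
qed

lemma integrable_power_wfac: "integrable lborel (\<lambda>u. of_real (u ^ k) * wfac e u)"
proof -
  obtain C K c where D: "C > 0" "K > 0" "c > 0"
    "\<And>e k u. cmod (dlist (replicate k 1) (wfac e) u) \<le> C * K ^ k * fact k powr r1 * sexp r2 c u"
    using wfac_decay by metis
  show ?thesis
    by (rule integrable_power_sexp[where c = c and r = r2 and C = C]) (use D r2 D(4)[of 0] in auto)
qed

lemma moment_psi: "(LINT u|lborel. of_real (u ^ k) * \<psi> u) = 0"
  using psi by (simp add: GS0_def xpow_def)  (drule conjunct2, drule spec[of _ "\<lambda>_. k"], simp)

text \<open>After the substitution \<open>u = a * x - b\<close> the binomial theorem reduces moments
  of the dilated and translated factor to those of the factor itself.\<close>

lemma
  assumes "a \<noteq> 0"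
  shows integrable_power_wfac_affine: "integrable lborel (\<lambda>x. of_real (x ^ k) * wfac e (a * x - b))"
    and moment_psi_affine: "(LINT x|lborel. of_real (x ^ k) * wfac True (a * x - b)) = 0"
proof -
  have eq: "of_real (((u + b) / a) ^ k) * wfac e u = (\<Sum>j\<le>k. of_real (of_nat (k choose j) * b ^ (k - j) / a ^ k) * (of_real (u ^ j) * wfac e u))"
    for e u
    by (simp add: power_divide binomial_ring sum_distrib_right sum_distrib_left sum_divide_distrib mult_ac)
  have i: "integrable lborel (\<lambda>u. of_real (((u + b) / a) ^ k) * wfac e u)" for e
    unfolding eq by (intro Bochner_Integration.integrable_sum integrable_mult_right integrable_power_wfac)
  have z: "(LINT u|lborel. of_real (((u + b) / a) ^ k) * wfac True u) = 0"
    unfolding eq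
    by (subst Bochner_Integration.integral_sum, (intro integrable_mult_right integrable_power_wfac))
       (simp add: moment_psi wfac_True del: of_real_power of_real_mult of_real_divide)
  have eq2: "of_real (x ^ k) * wfac e (a * x - b) = of_real (((-b + a * x + b) / a) ^ k) * wfac e (-b + a * x)" for x e
    using assms by simp
  show "integrable lborel (\<lambda>x. of_real (x ^ k) * wfac e (a * x - b))"
    unfolding eq2 by (rule lborel_integrable_real_affine[OF i assms])
  have "0 = \<bar>a\<bar> *\<^sub>R (LINT x|lborel. of_real (((-b + a * x + b) / a) ^ k) * wfac True (-b + a * x))"
    using lborel_integral_real_affine[OF assms, of "\<lambda>u. of_real (((u + b) / a) ^ k) * wfac True u" "-b"] z by simp
  thus "(LINT x|lborel. of_real (x ^ k) * wfac True (a * x - b)) = 0"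
    unfolding eq2 using assms by simp
qed

lemma xpow_wpsi: "of_real (xpow \<alpha> x) * wpsi \<phi> \<psi> (\<epsilon>, m, n) x = of_real (2 powr (of_int m * real CARD('d) / 2)) *
    (\<Prod>i\<in>UNIV. of_real ((x $ i) ^ \<alpha> (axis i 1)) * wfac (\<epsilon> i) (2 powr of_int m * (x::real^'d::finite) $ i - of_int (n i)))"
  by (simp add: wpsi_eq_tder tder_def xpow_vec prod.distrib)

text \<open>A type in \<open>wQ\<close> has at least one coordinate carrying \<open>\<psi>\<close>.
  The integral of the product factors over the coordinates, and that coordinate contributes
  zero.\<close>

lemma wpsi_GS0:
  assumes "lam \<in> wLambda" shows "(wpsi \<phi> \<psi> lam :: real^'d::finite \<Rightarrow> complex) \<in> GS0 s t"
proof -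
  obtain \<epsilon> m n where lam: "lam = (\<epsilon>, m, n)" by (cases lam) auto
  obtain i where i: "\<epsilon> i" using assms lam by (auto simp: wLambda_def wQ_def)
  obtain h0 where h0: "h0 > 0" "\<And>\<epsilon> m (n::'d \<Rightarrow> int). gs_bdd h0 s t (wpsi \<phi> \<psi> (\<epsilon>, m, n))"
    using wpsi_gs_norm[of 1] by (metis order_refl zero_less_one)
  have "(LINT x|lborel. of_real (xpow \<alpha> x) * wpsi \<phi> \<psi> lam x) = 0" for \<alpha>
  proof -
    have "(LINT x|lborel. of_real (xpow \<alpha> x) * wpsi \<phi> \<psi> lam x) =
       of_real (2 powr (of_int m * real CARD('d) / 2)) * (\<Prod>i\<in>UNIV.
        LINT v|lborel. of_real (v ^ \<alpha> (axis i 1)) * wfac (\<epsilon> i) (2 powr of_int m * v - of_int (n i)))"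
      unfolding lam xpow_wpsi
      by (subst integral_mult_right_zero, subst integral_prod_vec[where f = "\<lambda>i v. of_real (v ^ \<alpha> (axis i 1)) * wfac (\<epsilon> i) (2 powr of_int m * v - of_int (n i))"])
         (rule integrable_power_wfac_affine, simp_all)
    also have "(\<Prod>i\<in>UNIV.
        LINT v|lborel. of_real (v ^ \<alpha> (axis i 1)) * wfac (\<epsilon> i) (2 powr of_int m * v - of_int (n i))) = 0"
      using moment_psi_affine[of "2 powr of_int m" "\<alpha> (axis i 1)" "of_int (n i)"] i
      by (intro prod_zero bexI[of _ i]) simp_all
    finally show ?thesis by simp
  qed
  thus ?thesis using schwartz_wpsi h0 by (auto simp: GS0_def GS_def lam)
qed

end

subsection \<open>Wavelet coefficients\<close>

text \<open>Here \<open>y\<close> is a point where the test function is evaluated, \<open>b\<close>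
  the centre of the wavelet and \<open>u\<close> the argument of its profile. Either
  \<open>y\<close> is at distance at least \<open>\<bar>b\<bar> / 2\<close> from the origin or
  \<open>u\<close> is that large, so one of the two factors decays in \<open>b\<close>; both are
  weakened to the common index \<open>t\<close>.\<close>

lemma near_or_far:
  assumes "0 < r" "r \<le> t" "0 < r'" "r' \<le> t" "c > 0" "c' > 0" "\<bar>y - b\<bar> \<le> \<bar>u\<bar>"
  shows "sexp r c y * sexp r' c' u \<le> exp (max c c') * sexp t (min c c' * (1/2) powr (1/t)) b"
proof -
  have t: "t > 0" using assms by simp
  have *: "sexp r c z \<le> exp (max c c') * sexp t (min c c' * (1/2) powr (1/t)) b"
    if "\<bar>z\<bar> \<ge> \<bar>b\<bar> / 2" "0 < r" "r \<le> t" "c \<in> {c, c'}" "c > 0" for z r c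
  proof -
    have "sexp r c z \<le> exp c * sexp t c z" by (rule sexp_le_sexp) (use that in auto)
    also have "sexp t c z \<le> sexp t c (1/2 * b)" by (rule sexp_antimono) (use that t in auto)
    also have "sexp t c (1/2 * b) \<le> sexp t (min c c' * (1/2) powr (1/t)) b"
      by (subst sexp_scale) (auto intro!: sexp_mono_rate mult_right_mono)
    also have "exp c * \<dots> \<le> exp (max c c') * \<dots>" using that by (intro mult_right_mono) auto
    finally show ?thesis by simp
  qed
  have l: "sexp r c y \<le> 1" "sexp r' c' u \<le> 1" using assms by (auto intro: sexp_le_1)
  consider "\<bar>y\<bar> \<ge> \<bar>b\<bar> / 2" | "\<bar>u\<bar> \<ge> \<bar>b\<bar> / 2" using assms(7) by linarith
  thus ?thesis
  proof cases
    case 1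
    have "sexp r c y * sexp r' c' u \<le> sexp r c y" using l by (simp add: mult_left_le)
    also have "\<dots> \<le> exp (max c c') * sexp t (min c c' * (1/2) powr (1/t)) b" by (rule *[OF 1]) (use assms in auto)
    finally show ?thesis .
  next
    case 2
    have "sexp r c y * sexp r' c' u \<le> sexp r' c' u" using l by (simp add: mult_left_le_one_le)
    also have "\<dots> \<le> exp (max c c') * sexp t (min c' c * (1/2) powr (1/t)) b"
    proof -
      have "sexp r' c' u \<le> exp c' * sexp t c' u" by (rule sexp_le_sexp) (use assms in auto)
      also have "sexp t c' u \<le> sexp t c' (1/2 * b)" by (rule sexp_antimono) (use 2 assms t in auto)
      also have "sexp t c' (1/2 * b) \<le> sexp t (min c' c * (1/2) powr (1/t)) b"
        by (subst sexp_scale) (auto intro!: sexp_mono_rate mult_right_mono)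
      also have "exp c' * \<dots> \<le> exp (max c c') * \<dots>" by (intro mult_right_mono) auto
      finally show ?thesis by simp
    qed
    finally show ?thesis by (simp add: min.commute)
  qed
qed

lemma integrable_sexp: "c > 0 \<Longrightarrow> r > 0 \<Longrightarrow> integrable lborel (\<lambda>u. \<bar>u\<bar> ^ k * sexp r c u)"
  using integrable_norm[OF integrable_power_sexp[of "\<lambda>u. complex_of_real (sexp r c u)" c r 1 k]]
  by (simp add: norm_mult norm_power)

lemma integral_sexp_affine:
  assumes "c > 0" "r > 0" "X > 0"
  shows "integrable lborel (\<lambda>y. sexp r c (X * y - b))"
    and "(LINT y|lborel. sexp r c (X * y - b)) = (LINT u|lborel. sexp r c u) / X"
proof -
  have i: "integrable lborel (sexp r c)" using integrable_sexp[OF assms(1,2), of 0] by simp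
  show "integrable lborel (\<lambda>y. sexp r c (X * y - b))"
    using lborel_integrable_real_affine[OF i, of X "-b"] assms by simp
  show "(LINT y|lborel. sexp r c (X * y - b)) = (LINT u|lborel. sexp r c u) / X"
    using lborel_integral_real_affine[of X "sexp r c" "-b"] assms by (simp add: field_simps)
qed

lemma leibniz_has_vector_derivative:
  fixes f g :: "nat \<Rightarrow> real \<Rightarrow> complex"
  assumes f: "\<And>k. (f k has_vector_derivative f (Suc k) x) (at x)"
    and g: "\<And>k. (g k has_vector_derivative g (Suc k) x) (at x)"
  shows "((\<lambda>x. \<Sum>l\<le>k. of_nat (k choose l) * (f l x * g (k - l) x)) has_vector_derivative
      (\<Sum>l\<le>Suc k. of_nat (Suc k choose l) * (f l x * g (Suc k - l) x))) (at x)"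
proof -
  have "((\<lambda>x. \<Sum>l\<le>k. of_nat (k choose l) * (f l x * g (k - l) x)) has_vector_derivative
    (\<Sum>l\<le>k. of_nat (k choose l) * (f l x * g (Suc (k - l)) x + f (Suc l) x * g (k - l) x))) (at x)"
    by (intro has_vector_derivative_sum has_vector_derivative_mult_right has_vector_derivative_mult f g)
  also have "(\<Sum>l\<le>k. of_nat (k choose l) * (f l x * g (Suc (k - l)) x + f (Suc l) x * g (k - l) x)) =
     (\<Sum>l\<le>k. of_nat (k choose l) * (f l x * g (Suc k - l) x)) + (\<Sum>l\<le>k. of_nat (k choose l) * (f (Suc l) x * g (k - l) x))"
    by (simp add: sum.distrib [symmetric] distrib_left Suc_diff_le cong: sum.cong_simp)
  also have "(\<Sum>l\<le>k. of_nat (k choose l) * (f l x * g (Suc k - l) x)) = (\<Sum>l\<le>Suc k. of_nat (k choose l) * (f l x * g (Suc k - l) x))"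
    by simp
  also have "\<dots> = f 0 x * g (Suc k) x + (\<Sum>l\<le>k. of_nat (k choose Suc l) * (f (Suc l) x * g (k - l) x))"
    by (subst sum.atMost_Suc_shift) simp
  also have "\<dots> + (\<Sum>l\<le>k. of_nat (k choose l) * (f (Suc l) x * g (k - l) x)) =
     f 0 x * g (Suc k) x + (\<Sum>l\<le>k. of_nat (Suc k choose Suc l) * (f (Suc l) x * g (k - l) x))"
    by (simp add: sum.distrib [symmetric] distrib_right add_ac)
  also have "\<dots> = (\<Sum>l\<le>Suc k. of_nat (Suc k choose l) * (f l x * g (Suc k - l) x))"
    by (subst sum.atMost_Suc_shift) simp
  finally show ?thesis .
qed

text \<open>The inequality l! (k - l)! \<le> k! merges the factorial powers, and what remains is the
  binomial sum of \<open>(A + B) ^ k\<close>.\<close>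

lemma leibniz_bound:
  fixes f g :: "nat \<Rightarrow> complex"
  assumes "\<And>k. cmod (f k) \<le> P * A ^ k * fact k powr r" "\<And>k. cmod (g k) \<le> Q * B ^ k * fact k powr r"
    and "P \<ge> 0" "Q \<ge> 0" "A \<ge> 0" "B \<ge> 0" "r \<ge> 0"
  shows "cmod (\<Sum>l\<le>k. of_nat (k choose l) * (f l * g (k - l))) \<le> P * Q * (A + B) ^ k * fact k powr r"
proof -
  have "cmod (\<Sum>l\<le>k. of_nat (k choose l) * (f l * g (k - l))) \<le> (\<Sum>l\<le>k. cmod (of_nat (k choose l) * (f l * g (k - l))))"
    by (rule norm_sum)
  also have "\<dots> \<le> (\<Sum>l\<le>k. P * Q * fact k powr r * (of_nat (k choose l) * A ^ l * B ^ (k - l)))"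
  proof (rule sum_mono)
    fix l assume "l \<in> {..k}"
    hence l: "l \<le> k" by simp
    have "fact l * fact (k - l) \<le> (fact k :: nat)"
      by (rule dvd_imp_le) (use l fact_fact_dvd_fact[of l "k - l", where 'a = nat] in simp_all)
    hence "real (fact l * fact (k - l)) \<le> real (fact k)" by (rule of_nat_mono)
    hence "(fact l * fact (k - l) :: real) \<le> fact k" by simp
    hence "(fact l * fact (k - l) :: real) powr r \<le> fact k powr r" using assms by (intro powr_mono2) auto
    hence ff: "(fact l :: real) powr r * fact (k - l) powr r \<le> fact k powr r" by (simp add: powr_mult)
    have "cmod (of_nat (k choose l) * (f l * g (k - l))) = of_nat (k choose l) * (cmod (f l) * cmod (g (k - l)))"
      by (simp add: norm_mult)
    also have "\<dots> \<le> of_nat (k choose l) * ((P * A ^ l * fact l powr r) * (Q * B ^ (k - l) * fact (k - l) powr r))"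
      using assms by (intro mult_left_mono mult_mono) auto
    also have "\<dots> = of_nat (k choose l) * (P * A ^ l * Q * B ^ (k - l)) * (fact l powr r * fact (k - l) powr r)" by simp
    also have "\<dots> \<le> of_nat (k choose l) * (P * A ^ l * Q * B ^ (k - l)) * fact k powr r"
      using assms ff by (intro mult_left_mono) auto
    finally show "cmod (of_nat (k choose l) * (f l * g (k - l))) \<le> P * Q * fact k powr r * (of_nat (k choose l) * A ^ l * B ^ (k - l))"
      by (simp add: mult_ac)
  qed
  also have "\<dots> = P * Q * (A + B) ^ k * fact k powr r"
    by (simp add: binomial_ring sum_distrib_left sum_distrib_right mult_ac)
  finally show ?thesis .
qed

text \<open>\<open>H k y\<close> is the \<open>k\<close>-th derivative of the tensor product along
  the ray \<theta> y, built coordinate by coordinate with the Leibniz rule. At \<theta> = 0 it is a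
  polynomial in \<open>y\<close>. Instead of exhibiting the polynomial, \<open>P\<close> stands for
  any property closed under the operations that generate polynomials; the intended one is
  annihilation by a test function all of whose moments vanish.\<close>

lemma product_derivatives:
  fixes D :: "'d::finite \<Rightarrow> nat \<Rightarrow> real \<Rightarrow> complex" and n :: "'d \<Rightarrow> real"
  assumes D: "\<And>j k u. (D j k has_vector_derivative D j (Suc k) u) (at u)"
    and bd: "\<And>j k u. cmod (D j k u) \<le> E u * K ^ k * fact k powr r" and E: "\<And>u. E u \<ge> 0" and K: "K \<ge> 0" "r \<ge> 0"
    and P1: "P (\<lambda>_. 1)" and Padd: "\<And>p q. P p \<Longrightarrow> P q \<Longrightarrow> P (\<lambda>y. p y + q y)"
    and Pmult: "\<And>p c. P p \<Longrightarrow> P (\<lambda>y. c * p y)" and Pcoord: "\<And>p j. P p \<Longrightarrow> P (\<lambda>y. of_real (y $ j) * p y)"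
  obtains H :: "nat \<Rightarrow> real^'d \<Rightarrow> real \<Rightarrow> complex" where
    "\<And>y \<theta>. H 0 y \<theta> = (\<Prod>j\<in>UNIV. D j 0 (\<theta> * (X * y $ j) - n j))"
    "\<And>k y \<theta>. (H k y has_vector_derivative H (Suc k) y \<theta>) (at \<theta>)"
    "\<And>k y \<theta>. cmod (H k y \<theta>) \<le> (\<Prod>j\<in>UNIV. E (\<theta> * (X * y $ j) - n j)) * (\<Sum>j\<in>UNIV. K * \<bar>X * y $ j\<bar>) ^ k * fact k powr r"
    "\<And>k. P (\<lambda>y. H k y 0)"
proof -
  have Ppow: "P (\<lambda>y. c * of_real ((X * y $ j) ^ k) * p y)" if "P p" for p c j k
  proof (induction k)
    case 0 then show ?case using Pmult[OF that, of c] by simp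
  next
    case (Suc k)
    from Pmult[OF Pcoord[OF Suc, of j], of "of_real X"] show ?case by (simp add: mult_ac)
  qed
  have Psum: "P (\<lambda>y. \<Sum>l\<in>A. p l y)" if "finite A" "\<And>l. P (p l)" for A :: "nat set" and p
    using that(1)
  proof (induction A)
    case empty show ?case using Pmult[OF P1, of 0] by simp
  next
    case (insert x F) thus ?case using Padd[OF that(2)[of x] insert.IH] by simp
  qed
  have "\<exists>H :: nat \<Rightarrow> real^'d \<Rightarrow> real \<Rightarrow> complex.
    (\<forall>y \<theta>. H 0 y \<theta> = (\<Prod>j\<in>I. D j 0 (\<theta> * (X * y $ j) - n j))) \<and>
    (\<forall>k y \<theta>. (H k y has_vector_derivative H (Suc k) y \<theta>) (at \<theta>)) \<and>
    (\<forall>k y \<theta>. cmod (H k y \<theta>) \<le> (\<Prod>j\<in>I. E (\<theta> * (X * y $ j) - n j)) * (\<Sum>j\<in>I. K * \<bar>X * y $ j\<bar>) ^ k * fact k powr r) \<and>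
    (\<forall>k. P (\<lambda>y. H k y 0))" if "finite I" for I
    using that
  proof (induction I rule: finite_induct)
    case empty
    have "P (\<lambda>_. if k = 0 then 1 else 0)" for k :: nat using P1 Pmult[OF P1, of 0] by simp
    thus ?case by (intro exI[of _ "\<lambda>k y \<theta>. if k = 0 then 1 else 0"]) auto
  next
    case (insert j I)
    then obtain H where H: "\<And>y \<theta>. H 0 y \<theta> = (\<Prod>j\<in>I. D j 0 (\<theta> * (X * y $ j) - n j))"
      "\<And>k y \<theta>. (H k y has_vector_derivative H (Suc k) y \<theta>) (at \<theta>)"
      "\<And>k y \<theta>. cmod (H k y \<theta>) \<le> (\<Prod>j\<in>I. E (\<theta> * (X * y $ j) - n j)) * (\<Sum>j\<in>I. K * \<bar>X * y $ j\<bar>) ^ k * fact k powr r"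
      "\<And>k. P (\<lambda>y. H k y 0)" by blast
    define F where "F y k \<theta> = of_real ((X * y $ j) ^ k) * D j k (\<theta> * (X * y $ j) - n j)" for y k \<theta>
    have F: "(F y k has_vector_derivative F y (Suc k) \<theta>) (at \<theta>)" for y k \<theta>
    proof -
      have "((\<lambda>\<theta>. \<theta> * (X * y $ j) - n j) has_vector_derivative (X * y $ j)) (at \<theta>)"
        by (auto intro!: derivative_eq_intros)
      from has_vector_derivative_mult_right[OF vector_diff_chain_at[OF this D], of "of_real ((X * y $ j) ^ k)" j k]
      show ?thesis by (simp add: F_def [abs_def] o_def scaleR_conv_of_real mult_ac)
    qed
    have Fb: "cmod (F y k \<theta>) \<le> E (\<theta> * (X * y $ j) - n j) * (K * \<bar>X * y $ j\<bar>) ^ k * fact k powr r" for y k \<theta>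
    proof -
      have "cmod (F y k \<theta>) = \<bar>X * y $ j\<bar> ^ k * cmod (D j k (\<theta> * (X * y $ j) - n j))"
        by (simp add: F_def norm_mult norm_power abs_mult)
      also have "\<dots> \<le> \<bar>X * y $ j\<bar> ^ k * (E (\<theta> * (X * y $ j) - n j) * K ^ k * fact k powr r)"
        by (intro mult_left_mono bd) auto
      finally show ?thesis by (simp add: power_mult_distrib mult_ac)
    qed
    define H' where "H' k y \<theta> = (\<Sum>l\<le>k. of_nat (k choose l) * (F y l \<theta> * H (k - l) y \<theta>))" for k y \<theta>
    show ?case
    proof (intro exI[of _ H'] conjI allI)
      fix y \<theta> k
      show "H' 0 y \<theta> = (\<Prod>j\<in>insert j I. D j 0 (\<theta> * (X * y $ j) - n j))"
        using insert.hyps by (simp add: H'_def F_def H)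
      show "(H' k y has_vector_derivative H' (Suc k) y \<theta>) (at \<theta>)"
        unfolding H'_def [abs_def] by (rule leibniz_has_vector_derivative[where f = "F y" and g = "\<lambda>k. H k y", OF F H(2)])
      have "cmod (H' k y \<theta>) \<le> E (\<theta> * (X * y $ j) - n j) * (\<Prod>j\<in>I. E (\<theta> * (X * y $ j) - n j)) *
         ((K * \<bar>X * y $ j\<bar>) + (\<Sum>j\<in>I. K * \<bar>X * y $ j\<bar>)) ^ k * fact k powr r"
        unfolding H'_def by (rule leibniz_bound[OF Fb H(3)]) (use E K in \<open>auto intro!: prod_nonneg sum_nonneg\<close>)
      thus "cmod (H' k y \<theta>) \<le> (\<Prod>j\<in>insert j I. E (\<theta> * (X * y $ j) - n j)) *
          (\<Sum>j\<in>insert j I. K * \<bar>X * y $ j\<bar>) ^ k * fact k powr r"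
        using insert.hyps by simp
      \<comment> \<open>At \<theta> = 0 the derivative \<open>D j l\<close> is evaluated at
        \<open>- n j\<close>, a constant in \<open>y\<close>; only the power of \<open>y $ j\<close>
        remains.\<close>
      have "P (\<lambda>y. (of_nat (k choose l) * D j l (- n j)) * of_real ((X * y $ j) ^ l) * H (k - l) y 0)" for l
        by (rule Ppow[OF H(4)])
      hence "P (\<lambda>y. \<Sum>l\<le>k. (of_nat (k choose l) * D j l (- n j)) * of_real ((X * y $ j) ^ l) * H (k - l) y 0)"
        by (intro Psum) auto
      thus "P (\<lambda>y. H' k y 0)" by (simp add: H'_def F_def mult_ac)
    qed
  qed
  from this[OF finite[of UNIV]] show ?thesis using that by blast
qed

lemma integrable_xpow_GS:
  fixes g :: "real^'d::finite \<Rightarrow> complex"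
  assumes "g \<in> GS p r" "r > 0"
  shows "integrable lborel (\<lambda>y. of_real (xpow \<alpha> y) * g y)"
proof -
  obtain h where h: "h > 0" "gs_bdd h p r g" and g: "schwartz g" using assms by (auto simp: GS_def)
  define c where "c = r / 2 * h powr (1/r) / CARD('d)"
  have c: "c > 0" using h assms by (simp add: c_def)
  have [measurable]: "g \<in> borel_measurable borel"
    using schwartz_dlist[OF g, of "[]"] by (auto intro: borel_measurable_continuous_onI)
  let ?A = "2 powr r * gs_norm h p r g"
  show ?thesis
  proof (rule Bochner_Integration.integrable_bound)
    show "integrable lborel (\<lambda>y::real^'d. ?A * (\<Prod>j\<in>UNIV. \<bar>y $ j\<bar> ^ \<alpha> (axis j 1) * sexp r c (y $ j)))"
      using assms by (intro integrable_mult_right integrable_prod_vec integrable_sexp c) auto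
    show "AE y in lborel. norm (of_real (xpow \<alpha> y) * g y) \<le> norm (?A * (\<Prod>j\<in>UNIV. \<bar>y $ j\<bar> ^ \<alpha> (axis j 1) * sexp r c (y $ j)))"
    proof (rule AE_I2)
      fix y :: "real^'d"
      have "cmod (g y) \<le> ?A * (\<Prod>j\<in>UNIV. sexp r c (y $ j))"
        using gs_axis_decay[OF h(2,1), of 0 undefined y] assms by (simp add: c_def)
      hence "\<bar>xpow \<alpha> y\<bar> * cmod (g y) \<le> \<bar>xpow \<alpha> y\<bar> * (?A * (\<Prod>j\<in>UNIV. sexp r c (y $ j)))"
        by (intro mult_left_mono) auto
      also have "\<dots> = ?A * (\<Prod>j\<in>UNIV. \<bar>y $ j\<bar> ^ \<alpha> (axis j 1) * sexp r c (y $ j))"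
        by (simp add: xpow_vec abs_prod power_abs prod.distrib)
      finally show "norm (of_real (xpow \<alpha> y) * g y) \<le> norm (?A * (\<Prod>j\<in>UNIV. \<bar>y $ j\<bar> ^ \<alpha> (axis j 1) * sexp r c (y $ j)))"
        by (simp add: norm_mult)
    qed
    show "(\<lambda>y. of_real (xpow \<alpha> y) * g y) \<in> borel_measurable lborel"
      unfolding xpow_vec by measurable
  qed
qed

section \<open>Fine scales: vanishing moments of the wavelet\<close>

context gs_pair begin

definition s' :: real where "s' = s - (r1 + r2 - 1)"
definition t' :: real where "t' = t - (r1 + r2 - 1)"

text \<open>The equations for \<open>s - r1\<close> and \<open>t - r2\<close> are the exponent
  balances: \<open>r2 - 1\<close> and \<open>r1 - 1\<close> are what the factor of the pair
  contributes after division by the Taylor denominator.\<close>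

lemma exps: "s' > 0" "t' > 1" "s' + (r2 - 1) = s - r1" "t' + (r1 - 1) = t - r2" "s - r1 > 0" "t - r2 > 0" "t > 0" "r2 > 0"
   "r2 \<le> t" "t' \<le> t" "r2 < t"
  using r1 r2 s t by (auto simp: s'_def t'_def)

text \<open>The wavelet without its normalising factor. Dilation and translations are real, since
  the coefficient estimates do not see the dyadic structure.\<close>

definition wprod :: "('d::finite \<Rightarrow> bool) \<Rightarrow> real \<Rightarrow> ('d \<Rightarrow> real) \<Rightarrow> real^'d \<Rightarrow> complex" where
  "wprod \<epsilon> X n y = (\<Prod>j\<in>UNIV. wfac (\<epsilon> j) (X * y $ j - n j))"

lemma wprod_borel [measurable]: "wprod \<epsilon> X n \<in> borel_measurable borel"
  unfolding wprod_def by measurable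

lemma schwartz_borel: "schwartz (g :: real^'d::finite \<Rightarrow> complex) \<Longrightarrow> g \<in> borel_measurable borel"
  using schwartz_dlist[of g "[]"] by (auto intro: borel_measurable_continuous_onI)

lemma integrable_xpow_gs:
  fixes g :: "real^'d::finite \<Rightarrow> complex"
  assumes g: "schwartz g" and h: "h > 0" "gs_bdd h s' t' g"
  shows "integrable lborel (\<lambda>y. of_real (xpow \<alpha> y) * g y)"
  by (rule integrable_xpow_GS[where p = s' and r = t']) (use assms exps in \<open>auto simp: GS_def\<close>)

lemma wprod_bound:
  assumes "\<And>e u. cmod (wfac e u) \<le> C * sexp r2 c u"
  shows "cmod (wprod \<epsilon> X n (y::real^'d::finite)) \<le> C ^ CARD('d) * (\<Prod>j\<in>UNIV. sexp r2 c (X * y $ j - n j))"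
proof -
  have "cmod (wprod \<epsilon> X n y) \<le> (\<Prod>j\<in>(UNIV::'d set). C * sexp r2 c (X * y $ j - n j))"
    unfolding wprod_def prod_norm [symmetric] by (intro prod_mono) (auto intro: assms)
  thus ?thesis by (simp add: prod.distrib)
qed

lemma integrable_gs_wprod:
  fixes g :: "real^'d::finite \<Rightarrow> complex"
  assumes g: "schwartz g" and h: "h > 0" "gs_bdd h s' t' g"
  shows "integrable lborel (\<lambda>y. g y * wprod \<epsilon> X n y)"
proof -
  obtain C K c where D: "C > 0" "K > 0" "c > 0"
    "\<And>e k u. cmod (dlist (replicate k 1) (wfac e) u) \<le> C * K ^ k * fact k powr r1 * sexp r2 c u"
    using wfac_decay by metis
  have D0: "cmod (wfac e u) \<le> C * sexp r2 c u" for e u using D(4)[of 0] by simp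
  note [measurable] = schwartz_borel[OF g]
  have ig: "integrable lborel g" using integrable_xpow_gs[OF g h, of "\<lambda>_. 0"] by (simp add: xpow_def)
  show ?thesis
  proof (rule Bochner_Integration.integrable_bound)
    show "integrable lborel (\<lambda>y. C ^ CARD('d) * norm (g y))" using ig by auto
    show "AE y in lborel. norm (g y * wprod \<epsilon> X n y) \<le> norm (C ^ CARD('d) * norm (g y))"
    proof (rule AE_I2)
      fix y :: "real^'d"
      have "cmod (wprod \<epsilon> X n y) \<le> C ^ CARD('d) * 1"
        by (rule order_trans[OF wprod_bound[OF D0]], intro mult_left_mono prod_le_1) (use D in \<open>auto intro: sexp_le_1\<close>)
      thus "norm (g y * wprod \<epsilon> X n y) \<le> norm (C ^ CARD('d) * norm (g y))"
        using D by (simp add: norm_mult mult.commute mult_left_mono)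
    qed
    show "(\<lambda>y. g y * wprod \<epsilon> X n y) \<in> borel_measurable lborel" by measurable
  qed
qed

lemma axis_line:
  fixes x :: "real^'d::finite" shows "(\<chi> j. if j = i then b + \<theta> * w else x $ j) = (\<chi> j. if j = i then b else x $ j) + (\<theta> * w) *\<^sub>R axis i 1"
  by (simp add: vec_eq_iff axis_def)

text \<open>Expansion in the coordinate \<open>i\<close> alone, all others frozen: vanishing moments
  are available only in coordinates where the factor of the wavelet is
  \<open>\<psi>\<close>.\<close>

lemma fine_Taylor:
  fixes g :: "real^'d::finite \<Rightarrow> complex"
  assumes g: "schwartz g" and B: "\<And>\<theta>. \<theta> \<in> {0..1} \<Longrightarrow>
      cmod (dlist (replicate N (axis i 1)) g (\<chi> j. if j = i then b + \<theta> * (y $ i - b) else y $ j)) \<le> B"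
  shows "cmod (g y - (\<Sum>k<N. of_real ((y $ i - b) ^ k / fact k) * dlist (replicate k (axis i 1)) g (\<chi> j. if j = i then b else y $ j)))
     \<le> \<bar>y $ i - b\<bar> ^ N * B / fact N"
proof -
  define w where "w = y $ i - b"
  define f where "f k \<theta> = of_real (w ^ k) * dlist (replicate k (axis i 1)) g (\<chi> j. if j = i then b + \<theta> * w else y $ j)" for k \<theta>
  have ax: "axis i (1::real) \<in> Basis" by (simp add: axis_in_Basis_iff)
  have sub: "set (replicate k (axis i (1::real))) \<subseteq> Basis" for k using ax by (auto simp: set_replicate_conv_if)
  have "(f k has_vector_derivative f (Suc k) \<theta>) (at \<theta>)" for k \<theta>
  proof -
    have "((\<lambda>\<theta>. \<theta> * w) has_vector_derivative w) (at \<theta>)" by (auto intro!: derivative_eq_intros)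
    from has_vector_derivative_mult_right[OF vector_diff_chain_at[OF this
        dlist_has_vector_derivative[OF g sub ax, of k "\<chi> j. if j = i then b else y $ j" "\<theta> * w"]], of "of_real (w ^ k)"]
    show ?thesis unfolding f_def [abs_def] axis_line by (simp add: o_def scaleR_conv_of_real mult_ac)
  qed
  moreover have "cmod (f N \<theta>) \<le> \<bar>w\<bar> ^ N * B" if "\<theta> \<in> {0..1}" for \<theta>
    using B[OF that] unfolding w_def [symmetric] by (simp add: f_def norm_mult norm_power mult_left_mono)
  ultimately have "cmod (f 0 1 - (\<Sum>k<N. of_real (1 ^ k / fact k) * f k 0)) \<le> \<bar>w\<bar> ^ N * B * 1 ^ N / fact N"
    by (intro Taylor_remainder_bound) auto
  moreover have yy: "(\<chi> j. if j = i then b + 1 * w else y $ j) = y" by (simp add: vec_eq_iff w_def)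
  have "f 0 1 = g y" unfolding f_def yy by simp
  moreover have "(\<Sum>k<N. of_real (1 ^ k / fact k) * f k 0) =
      (\<Sum>k<N. of_real ((y $ i - b) ^ k / fact k) * dlist (replicate k (axis i 1)) g (\<chi> j. if j = i then b else y $ j))"
    unfolding f_def w_def by (simp only: mult_zero_left add_0_right power_one of_real_divide of_real_1 of_real_power) (simp add: mult_ac)
  ultimately show ?thesis by (simp only: w_def power_one mult_1_right)
qed

text \<open>The base point \<open>n i / X\<close> is the centre of the wavelet in coordinate
  \<open>i\<close>. Each Taylor term is a power of \<open>y $ i - n i / X\<close> times a function
  independent of \<open>y $ i\<close>, so that integrating over this coordinate first gives a moment
  of \<open>\<psi>\<close>.\<close>

lemma fine_Taylor_polynomial_annihilated:
  fixes g :: "real^'d::finite \<Rightarrow> complex" and n :: "'d \<Rightarrow> real"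
  assumes g: "schwartz g" and h: "h > 0" "gs_bdd h s' t' g" and i: "\<epsilon> i" and X: "X > 0"
  defines "T \<equiv> \<lambda>k y. of_real ((y $ i - n i / X) ^ k / fact k) * dlist (replicate k (axis i 1)) g (\<chi> j. if j = i then n i / X else y $ j)"
  shows "integrable lborel (\<lambda>y. T k y * wprod \<epsilon> X n y)" (is ?I) and "(LINT y|lborel. T k y * wprod \<epsilon> X n y) = 0" (is ?Z)
proof -
  define b where "b = n i / X"
  have ax: "axis i (1::real) \<in> Basis" by (simp add: axis_in_Basis_iff)
  have sub: "set (replicate k (axis i (1::real))) \<subseteq> Basis" using ax by (auto simp: set_replicate_conv_if)
  define G where "G = (\<lambda>y::real^'d. dlist (replicate k (axis i 1)) g (\<chi> j. if j = i then b else y $ j))"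
  have "continuous_on UNIV (\<lambda>y::real^'d. \<chi> j. if j = i then b else y $ j)"
  proof (rule continuous_on_vec_lambda)
    fix j show "continuous_on UNIV (\<lambda>y::real^'d. if j = i then b else y $ j)"
      by (cases "j = i") (auto intro!: continuous_intros)
  qed
  hence Gm [measurable]: "G \<in> borel_measurable borel"
    unfolding G_def
    by (intro borel_measurable_continuous_onI continuous_on_compose2[OF schwartz_dlist[OF g sub]]) auto
  define B where "B = 2 powr t' * gs_norm h s' t' g * (1/h) ^ k * fact k powr s'"
  have Gb: "cmod (G y) \<le> B" for y
  proof -
    have "cmod (G y) \<le> B * (\<Prod>j\<in>(UNIV::'d set). sexp t' (t' / 2 * h powr (1/t') / CARD('d)) ((\<chi> j. if j = i then b else y $ j) $ j))"
      unfolding G_def B_def by (rule gs_axis_decay[OF h(2,1)]) (use exps in auto)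
    also have "\<dots> \<le> B * 1"
      using exps h gs_norm_nonneg[OF h(2,1)] by (intro mult_left_mono prod_le_1) (auto intro!: sexp_le_1 simp: B_def)
    finally show ?thesis by simp
  qed
  have int1: "integrable lborel (\<lambda>v. of_real ((v - b) ^ l) * wfac e (X * v - a))" for l e a
  proof -
    have "integrable lborel (\<lambda>v. of_real (v ^ l) * wfac e (X * v - (a - X * b)))"
      by (rule integrable_power_wfac_affine) (use X in auto)
    from lborel_integrable_real_affine[OF this, of 1 "-b"] show ?thesis by (simp add: algebra_simps)
  qed
  have z1: "(LINT v|lborel. of_real ((v - b) ^ k) * wfac True (X * v - n i)) = 0"
  proof -
    have "0 = (LINT v|lborel. of_real (v ^ k) * wfac True (X * v - 0))"
      using moment_psi_affine[of X k 0] X by simp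
    also have "\<dots> = (LINT v|lborel. of_real ((-b + 1 * v) ^ k) * wfac True (X * (-b + 1 * v) - 0))"
      by (subst lborel_integral_real_affine[of 1 _ "-b"]) auto
    also have "\<dots> = (LINT v|lborel. of_real ((v - b) ^ k) * wfac True (X * v - n i))"
      using X by (intro Bochner_Integration.integral_cong) (auto simp: b_def algebra_simps)
    finally show ?thesis by simp
  qed
  have T: "T k y * wprod \<epsilon> X n y = of_real (1 / fact k) * (of_real ((y $ i - b) ^ k) * wprod \<epsilon> X n y) * G y" for y
    unfolding T_def G_def b_def by simp
  have int2: "integrable lborel (\<lambda>y::real^'d. of_real ((y $ i - b) ^ k) * wprod \<epsilon> X n y)"
  proof -
    have "of_real ((y $ i - b) ^ k) * wprod \<epsilon> X n y = (\<Prod>j\<in>UNIV. of_real ((y $ j - b) ^ (if j = i then k else 0)) * wfac (\<epsilon> j) (X * y $ j - n j))"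
      for y :: "real^'d"
    proof -
      have "(\<Prod>j\<in>UNIV. complex_of_real ((y $ j - b) ^ (if j = i then k else 0))) = of_real ((y $ i - b) ^ k)"
        by (subst prod.remove[of UNIV i]) auto
      thus ?thesis by (simp only: prod.distrib wprod_def)
    qed
    thus ?thesis by (simp only:) (intro integrable_prod_vec int1)
  qed
  show ?I
  proof (rule Bochner_Integration.integrable_bound[OF integrable_mult_right[OF integrable_norm[OF int2], of B]])
    show "AE y in lborel. norm (T k y * wprod \<epsilon> X n y) \<le> norm (B * norm (of_real ((y $ i - b) ^ k) * wprod \<epsilon> X n y))"
    proof (rule AE_I2)
      fix y :: "real^'d"
      have "norm (T k y * wprod \<epsilon> X n y) = (1 / fact k) * (norm (of_real ((y $ i - b) ^ k) * wprod \<epsilon> X n y) * cmod (G y))"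
        unfolding T by (simp add: norm_mult norm_divide)
      also have "\<dots> \<le> 1 * (norm (of_real ((y $ i - b) ^ k) * wprod \<epsilon> X n y) * B)"
        by (intro mult_mono mult_left_mono Gb) (auto simp: divide_le_eq_1)
      also have "\<dots> = B * norm (of_real ((y $ i - b) ^ k) * wprod \<epsilon> X n y)" by simp
      also have "\<dots> \<le> norm (B * norm (of_real ((y $ i - b) ^ k) * wprod \<epsilon> X n y))"
        using abs_ge_self by simp
      finally show "norm (T k y * wprod \<epsilon> X n y) \<le> norm (B * norm (of_real ((y $ i - b) ^ k) * wprod \<epsilon> X n y))" .
    qed
    show "(\<lambda>y. T k y * wprod \<epsilon> X n y) \<in> borel_measurable lborel" unfolding T by measurable
  qed
  thus ?Z
  proof (rule integral_vec_coordinate_eq_0[where i = i])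
    fix x :: "real^'d"
    let ?x = "\<lambda>v. \<chi> j. if j = i then v else x $ j"
    have G: "G (?x v) = G x" for v by (simp add: G_def) (rule arg_cong[of _ _ "dlist _ g"], simp add: vec_eq_iff)
    have W: "wprod \<epsilon> X n (?x v) = wfac True (X * v - n i) * (\<Prod>j\<in>UNIV-{i}. wfac (\<epsilon> j) (X * x $ j - n j))" for v
      unfolding wprod_def using i by (subst prod.remove[of UNIV i]) (auto intro!: prod.cong)
    have "T k (?x v) * wprod \<epsilon> X n (?x v) = (of_real (1 / fact k) * G x * (\<Prod>j\<in>UNIV-{i}. wfac (\<epsilon> j) (X * x $ j - n j))) *
       (of_real ((v - b) ^ k) * wfac True (X * v - n i))" for v
      unfolding T unfolding G W by simp
    thus "(LINT v|lborel. T k (?x v) * wprod \<epsilon> X n (?x v)) = 0"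
      by (simp only: integral_mult_right_zero z1)  simp
  qed
qed

text \<open>Subtracting the Taylor polynomial leaves a remainder of size X^(-N) with factorial
  constants; since this holds for every N, \<open>decay_of_moments\<close> turns it into decay in
  \<open>X\<close>. The decay in the position \<open>n j / X\<close> is inherited from the test
  function through \<open>near_or_far\<close>.\<close>

lemma fine_coefficient:
  assumes h: "h > 0"
  obtains C a c where "C > 0" "a > 0" "c > 0" "\<And>(g :: real^'d::finite \<Rightarrow> complex) \<epsilon> (X::real) n. schwartz g \<Longrightarrow> gs_bdd h s' t' g \<Longrightarrow> \<epsilon> \<in> wQ \<Longrightarrow> X \<ge> 1 \<Longrightarrow>
    cmod (LINT y|lborel. g y * wprod \<epsilon> X n y) \<le> C * gs_norm h s' t' g * sexp (s - r1) a X * (\<Prod>j\<in>UNIV. sexp t c (n j / X))"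
proof -
  obtain C K c where D: "C > 0" "K > 0" "c > 0"
    "\<And>e k u. cmod (dlist (replicate k 1) (wfac e) u) \<le> C * K ^ k * fact k powr r1 * sexp r2 c u"
    using wfac_decay by metis
  have D0: "cmod (wfac e u) \<le> C * sexp r2 c u" for e u using D(4)[of 0] by simp
  define d where "d = t' / 2 * h powr (1/t') / CARD('d)"
  have d: "d > 0" using h exps by (simp add: d_def)
  \<comment> \<open>The decay of the wavelet is spent in three equal parts: one carries the decay of
    \<open>g\<close> over to the centre of the wavelet, one absorbs the power
    \<open>\<bar>u i\<bar> ^ N\<close>, one keeps the integral finite.\<close>
  define c3 where "c3 = c / 3"
  have c3: "c3 > 0" "c3 + c3 + c3 = c" using D by (auto simp: c3_def)
  define J where "J = (LINT u|lborel. sexp r2 c3 u)"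
  have J: "J \<ge> 0" by (simp add: J_def)
  define B where "B = (r2 / c3) powr r2"
  have B: "B > 0" using exps c3 by (simp add: B_def)
  define M where "M = exp (max d c3)"
  define c1 where "c1 = min d c3 * (1/2) powr (1/t)"
  have c1: "c1 > 0" using d c3 by (simp add: c1_def)
  define A where "A = 2 powr t' * C ^ CARD('d) * M ^ CARD('d) * J ^ CARD('d)"
  have A: "A \<ge> 0" using D J by (simp add: A_def M_def)
  define a where "a = (s - r1) / 2 * (1/(B / h)) powr (1/(s - r1))"
  show ?thesis
  proof (rule that[of "2 powr (s - r1) * A + 1" a c1])
    show "a > 0" using exps B h by (simp add: a_def)
    show "2 powr (s - r1) * A + 1 > 0" using A by (simp add: add_nonneg_pos)
    fix g :: "real^'d \<Rightarrow> complex" and \<epsilon> :: "'d \<Rightarrow> bool" and X :: real and n :: "'d \<Rightarrow> real"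
    assume g: "schwartz g" and bd: "gs_bdd h s' t' g" and eps: "\<epsilon> \<in> wQ" and X1: "X \<ge> 1"
    obtain i where i: "\<epsilon> i" using eps by (auto simp: wQ_def)
    have X: "X > 0" using X1 by simp
    define P where "P = gs_norm h s' t' g"
    have P: "P \<ge> 0" unfolding P_def by (rule gs_norm_nonneg[OF bd h])
    define S where "S = (\<Prod>j\<in>UNIV. sexp t c1 (n j / X))"
    have S: "S \<ge> 0" by (simp add: S_def prod_nonneg)
    define I where "I = (LINT y|lborel. g y * wprod \<epsilon> X n y)"
    \<comment> \<open>This is the hypothesis of \<open>decay_of_moments\<close> at the point
      \<open>X\<close>; the order \<open>N\<close> of the expansion is left free.\<close>
    have main: "X ^ N * cmod I \<le> (A * P * S) * (B / h) ^ N * fact N powr (s - r1)" for N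
    proof -
      define T where "T k y = of_real ((y $ i - n i / X) ^ k / fact k) * dlist (replicate k (axis i 1)) g (\<chi> j. if j = i then n i / X else y $ j)" for k y
      have T: "integrable lborel (\<lambda>y. T k y * wprod \<epsilon> X n y)" "(LINT y|lborel. T k y * wprod \<epsilon> X n y) = 0" for k
        using fine_Taylor_polynomial_annihilated[where \<epsilon> = \<epsilon> and i = i and n = n and k = k, OF g h bd i X] by (simp_all only: T_def)
      have ig: "integrable lborel (\<lambda>y. g y * wprod \<epsilon> X n y)" by (rule integrable_gs_wprod[OF g h bd])
      have iT: "integrable lborel (\<lambda>y. \<Sum>k<N. T k y * wprod \<epsilon> X n y)" by (intro Bochner_Integration.integrable_sum T)
      have "I = (LINT y|lborel. g y * wprod \<epsilon> X n y - (\<Sum>k<N. T k y * wprod \<epsilon> X n y))"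
        by (subst Bochner_Integration.integral_diff[OF ig iT], subst Bochner_Integration.integral_sum)
           (auto simp: T I_def)
      also have "\<dots> = (LINT y|lborel. (g y - (\<Sum>k<N. T k y)) * wprod \<epsilon> X n y)"
        by (simp add: left_diff_distrib sum_distrib_right)
      finally have I: "I = (LINT y|lborel. (g y - (\<Sum>k<N. T k y)) * wprod \<epsilon> X n y)" .
      define R where "R = 2 powr t' * P * (1/h) ^ N * fact N powr s' * (1/X) ^ N * B ^ N * fact N powr (r2 - 1) * C ^ CARD('d) * M ^ CARD('d) * S"
      have R: "R \<ge> 0" using P D h X B S exps by (simp add: R_def M_def)
      have pt: "cmod ((g y - (\<Sum>k<N. T k y)) * wprod \<epsilon> X n y) \<le> R * (\<Prod>j\<in>UNIV. sexp r2 c3 (X * y $ j - n j))" for y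
      proof -
        define w where "w = y $ i - n i / X"
        define u where "u j = X * y $ j - n j" for j
        have w: "w = u i / X" using X by (simp add: w_def u_def field_simps)
        \<comment> \<open>The product in the denominator is the first third of the wavelet's decay,
          borrowed for \<open>near_or_far\<close> and returned when the remainder is multiplied by
          \<open>wprod\<close>.\<close>
        define Bt where "Bt = 2 powr t' * P * (1/h) ^ N * fact N powr s' * M ^ CARD('d) * S / (\<Prod>j\<in>UNIV. sexp r2 c3 (u j))"
        have pos: "(\<Prod>j\<in>UNIV. sexp r2 c3 (u j)) > 0" by (intro prod_pos) simp
        have "cmod (g y - (\<Sum>k<N. T k y)) \<le> \<bar>w\<bar> ^ N * Bt / fact N"
          unfolding T_def w_def
        proof (rule fine_Taylor[OF g])
          fix \<theta> :: real assume th: "\<theta> \<in> {0..1}"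
          define z where "z = (\<chi> j. if j = i then n i / X + \<theta> * (y $ i - n i / X) else y $ j)"
          have "cmod (dlist (replicate N (axis i 1)) g z) \<le> 2 powr t' * P * (1/h) ^ N * fact N powr s' * (\<Prod>j\<in>UNIV. sexp t' d (z $ j))"
            unfolding P_def d_def by (rule gs_axis_decay[OF bd h]) (use exps in auto)
          also have "(\<Prod>j\<in>UNIV. sexp t' d (z $ j)) \<le> M ^ CARD('d) * S / (\<Prod>j\<in>UNIV. sexp r2 c3 (u j))"
          proof -
            have "(\<Prod>j\<in>UNIV. sexp t' d (z $ j)) * (\<Prod>j\<in>UNIV. sexp r2 c3 (u j)) = (\<Prod>j\<in>UNIV. sexp t' d (z $ j) * sexp r2 c3 (u j))"
              by (simp add: prod.distrib)
            also have "\<dots> \<le> (\<Prod>j\<in>(UNIV::'d set). M * sexp t c1 (n j / X))"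
            proof (intro prod_mono conjI)
              fix j
              have "\<bar>z $ j - n j / X\<bar> \<le> \<bar>y $ j - n j / X\<bar>"
                using th by (auto simp: z_def abs_mult mult_left_le_one_le)
              also have "\<dots> = \<bar>u j\<bar> / X" using X by (simp add: u_def abs_divide [symmetric] field_simps)
              also have "\<dots> \<le> \<bar>u j\<bar>" using X1 by (simp add: divide_le_eq mult_le_cancel_left1)
              finally show "sexp t' d (z $ j) * sexp r2 c3 (u j) \<le> M * sexp t c1 (n j / X)"
                unfolding M_def c1_def by (intro near_or_far) (use exps d c3 in auto)
            qed simp
            also have "\<dots> = M ^ CARD('d) * S" by (simp add: prod.distrib S_def)
            finally show ?thesis using pos by (simp add: field_simps)
          qed
          finally show "cmod (dlist (replicate N (axis i 1)) g z) \<le> Bt"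
            using P h by (simp add: Bt_def mult_left_mono)
        qed
        also have "\<bar>w\<bar> ^ N = (1/X) ^ N * \<bar>u i\<bar> ^ N" using X by (simp add: w power_divide)
        finally have 1: "cmod (g y - (\<Sum>k<N. T k y)) \<le> (1/X) ^ N * \<bar>u i\<bar> ^ N * Bt / fact N" .
        have "\<bar>u i\<bar> ^ N * (\<Prod>j\<in>UNIV. sexp r2 c3 (u j)) \<le> B ^ N * fact N powr r2"
        proof -
          have "\<bar>u i\<bar> ^ N * (\<Prod>j\<in>UNIV. sexp r2 c3 (u j)) = (\<bar>u i\<bar> ^ N * sexp r2 c3 (u i)) * (\<Prod>j\<in>UNIV-{i}. sexp r2 c3 (u j))"
            by (subst prod.remove[of UNIV i]) auto
          also have "\<dots> \<le> (\<bar>u i\<bar> ^ N * sexp r2 c3 (u i)) * 1"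
            using c3 by (intro mult_left_mono prod_le_1) (auto intro: sexp_le_1)
          also have "\<dots> \<le> B ^ N * fact N powr r2" unfolding B_def using power_sexp_le[OF c3(1) exps(8), of "u i" N] by simp
          finally show ?thesis .
        qed
        note 2 = this
        have 3: "cmod (wprod \<epsilon> X n y) \<le> C ^ CARD('d) * ((\<Prod>j\<in>UNIV. sexp r2 c3 (u j)) * (\<Prod>j\<in>UNIV. sexp r2 c3 (u j)) * (\<Prod>j\<in>UNIV. sexp r2 c3 (u j)))"
          using wprod_bound[OF D0, of \<epsilon> X n y] unfolding c3(2)[symmetric] sexp_add u_def by (simp add: prod.distrib mult.assoc)
        have Bt0: "Bt \<ge> 0" using P h S pos by (simp add: Bt_def M_def)
        have "cmod ((g y - (\<Sum>k<N. T k y)) * wprod \<epsilon> X n y) \<le>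
          ((1/X) ^ N * \<bar>u i\<bar> ^ N * Bt / fact N) * (C ^ CARD('d) * ((\<Prod>j\<in>UNIV. sexp r2 c3 (u j)) * (\<Prod>j\<in>UNIV. sexp r2 c3 (u j)) * (\<Prod>j\<in>UNIV. sexp r2 c3 (u j))))"
          unfolding norm_mult using X Bt0 by (intro mult_mono 1 3) auto
        also have "\<dots> = (2 powr t' * P * (1/h) ^ N * fact N powr s' * M ^ CARD('d) * S * (1/X) ^ N / fact N * C ^ CARD('d) * (\<Prod>j\<in>UNIV. sexp r2 c3 (u j)))
           * (\<bar>u i\<bar> ^ N * (\<Prod>j\<in>UNIV. sexp r2 c3 (u j)))"
          unfolding Bt_def using pos by simp
        also have "\<dots> \<le> (2 powr t' * P * (1/h) ^ N * fact N powr s' * M ^ CARD('d) * S * (1/X) ^ N / fact N * C ^ CARD('d) * (\<Prod>j\<in>UNIV. sexp r2 c3 (u j)))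
           * (B ^ N * fact N powr r2)"
          using P h S X D pos by (intro mult_left_mono 2) (auto simp: M_def)
        also have "\<dots> = R * (\<Prod>j\<in>UNIV. sexp r2 c3 (u j))"
          by (simp add: R_def powr_diff field_simps)
        finally show ?thesis by (simp add: u_def)
      qed
      have int3: "integrable lborel (\<lambda>y::real^'d. \<Prod>j\<in>UNIV. sexp r2 c3 (X * y $ j - n j))"
        by (intro integrable_prod_vec integral_sexp_affine c3 exps X)
      have "cmod I \<le> (LINT y|lborel. R * (\<Prod>j\<in>UNIV. sexp r2 c3 (X * (y::real^'d) $ j - n j)))"
        unfolding I
      proof (rule Bochner_Integration.integral_norm_bound_integral)
        show "integrable lborel (\<lambda>y. (g y - (\<Sum>k<N. T k y)) * wprod \<epsilon> X n y)"
          using Bochner_Integration.integrable_diff[OF ig iT] by (simp add: left_diff_distrib sum_distrib_right)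
        show "integrable lborel (\<lambda>y. R * (\<Prod>j\<in>UNIV. sexp r2 c3 (X * (y::real^'d) $ j - n j)))"
          by (intro integrable_mult_right int3)
      qed (use pt in auto)
      also have "\<dots> = R * (\<Prod>j\<in>(UNIV::'d set). J / X)"
        by (subst integral_mult_right_zero, subst integral_prod_vec)
           (auto intro!: integral_sexp_affine c3 exps X simp: integral_sexp_affine(2)[OF c3(1) exps(8) X] J_def)
      also have "\<dots> \<le> R * (\<Prod>j\<in>(UNIV::'d set). J)"
        using R J X1 by (intro mult_left_mono prod_mono) (auto simp: divide_le_eq mult_le_cancel_left1)
      also have "\<dots> = R * J ^ CARD('d)" by simp
      finally have "X ^ N * cmod I \<le> X ^ N * (R * J ^ CARD('d))" using X by (intro mult_left_mono) auto
      also have "\<dots> = (A * P * S) * (B / h) ^ N * (fact N powr s' * fact N powr (r2 - 1))"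
        using X h by (simp add: R_def A_def power_divide field_simps)
      \<comment> \<open>The Taylor denominator \<open>fact N\<close> has already lowered
        \<open>r2\<close> to \<open>r2 - 1\<close>.\<close>
      also have "fact N powr s' * fact N powr (r2 - 1) = (fact N powr (s - r1) :: real)"
        by (simp add: powr_add [symmetric] exps)
      finally show ?thesis .
    qed
    have "cmod I \<le> 2 powr (s - r1) * (A * P * S) * sexp (s - r1) a X"
      unfolding a_def by (rule decay_of_moments) (use exps B h X main in auto)
    also have "\<dots> = (2 powr (s - r1) * A) * (P * sexp (s - r1) a X * S)" by simp
    also have "\<dots> \<le> (2 powr (s - r1) * A + 1) * (P * sexp (s - r1) a X * S)"
      using P S by (intro mult_right_mono) auto
    finally show "cmod (LINT y|lborel. g y * wprod \<epsilon> X n y) \<le> (2 powr (s - r1) * A + 1) * gs_norm h s' t' g * sexp (s - r1) a X * (\<Prod>j\<in>UNIV. sexp t c1 (n j / X))"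
      by (simp add: I_def P_def S_def mult_ac)
  qed (use c1 in auto)
qed

end

section \<open>Coarse scales: vanishing moments of the test function\<close>

text \<open>Here \<open>Y\<close> is the inverse scale. The first summand decays in \<open>n\<close>
  with index \<open>r\<close>, which \<open>powr_mult_le_add\<close> improves to decay in
  \<open>n * Y\<close> of index \<open>t\<close> at the expense of decay in \<open>Y\<close>; the
  second already decays in \<open>n * Y\<close>.\<close>

lemma sexp_mixed:
  assumes "a > 0" "c > 0" "d > 0" "0 < r" "r < t" "0 < r'" "r' \<le> t" "Y \<ge> 0"
  shows "sexp (t - r) a Y * (sexp r c (n / 2) + sexp r' d (n / 2 * Y))
     \<le> (1 + exp d) * sexp t (min (min a c) d * (1/2) powr (1/t)) (n * Y)"
proof -
  let ?m = "min (min a c) d"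
  have t: "t > 0" using assms by simp
  have "(Y * \<bar>n / 2\<bar>) powr (1/t) \<le> Y powr (1/(t-r)) + \<bar>n / 2\<bar> powr (1/r)"
    by (rule powr_mult_le_add) (use assms in auto)
  hence "?m * (Y * \<bar>n / 2\<bar>) powr (1/t) \<le> ?m * Y powr (1/(t-r)) + ?m * \<bar>n / 2\<bar> powr (1/r)"
    unfolding distrib_left [symmetric] by (rule mult_left_mono) (use assms in auto)
  also have "\<dots> \<le> a * Y powr (1/(t-r)) + c * \<bar>n / 2\<bar> powr (1/r)"
    by (intro add_mono mult_right_mono) auto
  finally have "sexp (t - r) a Y * sexp r c (n / 2) \<le> sexp t ?m (1/2 * (n * Y))"
    using assms by (simp add: sexp_def exp_add [symmetric] abs_mult mult_ac)
  moreover have "sexp (t - r) a Y * sexp r' d (n / 2 * Y) \<le> exp d * sexp t ?m (1/2 * (n * Y))"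
  proof -
    have "sexp (t - r) a Y * sexp r' d (n / 2 * Y) \<le> 1 * sexp r' d (n / 2 * Y)"
      using assms by (intro mult_right_mono sexp_le_1) auto
    also have "\<dots> \<le> exp d * sexp t d (n / 2 * Y)" using sexp_le_sexp[of r' t d] assms by simp
    also have "\<dots> \<le> exp d * sexp t ?m (n / 2 * Y)" by (intro mult_left_mono sexp_mono_rate) auto
    finally show ?thesis by simp
  qed
  moreover have e: "sexp t ?m (1/2 * (n * Y)) = sexp t (?m * (1/2) powr (1/t)) (n * Y)"
    by (rule sexp_scale) simp
  ultimately show ?thesis unfolding e distrib_left distrib_right by linarith
qed

text \<open>If \<open>X * y\<close> is at most half of \<open>n\<close> in size, then so is every
  point of the ray from the origin to it, and the wavelet factor is small; otherwise
  \<open>y\<close> itself is far out and the test function is small.\<close>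

lemma ray_near_or_far:
  assumes "c > 0" "d > 0" "r > 0" "r' > 0" "X > 0" "\<theta> \<in> {0..1}"
  shows "sexp r c (\<theta> * (X * y) - n) * sexp r' d y \<le> sexp r c (n / 2) + sexp r' d (n / 2 * (1 / X))"
proof (cases "\<bar>X * y\<bar> \<le> \<bar>n\<bar> / 2")
  case True
  have "\<bar>\<theta> * (X * y)\<bar> \<le> 1 * (\<bar>n\<bar> / 2)"
    unfolding abs_mult[of \<theta>] by (intro mult_mono) (use True assms in auto)
  hence "\<bar>n / 2\<bar> \<le> \<bar>\<theta> * (X * y) - n\<bar>" by linarith
  hence "sexp r c (\<theta> * (X * y) - n) \<le> sexp r c (n / 2)" by (intro sexp_antimono) (use assms in auto)
  hence "sexp r c (\<theta> * (X * y) - n) * sexp r' d y \<le> sexp r c (n / 2) * 1"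
    by (intro mult_mono sexp_le_1) (use assms in auto)
  then show ?thesis by (simp add: add_increasing2)
next
  case False
  hence "\<bar>n / 2 * (1 / X)\<bar> \<le> \<bar>y\<bar>" using assms by (simp add: abs_mult field_simps)
  hence "sexp r' d y \<le> sexp r' d (n / 2 * (1 / X))" by (intro sexp_antimono) (use assms in auto)
  hence "sexp r c (\<theta> * (X * y) - n) * sexp r' d y \<le> 1 * sexp r' d (n / 2 * (1 / X))"
    by (intro mult_mono sexp_le_1) (use assms in auto)
  then show ?thesis by (simp add: add_increasing)
qed

text \<open>The sum is at most \<open>CARD('d)\<close> times its largest term, and the decay in that
  one coordinate absorbs the power.\<close>

lemma sum_power_sexp_le:
  fixes y :: "real^'d::finite"
  assumes "c > 0" "r > 0"
  shows "(\<Sum>j\<in>UNIV. \<bar>y $ j\<bar>) ^ N * (\<Prod>j\<in>UNIV. sexp r c (y $ j)) \<le> (CARD('d) * (r/c) powr r) ^ N * fact N powr r"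
proof -
  have "Max ((\<lambda>j. \<bar>y $ j\<bar>) ` UNIV) \<in> (\<lambda>j. \<bar>y $ j\<bar>) ` UNIV" by (rule Max_in) auto
  then obtain i where i: "Max ((\<lambda>j. \<bar>y $ j\<bar>) ` UNIV) = \<bar>y $ i\<bar>" by (elim imageE)
  have "(\<Sum>j\<in>UNIV. \<bar>y $ j\<bar>) \<le> (\<Sum>j\<in>(UNIV::'d set). \<bar>y $ i\<bar>)"
    by (rule sum_mono) (auto simp: i [symmetric])
  hence le: "(\<Sum>j\<in>UNIV. \<bar>y $ j\<bar>) \<le> CARD('d) * \<bar>y $ i\<bar>" by simp
  have "(\<Sum>j\<in>UNIV. \<bar>y $ j\<bar>) ^ N * (\<Prod>j\<in>UNIV. sexp r c (y $ j)) =
     (\<Sum>j\<in>UNIV. \<bar>y $ j\<bar>) ^ N * (sexp r c (y $ i) * (\<Prod>j\<in>UNIV-{i}. sexp r c (y $ j)))"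
    by (subst prod.remove[of UNIV i]) auto
  also have "\<dots> \<le> (CARD('d) * \<bar>y $ i\<bar>) ^ N * (sexp r c (y $ i) * 1)"
    by (intro mult_mono power_mono le prod_le_1 mult_left_mono) (use assms in \<open>auto intro!: sexp_le_1 sum_nonneg prod_nonneg mult_nonneg_nonneg\<close>)
  also have "\<dots> = real CARD('d) ^ N * (\<bar>y $ i\<bar> ^ N * sexp r c (y $ i))" by (simp add: power_mult_distrib)
  also have "\<dots> \<le> real CARD('d) ^ N * (((r/c) powr r) ^ N * fact N powr r)"
    by (intro mult_left_mono power_sexp_le assms) auto
  finally show ?thesis by (simp add: power_mult_distrib)
qed

context gs_pair begin

text \<open>The roles are exchanged: the slowly varying wavelet is expanded along rays from the
  origin, its Taylor polynomial is annihilated by the moments of \<open>g\<close>, and the remainder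
  has size X^N. All coordinates take part, since the moments of \<open>g\<close> vanish
  jointly.\<close>

lemma coarse_coefficient:
  assumes h: "h > 0"
  obtains C a c where "C > 0" "a > 0" "c > 0" "\<And>(g :: real^'d::finite \<Rightarrow> complex) \<epsilon> (X::real) n.
    schwartz g \<Longrightarrow> gs_bdd h s' t' g \<Longrightarrow> (\<And>\<alpha>. (LINT x|lborel. of_real (xpow \<alpha> x) * g x) = 0) \<Longrightarrow> 0 < X \<Longrightarrow> X \<le> 1 \<Longrightarrow>
    cmod (LINT y|lborel. g y * wprod \<epsilon> X n y) \<le> C * gs_norm h s' t' g * sexp (t - r2) a (1 / X) * (\<Prod>j\<in>UNIV. sexp t c (n j / X))"
proof -
  obtain C K c where D: "C > 0" "K > 0" "c > 0"
    "\<And>e k u. cmod (dlist (replicate k 1) (wfac e) u) \<le> C * K ^ k * fact k powr r1 * sexp r2 c u"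
    using wfac_decay by metis
  define d where "d = t' / 2 * h powr (1/t') / CARD('d)"
  \<comment> \<open>Now the decay of \<open>g\<close> is spent in thirds: for
    \<open>ray_near_or_far\<close>, for the power \<open>SS ^ N\<close> of the remainder, and for
    integrability.\<close>
  define d3 where "d3 = d / 3"
  have d: "d > 0" using h exps by (simp add: d_def)
  have d3: "d3 > 0" "d3 + d3 + d3 = d" using d by (auto simp: d3_def)
  have t'0: "t' > 0" using exps by simp
  define J where "J = (LINT u|lborel. sexp t' d3 u)"
  have J: "J \<ge> 0" by (simp add: J_def)
  define B where "B = CARD('d) * (t' / d3) powr t'"
  have B: "B > 0" using t'0 d3 by (simp add: B_def)
  define A where "A = 2 powr t' * C ^ CARD('d) * J ^ CARD('d)"
  have A: "A \<ge> 0" using D J by (simp add: A_def)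
  define a where "a = (t - r2) / 2 * (1/(K * B)) powr (1/(t - r2))"
  have a: "a > 0" using exps D B by (simp add: a_def)
  \<comment> \<open>Half of the decay in \<open>1 / X\<close> is distributed evenly over the
    coordinates for \<open>sexp_mixed\<close>; the other half remains in the conclusion.\<close>
  define a' where "a' = a / 2 / CARD('d)"
  have a': "a' > 0" using a by (simp add: a'_def)
  define c1 where "c1 = min (min a' c) d3 * (1/2) powr (1/t)"
  have c1: "c1 > 0" using a' D d3 by (simp add: c1_def)
  define M where "M = 1 + exp d3"
  have M: "M > 0" by (simp add: M_def add_pos_pos)
  show ?thesis
  proof (rule that[of "2 powr (t - r2) * A * M ^ CARD('d) + 1" "a / 2" c1])
    show "2 powr (t - r2) * A * M ^ CARD('d) + 1 > 0" using A M by (simp add: add_nonneg_pos)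
    show "a / 2 > 0" "c1 > 0" using a c1 by auto
    fix g :: "real^'d \<Rightarrow> complex" and \<epsilon> :: "'d \<Rightarrow> bool" and X :: real and n :: "'d \<Rightarrow> real"
    assume g: "schwartz g" and bd: "gs_bdd h s' t' g" and mom: "\<And>\<alpha>. (LINT x|lborel. of_real (xpow \<alpha> x) * g x) = 0"
      and X: "0 < X" and X1: "X \<le> 1"
    define P where "P = gs_norm h s' t' g"
    have P: "P \<ge> 0" unfolding P_def by (rule gs_norm_nonneg[OF bd h])
    define U where "U j = sexp r2 c (n j / 2) + sexp t' d3 (n j / 2 * (1 / X))" for j
    have U: "U j > 0" for j by (simp add: U_def add_pos_pos)
    define I where "I = (LINT y|lborel. g y * wprod \<epsilon> X n y)"
    \<comment> \<open>The property passed to \<open>product_derivatives\<close>. All monomial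
      weights are included so that \<open>Q\<close> is stable under multiplication by a
      coordinate.\<close>
    define Q where "Q p \<longleftrightarrow> (\<forall>\<alpha>. integrable lborel (\<lambda>y. of_real (xpow \<alpha> y) * g y * p y) \<and>
        (LINT y|lborel. of_real (xpow \<alpha> y) * g y * p y) = 0)" for p :: "real^'d \<Rightarrow> complex"
    define E where "E u = C * sexp r2 c u" for u
    have Q1: "Q (\<lambda>_. 1)" by (simp add: Q_def mom integrable_xpow_gs[OF g h bd])
    have Qadd: "Q (\<lambda>y. p y + q y)" if "Q p" "Q q" for p q
      unfolding Q_def
    proof (intro allI conjI)
      fix \<alpha>
      have i: "integrable lborel (\<lambda>y. of_real (xpow \<alpha> y) * g y * p y)" "integrable lborel (\<lambda>y. of_real (xpow \<alpha> y) * g y * q y)"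
        using that by (auto simp: Q_def)
      show "integrable lborel (\<lambda>y. of_real (xpow \<alpha> y) * g y * (p y + q y))"
        unfolding distrib_left by (intro Bochner_Integration.integrable_add i)
      show "(LINT y|lborel. of_real (xpow \<alpha> y) * g y * (p y + q y)) = 0"
        unfolding distrib_left by (subst Bochner_Integration.integral_add[OF i]) (use that in \<open>simp add: Q_def\<close>)
    qed
    have Qmult: "Q (\<lambda>y. k * p y)" if "Q p" for p k
    proof -
      have eq: "of_real (xpow \<alpha> y) * g y * (k * p y) = k * (of_real (xpow \<alpha> y) * g y * p y)" for \<alpha> y by simp
      show ?thesis unfolding Q_def eq
        by (intro allI conjI integrable_mult_right, use that in \<open>simp add: Q_def\<close>)
           (subst integral_mult_right_zero, use that in \<open>simp add: Q_def\<close>)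
    qed
    have Qcoord: "Q (\<lambda>y. of_real (y $ j) * p y)" if "Q p" for p j
    proof -
      have "xpow (\<alpha>(axis j 1 := Suc (\<alpha> (axis j 1)))) y = xpow \<alpha> y * y $ j" for \<alpha> and y :: "real^'d"
        unfolding xpow_vec by (subst (1 2) prod.remove[of UNIV j]) (auto simp: axis_eq_axis intro!: prod.cong)
      hence eq: "of_real (xpow \<alpha> y) * g y * (of_real (y $ j) * p y) = of_real (xpow (\<alpha>(axis j 1 := Suc (\<alpha> (axis j 1)))) y) * g y * p y" for \<alpha> y
        by simp
      show ?thesis using that unfolding Q_def eq by blast
    qed
    obtain H :: "nat \<Rightarrow> real^'d \<Rightarrow> real \<Rightarrow> complex" where H:
      "\<And>y \<theta>. H 0 y \<theta> = (\<Prod>j\<in>UNIV. dlist (replicate 0 1) (wfac (\<epsilon> j)) (\<theta> * (X * y $ j) - n j))"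
      "\<And>k y \<theta>. (H k y has_vector_derivative H (Suc k) y \<theta>) (at \<theta>)"
      "\<And>k y \<theta>. cmod (H k y \<theta>) \<le> (\<Prod>j\<in>UNIV. E (\<theta> * (X * y $ j) - n j)) * (\<Sum>j\<in>UNIV. K * \<bar>X * y $ j\<bar>) ^ k * fact k powr r1"
      "\<And>k. Q (\<lambda>y. H k y 0)"
    proof (rule product_derivatives[where D = "\<lambda>j k. dlist (replicate k 1) (wfac (\<epsilon> j))" and E = E and K = K and r = r1 and P = Q and X = X and n = n])
      show "(dlist (replicate k 1) (wfac (\<epsilon> j)) has_vector_derivative dlist (replicate (Suc k) 1) (wfac (\<epsilon> j)) u) (at u)" for j k u
        by (rule dlist_real_has_vector_derivative[OF schwartz_wfac])
      show "cmod (dlist (replicate k 1) (wfac (\<epsilon> j)) u) \<le> E u * K ^ k * fact k powr r1" for j k u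
        using D(4)[of k "\<epsilon> j" u] by (simp add: E_def mult_ac)
    qed (use D r1 Q1 Qadd Qmult Qcoord in \<open>auto simp: E_def\<close>)
    have main: "(1 / X) ^ N * cmod I \<le> (A * P * (\<Prod>j\<in>UNIV. U j)) * (K * B) ^ N * fact N powr (t - r2)" for N
    proof -
      have iH: "integrable lborel (\<lambda>y. g y * (of_real (1 / fact k) * H k y 0))"
        and zH: "(LINT y|lborel. g y * (of_real (1 / fact k) * H k y 0)) = 0" for k
        using Qmult[OF H(4)[of k], of "of_real (1 / fact k)"] unfolding Q_def by (auto dest!: spec[of _ "\<lambda>_. 0"] simp: xpow_def)
      define T where "T y = (\<Sum>k<N. of_real (1 / fact k) * H k y 0)" for y
      have T: "g y * T y = (\<Sum>k<N. g y * (of_real (1 / fact k) * H k y 0))" for y by (simp add: T_def sum_distrib_left)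
      have ig: "integrable lborel (\<lambda>y. g y * wprod \<epsilon> X n y)" by (rule integrable_gs_wprod[OF g h bd])
      have iT: "integrable lborel (\<lambda>y. g y * T y)" unfolding T by (intro Bochner_Integration.integrable_sum iH)
      have zT: "(LINT y|lborel. g y * T y) = 0" unfolding T by (subst Bochner_Integration.integral_sum) (auto simp only: iH zH sum.neutral_const)
      have I: "I = (LINT y|lborel. g y * wprod \<epsilon> X n y - g y * T y)"
        by (subst Bochner_Integration.integral_diff[OF ig iT]) (simp add: zT I_def)
      define R where "R = 2 powr t' * P * C ^ CARD('d) * (\<Prod>j\<in>UNIV. U j) * (K * X) ^ N * fact N powr (r1 - 1) * (B ^ N * fact N powr t')"
      have R: "R \<ge> 0" using P D X B U by (simp add: R_def prod_nonneg less_imp_le)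
      have pt: "cmod (g y * wprod \<epsilon> X n y - g y * T y) \<le> R * (\<Prod>j\<in>UNIV. sexp t' d3 (y $ j))" for y :: "real^'d"
      proof -
        define Z where "Z = (\<Prod>j\<in>UNIV. sexp t' d3 (y $ j))"
        have Z: "Z > 0" unfolding Z_def by (intro prod_pos) simp
        define SS where "SS = (\<Sum>j\<in>UNIV. \<bar>y $ j\<bar>)"
        have SS: "SS \<ge> 0" by (simp add: SS_def sum_nonneg)
        have sumK: "(\<Sum>j\<in>UNIV. K * \<bar>X * y $ j\<bar>) = K * X * SS" using X by (simp add: SS_def sum_distrib_left abs_mult mult_ac)
        define V where "V = C ^ CARD('d) * (\<Prod>j\<in>UNIV. U j) / Z"
        have V: "(\<Prod>j\<in>UNIV. E (\<theta> * (X * y $ j) - n j)) \<le> V" if "\<theta> \<in> {0..1}" for \<theta>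
        proof -
          have "(\<Prod>j\<in>UNIV. E (\<theta> * (X * y $ j) - n j)) * Z = C ^ CARD('d) * (\<Prod>j\<in>UNIV. sexp r2 c (\<theta> * (X * y $ j) - n j) * sexp t' d3 (y $ j))"
            by (simp add: E_def Z_def prod.distrib)
          also have "\<dots> \<le> C ^ CARD('d) * (\<Prod>j\<in>UNIV. U j)"
            unfolding U_def by (intro mult_left_mono prod_mono conjI ray_near_or_far) (use D d3 exps t'0 X that in auto)
          finally show ?thesis using Z by (simp add: V_def field_simps)
        qed
        have "cmod (H 0 y 1 - (\<Sum>k<N. of_real (1 ^ k / fact k) * H k y 0)) \<le> (V * (K * X * SS) ^ N * fact N powr r1) * 1 ^ N / fact N"
        proof (rule Taylor_remainder_bound[where f = "\<lambda>k. H k y"])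
          fix \<theta> :: real assume th: "\<theta> \<in> {0..1}"
          show "cmod (H N y \<theta>) \<le> V * (K * X * SS) ^ N * fact N powr r1"
            by (rule order_trans[OF H(3)], unfold sumK, intro mult_right_mono V th) (use D X SS in auto)
        qed (use H in auto)
        moreover have "H 0 y 1 = wprod \<epsilon> X n y" by (simp add: H(1) wprod_def)
        ultimately have 1: "cmod (wprod \<epsilon> X n y - T y) \<le> V * (K * X * SS) ^ N * fact N powr r1 / fact N"
          by (simp only: T_def power_one mult_1_right)
        have "cmod (g y) \<le> 2 powr t' * P * (\<Prod>j\<in>UNIV. sexp t' d (y $ j))"
          using gs_axis_decay[OF bd h, of 0 undefined y] t'0 by (simp add: d_def P_def)
        also have "(\<Prod>j\<in>UNIV. sexp t' d (y $ j)) = Z * Z * Z"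
          unfolding d3(2)[symmetric] sexp_add prod.distrib Z_def by simp
        finally have 2: "cmod (g y) \<le> 2 powr t' * P * (Z * Z * Z)" .
        have 3: "SS ^ N * Z \<le> B ^ N * fact N powr t'" unfolding SS_def Z_def B_def by (rule sum_power_sexp_le[OF d3(1) t'0])
        have "cmod (g y * wprod \<epsilon> X n y - g y * T y) = cmod (g y) * cmod (wprod \<epsilon> X n y - T y)"
          by (simp add: norm_mult [symmetric] right_diff_distrib)
        also have "\<dots> \<le> (2 powr t' * P * (Z * Z * Z)) * (V * (K * X * SS) ^ N * fact N powr r1 / fact N)"
          using P Z by (intro mult_mono 1 2) auto
        also have "\<dots> = (2 powr t' * P * C ^ CARD('d) * (\<Prod>j\<in>UNIV. U j) * (K * X) ^ N * (fact N powr r1 / fact N)) * (SS ^ N * Z) * Z"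
          using Z by (simp add: V_def power_mult_distrib)
        also have "\<dots> \<le> (2 powr t' * P * C ^ CARD('d) * (\<Prod>j\<in>UNIV. U j) * (K * X) ^ N * (fact N powr r1 / fact N)) * (B ^ N * fact N powr t') * Z"
          using P D X U Z by (intro mult_right_mono mult_left_mono 3)
            (auto intro!: mult_nonneg_nonneg divide_nonneg_nonneg prod_nonneg simp: less_imp_le)
        also have "\<dots> = R * Z" by (simp add: R_def powr_diff)
        finally show ?thesis by (simp add: Z_def)
      qed
      have int3: "integrable lborel (\<lambda>y::real^'d. \<Prod>j\<in>UNIV. sexp t' d3 (y $ j))"
        using integrable_prod_vec[of "\<lambda>_. sexp t' d3"] integral_sexp_affine(1)[OF d3(1) t'0, of 1 0] by simp
      have "cmod I \<le> (LINT y|lborel. R * (\<Prod>j\<in>UNIV. sexp t' d3 ((y::real^'d) $ j)))"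
        unfolding I
        by (rule Bochner_Integration.integral_norm_bound_integral)
           (use pt in \<open>auto intro!: Bochner_Integration.integrable_diff ig iT int3\<close>)
      also have "\<dots> = R * J ^ CARD('d)"
        using integral_prod_vec[of "\<lambda>_::'d. sexp t' d3"] integral_sexp_affine(1)[OF d3(1) t'0, of 1 0] by (simp add: J_def)
      finally have "(1/X) ^ N * cmod I \<le> (1/X) ^ N * (R * J ^ CARD('d))" using X by (intro mult_left_mono) auto
      also have "\<dots> = (A * P * (\<Prod>j\<in>UNIV. U j)) * (K * B) ^ N * (fact N powr t' * fact N powr (r1 - 1))"
        using X by (simp add: R_def A_def power_divide power_mult_distrib)
      also have "fact N powr t' * fact N powr (r1 - 1) = (fact N powr (t - r2) :: real)"
        by (simp only: powr_add [symmetric] exps)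
      finally show ?thesis .
    qed
    have Y: "1 / X \<ge> 0" using X by simp
    have "cmod I \<le> 2 powr (t - r2) * (A * P * (\<Prod>j\<in>UNIV. U j)) * sexp (t - r2) a (1/X)"
      unfolding a_def by (rule decay_of_moments) (use exps B D X main in auto)
    also have "\<dots> = 2 powr (t - r2) * A * P * (sexp (t - r2) (a/2) (1/X) * (\<Prod>j\<in>UNIV. sexp (t - r2) a' (1/X) * U j))"
    proof -
      have "(\<Prod>j\<in>(UNIV::'d set). sexp (t - r2) a' (1/X)) = sexp (t - r2) (a/2) (1/X)"
        by (simp add: sexp_def exp_of_nat_mult [symmetric] a'_def)
      moreover have "sexp (t - r2) a (1/X) = sexp (t - r2) (a/2) (1/X) * sexp (t - r2) (a/2) (1/X)"
        by (simp add: sexp_add [symmetric])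
      ultimately show ?thesis by (simp only: prod.distrib mult_ac)
    qed
    also have "\<dots> \<le> 2 powr (t - r2) * A * P * (sexp (t - r2) (a/2) (1/X) * (\<Prod>j\<in>UNIV. M * sexp t c1 (n j * (1 / X))))"
    proof (intro mult_left_mono prod_mono conjI)
      fix j
      show "sexp (t - r2) a' (1/X) * U j \<le> M * sexp t c1 (n j * (1 / X))"
        unfolding U_def M_def c1_def by (rule sexp_mixed) (use a' D d3 exps t'0 Y in auto)
    qed (use A P U in \<open>auto simp: less_imp_le\<close>)
    also have "\<dots> = (2 powr (t - r2) * A * M ^ CARD('d)) * (P * sexp (t - r2) (a/2) (1/X) * (\<Prod>j\<in>UNIV. sexp t c1 (n j / X)))"
      by (simp add: prod.distrib mult_ac)
    also have "\<dots> \<le> (2 powr (t - r2) * A * M ^ CARD('d) + 1) * (P * sexp (t - r2) (a/2) (1/X) * (\<Prod>j\<in>UNIV. sexp t c1 (n j / X)))"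
      using P by (intro mult_right_mono) (auto intro!: mult_nonneg_nonneg prod_nonneg)
    finally show "cmod (LINT y|lborel. g y * wprod \<epsilon> X n y) \<le> (2 powr (t - r2) * A * M ^ CARD('d) + 1) * gs_norm h s' t' g *
        sexp (t - r2) (a/2) (1 / X) * (\<Prod>j\<in>UNIV. sexp t c1 (n j / X))"
      by (simp add: I_def P_def mult_ac)
  qed
qed

end

section \<open>Summation over scales and translations\<close>

lemma summable_on_inverse_square_int_vec:
  "(\<lambda>n::'d::finite \<Rightarrow> int. \<Prod>j\<in>UNIV. 1 / (1 + (real_of_int (n j))\<^sup>2)) summable_on UNIV"
proof -
  have "Infinite_Set_Sum.abs_summable_on (\<lambda>n::'d \<Rightarrow> int. \<Prod>j\<in>UNIV. 1 / (1 + (real_of_int (n j))\<^sup>2)) (PiE UNIV (\<lambda>_. UNIV))"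
  proof (rule abs_summable_on_prod_PiE)
    show "Infinite_Set_Sum.abs_summable_on (\<lambda>n::int. 1 / (1 + (real_of_int n)\<^sup>2)) UNIV"
      unfolding abs_summable_equivalent [symmetric]
      using summable_on_inverse_square_int by simp
  qed auto
  thus ?thesis
    by (simp add: PiE_UNIV_domain abs_summable_equivalent [symmetric] abs_prod prod_nonneg)
qed

lemma summable_on_product_real:
  fixes f :: "'a \<Rightarrow> real" and g :: "'b \<Rightarrow> real"
  assumes "f summable_on A" "g summable_on B" "\<And>x. f x \<ge> 0" "\<And>x. g x \<ge> 0"
  shows "(\<lambda>(x, y). f x * g y) summable_on (A \<times> B)"
proof (rule summable_on_SigmaI[where g = "\<lambda>x. f x * infsum g B"])
  show "((\<lambda>y. case (x, y) of (x, y) \<Rightarrow> f x * g y) has_sum f x * infsum g B) B" for x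
    using has_sum_cmult_right[OF has_sum_infsum[OF assms(2)], of "f x"] by simp
  show "(\<lambda>x. f x * infsum g B) summable_on A" by (rule summable_on_cmult_left) (rule assms)
qed (use assms in auto)

text \<open>Polynomial control of \<open>m\<close> by \<open>2 powr m\<close> and its inverse, so
  that decay in the scale on both ends yields summability over \<open>m\<close>.\<close>

lemma one_plus_square_le_powr: "1 + (real_of_int m)\<^sup>2 \<le> 4 * ((1 + 2 powr of_int m) * (1 + 1 / 2 powr of_int m))"
proof -
  define k where "k = nat \<bar>m\<bar>"
  have n: "1 + k\<^sup>2 \<le> 4 * 2 ^ k" for k :: nat
  proof (induction k rule: less_induct)
    case (less k)
    show ?case
    proof (cases "k \<le> 3")
      case True
      hence "k \<in> {0,1,2,3}" by auto
      thus ?thesis by auto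
    next
      case False
      then obtain j where j: "k = Suc j" "j \<ge> 3" by (cases k) auto
      have "2 * j \<le> j * j" using j by (intro mult_le_mono1) auto
      moreover have "1 + (b + 2 * a + 1) \<le> 2 * (1 + b)" if "2 * a \<le> b" for a b :: nat using that by simp
      ultimately have "1 + (j * j + 2 * j + 1) \<le> 2 * (1 + j * j)" by blast
      moreover have "(Suc j)\<^sup>2 = j * j + 2 * j + 1" "j\<^sup>2 = j * j" by (simp_all add: power2_eq_square)
      ultimately have "1 + (Suc j)\<^sup>2 \<le> 2 * (1 + j\<^sup>2)" by (simp only:)
      also have "\<dots> \<le> 2 * (4 * 2 ^ j)" using less[of j] j by simp
      finally show ?thesis using j by simp
    qed
  qed
  have "(real_of_int m)\<^sup>2 = (real k)\<^sup>2" by (simp add: k_def)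
  moreover have "1 + (real k)\<^sup>2 \<le> 4 * 2 ^ k" using of_nat_mono[OF n[of k], where 'a = real] by simp
  moreover have "(2::real) ^ k \<le> (1 + 2 powr of_int m) * (1 + 1 / 2 powr of_int m)"
  proof (cases "m \<ge> 0")
    case True
    hence "(2::real) ^ k = 2 powr of_int m" by (simp add: k_def powr_realpow [symmetric])
    thus ?thesis by (simp add: field_simps add_nonneg_nonneg)
  next
    case False
    hence "(2::real) ^ k = 1 / 2 powr of_int m" by (simp add: k_def powr_realpow [symmetric] powr_minus_divide)
    thus ?thesis by (simp add: field_simps add_nonneg_nonneg)
  qed
  ultimately show ?thesis by simp
qed

lemma exp_wweight:
  fixes n :: "'d::finite \<Rightarrow> int"
  shows "exp (- c * wweight p q t m n) = sexp p (c * CARD('d)) (2 powr of_int m) * sexp q (c * CARD('d)) (1 / 2 powr of_int m) *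
    (\<Prod>j\<in>UNIV. sexp t c (of_int (n j) / 2 powr of_int m))"
  by (simp add: wweight_def sexp_def exp_sum [symmetric] exp_add [symmetric] sum_negf sum_distrib_left abs_divide powr_powr
     powr_minus_divide [symmetric] algebra_simps)

text \<open>The factor \<open>2 powr (m * d)\<close> is the square of the normalisation, one copy
  coming from the coefficient and one from the wavelet. With z = n/X one has 1 + n^2 \<le> (1 + X^2)
  (1 + z^2), so each translation sum costs a factor 1 + X^2, absorbed by the decay in the
  scale.\<close>

lemma summable_on_wweight:
  assumes "c > 0" "p > 0" "q > 0" "t > 0"
  shows "(\<lambda>(\<epsilon>, m, n). 2 powr (of_int m * real CARD('d)) * exp (- c * wweight p q t m n)) summable_on
     (wLambda :: (('d::finite \<Rightarrow> bool) \<times> int \<times> ('d \<Rightarrow> int)) set)"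
proof -
  let ?d = "CARD('d)"
  have cd: "c * ?d > 0" using assms by simp
  \<comment> \<open>X^d (1 + X^2)^d is at most (1 + X)^(3d); one further power comes from
    \<open>one_plus_square_le_powr\<close>.\<close>
  obtain B1 where B1: "B1 > 0" "\<And>x. sexp p (c * ?d) x * (1 + \<bar>x\<bar>) ^ (3 * ?d + 1) \<le> B1"
    using sexp_mult_power_bounded[OF cd assms(2)] by metis
  obtain B2 where B2: "B2 > 0" "\<And>x. sexp q (c * ?d) x * (1 + \<bar>x\<bar>) ^ 1 \<le> B2"
    using sexp_mult_power_bounded[OF cd assms(3)] by metis
  obtain B3 where B3: "B3 > 0" "\<And>x. sexp t c x * (1 + \<bar>x\<bar>) ^ 2 \<le> B3"
    using sexp_mult_power_bounded[OF assms(1,4)] by metis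
  define a where "a m = 1 / (1 + (real_of_int m)\<^sup>2)" for m :: int
  define b where "b n = (\<Prod>j\<in>UNIV. 1 / (1 + (real_of_int (n j))\<^sup>2))" for n :: "'d \<Rightarrow> int"
  have bound: "2 powr (of_int m * real ?d) * exp (- c * wweight p q t m n) \<le> 4 * B1 * B2 * B3 ^ ?d * (1 * (a m * b n))" for m n
  proof -
    define X where "X = 2 powr real_of_int m"
    have X: "X > 0" by (simp add: X_def)
    have Xd: "2 powr (of_int m * real ?d) = X ^ ?d" by (simp add: X_def powr_powr [symmetric] powr_realpow)
    have S3: "sexp t c (of_int (n j) / X) \<le> B3 * (1 + X\<^sup>2) * (1 / (1 + (real_of_int (n j))\<^sup>2))" for j
    proof -
      define z where "z = real_of_int (n j) / X"
      have "1 + (real_of_int (n j))\<^sup>2 = 1 + X\<^sup>2 * z\<^sup>2" using X by (simp add: z_def power_divide)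
      also have "\<dots> \<le> (1 + X\<^sup>2) * (1 + z\<^sup>2)" by (simp add: algebra_simps)
      also have "\<dots> \<le> (1 + X\<^sup>2) * (1 + \<bar>z\<bar>)\<^sup>2" by (intro mult_left_mono) (auto simp: power2_eq_square algebra_simps)
      finally have "sexp t c z * (1 + (real_of_int (n j))\<^sup>2) \<le> (1 + X\<^sup>2) * (sexp t c z * (1 + \<bar>z\<bar>)\<^sup>2)"
        by (simp add: mult_left_mono mult.left_commute)
      also have "\<dots> \<le> (1 + X\<^sup>2) * B3" by (intro mult_left_mono B3) auto
      finally show ?thesis by (simp add: z_def field_simps add_pos_nonneg)
    qed
    have "(\<Prod>j\<in>UNIV. sexp t c (of_int (n j) / X)) \<le> (\<Prod>j\<in>UNIV. B3 * (1 + X\<^sup>2) * (1 / (1 + (real_of_int (n j))\<^sup>2)))"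
      by (intro prod_mono conjI S3) auto
    also have "\<dots> = B3 ^ ?d * (1 + X\<^sup>2) ^ ?d * b n" by (simp only: prod.distrib b_def prod_constant)
    finally have S: "(\<Prod>j\<in>UNIV. sexp t c (of_int (n j) / X)) \<le> B3 ^ ?d * (1 + X\<^sup>2) ^ ?d * b n" .
    have b0: "b n \<ge> 0" by (simp add: b_def prod_nonneg)
    have "X ^ ?d * (1 + X\<^sup>2) ^ ?d \<le> (1 + X) ^ ?d * ((1 + X)\<^sup>2) ^ ?d"
      using X by (intro mult_mono power_mono) (auto simp: power2_eq_square algebra_simps)
    also have "\<dots> = (1 + X) ^ (3 * ?d)" by (simp add: power_mult [symmetric] power_add [symmetric])
    finally have X3: "X ^ ?d * (1 + X\<^sup>2) ^ ?d \<le> (1 + X) ^ (3 * ?d)" .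
    have "(X ^ ?d * (1 + X\<^sup>2) ^ ?d * sexp p (c * ?d) X * sexp q (c * ?d) (1 / X)) * (1 + (real_of_int m)\<^sup>2) \<le>
       ((1 + X) ^ (3 * ?d) * sexp p (c * ?d) X * sexp q (c * ?d) (1 / X)) * (4 * ((1 + X) * (1 + 1 / X)))"
      using one_plus_square_le_powr[of m] X X3 unfolding X_def [symmetric] by (intro mult_mono) auto
    also have "\<dots> = 4 * (sexp p (c * ?d) X * (1 + \<bar>X\<bar>) ^ (3 * ?d + 1)) * (sexp q (c * ?d) (1 / X) * (1 + \<bar>1 / X\<bar>) ^ 1)"
      using X by simp
    also have "\<dots> \<le> 4 * B1 * B2" by (intro mult_mono B1 B2) (use B1(1) in auto)
    finally have A: "X ^ ?d * (1 + X\<^sup>2) ^ ?d * sexp p (c * ?d) X * sexp q (c * ?d) (1 / X) \<le> 4 * B1 * B2 * a m"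
      by (simp add: a_def field_simps add_pos_nonneg)
    have "X ^ ?d * exp (- c * wweight p q t m n) =
       (X ^ ?d * sexp p (c * ?d) X * sexp q (c * ?d) (1 / X)) * (\<Prod>j\<in>UNIV. sexp t c (of_int (n j) / X))"
      unfolding exp_wweight X_def by simp
    also have "\<dots> \<le> (X ^ ?d * sexp p (c * ?d) X * sexp q (c * ?d) (1 / X)) * (B3 ^ ?d * (1 + X\<^sup>2) ^ ?d * b n)"
      using X by (intro mult_left_mono S) auto
    also have "\<dots> = (X ^ ?d * (1 + X\<^sup>2) ^ ?d * sexp p (c * ?d) X * sexp q (c * ?d) (1 / X)) * (B3 ^ ?d * b n)" by simp
    also have "\<dots> \<le> 4 * B1 * B2 * a m * (B3 ^ ?d * b n)" using B3 b0 by (intro mult_right_mono A) auto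
    finally show ?thesis by (simp only: Xd mult_ac mult_1_left)
  qed
  have s1: "(\<lambda>(m, n). a m * b n) summable_on (UNIV \<times> UNIV)"
    using summable_on_inverse_square_int summable_on_inverse_square_int_vec
    by (intro summable_on_product_real) (auto simp: a_def b_def prod_nonneg)
  have s2: "(\<lambda>(\<epsilon>::'d \<Rightarrow> bool, x). 1 * (case x of (m, n) \<Rightarrow> a m * b n)) summable_on (wQ \<times> (UNIV \<times> UNIV))"
    by (intro summable_on_product_real s1) (auto simp: a_def b_def prod_nonneg)
  have s3: "(\<lambda>(\<epsilon>::'d \<Rightarrow> bool, m, n). 4 * B1 * B2 * B3 ^ ?d * (1 * (a m * b n))) summable_on wLambda"
    using summable_on_cmult_right[OF s2, of "4 * B1 * B2 * B3 ^ ?d"] unfolding wLambda_def by (simp add: case_prod_unfold)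
  show ?thesis by (rule summable_on_comparison_test[OF s3]) (use bound in auto)
qed

context gs_pair begin

text \<open>The weight contains decay at both ends of the scale, while each regime provides only
  one. The missing factor is bounded below in that regime and can be inserted at the cost of
  \<open>exp (c * CARD('d))\<close>.\<close>

lemma coefficient_bound:
  assumes h: "h > 0"
  obtains C c where "C > 0" "c > 0" "\<And>(g :: real^'d::finite \<Rightarrow> complex) \<epsilon> m n.
    g \<in> GS0 s' t' \<Longrightarrow> gs_bdd h s' t' g \<Longrightarrow> \<epsilon> \<in> wQ \<Longrightarrow>
    cmod (LINT y|lborel. g y * wpsi \<phi> \<psi> (\<epsilon>, m, n) y) \<le>
      C * gs_norm h s' t' g * 2 powr (of_int m * real CARD('d) / 2) * exp (- c * wweight (s - r1) (t - r2) t m n)"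
proof -
  let ?d = "CARD('d)"
  obtain C1 a1 c1 where 1: "C1 > 0" "a1 > 0" "c1 > 0" "\<And>(g :: real^'d \<Rightarrow> complex) \<epsilon> (X::real) n. schwartz g \<Longrightarrow> gs_bdd h s' t' g \<Longrightarrow> \<epsilon> \<in> wQ \<Longrightarrow> X \<ge> 1 \<Longrightarrow>
    cmod (LINT y|lborel. g y * wprod \<epsilon> X n y) \<le> C1 * gs_norm h s' t' g * sexp (s - r1) a1 X * (\<Prod>j\<in>UNIV. sexp t c1 (n j / X))"
    using fine_coefficient[OF h, where 'd = 'd] by blast
  obtain C2 a2 c2 where 2: "C2 > 0" "a2 > 0" "c2 > 0" "\<And>(g :: real^'d \<Rightarrow> complex) \<epsilon> (X::real) n.
    schwartz g \<Longrightarrow> gs_bdd h s' t' g \<Longrightarrow> (\<And>\<alpha>. (LINT x|lborel. of_real (xpow \<alpha> x) * g x) = 0) \<Longrightarrow> 0 < X \<Longrightarrow> X \<le> 1 \<Longrightarrow>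
    cmod (LINT y|lborel. g y * wprod \<epsilon> X n y) \<le> C2 * gs_norm h s' t' g * sexp (t - r2) a2 (1 / X) * (\<Prod>j\<in>UNIV. sexp t c2 (n j / X))"
    using coarse_coefficient[OF h, where 'd = 'd] by blast
  define c where "c = min (min (a1 / ?d) c1) (min (a2 / ?d) c2)"
  have "c \<le> a1 / ?d" "c \<le> a2 / ?d" by (auto simp: c_def)
  hence "c * ?d \<le> a1" "c * ?d \<le> a2" by (simp_all add: pos_le_divide_eq)
  moreover have "c > 0" "c \<le> c1" "c \<le> c2" using 1(1-3) 2(1-3) by (simp_all add: c_def)
  ultimately have c: "c > 0" "c * ?d \<le> a1" "c * ?d \<le> a2" "c \<le> c1" "c \<le> c2" by auto
  \<comment> \<open>Lower bound for the factor to be inserted: at fine scales \<open>1 / X\<close>,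
    at coarse scales \<open>X\<close>, is at most 1.\<close>
  have dist: "sexp p x y \<ge> exp (- x)" if "\<bar>y\<bar> \<le> 1" "x \<ge> 0" "p > 0" for p x y
  proof -
    have "\<bar>y\<bar> powr (1/p) \<le> 1 powr (1/p)" using that by (intro powr_mono2) auto
    thus ?thesis using that by (simp add: sexp_def mult_left_le)
  qed
  show ?thesis
  proof (rule that[of "(C1 + C2) * exp (c * ?d)" c])
    show "(C1 + C2) * exp (c * ?d) > 0" "c > 0" using 1 2 c by auto
    fix g :: "real^'d \<Rightarrow> complex" and \<epsilon> :: "'d \<Rightarrow> bool" and m and n :: "'d \<Rightarrow> int"
    assume g: "g \<in> GS0 s' t'" and bd: "gs_bdd h s' t' g" and eps: "\<epsilon> \<in> wQ"
    have sg: "schwartz g" and mom: "\<And>\<alpha>. (LINT x|lborel. of_real (xpow \<alpha> x) * g x) = 0" using g by (auto simp: GS0_def GS_def)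
    define X where "X = 2 powr real_of_int m"
    have X: "X > 0" by (simp add: X_def)
    define P where "P = gs_norm h s' t' g"
    have P: "P \<ge> 0" unfolding P_def by (rule gs_norm_nonneg[OF bd h])
    define I where "I = (LINT y|lborel. g y * wprod \<epsilon> X (\<lambda>j. of_int (n j)) y)"
    define W where "W = exp (- c * wweight (s - r1) (t - r2) t m n)"
    have W: "W = sexp (s - r1) (c * ?d) X * sexp (t - r2) (c * ?d) (1 / X) * (\<Prod>j\<in>UNIV. sexp t c (of_int (n j) / X))"
      unfolding W_def exp_wweight X_def ..
    have W0: "W > 0" by (simp add: W_def)
    have cd: "c * ?d > 0" using c by simp
    have main: "cmod I \<le> (C1 + C2) * exp (c * ?d) * P * W"
    proof (cases "m \<ge> 0")
      case True
      hence X1: "X \<ge> 1" unfolding X_def by (intro ge_one_powr_ge_zero) auto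
      have "cmod I \<le> C1 * P * sexp (s - r1) a1 X * (\<Prod>j\<in>UNIV. sexp t c1 (of_int (n j) / X))"
        unfolding I_def P_def by (rule 1(4)[OF sg bd eps X1])
      also have "\<dots> \<le> C1 * P * sexp (s - r1) (c * ?d) X * (\<Prod>j\<in>UNIV. sexp t c (of_int (n j) / X))"
        using 1 P c by (intro mult_mono prod_mono conjI order_refl sexp_mono_rate) (auto intro: prod_nonneg)
      also have "\<dots> = C1 * P * sexp (s - r1) (c * ?d) X * (\<Prod>j\<in>UNIV. sexp t c (of_int (n j) / X)) * (exp (c * ?d) * exp (- (c * ?d)))"
        by (simp add: exp_minus)
      also have "\<dots> \<le> C1 * P * sexp (s - r1) (c * ?d) X * (\<Prod>j\<in>UNIV. sexp t c (of_int (n j) / X)) * (exp (c * ?d) * sexp (t - r2) (c * ?d) (1 / X))"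
        using 1 P X X1 cd exps by (intro mult_left_mono dist) (auto intro!: mult_nonneg_nonneg prod_nonneg)
      also have "\<dots> = C1 * exp (c * ?d) * P * W" by (simp add: W)
      also have "\<dots> \<le> (C1 + C2) * exp (c * ?d) * P * W" using 2 P W0 by (intro mult_right_mono) auto
      finally show ?thesis .
    next
      case False
      hence "X \<le> 2 powr 0" unfolding X_def by (intro powr_mono) auto
      hence X1: "X \<le> 1" by simp
      have "cmod I \<le> C2 * P * sexp (t - r2) a2 (1 / X) * (\<Prod>j\<in>UNIV. sexp t c2 (of_int (n j) / X))"
        unfolding I_def P_def by (rule 2(4)[OF sg bd mom X X1])
      also have "\<dots> \<le> C2 * P * sexp (t - r2) (c * ?d) (1 / X) * (\<Prod>j\<in>UNIV. sexp t c (of_int (n j) / X))"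
        using 2 P c by (intro mult_mono prod_mono conjI order_refl sexp_mono_rate) (auto intro: prod_nonneg)
      also have "\<dots> = C2 * P * sexp (t - r2) (c * ?d) (1 / X) * (\<Prod>j\<in>UNIV. sexp t c (of_int (n j) / X)) * (exp (c * ?d) * exp (- (c * ?d)))"
        by (simp add: exp_minus)
      also have "\<dots> \<le> C2 * P * sexp (t - r2) (c * ?d) (1 / X) * (\<Prod>j\<in>UNIV. sexp t c (of_int (n j) / X)) * (exp (c * ?d) * sexp (s - r1) (c * ?d) X)"
        using 2 P X X1 cd exps by (intro mult_left_mono dist) (auto intro!: mult_nonneg_nonneg prod_nonneg)
      also have "\<dots> = C2 * exp (c * ?d) * P * W" by (simp add: W)
      also have "\<dots> \<le> (C1 + C2) * exp (c * ?d) * P * W" using 1 P W0 by (intro mult_right_mono) auto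
      finally show ?thesis .
    qed
    have "(LINT y|lborel. g y * wpsi \<phi> \<psi> (\<epsilon>, m, n) y) = of_real (2 powr (of_int m * real ?d / 2)) * I"
    proof -
      have "g y * wpsi \<phi> \<psi> (\<epsilon>, m, n) y = of_real (2 powr (of_int m * real ?d / 2)) * (g y * wprod \<epsilon> X (\<lambda>j. of_int (n j)) y)" for y
        by (simp add: wpsi_eq_tder tder_def wprod_def X_def)
      thus ?thesis unfolding I_def by (simp only: integral_mult_right_zero)
    qed
    thus "cmod (LINT y|lborel. g y * wpsi \<phi> \<psi> (\<epsilon>, m, n) y) \<le>
      (C1 + C2) * exp (c * ?d) * gs_norm h s' t' g * 2 powr (of_int m * real ?d / 2) * exp (- c * wweight (s - r1) (t - r2) t m n)"
      using mult_left_mono[OF main, of "2 powr (of_int m * real ?d / 2)"]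
      by (simp add: norm_mult P_def W_def mult_ac)
  qed
qed

end

subsection \<open>Square integrable functions\<close>

definition l2sq :: "(real \<Rightarrow> complex) \<Rightarrow> real" where "l2sq f = (LINT x|lborel. (cmod (f x))\<^sup>2)"

lemma l2norm_eq: "l2norm f = sqrt (l2sq f)" by (simp add: l2norm_def l2sq_def)
lemma l2sq_nonneg [simp]: "l2sq f \<ge> 0" by (simp add: l2sq_def)
lemma l2norm_less_iff: "\<delta> > 0 \<Longrightarrow> l2norm f < \<delta> \<longleftrightarrow> l2sq f < \<delta>\<^sup>2"
  by (metis l2norm_eq l2sq_nonneg real_sqrt_less_iff real_sqrt_unique less_imp_le)

lemma sqint_borel: "sqint f \<Longrightarrow> f \<in> borel_measurable borel" by (simp add: sqint_def)
lemma sqint_sq: "sqint f \<Longrightarrow> integrable lborel (\<lambda>x. (cmod (f x))\<^sup>2)" by (simp add: sqint_def)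

lemma borel_measurable_cnj [measurable]: "cnj \<in> borel_measurable borel"
  by (intro borel_measurable_continuous_onI continuous_intros)

lemma sqint_cmult: "sqint f \<Longrightarrow> sqint (\<lambda>x. c * f x)"
  by (auto simp: sqint_def norm_mult power_mult_distrib)

lemma cmod_add_sq_le: "(cmod (a + b))\<^sup>2 \<le> 2 * (cmod a)\<^sup>2 + 2 * (cmod b)\<^sup>2"
proof -
  have "(cmod (a + b))\<^sup>2 \<le> (cmod a + cmod b)\<^sup>2" by (intro power_mono norm_triangle_ineq) auto
  also have "\<dots> \<le> 2 * (cmod a)\<^sup>2 + 2 * (cmod b)\<^sup>2"
    using sum_squares_bound[of "cmod a" "cmod b"] by (simp add: power2_eq_square algebra_simps)
  finally show ?thesis .
qed

lemma sqint_add: assumes "sqint f" "sqint g" shows "sqint (\<lambda>x. f x + g x)"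
proof -
  note [measurable] = sqint_borel[OF assms(1)] sqint_borel[OF assms(2)]
  have "integrable lborel (\<lambda>x. (cmod (f x + g x))\<^sup>2)"
  proof (rule Bochner_Integration.integrable_bound)
    show "integrable lborel (\<lambda>x. 2 * (cmod (f x))\<^sup>2 + 2 * (cmod (g x))\<^sup>2)"
      using assms by (auto intro!: Bochner_Integration.integrable_add sqint_sq)
    show "AE x in lborel. norm ((cmod (f x + g x))\<^sup>2) \<le> norm (2 * (cmod (f x))\<^sup>2 + 2 * (cmod (g x))\<^sup>2)"
      by (rule AE_I2) (use cmod_add_sq_le in auto)
  qed measurable
  thus ?thesis by (simp add: sqint_def)
qed

lemma l2sq_add_le: assumes "sqint f" "sqint g" shows "l2sq (\<lambda>x. f x + g x) \<le> 2 * l2sq f + 2 * l2sq g"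
proof -
  have "l2sq (\<lambda>x. f x + g x) \<le> (LINT x|lborel. 2 * (cmod (f x))\<^sup>2 + 2 * (cmod (g x))\<^sup>2)"
    unfolding l2sq_def using sqint_sq[OF sqint_add[OF assms]] assms
    by (intro integral_mono cmod_add_sq_le) (auto intro!: Bochner_Integration.integrable_add sqint_sq)
  also have "\<dots> = 2 * l2sq f + 2 * l2sq g"
    using assms by (simp add: l2sq_def sqint_sq)
  finally show ?thesis .
qed

lemma sqint_0: "sqint (\<lambda>x. 0)" by (simp add: sqint_def)

lemma sqint_diff: "sqint f \<Longrightarrow> sqint g \<Longrightarrow> sqint (\<lambda>x. f x - g x)"
  using sqint_add[of f "\<lambda>x. (-1) * g x"] sqint_cmult[of g "-1"] by simp

lemma sqint_sum: "finite A \<Longrightarrow> (\<And>i. i \<in> A \<Longrightarrow> sqint (f i)) \<Longrightarrow> sqint (\<lambda>x. \<Sum>i\<in>A. f i x)"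
  by (induction A rule: finite_induct) (auto intro: sqint_0 sqint_add)

lemma l2inner_integrable: assumes "sqint f" "sqint g" shows "integrable lborel (\<lambda>x. f x * cnj (g x))"
proof -
  note [measurable] = sqint_borel[OF assms(1)] sqint_borel[OF assms(2)]
  show ?thesis
  proof (rule Bochner_Integration.integrable_bound)
    show "integrable lborel (\<lambda>x. (cmod (f x))\<^sup>2 + (cmod (g x))\<^sup>2)"
      using assms by (auto intro!: Bochner_Integration.integrable_add sqint_sq)
    show "AE x in lborel. norm (f x * cnj (g x)) \<le> norm ((cmod (f x))\<^sup>2 + (cmod (g x))\<^sup>2)"
    proof (rule AE_I2)
      fix x
      have "0 \<le> cmod (f x) * cmod (g x)" by simp
      hence "cmod (f x) * cmod (g x) \<le> (cmod (f x))\<^sup>2 + (cmod (g x))\<^sup>2"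
        using sum_squares_bound[of "cmod (f x)" "cmod (g x)"] by linarith
      thus "norm (f x * cnj (g x)) \<le> norm ((cmod (f x))\<^sup>2 + (cmod (g x))\<^sup>2)" by (simp add: norm_mult)
    qed
  qed measurable
qed

lemma l2inner_add_left: "sqint f \<Longrightarrow> sqint g \<Longrightarrow> sqint h \<Longrightarrow> l2inner (\<lambda>x. f x + g x) h = l2inner f h + l2inner g h"
  by (simp add: l2inner_def distrib_right l2inner_integrable)
lemma l2inner_cmult_left: "l2inner (\<lambda>x. c * f x) h = c * l2inner f h"
  by (simp add: l2inner_def mult.assoc)
lemma l2inner_commute: "l2inner f g = cnj (l2inner g f)"
proof -
  have "cnj (l2inner g f) = (LINT x|lborel. cnj (g x * cnj (f x)))" unfolding l2inner_def by (rule Bochner_Integration.integral_cnj [symmetric])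
  thus ?thesis by (simp add: l2inner_def mult.commute)
qed

lemma l2inner_diff_right: "sqint f \<Longrightarrow> sqint g \<Longrightarrow> sqint h \<Longrightarrow> l2inner h (\<lambda>x. f x - g x) = l2inner h f - l2inner h g"
  by (simp add: l2inner_def right_diff_distrib l2inner_integrable)
lemma l2inner_diff_left: "sqint f \<Longrightarrow> sqint g \<Longrightarrow> sqint h \<Longrightarrow> l2inner (\<lambda>x. f x - g x) h = l2inner f h - l2inner g h"
  by (simp add: l2inner_def left_diff_distrib l2inner_integrable)
lemma l2inner_sum_left: "finite A \<Longrightarrow> (\<And>i. i \<in> A \<Longrightarrow> sqint (f i)) \<Longrightarrow> sqint h \<Longrightarrow> l2inner (\<lambda>x. \<Sum>i\<in>A. f i x) h = (\<Sum>i\<in>A. l2inner (f i) h)"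
proof (induction A rule: finite_induct)
  case empty then show ?case by (simp add: l2inner_def)
qed (simp add: l2inner_add_left sqint_sum)
lemma l2inner_self: "l2inner f f = of_real (l2sq f)"
  unfolding l2inner_def l2sq_def complex_norm_square [symmetric] by (rule integral_complex_of_real)

lemma cmod_diff_sq: "(cmod (a - b))\<^sup>2 = (cmod a)\<^sup>2 - 2 * Re (a * cnj b) + (cmod b)\<^sup>2"
  unfolding cmod_power2 by (simp add: power2_eq_square algebra_simps)

lemma Re_cnj_mult_self: "Re (cnj z * z) = (cmod z)\<^sup>2"
  unfolding cmod_power2 by (simp add: power2_eq_square)

lemma l2sq_diff_cmult:
  assumes "sqint u" "sqint e"
  shows "l2sq (\<lambda>x. u x - c * e x) = l2sq u - 2 * Re (cnj c * l2inner u e) + (cmod c)\<^sup>2 * l2sq e"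
proof -
  define R where "R x = Re (cnj c * (u x * cnj (e x)))" for x
  have eq: "(cmod (u x - c * e x))\<^sup>2 = (cmod (u x))\<^sup>2 - 2 * R x + (cmod c)\<^sup>2 * (cmod (e x))\<^sup>2" for x
    unfolding cmod_diff_sq R_def by (simp only: norm_mult power_mult_distrib complex_cnj_mult mult_ac)
  have i: "integrable lborel (\<lambda>x. cnj c * (u x * cnj (e x)))"
    by (intro integrable_mult_right l2inner_integrable assms)
  have iR: "integrable lborel R" unfolding R_def [abs_def] by (rule integrable_Re[OF i])
  have "(LINT x|lborel. R x) = Re (cnj c * l2inner u e)"
    unfolding R_def l2inner_def by (subst integral_Re[OF i]) (simp only: integral_mult_right_zero)
  thus ?thesis unfolding l2sq_def eq using iR sqint_sq[OF assms(1)] sqint_sq[OF assms(2)] by simp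
qed

lemma l2sq_diff_sum:
  assumes "finite A" "\<And>i. i \<in> A \<Longrightarrow> sqint (e i)" "sqint u"
    and on: "\<And>i j. i \<in> A \<Longrightarrow> j \<in> A \<Longrightarrow> l2inner (e i) (e j) = (if i = j then 1 else 0)"
  shows "l2sq (\<lambda>x. u x - (\<Sum>i\<in>A. c i * e i x)) = l2sq u + (\<Sum>i\<in>A. (cmod (c i))\<^sup>2 - 2 * Re (cnj (c i) * l2inner u (e i)))"
  using assms
proof (induction A rule: finite_induct)
  case (insert a A)
  have sq: "sqint (\<lambda>x. \<Sum>i\<in>A. c i * e i x)" using insert by (intro sqint_sum sqint_cmult) auto
  have ea: "sqint (e a)" using insert by auto
  have "l2sq (e a) = 1" using insert.prems(3)[of a a] by (simp add: l2inner_self)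
  moreover have "l2inner (\<lambda>x. u x - (\<Sum>i\<in>A. c i * e i x)) (e a) = l2inner u (e a)"
  proof -
    have "l2inner (\<lambda>x. \<Sum>i\<in>A. c i * e i x) (e a) = (\<Sum>i\<in>A. c i * l2inner (e i) (e a))"
      using insert by (subst l2inner_sum_left) (auto intro!: sqint_cmult simp: l2inner_cmult_left)
    also have "\<dots> = 0" using insert by (intro sum.neutral) auto
    finally show ?thesis using insert ea sq by (simp add: l2inner_diff_left)
  qed
  moreover have "(\<lambda>x. u x - (\<Sum>i\<in>insert a A. c i * e i x)) = (\<lambda>x. (u x - (\<Sum>i\<in>A. c i * e i x)) - c a * e a x)"
    using insert.hyps by (auto simp: algebra_simps)
  ultimately have "l2sq (\<lambda>x. u x - (\<Sum>i\<in>insert a A. c i * e i x)) =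
     l2sq (\<lambda>x. u x - (\<Sum>i\<in>A. c i * e i x)) - 2 * Re (cnj (c a) * l2inner u (e a)) + (cmod (c a))\<^sup>2"
    using l2sq_diff_cmult[OF sqint_diff[OF insert.prems(2) sq] ea, of "c a"] by (simp only: mult_1_right)
  thus ?case using insert by (simp add: algebra_simps)
qed simp

text \<open>The finite sums supplied by \<open>l2_onb\<close> have unknown coefficients and support
  \<open>B\<close>. Passing to Fourier coefficients on a larger set \<open>A\<close> does not
  increase the error, which allows a further set of indices to be added for uniform
  convergence.\<close>

lemma best_approximation:
  assumes "finite A" "B \<subseteq> A" "\<And>i. i \<in> A \<Longrightarrow> sqint (e i)" "sqint u"
    and on: "\<And>i j. i \<in> A \<Longrightarrow> j \<in> A \<Longrightarrow> l2inner (e i) (e j) = (if i = j then 1 else 0)"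
  shows "l2sq (\<lambda>x. u x - (\<Sum>i\<in>A. l2inner u (e i) * e i x)) \<le> l2sq (\<lambda>x. u x - (\<Sum>i\<in>B. c i * e i x))"
proof -
  have fB: "finite B" using assms finite_subset by blast
  let ?a = "\<lambda>i. l2inner u (e i)"
  have "l2sq (\<lambda>x. u x - (\<Sum>i\<in>A. ?a i * e i x)) = l2sq u + (\<Sum>i\<in>A. (cmod (?a i))\<^sup>2 - 2 * Re (cnj (?a i) * ?a i))"
    by (rule l2sq_diff_sum) (use assms in auto)
  also have "(\<Sum>i\<in>A. (cmod (?a i))\<^sup>2 - 2 * Re (cnj (?a i) * ?a i)) = (\<Sum>i\<in>A. - (cmod (?a i))\<^sup>2)"
    by (simp only: Re_cnj_mult_self) (simp add: sum_negf)
  also have "\<dots> \<le> (\<Sum>i\<in>B. - (cmod (?a i))\<^sup>2)"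
    using sum_mono2[OF assms(1,2), of "\<lambda>i. (cmod (?a i))\<^sup>2"] by (simp add: sum_negf)
  also have "\<dots> \<le> (\<Sum>i\<in>B. (cmod (c i))\<^sup>2 - 2 * Re (cnj (c i) * ?a i))"
  proof (rule sum_mono)
    fix i
    have "0 \<le> (cmod (?a i - c i))\<^sup>2" by simp
    thus "- (cmod (?a i))\<^sup>2 \<le> (cmod (c i))\<^sup>2 - 2 * Re (cnj (c i) * ?a i)"
      unfolding cmod_diff_sq by (simp add: mult.commute)
  qed
  also have "l2sq u + \<dots> = l2sq (\<lambda>x. u x - (\<Sum>i\<in>B. c i * e i x))"
  proof (rule l2sq_diff_sum [symmetric])
    show "l2inner (e i) (e j) = (if i = j then 1 else 0)" if "i \<in> B" "j \<in> B" for i j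
      using on[of i j] that assms(2) by blast
  qed (use assms fB in auto)
  finally show ?thesis by simp
qed

text \<open>Orthogonality passes to L^2 limits; the weighted inequality 2ab \<le> \<eta> a^2 +
  b^2/\<eta> bounds the inner product with the error.\<close>

lemma orthogonal_limit:
  assumes F: "sqint F" and h: "sqint h"
    and ap: "\<And>\<delta>. \<delta> > 0 \<Longrightarrow> \<exists>h'. sqint h' \<and> l2sq (\<lambda>x. h x - h' x) < \<delta> \<and> l2inner F h' = 0"
  shows "l2inner F h = 0"
proof (rule ccontr)
  assume ne: "l2inner F h \<noteq> 0"
  define \<kappa> where "\<kappa> = cmod (l2inner F h)"
  have k: "\<kappa> > 0" using ne by (simp add: \<kappa>_def)
  \<comment> \<open>With this weight the contribution of \<open>F\<close> is at most \<kappa>; the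
    error is then required to contribute less than \<kappa>, which yields \<kappa> <
    \<kappa>.\<close>
  define \<eta> where "\<eta> = \<kappa> / (1 + l2sq F)"
  have pos: "1 + l2sq F > 0" by (simp add: add_pos_nonneg)
  have eta: "\<eta> > 0" using k pos by (simp add: \<eta>_def)
  obtain h' where h': "sqint h'" "l2sq (\<lambda>x. h x - h' x) < \<eta> * \<kappa>" "l2inner F h' = 0"
    using ap[of "\<eta> * \<kappa>"] eta k by auto
  let ?w = "\<lambda>x. h x - h' x"
  have w: "sqint ?w" using h h' by (intro sqint_diff)
  have "\<kappa> = cmod (l2inner F ?w)" using h' F h by (simp add: \<kappa>_def l2inner_diff_right)
  also have "\<dots> \<le> (LINT x|lborel. (\<eta> * (cmod (F x))\<^sup>2 + (cmod (?w x))\<^sup>2 / \<eta>) / 2)"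
    unfolding l2inner_def
  proof (rule Bochner_Integration.integral_norm_bound_integral)
    show "integrable lborel (\<lambda>x. F x * cnj (?w x))" by (rule l2inner_integrable[OF F w])
    show "integrable lborel (\<lambda>x. (\<eta> * (cmod (F x))\<^sup>2 + (cmod (?w x))\<^sup>2 / \<eta>) / 2)"
      using sqint_sq[OF F] sqint_sq[OF w] by auto
    fix x
    have "0 \<le> (sqrt \<eta> * cmod (F x) - cmod (?w x) / sqrt \<eta>)\<^sup>2" by simp
    also have "\<dots> = \<eta> * (cmod (F x))\<^sup>2 + (cmod (?w x))\<^sup>2 / \<eta> - 2 * (cmod (F x) * cmod (?w x))"
      using eta by (simp add: power2_diff power_mult_distrib power_divide)
    finally show "norm (F x * cnj (?w x)) \<le> (\<eta> * (cmod (F x))\<^sup>2 + (cmod (?w x))\<^sup>2 / \<eta>) / 2"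
      by (simp add: norm_mult del: complex_cnj_diff)
  qed
  also have "\<dots> = (\<eta> * l2sq F + l2sq ?w / \<eta>) / 2"
    using sqint_sq[OF F] sqint_sq[OF w] by (simp add: l2sq_def)
  also have "\<dots> < (\<kappa> + \<kappa>) / 2"
  proof -
    have "\<eta> * l2sq F \<le> \<kappa>" using k pos by (simp add: \<eta>_def field_simps)
    moreover have "l2sq ?w / \<eta> < \<kappa>" using h'(2) eta by (simp add: field_simps)
    ultimately show ?thesis by simp
  qed
  finally show False by simp
qed

text \<open>L^2 arguments determine functions only almost everywhere; this is how they become
  pointwise statements about kernels.\<close>

lemma continuous_AE_eq_0:
  fixes F :: "real \<Rightarrow> complex"
  assumes "continuous_on UNIV F" "open U" "x \<in> U" and ae: "AE y in lborel. y \<in> U \<longrightarrow> F y = 0"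
  shows "F x = 0"
proof (rule ccontr)
  assume "F x \<noteq> 0"
  have op: "open ({x. F x \<noteq> 0} \<inter> U)" using assms by (intro open_Int open_Collect_neq) auto
  hence "{x. F x \<noteq> 0} \<inter> U \<in> sets lborel" by auto
  moreover have "AE y in lborel. y \<notin> {x. F x \<noteq> 0} \<inter> U" using ae by eventually_elim auto
  ultimately have null: "{x. F x \<noteq> 0} \<inter> U \<in> null_sets lborel" by (simp add: AE_iff_null_sets)
  obtain e where e: "e > 0" "ball x e \<subseteq> {x. F x \<noteq> 0} \<inter> U"
    using openE[OF op, of x] \<open>F x \<noteq> 0\<close> \<open>x \<in> U\<close> by auto
  have "{x - e/2..x + e/2} \<subseteq> {x. F x \<noteq> 0} \<inter> U" using e by (auto simp: dist_real_def subset_iff)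
  hence "emeasure lborel {x - e/2..x + e/2} \<le> emeasure lborel ({x. F x \<noteq> 0} \<inter> U)"
    using op by (intro emeasure_mono) auto
  thus False using null e by (simp add: null_sets_def)
qed

lemma continuous_l2sq_eq_0:
  assumes "continuous_on UNIV F" "sqint F" "l2sq F = 0" shows "F x = 0"
proof (rule continuous_AE_eq_0[OF assms(1) open_UNIV UNIV_I])
  have "AE x in lborel. (cmod (F x))\<^sup>2 = 0"
    using assms(3) sqint_sq[OF assms(2)] unfolding l2sq_def by (subst (asm) integral_nonneg_eq_0_iff_AE) auto
  thus "AE y in lborel. y \<in> UNIV \<longrightarrow> F y = 0" by simp
qed

subsection \<open>Dilated translates and their reproducing kernels\<close>

definition dil :: "real \<Rightarrow> (real \<Rightarrow> complex) \<Rightarrow> int \<Rightarrow> real \<Rightarrow> complex" where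
  "dil X f n x = of_real (sqrt X) * f (X * x - of_int n)"

text \<open>When the integer translates of \<open>f\<close> are orthonormal, this is the reproducing
  kernel of their closed span.\<close>

definition kern :: "(real \<Rightarrow> complex) \<Rightarrow> real \<Rightarrow> real \<Rightarrow> complex" where
  "kern f x y = (\<Sum>\<^sub>\<infinity>n::int. f (x - of_int n) * cnj (f (y - of_int n)))"

definition isq :: real where "isq = (\<Sum>\<^sub>\<infinity>n::int. 1 / (1 + (real_of_int n)\<^sup>2))"

lemma isq_nonneg: "isq \<ge> 0" unfolding isq_def by (rule infsum_nonneg) auto

text \<open>Only this much decay is needed for kernels: of the square, one factor is traded for
  decay in the distance of two points, the other for summation over translations.\<close>

definition rapid :: "(real \<Rightarrow> complex) \<Rightarrow> real \<Rightarrow> bool" where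
  "rapid f C \<longleftrightarrow> C \<ge> 0 \<and> continuous_on UNIV f \<and> (\<forall>u. cmod (f u) \<le> C / (1 + u\<^sup>2)\<^sup>2)"

lemma rapidD: assumes "rapid f C" shows "C \<ge> 0" "continuous_on UNIV f" "cmod (f u) \<le> C / (1 + u\<^sup>2)\<^sup>2"
  "cmod (f u) \<le> C / (1 + u\<^sup>2)" "cmod (f u) \<le> C"
proof -
  show C: "C \<ge> 0" "continuous_on UNIV f" and 1: "cmod (f u) \<le> C / (1 + u\<^sup>2)\<^sup>2" using assms by (auto simp: rapid_def)
  have "C / (1 + u\<^sup>2)\<^sup>2 \<le> C / (1 + u\<^sup>2)" using C by (intro divide_left_mono self_le_power) (auto intro!: mult_pos_pos zero_less_power add_pos_nonneg)
  thus 2: "cmod (f u) \<le> C / (1 + u\<^sup>2)" using 1 by simp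
  have "C / (1 + u\<^sup>2) \<le> C" using C by (simp add: divide_le_eq add_pos_nonneg mult_le_cancel_left1)
  thus "cmod (f u) \<le> C" using 2 by simp
qed

text \<open>The denominator is the square of \<open>p * q\<close>. Peetre's inequality turns
  \<open>p * q\<close> into decay in \<open>x - y\<close>, and one factor \<open>p\<close> is left
  for the sum over \<open>n\<close>.\<close>

lemma rapid_product_bound:
  assumes "rapid f C"
  shows "cmod (f (x - n) * cnj (f (y - n))) \<le> 2 * C\<^sup>2 / (1 + (x - y)\<^sup>2) * (1 / (1 + (x - n)\<^sup>2))"
proof -
  define p q where "p = 1 + (x - n)\<^sup>2" and "q = 1 + (y - n)\<^sup>2"
  have pq: "p \<ge> 1" "q \<ge> 1" by (auto simp: p_def q_def)
  have "1 + (x - y)\<^sup>2 \<le> 2 * p * q" using peetre[of "x - n" "n - y"] by (simp add: p_def q_def power2_commute)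
  also have "\<dots> \<le> 2 * (p * q\<^sup>2)" using pq by (simp add: power2_eq_square)
  finally have pe: "1 + (x - y)\<^sup>2 \<le> 2 * (p * q\<^sup>2)" .
  have "cmod (f (x - n) * cnj (f (y - n))) \<le> (C / p\<^sup>2) * (C / q\<^sup>2)"
    unfolding norm_mult complex_mod_cnj p_def q_def using rapidD[OF assms] by (intro mult_mono) auto
  also have "\<dots> = C\<^sup>2 / p * (1 / (p * q\<^sup>2))" by (simp add: power2_eq_square)
  also have "\<dots> \<le> C\<^sup>2 / p * (2 / (1 + (x - y)\<^sup>2))"
  proof (rule mult_left_mono)
    show "1 / (p * q\<^sup>2) \<le> 2 / (1 + (x - y)\<^sup>2)" using pe pq by (simp add: field_simps add_pos_nonneg)
  qed (use pq in auto)
  finally show ?thesis by (simp add: p_def mult_ac)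
qed

lemma
  assumes "rapid f C"
  shows kern_abs_summable: "(\<lambda>n::int. cmod (f (x - of_int n) * cnj (f (y - of_int n)))) summable_on UNIV"
    and kern_abs_sum_bound: "(\<Sum>\<^sub>\<infinity>n::int. cmod (f (x - of_int n) * cnj (f (y - of_int n)))) \<le> 8 * C\<^sup>2 * isq / (1 + (x - y)\<^sup>2)"
    and kern_bound: "cmod (kern f x y) \<le> 8 * C\<^sup>2 * isq / (1 + (x - y)\<^sup>2)"
proof -
  have s: "(\<lambda>n::int. 2 * C\<^sup>2 / (1 + (x - y)\<^sup>2) * (1 / (1 + (x - of_int n)\<^sup>2))) summable_on UNIV"
    by (intro summable_on_cmult_right summable_shifted_inverse_square)
  show 1: "(\<lambda>n::int. cmod (f (x - of_int n) * cnj (f (y - of_int n)))) summable_on UNIV"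
    by (rule Infinite_Sum.abs_summable_on_comparison_test'[OF s rapid_product_bound[OF assms]])
  have "(\<Sum>\<^sub>\<infinity>n::int. cmod (f (x - of_int n) * cnj (f (y - of_int n)))) \<le>
     (\<Sum>\<^sub>\<infinity>n::int. 2 * C\<^sup>2 / (1 + (x - y)\<^sup>2) * (1 / (1 + (x - of_int n)\<^sup>2)))"
    by (intro infsum_mono 1 s rapid_product_bound[OF assms])
  also have "\<dots> = 2 * C\<^sup>2 / (1 + (x - y)\<^sup>2) * (\<Sum>\<^sub>\<infinity>n::int. 1 / (1 + (x - of_int n)\<^sup>2))" by (rule infsum_cmult_right')
  also have "\<dots> \<le> 2 * C\<^sup>2 / (1 + (x - y)\<^sup>2) * (4 * isq)" unfolding isq_def
    by (intro mult_left_mono infsum_shifted_inverse_square) auto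
  finally show 2: "(\<Sum>\<^sub>\<infinity>n::int. cmod (f (x - of_int n) * cnj (f (y - of_int n)))) \<le> 8 * C\<^sup>2 * isq / (1 + (x - y)\<^sup>2)" by simp
  show "cmod (kern f x y) \<le> 8 * C\<^sup>2 * isq / (1 + (x - y)\<^sup>2)"
    unfolding kern_def by (rule order_trans[OF norm_infsum_bound[OF 1] 2])
qed

lemma continuous_infsum:
  fixes f :: "'i \<Rightarrow> 'a::topological_space \<Rightarrow> complex"
  assumes "\<And>i. i \<in> I \<Longrightarrow> continuous_on S (f i)" "\<And>i x. i \<in> I \<Longrightarrow> x \<in> S \<Longrightarrow> norm (f i x) \<le> M i" "M summable_on I"
  shows "continuous_on S (\<lambda>x. \<Sum>\<^sub>\<infinity>i\<in>I. f i x)"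
  by (rule uniform_limit_theorem[OF _ Weierstrass_m_test_general[OF assms(2,3)]])
     (auto intro!: eventually_finite_subsets_at_top_weakI continuous_on_sum assms(1))

lemma summable_rapid: "rapid f C \<Longrightarrow> (\<lambda>n::int. cmod (f (x - of_int n))) summable_on UNIV"
proof (rule Infinite_Sum.abs_summable_on_comparison_test')
  assume f: "rapid f C"
  show "(\<lambda>n::int. C * (1 / (1 + (x - of_int n)\<^sup>2))) summable_on UNIV"
    by (intro summable_on_cmult_right summable_shifted_inverse_square)
  show "cmod (f (x - of_int n)) \<le> C * (1 / (1 + (x - of_int n)\<^sup>2))" for n :: int
    using rapidD(4)[OF f, of "x - of_int n"] by simp
qed

lemma continuous_kern: assumes "rapid f C" shows "continuous_on UNIV (\<lambda>y. kern f y x)"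
  unfolding kern_def
proof (rule continuous_infsum)
  show "(\<lambda>n::int. C * cmod (f (x - of_int n))) summable_on UNIV" by (intro summable_on_cmult_right summable_rapid[OF assms])
  show "continuous_on UNIV (\<lambda>y. f (y - of_int n) * cnj (f (x - of_int n)))" for n
    by (intro continuous_intros continuous_on_compose2[OF rapidD(2)[OF assms]]) auto
  show "norm (f (y - of_int n) * cnj (f (x - of_int n))) \<le> C * cmod (f (x - of_int n))" for n y
    unfolding norm_mult complex_mod_cnj by (intro mult_right_mono rapidD(5)[OF assms]) auto
qed

lemma cnj_kern: "cnj (kern f x y) = kern f y x"
  unfolding kern_def infsum_cnj [symmetric] by (simp add: mult.commute)

lemma integrable_inverse_square_affine:
  assumes "X \<noteq> 0" shows "integrable lborel (\<lambda>y::real. 1 / (1 + (X * y - z)\<^sup>2))"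
  using lborel_integrable_real_affine[OF integrable_inverse_square[of z] assms, of 0] by simp

lemma
  assumes "continuous_on UNIV f" "\<And>y. cmod (f y) \<le> C / (1 + (X * y - z)\<^sup>2)" "X \<noteq> 0"
  shows sqint_bounded: "sqint f" and integrable_bounded: "integrable lborel f"
proof -
  have m [measurable]: "f \<in> borel_measurable borel" by (rule borel_measurable_continuous_onI) fact
  have "0 \<le> C / (1 + (X * 0 - z)\<^sup>2)" by (rule order_trans[OF norm_ge_zero assms(2)])
  hence C: "C \<ge> 0" by (simp add: zero_le_divide_iff add_nonneg_eq_0_iff) (smt (verit) zero_le_power2)
  have i: "integrable lborel (\<lambda>y. C * (1 / (1 + (X * y - z)\<^sup>2)))" by (intro integrable_mult_right integrable_inverse_square_affine assms)
  show "integrable lborel f"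
    by (rule Bochner_Integration.integrable_bound[OF i]) (use assms(2) C in auto)
  have "integrable lborel (\<lambda>x. (cmod (f x))\<^sup>2)"
  proof (rule Bochner_Integration.integrable_bound[OF integrable_mult_right[OF i, of C]])
    show "AE y in lborel. norm ((cmod (f y))\<^sup>2) \<le> norm (C * (C * (1 / (1 + (X * y - z)\<^sup>2))))"
    proof (rule AE_I2)
      fix y
      have "C / (1 + (X * y - z)\<^sup>2) \<le> C" using C by (simp add: divide_le_eq add_pos_nonneg mult_le_cancel_left1)
      hence "cmod (f y) * cmod (f y) \<le> C * (C / (1 + (X * y - z)\<^sup>2))"
        using C assms(2)[of y] by (intro mult_mono) auto
      thus "norm ((cmod (f y))\<^sup>2) \<le> norm (C * (C * (1 / (1 + (X * y - z)\<^sup>2))))" using C by (simp add: power2_eq_square)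
    qed
  qed measurable
  thus "sqint f" by (simp add: sqint_def)
qed

lemma
  assumes "rapid f C" "X > 0"
  shows continuous_dil: "continuous_on UNIV (dil X f n)"
    and dil_bound: "cmod (dil X f n y) \<le> sqrt X * C / (1 + (X * y - of_int n)\<^sup>2)"
    and sqint_dil: "sqint (dil X f n)"
    and dil_bound': "cmod (dil X f n y) \<le> sqrt X * C"
proof -
  show 1: "continuous_on UNIV (dil X f n)" unfolding dil_def
    by (intro continuous_intros continuous_on_compose2[OF rapidD(2)[OF assms(1)]]) auto
  show 2: "cmod (dil X f n y) \<le> sqrt X * C / (1 + (X * y - of_int n)\<^sup>2)" for y
    using mult_left_mono[OF rapidD(4)[OF assms(1), of "X * y - of_int n"], of "sqrt X"] assms(2) by (simp add: dil_def norm_mult)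
  show "sqint (dil X f n)" by (rule sqint_bounded[OF 1 2]) (use assms in auto)
  show "cmod (dil X f n y) \<le> sqrt X * C"
    using mult_left_mono[OF rapidD(5)[OF assms(1), of "X * y - of_int n"], of "sqrt X"] assms(2) by (simp add: dil_def norm_mult)
qed

text \<open>On bounded sets of \<open>x\<close>, Peetre's inequality moves the decay from
  \<open>X * x - n\<close> to \<open>n\<close>, giving a summable majorant independent of
  \<open>x\<close>.\<close>

lemma dil_local_bound:
  assumes f: "rapid f C" and X: "X > 0" and x: "\<bar>x\<bar> \<le> R"
  shows "cmod (dil X f n x) \<le> 2 * sqrt X * C * (1 + (X * R)\<^sup>2) * (1 / (1 + (of_int n)\<^sup>2))"
proof -
  have "1 + (real_of_int n)\<^sup>2 \<le> 2 * (1 + (of_int n - X * x)\<^sup>2) * (1 + (X * x)\<^sup>2)"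
    using peetre[of "of_int n - X * x" "X * x"] by simp
  also have "(X * x)\<^sup>2 \<le> (X * R)\<^sup>2" using x X by (intro power2_le_iff_abs_le[THEN iffD2]) (auto simp: abs_mult)
  finally have le: "1 + (real_of_int n)\<^sup>2 \<le> 2 * (1 + (X * x - of_int n)\<^sup>2) * (1 + (X * R)\<^sup>2)"
    by (simp add: power2_commute mult_left_mono)
  have pos: "0 < 1 + (X * x - of_int n)\<^sup>2" "0 < 1 + (real_of_int n)\<^sup>2" by (simp_all add: add_pos_nonneg)
  have "1 / (1 + (X * x - of_int n)\<^sup>2) \<le> 2 * (1 + (X * R)\<^sup>2) * (1 / (1 + (of_int n)\<^sup>2))"
    using le pos by (simp add: field_simps)
  from mult_left_mono[OF this, of "sqrt X * C"] X rapidD(1)[OF f] dil_bound[OF f X, of n x] show ?thesis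
    by (simp add: mult_ac)
qed

lemma infsum_split_finite:
  fixes f :: "'i \<Rightarrow> 'b::banach"
  assumes "f summable_on A" "finite F" "F \<subseteq> A" shows "infsum f A = sum f F + infsum f (A - F)"
proof -
  have "infsum f (F \<union> (A - F)) = infsum f F + infsum f (A - F)"
    by (rule infsum_Un_disjoint) (use assms in \<open>auto intro: summable_on_subset_banach\<close>)
  moreover have "F \<union> (A - F) = A" using assms by auto
  ultimately show ?thesis using assms by simp
qed

lemma infsum_tail_tendsto_0:
  fixes f :: "'i \<Rightarrow> real"
  assumes "f summable_on A" shows "((\<lambda>F. infsum f (A - F)) \<longlongrightarrow> 0) (finite_subsets_at_top A)"
proof -
  have "((\<lambda>F. infsum f A - sum f F) \<longlongrightarrow> infsum f A - infsum f A) (finite_subsets_at_top A)"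
    by (intro tendsto_diff tendsto_const infsum_tendsto assms)
  moreover have "\<forall>\<^sub>F F in finite_subsets_at_top A. infsum f A - sum f F = infsum f (A - F)"
    by (rule eventually_finite_subsets_at_top_weakI) (use infsum_split_finite[OF assms] in auto)
  ultimately show ?thesis by (simp add: tendsto_cong)
qed

lemma infsum_tail_less:
  fixes f :: "'i \<Rightarrow> real"
  assumes "f summable_on A" "\<epsilon> > 0" obtains F where "finite F" "F \<subseteq> A" "infsum f (A - F) < \<epsilon>"
proof -
  have "\<forall>\<^sub>F F in finite_subsets_at_top A. infsum f (A - F) < \<epsilon>"
    using order_tendstoD(2)[OF infsum_tail_tendsto_0[OF assms(1)] assms(2)] .
  thus ?thesis using that by (auto simp: eventually_finite_subsets_at_top)
qed

lemma GS_rapid: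
  assumes "f \<in> GS r1 r2" "r2 > 0" obtains C where "rapid f C"
proof -
  obtain C K c where D: "C > 0" "K > 0" "c > 0"
    "\<And>k u. cmod (dlist (replicate k 1) f u) \<le> C * K ^ k * fact k powr r1 * sexp r2 c u"
    using gs_real_decay[OF assms] by metis
  obtain B where B: "B > 0" "\<And>x. sexp r2 c x * (1 + \<bar>x\<bar>) ^ 4 \<le> B" using sexp_mult_power_bounded[OF D(3) assms(2)] by metis
  have "cmod (f u) \<le> C * B / (1 + u\<^sup>2)\<^sup>2" for u
  proof -
    have "(1 + u\<^sup>2)\<^sup>2 \<le> ((1 + \<bar>u\<bar>)\<^sup>2)\<^sup>2" by (intro power_mono) (auto simp: power2_eq_square algebra_simps)
    also have "\<dots> = (1 + \<bar>u\<bar>) ^ 4" by (simp add: power_mult [symmetric])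
    finally have "sexp r2 c u * (1 + u\<^sup>2)\<^sup>2 \<le> B" using B(2)[of u] by (meson mult_left_mono order_trans sexp_nonneg)
    moreover have "0 < (1 + u\<^sup>2)\<^sup>2" by (intro zero_less_power add_pos_nonneg) auto
    ultimately have "sexp r2 c u \<le> B / (1 + u\<^sup>2)\<^sup>2" by (simp only: pos_le_divide_eq)
    thus ?thesis using D(4)[of 0 u] mult_left_mono[of "sexp r2 c u" "B / (1 + u\<^sup>2)\<^sup>2" C] D(1) by simp
  qed
  moreover have "continuous_on UNIV f" using assms(1) schwartz_dlist[of f "[]"] by (auto simp: GS_def)
  ultimately show ?thesis using D B by (intro that[of "C * B"]) (auto simp: rapid_def)
qed

section \<open>Kernels as elements of closed spans\<close>

text \<open>The reproducing kernel at scale \<open>X\<close> with its second point frozen;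
  \<open>z\<close> is that point multiplied by \<open>X\<close>. Inner products with it evaluate the
  projection at \<open>z / X\<close>.\<close>

definition rkern :: "real \<Rightarrow> (real \<Rightarrow> complex) \<Rightarrow> real \<Rightarrow> real \<Rightarrow> complex" where
  "rkern X f z y = of_real X * kern f (X * y) z"

lemma
  assumes f: "rapid f C" and X: "X > 0"
  shows continuous_rkern: "continuous_on UNIV (rkern X f z)"
    and sqint_rkern: "sqint (rkern X f z)"
    and integrable_rkern: "integrable lborel (rkern X f z)"
proof -
  show 1: "continuous_on UNIV (rkern X f z)" unfolding rkern_def [abs_def]
    by (intro continuous_intros continuous_on_compose2[OF continuous_kern[OF f]]) auto
  have 2: "cmod (rkern X f z y) \<le> X * (8 * C\<^sup>2 * isq) / (1 + (X * y - z)\<^sup>2)" for y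
    using mult_left_mono[OF kern_bound[OF f, of "X * y" z], of X] X by (simp add: rkern_def norm_mult)
  show "sqint (rkern X f z)" "integrable lborel (rkern X f z)"
    using sqint_bounded[OF 1 2] integrable_bounded[OF 1 2] X by auto
qed

lemma rkern_summand: "of_real X * (f (X * y - of_int n) * cnj (f (z - of_int n))) = (of_real (sqrt X) * cnj (f (z - of_int n))) * dil X f n y"
  if "X > 0" for X :: real
  using that by (simp add: dil_def mult_ac flip: of_real_mult)

lemma l2subspace_sum:
  assumes "l2subspace V" "finite F" "\<And>i. i \<in> F \<Longrightarrow> e i \<in> V" shows "(\<lambda>x. \<Sum>i\<in>F. c i * e i x) \<in> V"
  using assms(2,3) by (induction F rule: finite_induct) (use assms(1) in \<open>auto simp: l2subspace_def\<close>)

lemma l2subspace_diff: "l2subspace V \<Longrightarrow> f \<in> V \<Longrightarrow> g \<in> V \<Longrightarrow> (\<lambda>x. f x - g x) \<in> V"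
proof -
  assume V: "l2subspace V" "f \<in> V" "g \<in> V"
  from V(1) have add: "\<And>f g. f \<in> V \<Longrightarrow> g \<in> V \<Longrightarrow> (\<lambda>x. f x + g x) \<in> V"
    and scale: "\<And>f c. f \<in> V \<Longrightarrow> (\<lambda>x. c * f x) \<in> V" unfolding l2subspace_def by simp_all
  from add[OF V(2) scale[OF V(3), of "-1"]] show ?thesis by simp
qed

text \<open>The tail of the kernel series has a uniform bound that is small and an integrable bound
  independent of the finite set. Their product bounds its square, so the partial sums converge in
  L^2 and \<open>l2closed\<close> applies.\<close>

lemma rkern_mem:
  assumes V: "l2subspace V" "l2closed V" and f: "rapid f C" and X: "X > 0" and mem: "\<And>n. dil X f n \<in> V"
  shows "rkern X f z \<in> V"
proof -
  let ?b = "\<lambda>y. X * (8 * C\<^sup>2 * isq) * (1 / (1 + (X * y - z)\<^sup>2))"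
  have b: "integrable lborel ?b" using X by (intro integrable_mult_right integrable_inverse_square_affine) auto
  define B where "B = (LINT y|lborel. ?b y)"
  have C: "C \<ge> 0" by (rule rapidD(1)[OF f])
  have B: "B \<ge> 0" unfolding B_def using X isq_nonneg by (intro integral_nonneg_AE) auto
  have "\<exists>g\<in>V. l2norm (\<lambda>y. rkern X f z y - g y) < e" if e: "e > 0" for e
  proof -
    \<comment> \<open>Makes the squared L^2 error, at most \<open>X * C * \<epsilon> * B\<close>,
      less than \<open>e\<^sup>2\<close>; the summand 1 keeps the denominator positive.\<close>
    define \<epsilon> where "\<epsilon> = e\<^sup>2 / (X * C * B + 1)"
    have eps: "\<epsilon> > 0" using e X C B by (simp add: \<epsilon>_def add_nonneg_pos)
    obtain F :: "int set" where F: "finite F" "infsum (\<lambda>n. cmod (f (z - of_int n))) (UNIV - F) < \<epsilon>"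
      using infsum_tail_less[OF summable_rapid[OF f, of z] eps] by metis
    define g where "g y = (\<Sum>n\<in>F. (of_real (sqrt X) * cnj (f (z - of_int n))) * dil X f n y)" for y
    have g: "g \<in> V" unfolding g_def [abs_def] by (rule l2subspace_sum[OF V(1) F(1) mem])
    let ?t = "\<lambda>y n. f (X * y - of_int n) * cnj (f (z - of_int n))"
    have tail: "rkern X f z y - g y = of_real X * infsum (?t y) (UNIV - F)" for y
    proof -
      have "kern f (X * y) z = sum (?t y) F + infsum (?t y) (UNIV - F)"
        unfolding kern_def by (rule infsum_split_finite[OF abs_summable_summable[OF kern_abs_summable[OF f]] F(1)]) auto
      moreover have "g y = of_real X * sum (?t y) F"
        using X by (simp add: g_def rkern_summand [symmetric] sum_distrib_left)
      ultimately show ?thesis by (simp add: rkern_def algebra_simps)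
    qed
    have sF: "(\<lambda>n. cmod (?t y n)) summable_on (UNIV - F)" for y
      by (rule summable_on_subset_banach[OF kern_abs_summable[OF f]]) auto
    have le1: "cmod (rkern X f z y - g y) \<le> X * C * \<epsilon>" for y
    proof -
      have "cmod (infsum (?t y) (UNIV - F)) \<le> (\<Sum>\<^sub>\<infinity>n\<in>UNIV - F. cmod (?t y n))" by (rule norm_infsum_bound[OF sF])
      also have "\<dots> \<le> (\<Sum>\<^sub>\<infinity>n\<in>UNIV - F. C * cmod (f (z - of_int n)))"
        by (intro infsum_mono sF summable_on_cmult_right summable_on_subset_banach[OF summable_rapid[OF f]])
           (auto simp: norm_mult intro!: mult_right_mono rapidD(5)[OF f])
      also have "\<dots> = C * (\<Sum>\<^sub>\<infinity>n\<in>UNIV - F. cmod (f (z - of_int n)))" by (rule infsum_cmult_right')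
      also have "\<dots> \<le> C * \<epsilon>" using F C by (intro mult_left_mono) auto
      finally show ?thesis unfolding tail norm_mult using X by simp
    qed
    have le2: "cmod (rkern X f z y - g y) \<le> ?b y" for y
    proof -
      have "cmod (infsum (?t y) (UNIV - F)) \<le> (\<Sum>\<^sub>\<infinity>n\<in>UNIV - F. cmod (?t y n))" by (rule norm_infsum_bound[OF sF])
      also have "\<dots> \<le> (\<Sum>\<^sub>\<infinity>n\<in>UNIV. cmod (?t y n))"
        by (rule infsum_mono_neutral[OF sF kern_abs_summable[OF f]]) auto
      also have "\<dots> \<le> 8 * C\<^sup>2 * isq / (1 + (X * y - z)\<^sup>2)" by (rule kern_abs_sum_bound[OF f])
      finally have "X * cmod (infsum (?t y) (UNIV - F)) \<le> X * (8 * C\<^sup>2 * isq / (1 + (X * y - z)\<^sup>2))"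
        using X by (intro mult_left_mono) auto
      thus ?thesis unfolding tail norm_mult using X by simp
    qed
    have sq: "sqint (\<lambda>y. rkern X f z y - g y)"
      using V(1) g sqint_rkern[OF f X, of z] by (intro sqint_diff) (auto simp: l2subspace_def)
    have "l2sq (\<lambda>y. rkern X f z y - g y) \<le> (LINT y|lborel. X * C * \<epsilon> * ?b y)"
      unfolding l2sq_def
    proof (rule integral_mono[OF sqint_sq[OF sq] integrable_mult_right[OF b]])
      fix y show "(cmod (rkern X f z y - g y))\<^sup>2 \<le> X * C * \<epsilon> * ?b y"
        unfolding power2_eq_square [of "cmod (rkern X f z y - g y)"] using X C eps by (intro mult_mono le1 le2) auto
    qed
    also have "\<dots> = X * C * \<epsilon> * B" unfolding B_def by (rule integral_mult_right_zero)
    also have "\<dots> = (X * C * B) / (X * C * B + 1) * e\<^sup>2" by (simp add: \<epsilon>_def)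
    also have "\<dots> < 1 * e\<^sup>2" using e X C B by (intro mult_strict_right_mono) (auto simp: divide_less_eq_1 add_nonneg_pos)
    finally have "l2norm (\<lambda>y. rkern X f z y - g y) < e" using e by (simp add: l2norm_less_iff)
    thus ?thesis using g by blast
  qed
  thus ?thesis using V(2) sqint_rkern[OF f X, of z] unfolding l2closed_def by blast
qed

lemma l2inner_dil:
  assumes v: "integrable lborel v" and f: "rapid f C" and X: "X > 0"
  shows "integrable lborel (\<lambda>y. v y * cnj (dil X f n y))"
    and "(LINT y|lborel. norm (v y * cnj (dil X f n y))) \<le> sqrt X * C * (LINT y|lborel. norm (v y))"
    and "cmod (l2inner v (dil X f n)) \<le> sqrt X * C * (LINT y|lborel. norm (v y))"
proof -
  have C: "C \<ge> 0" by (rule rapidD(1)[OF f])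
  note [measurable] = borel_measurable_integrable[OF v] borel_measurable_continuous_onI[OF continuous_dil[OF f X]]
  have le: "norm (v y * cnj (dil X f n y)) \<le> sqrt X * C * norm (v y)" for y
    unfolding norm_mult complex_mod_cnj using dil_bound'[OF f X, of n y] by (subst mult.commute) (rule mult_right_mono, auto)
  show 1: "integrable lborel (\<lambda>y. v y * cnj (dil X f n y))"
    by (rule Bochner_Integration.integrable_bound[OF integrable_mult_right[OF integrable_norm[OF v], of "sqrt X * C"]])
       (use le X C in auto)
  show 2: "(LINT y|lborel. norm (v y * cnj (dil X f n y))) \<le> sqrt X * C * (LINT y|lborel. norm (v y))"
    using integral_mono[OF integrable_norm[OF 1] integrable_mult_right[OF integrable_norm[OF v], of "sqrt X * C"] le] by simp
  show "cmod (l2inner v (dil X f n)) \<le> sqrt X * C * (LINT y|lborel. norm (v y))"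
    unfolding l2inner_def by (rule order_trans[OF integral_norm_bound 2])
qed

text \<open>Termwise integration: the inner products with \<open>dil X f n\<close> are bounded by a
  multiple of the L^1 norm of \<open>v\<close>, so that the translates of \<open>f\<close> at
  \<open>z\<close> supply the summable majorant.\<close>

lemma l2inner_rkern:
  assumes v: "integrable lborel v" and f: "rapid f C" and X: "X > 0"
  shows "((\<lambda>n. of_real (sqrt X) * f (z - of_int n) * l2inner v (dil X f n)) has_sum l2inner v (rkern X f z)) UNIV"
proof -
  define g where "g n y = of_real (sqrt X) * f (z - of_int n) * (v y * cnj (dil X f n y))" for n y
  have C: "C \<ge> 0" by (rule rapidD(1)[OF f])
  let ?I = "LINT y|lborel. norm (v y)"
  have geq: "g n y = of_real X * v y * cnj (f (X * y - of_int n) * cnj (f (z - of_int n)))" for n y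
    using X by (simp add: g_def dil_def mult_ac flip: of_real_mult)
  have "((\<lambda>n. LINT y|lborel. g n y) has_sum (LINT y|lborel. (\<Sum>\<^sub>\<infinity>n\<in>UNIV. g n y))) UNIV"
  proof (rule has_sum_integral)
    show "integrable lborel (g n)" for n unfolding g_def by (intro integrable_mult_right l2inner_dil(1)[OF v f X])
    show "(\<lambda>n. norm (g n y)) summable_on UNIV" for y
      unfolding geq norm_mult complex_mod_cnj using kern_abs_summable[OF f, of "X * y" z]
      by (intro summable_on_cmult_right) (simp add: norm_mult)
    show "(\<lambda>n. LINT y|lborel. norm (g n y)) summable_on UNIV"
    proof (rule summable_on_comparison_test)
      show "(\<lambda>n::int. sqrt X * (sqrt X * C * ?I) * cmod (f (z - of_int n))) summable_on UNIV"
        by (intro summable_on_cmult_right summable_rapid[OF f])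
      fix n
      have "(LINT y|lborel. norm (g n y)) = (sqrt X * cmod (f (z - of_int n))) * (LINT y|lborel. norm (v y * cnj (dil X f n y)))"
        unfolding g_def norm_mult[of "of_real (sqrt X) * f (z - of_int n)"] using X by (simp add: norm_mult)
      also have "\<dots> \<le> (sqrt X * cmod (f (z - of_int n))) * (sqrt X * C * ?I)"
        using X by (intro mult_left_mono l2inner_dil(2)[OF v f X]) auto
      finally show "(LINT y|lborel. norm (g n y)) \<le> sqrt X * (sqrt X * C * ?I) * cmod (f (z - of_int n))" by (simp add: mult_ac)
    qed auto
  qed auto
  moreover have "(LINT y|lborel. g n y) = of_real (sqrt X) * f (z - of_int n) * l2inner v (dil X f n)" for n
    unfolding g_def l2inner_def by (rule integral_mult_right_zero)
  moreover have "(\<Sum>\<^sub>\<infinity>n\<in>UNIV. g n y) = v y * cnj (rkern X f z y)" for y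
    unfolding geq infsum_cmult_right' infsum_cnj rkern_def kern_def by simp
  ultimately show ?thesis by (simp add: l2inner_def)
qed

text \<open>Bounded coefficients suffice, because \<open>dil_local_bound\<close> supplies the
  summable factor on each interval. Continuity is then a local matter.\<close>

lemma dil_series_uniform:
  assumes f: "rapid f C" and X: "X > 0" and a: "\<And>n. cmod (a n) \<le> A"
  shows "uniform_limit {-R..R} (\<lambda>F x. \<Sum>n\<in>F. a n * dil X f n x) (\<lambda>x. \<Sum>\<^sub>\<infinity>n. a n * dil X f n x) (finite_subsets_at_top UNIV)"
    and "continuous_on UNIV (\<lambda>x. \<Sum>\<^sub>\<infinity>n. a n * dil X f n x)"
proof -
  define M where "M R n = A * (2 * sqrt X * C * (1 + (X * R)\<^sup>2) * (1 / (1 + (real_of_int n)\<^sup>2)))" for R n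
  have A: "A \<ge> 0" using order_trans[OF norm_ge_zero a] .
  have bd: "norm (a n * dil X f n x) \<le> M R n" if "x \<in> {-R..R}" for n x R
    unfolding M_def norm_mult using that A by (intro mult_mono a dil_local_bound[OF f X]) auto
  have sm: "M R summable_on UNIV" for R
    unfolding M_def by (intro summable_on_cmult_right summable_on_inverse_square_int)
  show "uniform_limit {-R..R} (\<lambda>F x. \<Sum>n\<in>F. a n * dil X f n x) (\<lambda>x. \<Sum>\<^sub>\<infinity>n. a n * dil X f n x) (finite_subsets_at_top UNIV)" for R
    by (rule Weierstrass_m_test_general[OF bd sm])
  have c: "continuous_on {-R..R} (\<lambda>x. \<Sum>\<^sub>\<infinity>n. a n * dil X f n x)" for R
    by (rule continuous_infsum[OF _ bd sm]) (auto intro!: continuous_intros continuous_on_subset[OF continuous_dil[OF f X]])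
  show "continuous_on UNIV (\<lambda>x. \<Sum>\<^sub>\<infinity>n. a n * dil X f n x)"
  proof (intro continuous_at_imp_continuous_on ballI)
    fix x :: real
    have "continuous_on {-(\<bar>x\<bar> + 1)<..<\<bar>x\<bar> + 1} (\<lambda>x. \<Sum>\<^sub>\<infinity>n. a n * dil X f n x)"
      by (rule continuous_on_subset[OF c[of "\<bar>x\<bar> + 1"]]) auto
    thus "isCont (\<lambda>x. \<Sum>\<^sub>\<infinity>n. a n * dil X f n x) x"
      by (rule continuous_on_interior) (auto simp: abs_if)
  qed
qed

text \<open>On a large finite set the partial sum is close to \<open>u\<close> in L^2 by best
  approximation and close to \<open>S\<close> uniformly on the interval. An error \<delta> is kept
  rather than a limit taken, since the lemma serves both elements of the closed span and an
  indicator function that is merely approximated by the span.\<close>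

lemma dil_series_local_l2:
  assumes f: "rapid f C" and X: "X > 0" and u: "sqint u" "integrable lborel u"
    and on: "\<And>i j. l2inner (dil X f i) (dil X f j) = (if i = j then 1 else 0)"
    and F0: "finite F0" "l2sq (\<lambda>x. u x - (\<Sum>n\<in>F0. c n * dil X f n x)) < \<delta>" and R: "R > 0"
  defines "S \<equiv> \<lambda>x. \<Sum>\<^sub>\<infinity>n. l2inner u (dil X f n) * dil X f n x"
  shows "integrable lborel (\<lambda>x. indicator {-R..R} x * (cmod (u x - S x))\<^sup>2)" (is ?t1)
    and "(LINT x|lborel. indicator {-R..R} x * (cmod (u x - S x))\<^sup>2) \<le> 3 * \<delta>" (is ?t2)
proof -
  have d: "\<delta> > 0" using order_le_less_trans[OF l2sq_nonneg F0(2)] .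
  \<comment> \<open>Chosen so that the uniform error contributes 2 \<eta>^2 * 2R = \<delta>;
    together with twice the L^2 error this makes 3 \<delta>.\<close>
  define \<eta> where "\<eta> = sqrt (\<delta> / (4 * R))"
  have eta: "\<eta> > 0" "\<eta>\<^sup>2 = \<delta> / (4 * R)" using d R by (auto simp: \<eta>_def)
  define A where "A = sqrt X * C * (LINT y|lborel. norm (u y))"
  have a: "cmod (l2inner u (dil X f n)) \<le> A" for n unfolding A_def by (rule l2inner_dil(3)[OF u(2) f X])
  note ser = dil_series_uniform[where a = "\<lambda>n. l2inner u (dil X f n)", OF f X a, folded S_def]
  have "\<forall>\<^sub>F F in finite_subsets_at_top UNIV. \<forall>x\<in>{-R..R}. dist (\<Sum>n\<in>F. l2inner u (dil X f n) * dil X f n x) (S x) < \<eta>"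
    using uniform_limitD[OF ser(1) eta(1)] .
  then obtain F1 where F1: "finite F1" "\<And>F. finite F \<Longrightarrow> F1 \<subseteq> F \<Longrightarrow> \<forall>x\<in>{-R..R}. dist (\<Sum>n\<in>F. l2inner u (dil X f n) * dil X f n x) (S x) < \<eta>"
    by (auto simp: eventually_finite_subsets_at_top)
  define F where "F = F0 \<union> F1"
  define P where "P x = (\<Sum>n\<in>F. l2inner u (dil X f n) * dil X f n x)" for x
  have P: "cmod (P x - S x) < \<eta>" if "x \<in> {-R..R}" for x
    using F1(2)[of F] F1(1) F0(1) that by (auto simp: F_def P_def dist_norm)
  have sqP: "sqint (\<lambda>x. u x - P x)"
    unfolding P_def using F0 F1 by (intro sqint_diff u sqint_sum sqint_cmult sqint_dil[OF f X]) (auto simp: F_def)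
  have "l2sq (\<lambda>x. u x - P x) \<le> l2sq (\<lambda>x. u x - (\<Sum>n\<in>F0. c n * dil X f n x))"
    unfolding P_def by (rule best_approximation) (use F0 F1 u on in \<open>auto simp: F_def intro: sqint_dil[OF f X]\<close>)
  hence lP: "l2sq (\<lambda>x. u x - P x) < \<delta>" using F0 by simp
  let ?G = "\<lambda>x. 2 * (cmod (u x - P x))\<^sup>2 + 2 * \<eta>\<^sup>2 * indicator {-R..R} x"
  have iG: "integrable lborel ?G"
    by (intro Bochner_Integration.integrable_add integrable_mult_right sqint_sq[OF sqP]) (use R in auto)
  have le: "indicator {-R..R} x * (cmod (u x - S x))\<^sup>2 \<le> ?G x" for x
  proof (cases "x \<in> {-R..R}")
    case True
    have "(cmod (u x - S x))\<^sup>2 \<le> 2 * (cmod (u x - P x))\<^sup>2 + 2 * (cmod (P x - S x))\<^sup>2"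
      using cmod_add_sq_le[of "u x - P x" "P x - S x"] by simp
    also have "(cmod (P x - S x))\<^sup>2 \<le> \<eta>\<^sup>2" using P[OF True] by (intro power_mono) auto
    finally show ?thesis using True by simp
  qed auto
  have [measurable]: "S \<in> borel_measurable borel" by (rule borel_measurable_continuous_onI[OF ser(2)])
  note [measurable] = sqint_borel[OF u(1)]
  show ?t1
    by (rule Bochner_Integration.integrable_bound[OF iG]) (use le in \<open>auto simp: abs_mult\<close>)
  from integral_mono[OF this iG le]
  have "(LINT x|lborel. indicator {-R..R} x * (cmod (u x - S x))\<^sup>2) \<le> (LINT x|lborel. ?G x)" .
  also have "\<dots> = 2 * l2sq (\<lambda>x. u x - P x) + 2 * \<eta>\<^sup>2 * (2 * R)"
    using sqint_sq[OF sqP] R by (subst Bochner_Integration.integral_add) (auto simp: l2sq_def)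
  also have "\<dots> \<le> 3 * \<delta>" using lP R by (simp add: eta(2))
  finally show ?t2 .
qed

text \<open>For \<open>u\<close> in \<open>V\<close> the error in \<open>dil_series_local_l2\<close>
  is arbitrary, so \<open>u\<close> and its series agree almost everywhere on the interval, and
  everywhere by continuity.\<close>

lemma dil_expansion:
  assumes f: "rapid f C" and X: "X > 0" and u: "sqint u" "integrable lborel u" "continuous_on UNIV u" "u \<in> V"
    and onb: "l2_onb (dil X f) UNIV V"
  shows "u x = (\<Sum>\<^sub>\<infinity>n. l2inner u (dil X f n) * dil X f n x)"
proof -
  define S where "S = (\<lambda>x. \<Sum>\<^sub>\<infinity>n. l2inner u (dil X f n) * dil X f n x)"
  have on: "l2inner (dil X f i) (dil X f j) = (if i = j then 1 else 0)" for i j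
    using onb by (auto simp: l2_onb_def)
  define R where "R = \<bar>x\<bar> + 1"
  have R: "R > 0" by (simp add: R_def)
  have ap: "\<exists>F c. finite F \<and> l2sq (\<lambda>x. u x - (\<Sum>n\<in>F. c n * dil X f n x)) < \<delta>" if "\<delta> > 0" for \<delta>
  proof -
    have "sqrt \<delta> > 0" using that by simp
    then obtain F c where "finite F" "l2norm (\<lambda>x. u x - (\<Sum>n\<in>F. c n * dil X f n x)) < sqrt \<delta>"
      using onb u(4) unfolding l2_onb_def by blast
    thus ?thesis using that by (auto simp: l2norm_less_iff)
  qed
  let ?J = "LINT x|lborel. indicator {-R..R} x * (cmod (u x - S x))\<^sup>2"
  have int: "integrable lborel (\<lambda>x. indicator {-R..R} x * (cmod (u x - S x))\<^sup>2)"
  proof -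
    obtain F c where "finite F" "l2sq (\<lambda>x. u x - (\<Sum>n\<in>F. c n * dil X f n x)) < 1" using ap[of 1] by auto
    from dil_series_local_l2(1)[OF f X u(1,2) on this R] show ?thesis by (simp add: S_def)
  qed
  have "?J \<le> 0"
  proof (rule field_le_epsilon)
    fix e :: real assume "e > 0"
    then obtain F c where "finite F" "l2sq (\<lambda>x. u x - (\<Sum>n\<in>F. c n * dil X f n x)) < e / 3" using ap[of "e/3"] by auto
    from dil_series_local_l2(2)[OF f X u(1,2) on this R] show "?J \<le> 0 + e" by (simp add: S_def)
  qed
  moreover have "?J \<ge> 0" by (rule integral_nonneg_AE) auto
  ultimately have "?J = 0" by simp
  hence "AE y in lborel. indicator {-R..R} y * (cmod (u y - S y))\<^sup>2 = 0"
    using int by (subst (asm) integral_nonneg_eq_0_iff_AE) auto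
  hence "AE y in lborel. y \<in> {-R<..<R} \<longrightarrow> u y - S y = 0"
    by eventually_elim (auto simp: indicator_def split: if_splits)
  moreover have "continuous_on UNIV (\<lambda>y. u y - S y)"
    unfolding S_def by (intro continuous_on_diff u dil_series_uniform(2)[OF f X l2inner_dil(3)[OF u(2) f X]])
  ultimately have "u x - S x = 0" by (intro continuous_AE_eq_0[of _ "{-R<..<R}"]) (auto simp: R_def)
  thus ?thesis by (simp add: S_def)
qed

subsection \<open>Consequences of the multiresolution structure\<close>

lemma integrable_dil: "rapid f C \<Longrightarrow> X > 0 \<Longrightarrow> integrable lborel (dil X f n)"
  by (rule integrable_bounded[OF continuous_dil dil_bound]) auto

lemma dil_double: "X > 0 \<Longrightarrow> dil (2 * X) f n x = of_real (sqrt 2) * dil X f n (2 * x)"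
  by (simp add: dil_def real_sqrt_mult mult_ac)

lemma l2sq_double: "l2sq (\<lambda>x. w (2 * x)) = l2sq w / 2"
  using lborel_integral_real_affine[of 2 "\<lambda>x. (cmod (w x))\<^sup>2" 0] by (simp add: l2sq_def)

text \<open>Transports the basis one scale up. Orthonormality is the substitution x to 2x, and an
  approximation in \<open>V'\<close> is the rescaling of one in \<open>V\<close>, with an error that
  only shrinks.\<close>

lemma onb_dil_double:
  assumes onb: "l2_onb (dil X f) UNIV V" and X: "X > 0"
    and V': "l2subspace V'" and iff: "\<And>g. g \<in> V \<longleftrightarrow> (\<lambda>x. g (2 * x)) \<in> V'"
  shows "l2_onb (dil (2 * X) f) UNIV V'"
  unfolding l2_onb_def
proof (intro conjI ballI allI impI)
  have eq: "dil (2 * X) f n = (\<lambda>x. of_real (sqrt 2) * dil X f n (2 * x))" for n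
    using dil_double[OF X] by blast
  have sq2: "complex_of_real (sqrt 2) * complex_of_real (sqrt 2) = 2" by (simp flip: of_real_mult)
  fix i j :: int
  have "(\<lambda>x. dil X f i (2 * x)) \<in> V'" using onb iff by (auto simp: l2_onb_def)
  thus "dil (2 * X) f i \<in> V'" unfolding eq using V' by (simp add: l2subspace_def)
  have "l2inner (dil (2 * X) f i) (dil (2 * X) f j) = (LINT x|lborel. 2 * (dil X f i (2 * x) * cnj (dil X f j (2 * x))))"
    unfolding l2inner_def eq by (intro Bochner_Integration.integral_cong refl) (simp add: mult_ac sq2[symmetric])
  also have "\<dots> = 2 * (LINT x|lborel. dil X f i (2 * x) * cnj (dil X f j (2 * x)))" by (rule integral_mult_right_zero)
  also have "\<dots> = l2inner (dil X f i) (dil X f j)"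
    using lborel_integral_real_affine[of 2 "\<lambda>x. dil X f i x * cnj (dil X f j x)" 0] by (simp add: l2inner_def scaleR_conv_of_real)
  finally show "l2inner (dil (2 * X) f i) (dil (2 * X) f j) = (if i = j then 1 else 0)"
    using onb by (simp add: l2_onb_def)
next
  have eq: "dil (2 * X) f n = (\<lambda>x. of_real (sqrt 2) * dil X f n (2 * x))" for n
    using dil_double[OF X] by blast
  fix g and e :: real assume g: "g \<in> V'" and e: "e > 0"
  define h where "h x = g (x / 2)" for x
  have "h \<in> V" using g iff by (simp add: h_def)
  then obtain F c where F: "finite F" "l2norm (\<lambda>x. h x - (\<Sum>i\<in>F. c i * dil X f i x)) < e"
    using onb e unfolding l2_onb_def by blast
  define w where "w x = h x - (\<Sum>i\<in>F. c i * dil X f i x)" for x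
  have "g x - (\<Sum>i\<in>F. (c i / of_real (sqrt 2)) * dil (2 * X) f i x) = w (2 * x)" for x
    by (simp add: w_def h_def eq)
  moreover have "l2norm (\<lambda>x. w (2 * x)) < e"
  proof -
    have "l2sq w / 2 \<le> l2sq w" by simp
    hence "l2norm (\<lambda>x. w (2 * x)) \<le> l2norm w" unfolding l2norm_eq l2sq_double by (simp only: real_sqrt_le_iff)
    thus ?thesis using F(2) unfolding w_def [symmetric] by simp
  qed
  ultimately show "\<exists>F c. finite F \<and> F \<subseteq> UNIV \<and> l2norm (\<lambda>x. g x - (\<Sum>i\<in>F. c i * dil (2 * X) f i x)) < e"
    using F(1) by (intro exI[of _ F] exI[of _ "\<lambda>i. c i / of_real (sqrt 2)"]) simp
qed

lemma dil_1: "dil 1 f = (\<lambda>n x. f (x - of_int n))" by (simp add: dil_def fun_eq_iff)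

lemma mra_onb:
  assumes "is_mra V \<phi>" shows "l2_onb (dil (2 ^ m) \<phi>) UNIV (V (int m))"
proof (induction m)
  case 0 then show ?case using assms by (simp add: is_mra_def dil_1)
next
  case (Suc m)
  have "l2subspace (V (int (Suc m)))" using assms unfolding is_mra_def by blast
  moreover have "g \<in> V (int m) \<longleftrightarrow> (\<lambda>x. g (2 * x)) \<in> V (int (Suc m))" for g
    using assms unfolding is_mra_def by (metis of_nat_Suc add.commute)
  ultimately show ?case using onb_dil_double[OF Suc] by simp
qed

text \<open>Finite combinations of the basis approximate \<open>h\<close>, and orthogonality
  survives the limit.\<close>

lemma orthogonal_to_onb:
  assumes onb: "l2_onb e UNIV V" and sq: "\<And>n. sqint (e n)" and F: "sqint F" and h: "h \<in> V" "sqint h"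
    and z: "\<And>n. l2inner (e n) F = 0"
  shows "l2inner F h = 0"
proof (rule orthogonal_limit[OF F h(2)])
  fix \<delta> :: real assume d: "\<delta> > 0"
  hence "sqrt \<delta> > 0" by simp
  then obtain A c where A: "finite A" "l2norm (\<lambda>x. h x - (\<Sum>n\<in>A. c n * e n x)) < sqrt \<delta>"
    using onb h(1) unfolding l2_onb_def by blast
  have "l2inner (\<lambda>x. \<Sum>n\<in>A. c n * e n x) F = 0"
    using A sq F by (subst l2inner_sum_left) (auto intro: sqint_cmult simp: l2inner_cmult_left z)
  hence "l2inner F (\<lambda>x. \<Sum>n\<in>A. c n * e n x) = 0" by (subst l2inner_commute) simp
  moreover have "l2sq (\<lambda>x. h x - (\<Sum>n\<in>A. c n * e n x)) < \<delta>" using A(2) d by (simp add: l2norm_less_iff)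
  ultimately show "\<exists>h'. sqint h' \<and> l2sq (\<lambda>x. h x - h' x) < \<delta> \<and> l2inner F h' = 0"
    using A sq by (intro exI[of _ "\<lambda>x. \<Sum>n\<in>A. c n * e n x"] conjI sqint_sum sqint_cmult) auto
qed

text \<open>The difference of both sides, as a function of one variable, lies in \<open>V 1\<close> and is orthogonal to
  \<open>V 0\<close> and to its orthogonal complement in \<open>V 1\<close>.\<close>
lemma two_scale_kernel:
  assumes mra: "is_mra V \<phi>" and wav: "assoc_wavelet V \<psi>" and rp: "rapid \<phi> C" "rapid \<psi> C'"
  shows "2 * kern \<phi> (2 * y) (2 * x) = kern \<phi> y x + kern \<psi> y x"
proof -
  have V: "l2subspace (V m)" "l2closed (V m)" "V m \<subseteq> V (m + 1)" for m using mra by (auto simp: is_mra_def)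
  have sqV: "sqint g" if "g \<in> V m" for g m using V(1)[of m] that by (auto simp: l2subspace_def)
  have onb0: "l2_onb (dil 1 \<phi>) UNIV (V 0)" using mra_onb[OF mra, of 0] by simp
  have onb1: "l2_onb (dil 2 \<phi>) UNIV (V 1)" using mra_onb[OF mra, of 1] by simp
  define W where "W = {f \<in> V 1. \<forall>g\<in>V 0. l2inner f g = 0}"
  have onbW: "l2_onb (dil 1 \<psi>) UNIV W" using wav by (simp add: assoc_wavelet_def W_def dil_1)
  have m0: "dil 1 \<phi> n \<in> V 0" and m1: "dil 2 \<phi> n \<in> V 1" and mW: "dil 1 \<psi> n \<in> W" for n
    using onb0 onb1 onbW by (auto simp: l2_onb_def)
  have m0': "dil 1 \<phi> n \<in> V 1" and mW': "dil 1 \<psi> n \<in> V 1" for n using m0 mW V(3)[of 0] by (auto simp: W_def)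
  define A where "A = rkern 2 \<phi> (2 * x)"
  define B where "B = rkern 1 \<phi> x"
  define D where "D = rkern 1 \<psi> x"
  define F where "F y = A y - B y - D y" for y
  have AV: "A \<in> V 1" unfolding A_def by (rule rkern_mem[OF V(1,2) rp(1) _ m1]) simp
  have BV: "B \<in> V 1" unfolding B_def by (rule rkern_mem[OF V(1,2) rp(1) _ m0']) simp
  have DV: "D \<in> V 1" unfolding D_def by (rule rkern_mem[OF V(1,2) rp(2) _ mW']) simp
  have FV: "F \<in> V 1" unfolding F_def [abs_def] by (intro l2subspace_diff V AV BV DV)
  have sq: "sqint A" "sqint B" "sqint D" "sqint F" using AV BV DV FV sqV by blast+
  \<comment> \<open>\<open>A\<close> is the reproducing kernel of \<open>V 1\<close> at the point
    \<open>x\<close>, so its inner product with \<open>v\<close> is the expansion of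
    \<open>v\<close> evaluated there.\<close>
  have inner: "l2inner v F = v x - l2inner v B - l2inner v D"
    if "v \<in> V 1" "continuous_on UNIV v" "integrable lborel v" for v
  proof -
    have v: "sqint v" using that sqV by blast
    have "((\<lambda>n. dil 2 \<phi> n x * l2inner v (dil 2 \<phi> n)) has_sum l2inner v A) UNIV"
      using l2inner_rkern[OF that(3) rp(1), of 2 "2 * x"] by (simp add: A_def dil_def)
    hence "l2inner v A = (\<Sum>\<^sub>\<infinity>n. l2inner v (dil 2 \<phi> n) * dil 2 \<phi> n x)" by (simp add: infsumI mult.commute)
    also have "\<dots> = v x" by (rule dil_expansion[OF rp(1) _ v that(3,2,1) onb1, symmetric]) simp
    finally show ?thesis unfolding F_def [abs_def] using sq v by (simp add: l2inner_diff_right sqint_diff)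
  qed
  have innerB: "l2inner v B = (\<Sum>\<^sub>\<infinity>n. dil 1 \<phi> n x * l2inner v (dil 1 \<phi> n))" if "integrable lborel v" for v
    using l2inner_rkern[OF that rp(1), of 1 x] by (simp add: B_def dil_def infsumI)
  have innerD: "l2inner v D = (\<Sum>\<^sub>\<infinity>n. dil 1 \<psi> n x * l2inner v (dil 1 \<psi> n))" if "integrable lborel v" for v
    using l2inner_rkern[OF that rp(2), of 1 x] by (simp add: D_def dil_def infsumI)
  have single: "(\<Sum>\<^sub>\<infinity>n. a n * (if k = n then 1 else 0)) = a k" for a :: "int \<Rightarrow> complex" and k
  proof -
    have "(\<Sum>\<^sub>\<infinity>n. a n * (if k = n then 1 else 0)) = (\<Sum>\<^sub>\<infinity>n\<in>{k}. a n * (if k = n then 1 else 0))"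
      by (rule infsum_cong_neutral) auto
    thus ?thesis by simp
  qed
  have on0: "l2inner (dil 1 \<phi> n) (dil 1 \<phi> k) = (if n = k then 1 else 0)"
    and onW: "l2inner (dil 1 \<psi> n) (dil 1 \<psi> k) = (if n = k then 1 else 0)" for n k
    using onb0 onbW by (simp_all add: l2_onb_def)
  have cross1: "l2inner (dil 1 \<psi> n) (dil 1 \<phi> k) = 0" for n k using mW m0 by (simp add: W_def)
  hence cross2: "l2inner (dil 1 \<phi> n) (dil 1 \<psi> k) = 0" for n k by (subst l2inner_commute) simp
  note i\<phi> = integrable_dil[OF rp(1), of 1] and i\<psi> = integrable_dil[OF rp(2), of 1]
  have z0: "l2inner (dil 1 \<phi> n) F = 0" for n
    using inner[OF m0' continuous_dil[OF rp(1)] i\<phi>, of n] innerB[OF i\<phi>, of n] innerD[OF i\<phi>, of n]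
    by (simp add: on0 cross2 single)
  have zW: "l2inner (dil 1 \<psi> n) F = 0" for n
    using inner[OF mW' continuous_dil[OF rp(2)] i\<psi>, of n] innerB[OF i\<psi>, of n] innerD[OF i\<psi>, of n]
    by (simp add: onW cross1 single)
  have sqd: "sqint (dil 1 \<phi> n)" "sqint (dil 1 \<psi> n)" for n using sqint_dil rp by (metis zero_less_one)+
  \<comment> \<open>Orthogonality to the basis of \<open>V 0\<close> places \<open>F\<close> in
    \<open>W\<close>; orthogonality to the basis of \<open>W\<close> then makes it orthogonal to
    itself.\<close>
  have "F \<in> W"
    unfolding W_def using FV orthogonal_to_onb[OF onb0 sqd(1) sq(4) _ _ z0] sqV by blast
  hence "l2inner F F = 0" by (rule orthogonal_to_onb[OF onbW sqd(2) sq(4) _ sq(4) zW])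
  hence "l2sq F = 0" by (simp add: l2inner_self)
  moreover have "continuous_on UNIV F"
    unfolding F_def [abs_def] A_def B_def D_def by (intro continuous_on_diff continuous_rkern[OF rp(1)] continuous_rkern[OF rp(2)]) auto
  ultimately have "F y = 0" using continuous_l2sq_eq_0 sq(4) by blast
  thus ?thesis by (simp add: F_def A_def B_def D_def rkern_def algebra_simps)
qed

section \<open>The integral of the scaling kernel\<close>

text \<open>Formally the projection of the constant function 1 onto the span of the translates of
  \<open>f\<close>. It is continuous and has period one for rapidly decaying
  \<open>f\<close>.\<close>

definition kint :: "(real \<Rightarrow> complex) \<Rightarrow> real \<Rightarrow> complex" where "kint f x = (LINT y|lborel. kern f x y)"

lemma integrable_kern:
  assumes f: "rapid f C" and X: "X > 0" shows "integrable lborel (\<lambda>y. kern f x (X * y))"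
proof -
  have "integrable lborel (\<lambda>y. of_real (1 / X) * cnj (rkern X f x y))"
    by (intro integrable_mult_right integrable_cnj integrable_rkern[OF f X])
  thus ?thesis using X by (simp add: rkern_def cnj_kern)
qed

lemma kint_series: assumes f: "rapid f C" shows "kint f x = (\<Sum>\<^sub>\<infinity>n. cnj (LINT y|lborel. f y) * dil 1 f n x)"
proof -
  define g where "g n y = f (x - of_int n) * cnj (f (y - of_int n))" for n :: int and y
  have fi: "integrable lborel f" using integrable_dil[OF f, of 1 0] by (simp add: dil_1)
  have tr: "(LINT y|lborel. h (y - of_int n)) = (LINT y|lborel. h y)" for h :: "real \<Rightarrow> 'b::{banach, second_countable_topology}" and n :: int
    using lborel_integral_real_affine[of 1 h "- of_int n"] by simp
  have fi': "integrable lborel (\<lambda>y. f (y - of_int n))" for n :: int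
    using lborel_integrable_real_affine[OF fi, of 1 "- of_int n"] by simp
  have "((\<lambda>n. LINT y|lborel. g n y) has_sum (LINT y|lborel. (\<Sum>\<^sub>\<infinity>n\<in>UNIV. g n y))) UNIV"
  proof (rule has_sum_integral)
    show "integrable lborel (g n)" for n unfolding g_def by (intro integrable_mult_right integrable_cnj fi')
    show "(\<lambda>n. norm (g n y)) summable_on UNIV" for y unfolding g_def by (rule kern_abs_summable[OF f])
    have "(LINT y|lborel. norm (g n y)) = cmod (f (x - of_int n)) * (LINT y|lborel. cmod (f y))" for n
      using tr[of "\<lambda>y. cmod (f y)" n] by (simp add: g_def norm_mult)
    thus "(\<lambda>n. LINT y|lborel. norm (g n y)) summable_on UNIV"
      using summable_rapid[OF f, of x] by (simp add: summable_on_cmult_left)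
  qed auto
  moreover have "(LINT y|lborel. g n y) = cnj (LINT y|lborel. f y) * dil 1 f n x" for n
    using tr[of f n] by (simp add: g_def dil_def mult.commute)
  ultimately show ?thesis by (simp add: kint_def kern_def g_def infsumI)
qed

lemma continuous_kint: assumes "rapid f C" shows "continuous_on UNIV (kint f)"
proof -
  have "kint f = (\<lambda>x. \<Sum>\<^sub>\<infinity>n. cnj (LINT y|lborel. f y) * dil 1 f n x)" using kint_series[OF assms] by blast
  thus ?thesis using dil_series_uniform(2)[OF assms, of 1 "\<lambda>_. cnj (LINT y|lborel. f y)"] by auto
qed

lemma kint_periodic: assumes f: "rapid f C" shows "kint f (x + 1) = kint f x"
proof -
  have bij: "bij (\<lambda>n::int. n - 1)" by (rule bij_betw_byWitness[where f' = "\<lambda>n. n + 1"]) auto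
  have "kint f (x + 1) = (\<Sum>\<^sub>\<infinity>n. cnj (LINT y|lborel. f y) * dil 1 f (n - 1) x)"
    unfolding kint_series[OF f] by (intro infsum_cong) (simp add: dil_def algebra_simps)
  also have "\<dots> = kint f x"
    unfolding kint_series[OF f] by (rule infsum_reindex_bij_betw[OF bij])
  finally show ?thesis .
qed

text \<open>Doubling the frequency runs through two periods at half the length. The average over a
  period can thus be computed at any fine scale, which is where density of the spaces becomes
  effective.\<close>

lemma periodic_average_dilate:
  fixes h :: "real \<Rightarrow> real"
  assumes h: "continuous_on UNIV h" and per: "\<And>x. h (x + 1) = h x"
  shows "(LINT x|lborel. indicator {0..<1} x * h (2 ^ m * x)) = (LINT x|lborel. indicator {0..<1} x * h x)"
proof (induction m)
  case (Suc m)
  define g where "g x = h (2 ^ m * x)" for x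
  have g: "continuous_on UNIV g" unfolding g_def by (intro continuous_on_compose2[OF h] continuous_intros) auto
  have hn: "h (x + real k) = h x" for x and k :: nat
  proof (induction k)
    case (Suc k)
    have "h (x + real (Suc k)) = h ((x + real k) + 1)" by (simp add: add_ac)
    thus ?case using Suc per by simp
  qed simp
  have gper: "g (x + 1) = g x" for x using hn[of "2 ^ m * x" "2 ^ m"] by (simp add: g_def distrib_left)
  have i: "integrable lborel (\<lambda>x. indicator {0..<1} x * g x)"
  proof -
    have i0: "integrable lborel (\<lambda>x. indicator {0..1} x *\<^sub>R g x)"
      using borel_integrable_atLeastAtMost'[OF continuous_on_subset[OF g], of 0 1] by (simp add: set_integrable_def)
    have [measurable]: "g \<in> borel_measurable borel" by (rule borel_measurable_continuous_onI[OF g])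
    show ?thesis
      by (rule Bochner_Integration.integrable_bound[OF i0]) (auto simp: indicator_def)
  qed
  have i': "integrable lborel (\<lambda>x. indicator {0..<1} (x - 1) * g x)"
    using lborel_integrable_real_affine[OF i, of 1 "-1"] gper[of "_ - 1"] by simp
  have "(LINT x|lborel. indicator {0..<1} x * h (2 ^ Suc m * x)) = (LINT x|lborel. indicator {0..<2} (2 * x) * g (2 * x))"
    by (intro Bochner_Integration.integral_cong) (auto simp: g_def indicator_def mult_ac)
  also have "\<dots> = (1/2) * (LINT x|lborel. indicator {0..<2} x * g x)"
    using lborel_integral_real_affine[of 2 "\<lambda>x. indicator {0..<2} x * g x" 0] by simp
  also have "(LINT x|lborel. indicator {0..<2} x * g x) = (LINT x|lborel. indicator {0..<1} x * g x + indicator {0..<1} (x - 1) * g x)"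
    by (intro Bochner_Integration.integral_cong) (auto simp: indicator_def)
  also have "\<dots> = (LINT x|lborel. indicator {0..<1} x * g x) + (LINT x|lborel. indicator {0..<1} (x - 1) * g x)"
    by (rule Bochner_Integration.integral_add[OF i i'])
  also have "(LINT x|lborel. indicator {0..<1} (x - 1) * g x) = (LINT x|lborel. indicator {0..<1} x * g x)"
    using lborel_integral_real_affine[of 1 "\<lambda>x. indicator {0..<1} x * g x" "-1"] gper[of "_ - 1"] by simp
  finally show ?case using Suc by (simp add: g_def)
qed simp

text \<open>Both terms integrate the kernel at scale \<open>X\<close>, one of them only over the
  interval. A point of the complement of [-1,2] is at distance at least 1 from \<open>x\<close>, so
  the difference is of order \<open>1 / X\<close>. The factor 16 is 8 from \<open>kern_bound\<close>
  times 2 from 1 + v^2 \<le> 2 v^2.\<close>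

lemma dist_indicator_kernel:
  assumes f: "rapid f C" and X: "X > 0" and x: "x \<in> {0..<1}"
  shows "cmod (l2inner (indicator {-1..2}) (rkern X f (X * x)) - kint f (X * x)) \<le> 16 * C\<^sup>2 * isq * (LINT v|lborel. 1 / (1 + v\<^sup>2)) / X"
proof -
  let ?u = "indicator {-1..2} :: real \<Rightarrow> complex"
  let ?k = "\<lambda>y. of_real X * kern f (X * x) (X * y)"
  have ik: "integrable lborel ?k" by (intro integrable_mult_right integrable_kern[OF f X])
  have iuk: "integrable lborel (\<lambda>y. ?u y * ?k y)"
    by (rule Bochner_Integration.integrable_bound[OF ik]) (use borel_measurable_integrable[OF ik] in \<open>auto simp: indicator_def\<close>)
  have 1: "l2inner ?u (rkern X f (X * x)) = (LINT y|lborel. ?u y * ?k y)"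
    by (simp add: l2inner_def rkern_def cnj_kern)
  have 2: "kint f (X * x) = (LINT y|lborel. ?k y)"
    using lborel_integral_real_affine[of X "kern f (X * x)" 0] X by (simp add: kint_def scaleR_conv_of_real)
  define D where "D = 8 * C\<^sup>2 * isq"
  have D: "D \<ge> 0" by (simp add: D_def isq_nonneg)
  have "cmod (l2inner ?u (rkern X f (X * x)) - kint f (X * x)) = cmod (LINT y|lborel. ?u y * ?k y - ?k y)"
    unfolding 1 2 by (subst Bochner_Integration.integral_diff[OF iuk ik]) simp
  also have "\<dots> \<le> (LINT y|lborel. 2 * D / X * (1 / (1 + (y - x)\<^sup>2)))"
  proof (rule Bochner_Integration.integral_norm_bound_integral)
    show "integrable lborel (\<lambda>y. ?u y * ?k y - ?k y)" by (intro Bochner_Integration.integrable_diff iuk ik)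
    show "integrable lborel (\<lambda>y. 2 * D / X * (1 / (1 + (y - x)\<^sup>2)))" by (intro integrable_mult_right integrable_inverse_square)
    fix y
    show "norm (?u y * ?k y - ?k y) \<le> 2 * D / X * (1 / (1 + (y - x)\<^sup>2))"
    proof (cases "y \<in> {-1..2}")
      case False
      hence "1 \<le> \<bar>y - x\<bar>" using x by auto
      hence v: "1 \<le> (y - x)\<^sup>2" by (metis one_le_power power2_abs)
      have "norm (?u y * ?k y - ?k y) = X * cmod (kern f (X * x) (X * y))" using False X by (simp add: norm_mult)
      also have "\<dots> \<le> X * (D / (1 + (X * x - X * y)\<^sup>2))"
        using X kern_bound[OF f, of "X * x" "X * y"] by (intro mult_left_mono) (auto simp: D_def)
      also have "(X * x - X * y)\<^sup>2 = X\<^sup>2 * (y - x)\<^sup>2" by (simp add: power2_eq_square algebra_simps)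
      also have "X * (D / (1 + X\<^sup>2 * (y - x)\<^sup>2)) = D * (X / (1 + X\<^sup>2 * (y - x)\<^sup>2))" by simp
      also have "\<dots> \<le> D * (2 / X * (1 / (1 + (y - x)\<^sup>2)))"
      proof (rule mult_left_mono[OF _ D])
        have "X\<^sup>2 * (1 + (y - x)\<^sup>2) \<le> X\<^sup>2 * (2 * (y - x)\<^sup>2)" using v by (intro mult_left_mono) auto
        hence "X * (X * (1 + (y - x)\<^sup>2)) \<le> 2 * (1 + X\<^sup>2 * (y - x)\<^sup>2)" by (simp add: power2_eq_square algebra_simps)
        moreover have "0 < 1 + X\<^sup>2 * (y - x)\<^sup>2" "0 < X * (1 + (y - x)\<^sup>2)" using X by (auto intro!: add_pos_nonneg mult_pos_pos)
        ultimately have "X / (1 + X\<^sup>2 * (y - x)\<^sup>2) \<le> 2 / (X * (1 + (y - x)\<^sup>2))" by (simp add: divide_le_eq le_divide_eq mult_ac)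
        thus "X / (1 + X\<^sup>2 * (y - x)\<^sup>2) \<le> 2 / X * (1 / (1 + (y - x)\<^sup>2))" by simp
      qed
      finally show ?thesis by (simp only: mult_ac times_divide_eq_right times_divide_eq_left mult_1_right mult_1_left divide_divide_eq_left)
    qed (use X D in auto)
  qed
  also have "\<dots> = 2 * D / X * (LINT y|lborel. 1 / (1 + (y - x)\<^sup>2))" by (rule integral_mult_right_zero)
  also have "(LINT y|lborel. 1 / (1 + (y - x)\<^sup>2)) = (LINT v|lborel. 1 / (1 + v\<^sup>2))"
    using lborel_integral_real_affine[of 1 "\<lambda>v. 1 / (1 + v\<^sup>2)" "-x"] by simp
  finally show ?thesis by (simp add: D_def)
qed

text \<open>Density approximates the indicator of [-1,2] by its projection at a fine scale X = 2^m.
  On the unit interval that projection differs from \<open>kint \<phi> (X * x)\<close> by at most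
  K/X, so the mean square of \<open>1 - kint \<phi> (X * x)\<close> is small. By periodicity this
  mean does not depend on m, hence it is zero; continuity and periodicity give every point.\<close>

lemma kint_eq_1:
  assumes mra: "is_mra V \<phi>" and f: "rapid \<phi> C" shows "kint \<phi> x = 1"
proof -
  define h where "h x = (cmod (1 - kint \<phi> x))\<^sup>2" for x
  have h: "continuous_on UNIV h" unfolding h_def by (intro continuous_intros continuous_kint[OF f])
  have per: "h (x + 1) = h x" for x by (simp add: h_def kint_periodic[OF f])
  let ?Av = "\<lambda>h. LINT x|lborel. indicator {0..<1::real} x * h x :: real"
  have iav: "integrable lborel (\<lambda>x. indicator {0..<1} x * h (X * x))" for X
  proof -
    have c: "continuous_on UNIV (\<lambda>x. h (X * x))" by (intro continuous_on_compose2[OF h] continuous_intros) auto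
    have i0: "integrable lborel (\<lambda>x. indicator {0..1} x *\<^sub>R h (X * x))"
      using borel_integrable_atLeastAtMost'[OF continuous_on_subset[OF c], of 0 1] by (simp add: set_integrable_def)
    have [measurable]: "(\<lambda>x. h (X * x)) \<in> borel_measurable borel" by (rule borel_measurable_continuous_onI[OF c])
    show ?thesis
      by (rule Bochner_Integration.integrable_bound[OF i0]) (auto simp: indicator_def)
  qed
  let ?u = "indicator {-1..2} :: real \<Rightarrow> complex"
  have "integrable lborel (\<lambda>x::real. complex_of_real (indicator {-1..2} x))"
    by (intro integrable_of_real) simp
  hence iu: "integrable lborel ?u"
    by (rule Bochner_Integration.integrable_cong[THEN iffD1, rotated -1]) (auto simp: indicator_def)
  have "(\<lambda>x. (cmod (?u x))\<^sup>2) = indicator {-1..2}" by (auto simp: indicator_def)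
  hence su: "sqint ?u" by (simp add: sqint_def)
  define K where "K = 16 * C\<^sup>2 * isq * (LINT v|lborel. 1 / (1 + v\<^sup>2))"
  have K: "K \<ge> 0" using isq_nonneg by (simp add: K_def)
  have mono: "V (m0 + int k) \<supseteq> V m0" for m0 k
  proof (induction k)
    case (Suc k)
    have "V (m0 + int k) \<subseteq> V (m0 + int k + 1)" using mra by (auto simp: is_mra_def)
    thus ?case using Suc by (simp add: add_ac)
  qed simp
  have small: "?Av h \<le> \<epsilon>" if eps: "\<epsilon> > 0" for \<epsilon>
  proof -
    \<comment> \<open>The L^2 error enters as 2 * 3 * 4 * \<delta> = \<epsilon>/2, the other half of
      \<epsilon> being left for the kernel error.\<close>
    define \<delta> where "\<delta> = \<epsilon> / 48"
    have d: "\<delta> > 0" using eps by (simp add: \<delta>_def)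
    have sd: "sqrt \<delta> > 0" using d by simp
    have "l2dense (\<Union>m. V m)" using mra by (simp add: is_mra_def)
    then obtain m0 g where g: "g \<in> V m0" "l2norm (\<lambda>x. ?u x - g x) < sqrt \<delta>"
      unfolding l2dense_def using su sd by blast
    obtain m1 :: nat where m1: "4 * K\<^sup>2 / \<epsilon> < 2 ^ m1" using real_arch_pow[of 2 "4 * K\<^sup>2 / \<epsilon>"] by auto
    \<comment> \<open>\<open>m1\<close> makes the kernel error small; lying above \<open>m0\<close>
      keeps \<open>g\<close> in the space at scale \<open>m\<close>, as the spaces increase.\<close>
    define m where "m = max m1 (nat m0)"
    have "int m \<ge> m0" by (simp add: m_def)
    hence "m0 + int (nat (int m - m0)) = int m" by simp
    hence gm: "g \<in> V (int m)" using g(1) mono[of m0 "nat (int m - m0)"] by auto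
    define X :: real where "X = 2 ^ m"
    have X: "X > 0" "X \<ge> 1" by (simp_all add: X_def)
    have "(2::real) ^ m1 \<le> X" unfolding X_def by (intro power_increasing) (auto simp: m_def)
    also have "X \<le> X\<^sup>2" using X by (simp add: power2_eq_square)
    finally have "\<epsilon> * 2 ^ m1 \<le> \<epsilon> * X\<^sup>2" using eps by (intro mult_left_mono) auto
    moreover have "4 * K\<^sup>2 < \<epsilon> * 2 ^ m1" using m1 eps by (simp add: field_simps)
    ultimately have KX: "(K / X)\<^sup>2 \<le> \<epsilon> / 4" using X by (simp add: power_divide field_simps)
    have onb: "l2_onb (dil X \<phi>) UNIV (V (int m))" unfolding X_def by (rule mra_onb[OF mra])
    then obtain F c where F: "finite F" "l2norm (\<lambda>x. g x - (\<Sum>n\<in>F. c n * dil X \<phi> n x)) < sqrt \<delta>"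
      using gm sd unfolding l2_onb_def by blast
    have sg: "sqint g" using gm mra by (auto simp: is_mra_def l2subspace_def)
    have sP: "sqint (\<lambda>x. \<Sum>n\<in>F. c n * dil X \<phi> n x)" by (intro sqint_sum F sqint_cmult sqint_dil[OF f X(1)])
    have "l2sq (\<lambda>x. (?u x - g x) + (g x - (\<Sum>n\<in>F. c n * dil X \<phi> n x))) \<le>
       2 * l2sq (\<lambda>x. ?u x - g x) + 2 * l2sq (\<lambda>x. g x - (\<Sum>n\<in>F. c n * dil X \<phi> n x))"
      by (intro l2sq_add_le sqint_diff su sg sP)
    also have "\<dots> < 2 * \<delta> + 2 * \<delta>"
      using g(2) F(2) d sd by (intro add_strict_mono) (simp_all add: l2norm_less_iff)
    finally have ap: "l2sq (\<lambda>x. ?u x - (\<Sum>n\<in>F. c n * dil X \<phi> n x)) < 4 * \<delta>" by simp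
    have on: "l2inner (dil X \<phi> i) (dil X \<phi> j) = (if i = j then 1 else 0)" for i j using onb by (auto simp: l2_onb_def)
    define S where "S x = (\<Sum>\<^sub>\<infinity>n. l2inner ?u (dil X \<phi> n) * dil X \<phi> n x)" for x
    note loc = dil_series_local_l2[OF f X(1) su iu on F(1) ap, of 2, folded S_def]
    have Seq: "S x = l2inner ?u (rkern X \<phi> (X * x))" for x
    proof -
      have "((\<lambda>n. dil X \<phi> n x * l2inner ?u (dil X \<phi> n)) has_sum l2inner ?u (rkern X \<phi> (X * x))) UNIV"
        using l2inner_rkern[OF iu f X(1), of "X * x"] by (simp add: dil_def)
      thus ?thesis by (simp add: S_def infsumI mult.commute)
    qed
    have "?Av h = ?Av (\<lambda>x. h (X * x))" unfolding X_def by (rule periodic_average_dilate[OF h per, symmetric])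
    also have "\<dots> \<le> (LINT x|lborel. 2 * (indicator {-2..2} x * (cmod (?u x - S x))\<^sup>2) + 2 * (K / X)\<^sup>2 * indicator {0..<1} x)"
    proof (rule integral_mono[OF iav])
      show "integrable lborel (\<lambda>x. 2 * (indicator {-2..2} x * (cmod (?u x - S x))\<^sup>2) + 2 * (K / X)\<^sup>2 * indicator {0..<1} x)"
        by (intro Bochner_Integration.integrable_add integrable_mult_right loc) auto
      fix x :: real
      show "indicator {0..<1} x * h (X * x) \<le> 2 * (indicator {-2..2} x * (cmod (?u x - S x))\<^sup>2) + 2 * (K / X)\<^sup>2 * indicator {0..<1} x"
      proof (cases "x \<in> {0..<1}")
        case True
        hence [simp]: "?u x = 1" by auto
        have "(cmod (1 - kint \<phi> (X * x)))\<^sup>2 \<le> 2 * (cmod (1 - S x))\<^sup>2 + 2 * (cmod (S x - kint \<phi> (X * x)))\<^sup>2"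
          using cmod_add_sq_le[of "1 - S x" "S x - kint \<phi> (X * x)"] by simp
        also have "cmod (S x - kint \<phi> (X * x)) \<le> K / X"
          using dist_indicator_kernel[OF f X(1) True] by (simp add: Seq K_def)
        hence "(cmod (S x - kint \<phi> (X * x)))\<^sup>2 \<le> (K / X)\<^sup>2" by (intro power_mono) auto
        finally show ?thesis using True by (simp add: h_def)
      qed auto
    qed
    also have "\<dots> = 2 * (LINT x|lborel. indicator {-2..2} x * (cmod (?u x - S x))\<^sup>2) + 2 * (K / X)\<^sup>2"
      using loc(1) by (subst Bochner_Integration.integral_add) auto
    also have "\<dots> \<le> 2 * (3 * (4 * \<delta>)) + 2 * (\<epsilon> / 4)"
      using loc(2) KX by (intro add_mono mult_left_mono) auto
    also have "\<dots> \<le> \<epsilon>" using eps by (simp add: \<delta>_def)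
    finally show ?thesis .
  qed
  have "?Av h \<le> 0" by (rule field_le_epsilon) (use small in simp)
  moreover have "?Av h \<ge> 0" by (rule integral_nonneg_AE) (auto simp: h_def)
  ultimately have "?Av h = 0" by simp
  hence "AE x in lborel. indicator {0..<1} x * h x = 0"
    using iav[of 1] by (subst (asm) integral_nonneg_eq_0_iff_AE) (auto simp: h_def)
  hence ae: "AE y in lborel. y \<in> {0<..<1} \<longrightarrow> 1 - kint \<phi> y = 0"
    by eventually_elim (auto simp: h_def indicator_def split: if_splits)
  have cont: "continuous_on UNIV (\<lambda>y. 1 - kint \<phi> y)" by (intro continuous_intros continuous_kint[OF f])
  have "{0<..<1} \<subseteq> {y. 1 - kint \<phi> y = 0}"
    using continuous_AE_eq_0[OF cont _ _ ae] by auto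
  moreover have "closed {y. 1 - kint \<phi> y = 0}" by (intro closed_Collect_eq cont continuous_on_const)
  ultimately have "closure {0<..<1::real} \<subseteq> {y. 1 - kint \<phi> y = 0}" by (rule closure_minimal)
  hence 01: "kint \<phi> y = 1" if "0 \<le> y" "y \<le> 1" for y using that by auto
  have pn: "kint \<phi> (y + real n) = kint \<phi> y" for y n
  proof (induction n)
    case (Suc n)
    have "kint \<phi> (y + real (Suc n)) = kint \<phi> ((y + real n) + 1)" by (simp add: add_ac)
    thus ?case using Suc kint_periodic[OF f] by simp
  qed simp
  show ?thesis
  proof (cases "x \<ge> 0")
    case True
    have "x = frac x + real (nat \<lfloor>x\<rfloor>)" using True by (simp add: frac_def)
    thus ?thesis using pn[of "frac x" "nat \<lfloor>x\<rfloor>"] 01[of "frac x"] by (simp add: less_imp_le[OF frac_lt_1])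
  next
    case False
    have "x + real (nat (- \<lfloor>x\<rfloor>)) = frac x" using False by (simp add: frac_def)
    thus ?thesis using pn[of x "nat (- \<lfloor>x\<rfloor>)"] 01[of "frac x"] by (simp add: less_imp_le[OF frac_lt_1])
  qed
qed

subsection \<open>Pointwise wavelet expansions\<close>

text \<open>The multiresolution approximation is condensed to two identities. Both are stable under
  complex conjugation, so that the conjugate pair is an instance without constructing a
  multiresolution approximation for it.\<close>

locale wavelet_pair = gs_pair +
  assumes two_scale: "2 * kern \<phi> (2 * x) (2 * y) = kern \<phi> x y + kern \<psi> x y"
    and kint_1: "kint \<phi> x = 1"
begin

lemma rapid_wfac_ex: "\<exists>C. \<forall>e. rapid (wfac e) C"
proof -
  have r2': "r2 > 0" using r2 by simp
  obtain C1 where 1: "rapid \<phi> C1" using GS_rapid[OF phi r2'] by blast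
  have "\<psi> \<in> GS r1 r2" using psi by (simp add: GS0_def)
  then obtain C2 where 2: "rapid \<psi> C2" using GS_rapid[OF _ r2'] by blast
  have up: "rapid f (max C1 C2)" if "rapid f C" "C = C1 \<or> C = C2" for f C
  proof -
    have "cmod (f u) \<le> max C1 C2 / (1 + u\<^sup>2)\<^sup>2" for u
      by (rule order_trans[OF rapidD(3)[OF that(1)]]) (use that(2) in \<open>auto intro!: divide_right_mono\<close>)
    thus ?thesis using that by (auto simp: rapid_def)
  qed
  have "rapid (wfac e) (max C1 C2)" for e using up[OF 1] up[OF 2] by (simp add: wfac_def)
  thus ?thesis by blast
qed

definition RC :: real where "RC = (SOME C. \<forall>e. rapid (wfac e) C)"

lemma rapid_wfac: "rapid (wfac e) RC"
  using someI_ex[OF rapid_wfac_ex] by (simp add: RC_def)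

lemma RC_nonneg: "RC \<ge> 0" using rapidD(1)[OF rapid_wfac] .

text \<open>Tensor product kernel at scale \<open>X\<close>: for the type that is
  \<open>False\<close> everywhere it belongs to the approximation space, for a type in
  \<open>wQ\<close> to one of the detail spaces.\<close>

definition kd :: "('d::finite \<Rightarrow> bool) \<Rightarrow> real \<Rightarrow> real^'d \<Rightarrow> real^'d \<Rightarrow> complex" where
  "kd \<epsilon> X x y = (\<Prod>i\<in>UNIV. of_real X * kern (wfac (\<epsilon> i)) (X * x $ i) (X * y $ i))"

lemma kern_bound_const: "cmod (kern (wfac e) x y) \<le> 8 * RC\<^sup>2 * isq"
proof -
  have "8 * RC\<^sup>2 * isq / (1 + (x - y)\<^sup>2) \<le> 8 * RC\<^sup>2 * isq / 1"
    using isq_nonneg by (intro divide_left_mono) (auto simp: add_pos_nonneg)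
  thus ?thesis using kern_bound[OF rapid_wfac[of e], of x y] by simp
qed

lemma kd_bound: assumes "X > 0" shows "cmod (kd \<epsilon> X x (y :: real^'d::finite)) \<le> (X * (8 * RC\<^sup>2 * isq)) ^ CARD('d)"
proof -
  have "cmod (kd \<epsilon> X x y) \<le> (\<Prod>i\<in>(UNIV::'d set). X * (8 * RC\<^sup>2 * isq))"
    unfolding kd_def prod_norm [symmetric]
  proof (intro prod_mono conjI)
    fix i
    show "cmod (of_real X * kern (wfac (\<epsilon> i)) (X * x $ i) (X * y $ i)) \<le> X * (8 * RC\<^sup>2 * isq)"
      using mult_left_mono[OF kern_bound_const, of X] assms by (simp add: norm_mult)
  qed auto
  thus ?thesis by simp
qed

lemma continuous_kern2: "continuous_on UNIV (\<lambda>y. kern (wfac e) x y)"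
proof -
  have "continuous_on UNIV (\<lambda>y. cnj (kern (wfac e) y x))"
    by (intro continuous_intros continuous_kern[OF rapid_wfac])
  thus ?thesis by (simp add: cnj_kern)
qed

lemma borel_measurable_kern2 [measurable]: "(\<lambda>y. kern (wfac e) x y) \<in> borel_measurable borel"
  by (rule borel_measurable_continuous_onI[OF continuous_kern2])

lemma borel_measurable_kd [measurable]: "kd \<epsilon> X x \<in> borel_measurable borel"
  unfolding kd_def by measurable

lemma integrable_kd:
  assumes g: "integrable lborel g" and X: "X > 0" shows "integrable lborel (\<lambda>y. g y * kd \<epsilon> X (x::real^'d::finite) y)"
proof (rule Bochner_Integration.integrable_bound)
  let ?B = "(X * (8 * RC\<^sup>2 * isq)) ^ CARD('d)"
  have [measurable]: "g \<in> borel_measurable borel" using borel_measurable_integrable[OF g] by simp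
  show "integrable lborel (\<lambda>y. ?B * norm (g y))" using g by auto
  show "AE y in lborel. norm (g y * kd \<epsilon> X x y) \<le> norm (?B * norm (g y))"
  proof (rule AE_I2)
    fix y :: "real^'d"
    have "norm (g y * kd \<epsilon> X x y) \<le> norm (g y) * ?B"
      unfolding norm_mult by (intro mult_left_mono kd_bound X) auto
    also have "\<dots> \<le> norm (?B * norm (g y))" by (simp add: mult.commute)
    finally show "norm (g y * kd \<epsilon> X x y) \<le> norm (?B * norm (g y))" .
  qed
  show "(\<lambda>y. g y * kd \<epsilon> X x y) \<in> borel_measurable lborel" by measurable
qed

text \<open>Expanding the product over the coordinates of the one-dimensional two-scale identity
  produces one term for every choice of \<open>\<phi>\<close> or \<open>\<psi>\<close> in each
  coordinate.\<close>

lemma kd_two_scale: "kd (\<lambda>_. False) (2 * X) x y = (\<Sum>\<epsilon>\<in>UNIV. kd \<epsilon> X x (y :: real^'d::finite))"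
proof -
  have "kd (\<lambda>_. False) (2 * X) x y = (\<Prod>i\<in>UNIV. \<Sum>e\<in>UNIV. of_real X * kern (wfac e) (X * x $ i) (X * y $ i))"
    unfolding kd_def
  proof (intro prod.cong refl)
    fix i :: 'd
    have "of_real (2 * X) * kern (wfac False) (2 * X * x $ i) (2 * X * y $ i) =
       of_real X * (2 * kern \<phi> (2 * (X * x $ i)) (2 * (X * y $ i)))" by (simp add: wfac_def mult_ac)
    also have "\<dots> = of_real X * (kern \<phi> (X * x $ i) (X * y $ i) + kern \<psi> (X * x $ i) (X * y $ i))"
      by (simp only: two_scale)
    also have "\<dots> = (\<Sum>e\<in>UNIV. of_real X * kern (wfac e) (X * x $ i) (X * y $ i))"
      by (simp add: UNIV_bool wfac_def distrib_left)
    finally show "of_real (2 * X) * kern (wfac False) (2 * X * x $ i) (2 * X * y $ i) =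
       (\<Sum>e\<in>UNIV. of_real X * kern (wfac e) (X * x $ i) (X * y $ i))" .
  qed
  also have "\<dots> = (\<Sum>\<epsilon>\<in>PiE UNIV (\<lambda>_. UNIV). \<Prod>i\<in>UNIV. of_real X * kern (wfac (\<epsilon> i)) (X * x $ i) (X * y $ i))"
    by (rule prod_sum_PiE) auto
  finally show ?thesis by (simp add: kd_def PiE_UNIV_domain)
qed

lemma wpsi_mult_cnj_wpsi:
  "wpsi \<phi> \<psi> (\<epsilon>, m, n) x * cnj (wpsi \<phi> \<psi> (\<epsilon>, m, n) (y :: real^'d::finite)) =
    (\<Prod>i\<in>UNIV. of_real (2 powr of_int m) * (wfac (\<epsilon> i) (2 powr of_int m * x $ i - of_int (n i)) * cnj (wfac (\<epsilon> i) (2 powr of_int m * y $ i - of_int (n i)))))"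
proof -
  have "2 powr (of_int m * real CARD('d) / 2) * 2 powr (of_int m * real CARD('d) / 2) = (2 powr of_int m) ^ CARD('d)"
    by (simp add: powr_add [symmetric] powr_realpow [symmetric] powr_powr)
  hence "complex_of_real (2 powr (of_int m * real CARD('d) / 2)) * complex_of_real (2 powr (of_int m * real CARD('d) / 2)) =
     of_real (2 powr of_int m) ^ CARD('d)" by (simp flip: of_real_mult of_real_power)
  thus ?thesis by (simp add: wpsi_eq_tder tder_def prod.distrib mult_ac)
qed

lemma summable_prod_int:
  fixes f :: "'d::finite \<Rightarrow> int \<Rightarrow> complex"
  assumes "\<And>i. (\<lambda>n. cmod (f i n)) summable_on UNIV"
  shows "(\<lambda>n. cmod (\<Prod>i\<in>UNIV. f i (n i))) summable_on UNIV"
    and "(\<Sum>\<^sub>\<infinity>n. \<Prod>i\<in>UNIV. f i (n i)) = (\<Prod>i\<in>UNIV. \<Sum>\<^sub>\<infinity>n. f i n)"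
proof -
  have "Infinite_Set_Sum.abs_summable_on (\<lambda>n. \<Prod>i\<in>UNIV. f i (n i)) (PiE UNIV (\<lambda>_. UNIV))"
    by (rule abs_summable_on_prod_PiE) (use assms in \<open>auto simp: abs_summable_equivalent [symmetric]\<close>)
  thus "(\<lambda>n. cmod (\<Prod>i\<in>UNIV. f i (n i))) summable_on UNIV"
    by (simp add: PiE_UNIV_domain abs_summable_equivalent [symmetric])
  show "(\<Sum>\<^sub>\<infinity>n. \<Prod>i\<in>UNIV. f i (n i)) = (\<Prod>i\<in>UNIV. \<Sum>\<^sub>\<infinity>n. f i n)"
    using infsum_prod_PiE_abs[of "UNIV :: 'd set" f "\<lambda>_. UNIV"] assms by (simp add: PiE_UNIV_domain)
qed

lemma kd_series:
  fixes x y :: "real^'d::finite"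
  shows "(\<lambda>n. cmod (wpsi \<phi> \<psi> (\<epsilon>, m, n) x * cnj (wpsi \<phi> \<psi> (\<epsilon>, m, n) y))) summable_on UNIV"
    and "(\<Sum>\<^sub>\<infinity>n. wpsi \<phi> \<psi> (\<epsilon>, m, n) x * cnj (wpsi \<phi> \<psi> (\<epsilon>, m, n) y)) = kd \<epsilon> (2 powr of_int m) x y"
proof -
  define X where "X = 2 powr real_of_int m"
  define f where "f i n = of_real X * (wfac (\<epsilon> i) (X * x $ i - of_int n) * cnj (wfac (\<epsilon> i) (X * y $ i - of_int n)))" for i and n :: int
  have f: "(\<lambda>n. cmod (f i n)) summable_on UNIV" for i
    unfolding f_def norm_mult[of "of_real X"] by (intro summable_on_cmult_right kern_abs_summable[OF rapid_wfac])
  have eq: "wpsi \<phi> \<psi> (\<epsilon>, m, n) x * cnj (wpsi \<phi> \<psi> (\<epsilon>, m, n) y) = (\<Prod>i\<in>UNIV. f i (n i))" for n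
    by (simp only: wpsi_mult_cnj_wpsi f_def X_def)
  show "(\<lambda>n. cmod (wpsi \<phi> \<psi> (\<epsilon>, m, n) x * cnj (wpsi \<phi> \<psi> (\<epsilon>, m, n) y))) summable_on UNIV"
    unfolding eq by (rule summable_prod_int(1)[OF f])
  have "(\<Sum>\<^sub>\<infinity>n. f i n) = of_real X * kern (wfac (\<epsilon> i)) (X * x $ i) (X * y $ i)" for i
    unfolding f_def kern_def by (rule infsum_cmult_right')
  thus "(\<Sum>\<^sub>\<infinity>n. wpsi \<phi> \<psi> (\<epsilon>, m, n) x * cnj (wpsi \<phi> \<psi> (\<epsilon>, m, n) y)) = kd \<epsilon> (2 powr of_int m) x y"
    unfolding eq by (simp only: summable_prod_int(2)[OF f] kd_def X_def)
qed

lemma wpsi_sup: "cmod (wpsi \<phi> \<psi> (\<epsilon>, m, n) (x::real^'d::finite)) \<le> 2 powr (of_int m * real CARD('d) / 2) * RC ^ CARD('d)"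
proof -
  have "cmod (\<Prod>i\<in>UNIV. wfac (\<epsilon> i) (2 powr of_int m * x $ i - of_int (n i))) \<le> (\<Prod>i\<in>(UNIV::'d set). RC)"
    unfolding prod_norm [symmetric] by (intro prod_mono conjI rapidD(5)[OF rapid_wfac]) auto
  thus ?thesis by (simp add: wpsi_eq_tder tder_def norm_mult)
qed

lemma summable_wpsi: "(\<lambda>n. cmod (wpsi \<phi> \<psi> (\<epsilon>, m, n) (x::real^'d::finite))) summable_on UNIV"
proof -
  have "(\<lambda>n. cmod (\<Prod>i\<in>UNIV. wfac (\<epsilon> i) (2 powr of_int m * x $ i - of_int (n i)))) summable_on UNIV"
    by (rule summable_prod_int(1)) (rule summable_rapid[OF rapid_wfac])
  from summable_on_cmult_right[OF this, of "2 powr (of_int m * real CARD('d) / 2)"]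
  show ?thesis by (simp add: wpsi_eq_tder tder_def norm_mult)
qed

lemma borel_measurable_wpsi [measurable]: "wpsi \<phi> \<psi> lam \<in> borel_measurable (borel :: (real^'d::finite) measure)"
  using schwartz_borel[OF schwartz_wpsi] .

lemma integrable_mult_cnj_wpsi:
  fixes g :: "real^'d::finite \<Rightarrow> complex"
  assumes g: "integrable lborel g"
  shows "integrable lborel (\<lambda>y. g y * cnj (wpsi \<phi> \<psi> (\<epsilon>, m, n) y))"
    and "(LINT y|lborel. norm (g y * cnj (wpsi \<phi> \<psi> (\<epsilon>, m, n) y))) \<le> 2 powr (of_int m * real CARD('d) / 2) * RC ^ CARD('d) * (LINT y|lborel. norm (g y))"
proof -
  let ?B = "2 powr (of_int m * real CARD('d) / 2) * RC ^ CARD('d)"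
  have [measurable]: "g \<in> borel_measurable borel" using borel_measurable_integrable[OF g] by simp
  have le: "norm (g y * cnj (wpsi \<phi> \<psi> (\<epsilon>, m, n) y)) \<le> ?B * norm (g y)" for y
    unfolding norm_mult complex_mod_cnj by (subst mult.commute) (intro mult_right_mono wpsi_sup, auto)
  show 1: "integrable lborel (\<lambda>y. g y * cnj (wpsi \<phi> \<psi> (\<epsilon>, m, n) y))"
    by (rule Bochner_Integration.integrable_bound[OF integrable_mult_right[OF integrable_norm[OF g], of ?B]])
       (use le RC_nonneg in auto)
  show "(LINT y|lborel. norm (g y * cnj (wpsi \<phi> \<psi> (\<epsilon>, m, n) y))) \<le> ?B * (LINT y|lborel. norm (g y))"
    using integral_mono[OF integrable_norm[OF 1] integrable_mult_right[OF integrable_norm[OF g], of ?B] le] by simp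
qed

definition coef :: "(real^'d::finite \<Rightarrow> complex) \<Rightarrow> ('d \<Rightarrow> bool) \<times> int \<times> ('d \<Rightarrow> int) \<Rightarrow> complex" where
  "coef g lam = (LINT y|lborel. g y * cnj (wpsi \<phi> \<psi> lam y))"

text \<open>For fixed type and scale the sum over translations is an integral operator with kernel
  \<open>kd\<close>; absolute convergence comes from the supremum bound on the coefficients and the
  summability of the translates at \<open>x\<close>.\<close>

lemma detail_series:
  fixes g :: "real^'d::finite \<Rightarrow> complex"
  assumes g: "integrable lborel g"
  shows "((\<lambda>n. coef g (\<epsilon>, m, n) * wpsi \<phi> \<psi> (\<epsilon>, m, n) x) has_sum (LINT y|lborel. g y * kd \<epsilon> (2 powr of_int m) x y)) UNIV"
proof -
  define f where "f n y = wpsi \<phi> \<psi> (\<epsilon>, m, n) x * (g y * cnj (wpsi \<phi> \<psi> (\<epsilon>, m, n) y))" for n y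
  have feq: "f n y = g y * (wpsi \<phi> \<psi> (\<epsilon>, m, n) x * cnj (wpsi \<phi> \<psi> (\<epsilon>, m, n) y))" for n y by (simp add: f_def)
  let ?B = "2 powr (of_int m * real CARD('d) / 2) * RC ^ CARD('d) * (LINT y|lborel. norm (g y))"
  have "((\<lambda>n. LINT y|lborel. f n y) has_sum (LINT y|lborel. (\<Sum>\<^sub>\<infinity>n\<in>UNIV. f n y))) UNIV"
  proof (rule has_sum_integral)
    show "integrable lborel (f n)" for n unfolding f_def by (intro integrable_mult_right integrable_mult_cnj_wpsi g)
    show "(\<lambda>n. norm (f n y)) summable_on UNIV" for y
      unfolding feq norm_mult[of "g y"] by (intro summable_on_cmult_right kd_series)
    show "(\<lambda>n. LINT y|lborel. norm (f n y)) summable_on UNIV"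
    proof (rule summable_on_comparison_test)
      show "(\<lambda>n. ?B * cmod (wpsi \<phi> \<psi> (\<epsilon>, m, n) x)) summable_on UNIV" by (intro summable_on_cmult_right summable_wpsi)
      fix n
      have "(LINT y|lborel. norm (f n y)) = cmod (wpsi \<phi> \<psi> (\<epsilon>, m, n) x) * (LINT y|lborel. norm (g y * cnj (wpsi \<phi> \<psi> (\<epsilon>, m, n) y)))"
        unfolding f_def norm_mult[of "wpsi \<phi> \<psi> (\<epsilon>, m, n) x"] by (rule integral_mult_right_zero)
      also have "\<dots> \<le> cmod (wpsi \<phi> \<psi> (\<epsilon>, m, n) x) * ?B"
        by (intro mult_left_mono integrable_mult_cnj_wpsi g) auto
      finally show "(LINT y|lborel. norm (f n y)) \<le> ?B * cmod (wpsi \<phi> \<psi> (\<epsilon>, m, n) x)" by (simp add: mult.commute)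
    qed auto
  qed auto
  moreover have "(LINT y|lborel. f n y) = coef g (\<epsilon>, m, n) * wpsi \<phi> \<psi> (\<epsilon>, m, n) x" for n
    unfolding f_def coef_def by (subst integral_mult_right_zero) (rule mult.commute)
  moreover have "(\<Sum>\<^sub>\<infinity>n\<in>UNIV. f n y) = g y * kd \<epsilon> (2 powr of_int m) x y" for y
    unfolding feq infsum_cmult_right' kd_series(2) ..
  ultimately show ?thesis by simp
qed

definition approx :: "(real^'d::finite \<Rightarrow> complex) \<Rightarrow> int \<Rightarrow> real^'d \<Rightarrow> complex" where
  "approx g m x = (LINT y|lborel. g y * kd (\<lambda>_. False) (2 powr of_int m) x y)"

lemma approx_step:
  assumes g: "integrable lborel g"
  shows "approx g (m + 1) x = approx g m x + (\<Sum>\<epsilon>\<in>wQ. LINT y|lborel. g y * kd \<epsilon> (2 powr of_int m) x y)"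
proof -
  have X: "2 powr real_of_int (m + 1) = 2 * 2 powr of_int m" by (simp add: powr_add)
  have "approx g (m + 1) x = (LINT y|lborel. (\<Sum>\<epsilon>\<in>UNIV. g y * kd \<epsilon> (2 powr of_int m) x y))"
    unfolding approx_def X kd_two_scale by (simp add: sum_distrib_left)
  also have "\<dots> = (\<Sum>\<epsilon>\<in>UNIV. LINT y|lborel. g y * kd \<epsilon> (2 powr of_int m) x y)"
    by (rule Bochner_Integration.integral_sum) (intro integrable_kd g, simp)
  also have "UNIV = insert (\<lambda>_. False) wQ" by (auto simp: wQ_def)
  also have "(\<Sum>\<epsilon>\<in>insert (\<lambda>_. False) wQ. LINT y|lborel. g y * kd \<epsilon> (2 powr of_int m) x y) =
     approx g m x + (\<Sum>\<epsilon>\<in>wQ. LINT y|lborel. g y * kd \<epsilon> (2 powr of_int m) x y)"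
    by (subst sum.insert) (auto simp: wQ_def approx_def)
  finally show ?thesis .
qed

lemma approx_telescope:
  assumes g: "integrable lborel g"
  shows "(\<Sum>m\<in>{-int M..<int M}. \<Sum>\<epsilon>\<in>wQ. LINT y|lborel. g y * kd \<epsilon> (2 powr of_int m) x y) = approx g (int M) x - approx g (- int M) x"
proof (induction M)
  case (Suc M)
  define a where "a m = (\<Sum>\<epsilon>\<in>wQ. LINT y|lborel. g y * kd \<epsilon> (2 powr of_int m) x y)" for m
  have set: "{-int (Suc M)..<int (Suc M)} = insert (int M) (insert (- int M - 1) {-int M..<int M})" by auto
  have "(\<Sum>m\<in>{-int (Suc M)..<int (Suc M)}. a m) = a (int M) + (a (- int M - 1) + (\<Sum>m\<in>{-int M..<int M}. a m))"
    unfolding set by (subst sum.insert; simp)+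
  also have "(\<Sum>m\<in>{-int M..<int M}. a m) = approx g (int M) x - approx g (- int M) x" using Suc by (simp add: a_def)
  also have "a (int M) = approx g (int (Suc M)) x - approx g (int M) x"
    using approx_step[OF g, of "int M" x] by (simp add: a_def add.commute)
  also have "a (- int M - 1) = approx g (- int M) x - approx g (- int (Suc M)) x"
  proof -
    have "- int (Suc M) = - int M - 1" by simp
    thus ?thesis using approx_step[OF g, of "- int M - 1" x] by (simp only: a_def) simp
  qed
  finally show ?case by (simp add: a_def)
qed simp

text \<open>The kernel at scale X is bounded by a constant times X^d, which tends to zero against an
  integrable function.\<close>

lemma approx_coarse_tendsto:
  fixes g :: "real^'d::finite \<Rightarrow> complex"
  assumes g: "integrable lborel g" shows "(\<lambda>M. approx g (- int M) x) \<longlonglongrightarrow> 0"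
proof (rule Lim_null_comparison)
  define D where "D = (8 * RC\<^sup>2 * isq) ^ CARD('d) * (LINT y|lborel. norm (g y))"
  have D: "D \<ge> 0" using isq_nonneg by (simp add: D_def)
  show "(\<lambda>M. (1/2) ^ M * D) \<longlonglongrightarrow> 0" by (intro tendsto_mult_left_zero LIMSEQ_power_zero) auto
  show "\<forall>\<^sub>F M in sequentially. norm (approx g (- int M) x) \<le> (1/2) ^ M * D"
  proof (rule always_eventually, rule allI)
    fix M
    define X :: real where "X = (1/2) ^ M"
    have X: "X > 0" "X \<le> 1" by (simp_all add: X_def power_le_one)
    have X': "2 powr real_of_int (- int M) = X" by (simp add: X_def powr_minus powr_realpow power_one_over inverse_eq_divide)
    have "norm (approx g (- int M) x) \<le> (LINT y|lborel. (X * (8 * RC\<^sup>2 * isq)) ^ CARD('d) * norm (g y))"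
      unfolding approx_def X'
    proof (rule Bochner_Integration.integral_norm_bound_integral[OF integrable_kd[OF g X(1)]])
      fix y
      show "norm (g y * kd (\<lambda>_. False) X x y) \<le> (X * (8 * RC\<^sup>2 * isq)) ^ CARD('d) * norm (g y)"
        unfolding norm_mult using kd_bound[OF X(1), of "\<lambda>_. False" x y] by (subst mult.commute) (intro mult_right_mono, auto)
    qed (use g in auto)
    also have "\<dots> = X ^ CARD('d) * D" by (simp add: D_def power_mult_distrib)
    also have "\<dots> \<le> X * D" using X D power_decreasing[of 1 "CARD('d)" X] by (intro mult_right_mono) (auto simp: Suc_leI)
    finally show "norm (approx g (- int M) x) \<le> (1/2) ^ M * D" by (simp add: X_def)
  qed
qed

text \<open>After \<open>y = x + u / X\<close> the kernel has integral one by \<open>kint_1\<close>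
  and a majorant \<open>E\<close> independent of the scale. The kernel still depends on
  \<open>X * x\<close>, so it is not the dilation of a fixed mollifier; the uniform majorant is what
  permits dominated convergence.\<close>

lemma approx_fine_tendsto:
  fixes g :: "real^'d::finite \<Rightarrow> complex"
  assumes g: "integrable lborel g" and cont: "continuous_on UNIV g" and bd: "\<And>y. cmod (g y) \<le> B"
  shows "(\<lambda>M. approx g (int M) x) \<longlonglongrightarrow> g x"
proof -
  define D where "D = 8 * RC\<^sup>2 * isq"
  have D: "D \<ge> 0" using isq_nonneg by (simp add: D_def)
  define E where "E u = (\<Prod>i\<in>UNIV. D * (1 / (1 + (u $ i - 0)\<^sup>2)))" for u :: "real^'d"
  have E0: "E u \<ge> 0" for u using D by (simp add: E_def prod_nonneg)
  have iE: "integrable lborel E" unfolding E_def [abs_def] by (intro integrable_prod_vec integrable_mult_right integrable_inverse_square)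
  have [measurable]: "g \<in> borel_measurable borel" by (rule borel_measurable_continuous_onI[OF cont])
  define s where "s M u = cmod (g (x + (1/2) ^ M *\<^sub>R u) - g x) * E u" for M u
  have le: "cmod (approx g (int M) x - g x) \<le> (LINT u|lborel. s M u)" for M
  proof -
    define X :: real where "X = 2 ^ M"
    have X: "X > 0" by (simp add: X_def)
    have X': "2 powr real_of_int (int M) = X" by (simp add: X_def powr_realpow)
    define q where "q u = (\<Prod>i\<in>UNIV. kern \<phi> (X * x $ i) (X * x $ i + u $ i))" for u :: "real^'d"
    have kphi: "integrable lborel (\<lambda>v. kern \<phi> z (z + v))" "(LINT v|lborel. kern \<phi> z (z + v)) = 1" for z
    proof -
      have i: "integrable lborel (kern \<phi> z)" using integrable_kern[OF rapid_wfac[of False], of 1 z] by (simp add: wfac_def)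
      show "integrable lborel (\<lambda>v. kern \<phi> z (z + v))" using lborel_integrable_real_affine[OF i, of 1 z] by simp
      show "(LINT v|lborel. kern \<phi> z (z + v)) = 1"
        using lborel_integral_real_affine[of 1 "kern \<phi> z" z] kint_1[of z] by (simp add: kint_def)
    qed
    have iq: "integrable lborel q" and q1: "(LINT u|lborel. q u) = 1"
      unfolding q_def using integrable_prod_vec[of "\<lambda>i v. kern \<phi> (X * x $ i) (X * x $ i + v)"]
        integral_prod_vec[of "\<lambda>i v. kern \<phi> (X * x $ i) (X * x $ i + v)"] kphi by simp_all
    have qE: "cmod (q u) \<le> E u" for u
      unfolding q_def E_def prod_norm [symmetric]
    proof (intro prod_mono conjI)
      fix i show "cmod (kern \<phi> (X * x $ i) (X * x $ i + u $ i)) \<le> D * (1 / (1 + (u $ i - 0)\<^sup>2))"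
        using kern_bound[OF rapid_wfac[of False], of "X * x $ i" "X * x $ i + u $ i"] by (simp add: wfac_def D_def)
    qed auto
    have "approx g (int M) x = \<bar>1 / X\<bar> ^ DIM(real^'d) *\<^sub>R (LINT u|lborel. g (x + (1/X) *\<^sub>R u) * kd (\<lambda>_. False) X x (x + (1/X) *\<^sub>R u))"
      unfolding approx_def X' by (rule integral_affine) (use X integrable_kd[OF g X] in auto)
    also have "\<dots> = (LINT u|lborel. \<bar>1 / X\<bar> ^ DIM(real^'d) *\<^sub>R (g (x + (1/X) *\<^sub>R u) * kd (\<lambda>_. False) X x (x + (1/X) *\<^sub>R u)))"
      by (rule integral_scaleR_right [symmetric])
    also have "\<dots> = (LINT u|lborel. g (x + (1/X) *\<^sub>R u) * q u)"
    proof (intro Bochner_Integration.integral_cong refl)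
      fix u :: "real^'d"
      have "kd (\<lambda>_. False) X x (x + (1/X) *\<^sub>R u) = of_real (X ^ CARD('d)) * q u"
        using X by (simp add: kd_def q_def wfac_def prod.distrib distrib_left)
      thus "\<bar>1 / X\<bar> ^ DIM(real^'d) *\<^sub>R (g (x + (1/X) *\<^sub>R u) * kd (\<lambda>_. False) X x (x + (1/X) *\<^sub>R u)) = g (x + (1/X) *\<^sub>R u) * q u"
        using X by (simp add: scaleR_conv_of_real power_divide)
    qed
    finally have ap: "approx g (int M) x = (LINT u|lborel. g (x + (1/X) *\<^sub>R u) * q u)" .
    have [measurable]: "q \<in> borel_measurable borel" using borel_measurable_integrable[OF iq] by simp
    have m: "(\<lambda>u. g (x + (1/X) *\<^sub>R u)) \<in> borel_measurable borel"
      by (intro borel_measurable_continuous_onI continuous_on_compose2[OF cont] continuous_intros) auto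
    have i1: "integrable lborel (\<lambda>u. g (x + (1/X) *\<^sub>R u) * q u)"
    proof (rule Bochner_Integration.integrable_bound[OF integrable_mult_right[OF integrable_norm[OF iq], of B]])
      show "AE u in lborel. norm (g (x + (1/X) *\<^sub>R u) * q u) \<le> norm (B * norm (q u))"
      proof (rule AE_I2)
        fix u
        have "norm (g (x + (1/X) *\<^sub>R u) * q u) \<le> B * norm (q u)" unfolding norm_mult by (intro mult_right_mono bd) auto
        also have "\<dots> \<le> norm (B * norm (q u))" using abs_ge_self by simp
        finally show "norm (g (x + (1/X) *\<^sub>R u) * q u) \<le> norm (B * norm (q u))" .
      qed
    qed (use m in measurable)
    have i2: "integrable lborel (\<lambda>u. g x * q u)" by (intro integrable_mult_right iq)
    have "approx g (int M) x - g x = (LINT u|lborel. g (x + (1/X) *\<^sub>R u) * q u - g x * q u)"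
      unfolding ap by (subst Bochner_Integration.integral_diff[OF i1 i2]) (simp add: q1)
    also have "cmod \<dots> \<le> (LINT u|lborel. s M u)"
    proof (rule Bochner_Integration.integral_norm_bound_integral)
      show "integrable lborel (\<lambda>u. g (x + (1/X) *\<^sub>R u) * q u - g x * q u)" by (intro Bochner_Integration.integrable_diff i1 i2)
      have sX: "s M u = cmod (g (x + (1/X) *\<^sub>R u) - g x) * E u" for u by (simp add: s_def X_def power_one_over)
      show "integrable lborel (s M)"
      proof (rule Bochner_Integration.integrable_bound[OF integrable_mult_right[OF iE, of "2 * B"]])
        show "AE u in lborel. norm (s M u) \<le> norm (2 * B * E u)"
        proof (rule AE_I2)
          fix u
          have "cmod (g (x + (1/X) *\<^sub>R u) - g x) \<le> 2 * B" using norm_triangle_ineq4[of "g (x + (1/X) *\<^sub>R u)" "g x"] bd[of "x + (1/X) *\<^sub>R u"] bd[of x] by linarith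
          thus "norm (s M u) \<le> norm (2 * B * E u)" unfolding sX using E0[of u]
            by (simp add: abs_mult) (metis abs_ge_self mult_right_mono order_trans abs_mult abs_numeral)
        qed
        have [measurable]: "E \<in> borel_measurable borel" using borel_measurable_integrable[OF iE] by simp
        show "s M \<in> borel_measurable lborel" unfolding sX [abs_def] using m by measurable
      qed
      fix u
      have "norm (g (x + (1/X) *\<^sub>R u) * q u - g x * q u) = cmod (g (x + (1/X) *\<^sub>R u) - g x) * cmod (q u)"
        by (simp add: norm_mult [symmetric] left_diff_distrib)
      also have "\<dots> \<le> s M u" unfolding sX by (intro mult_left_mono qE) auto
      finally show "norm (g (x + (1/X) *\<^sub>R u) * q u - g x * q u) \<le> s M u" .
    qed
    finally show ?thesis .
  qed
  have "(\<lambda>M. LINT u|lborel. s M u) \<longlonglongrightarrow> (LINT u|(lborel::(real^'d) measure). 0)"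
  proof (rule integral_dominated_convergence[where w = "\<lambda>u. 2 * B * E u"])
    have [measurable]: "E \<in> borel_measurable borel" using borel_measurable_integrable[OF iE] by simp
    show "s M \<in> borel_measurable lborel" for M
    proof -
      have [measurable]: "(\<lambda>u. g (x + (1/2) ^ M *\<^sub>R u)) \<in> borel_measurable borel"
        by (intro borel_measurable_continuous_onI continuous_on_compose2[OF cont] continuous_intros) auto
      show ?thesis unfolding s_def [abs_def] by measurable
    qed
    show "integrable lborel (\<lambda>u. 2 * B * E u)" by (intro integrable_mult_right iE)
    show "AE u in lborel. (\<lambda>M. s M u) \<longlonglongrightarrow> 0"
    proof (rule AE_I2)
      fix u
      have "(\<lambda>M. x + (1/2) ^ M *\<^sub>R u) \<longlonglongrightarrow> x + 0 *\<^sub>R u" by (intro tendsto_intros LIMSEQ_power_zero) auto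
      hence "(\<lambda>M. g (x + (1/2) ^ M *\<^sub>R u)) \<longlonglongrightarrow> g x"
        using cont by (intro continuous_on_tendsto_compose[OF cont]) auto
      hence "(\<lambda>M. cmod (g (x + (1/2) ^ M *\<^sub>R u) - g x) * E u) \<longlonglongrightarrow> cmod (g x - g x) * E u"
        by (intro tendsto_intros)
      thus "(\<lambda>M. s M u) \<longlonglongrightarrow> 0" by (simp add: s_def)
    qed
    show "AE u in lborel. norm (s M u) \<le> 2 * B * E u" for M
    proof (rule AE_I2)
      fix u
      have "cmod (g (x + (1/2) ^ M *\<^sub>R u) - g x) \<le> 2 * B"
        using norm_triangle_ineq4[of "g (x + (1/2) ^ M *\<^sub>R u)" "g x"] bd[of "x + (1/2) ^ M *\<^sub>R u"] bd[of x] by linarith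
      thus "norm (s M u) \<le> 2 * B * E u" unfolding s_def using E0[of u] by (simp add: abs_mult mult_right_mono)
    qed
  qed auto
  hence "(\<lambda>M. LINT u|lborel. s M u) \<longlonglongrightarrow> 0" by simp
  hence "(\<lambda>M. approx g (int M) x - g x) \<longlonglongrightarrow> 0"
    by (rule Lim_null_comparison[rotated]) (use le in auto)
  thus ?thesis by (simp add: LIM_zero_iff)
qed

lemma symmetric_intervals_at_top: "filterlim (\<lambda>M. {-int M..<int M}) (finite_subsets_at_top UNIV) sequentially"
  unfolding filterlim_finite_subsets_at_top
proof (intro allI impI)
  fix X :: "int set" assume X: "finite X \<and> X \<subseteq> UNIV"
  define N where "N = Max (insert 0 (abs ` X))"
  have N: "\<bar>k\<bar> \<le> N" if "k \<in> X" for k unfolding N_def using X that by (intro Max_ge) auto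
  show "\<forall>\<^sub>F M in sequentially. finite {-int M..<int M} \<and> X \<subseteq> {-int M..<int M} \<and> {-int M..<int M} \<subseteq> UNIV"
    using eventually_gt_at_top[of "nat N"]
  proof eventually_elim
    case (elim M)
    have "k \<in> {-int M..<int M}" if "k \<in> X" for k using N[OF that] elim by auto
    thus ?case by auto
  qed
qed

text \<open>Unconditional summability comes from the coefficient estimates, so only the value of the
  sum is in question and any order may be used: translations, then types, then scales in symmetric
  intervals, where the sums telescope.\<close>

lemma wavelet_expansion_pointwise:
  fixes g :: "real^'d::finite \<Rightarrow> complex"
  assumes g: "integrable lborel g" "continuous_on UNIV g" "\<And>y. cmod (g y) \<le> B"
    and sm: "(\<lambda>lam. coef g lam * wpsi \<phi> \<psi> lam x) summable_on wLambda"
  shows "((\<lambda>lam. coef g lam * wpsi \<phi> \<psi> lam x) has_sum g x) wLambda"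
proof -
  define T where "T = infsum (\<lambda>lam. coef g lam * wpsi \<phi> \<psi> lam x) wLambda"
  have "((\<lambda>lam. coef g lam * wpsi \<phi> \<psi> lam x) has_sum T) wLambda" unfolding T_def using sm by simp
  hence "((\<lambda>(m, \<epsilon>, n). coef g (\<epsilon>, m, n) * wpsi \<phi> \<psi> (\<epsilon>, m, n) x) has_sum T) (UNIV \<times> (wQ \<times> UNIV))"
    by (subst (asm) has_sum_reindex_bij_witness[of wLambda "\<lambda>(m, \<epsilon>, n). (\<epsilon>, m, n)" "\<lambda>(\<epsilon>, m, n). (m, \<epsilon>, n)"
         "UNIV \<times> (wQ \<times> UNIV)" "\<lambda>(m, \<epsilon>, n). coef g (\<epsilon>, m, n) * wpsi \<phi> \<psi> (\<epsilon>, m, n) x" _ T T])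
       (auto simp: wLambda_def)
  hence "((\<lambda>m. \<Sum>\<epsilon>\<in>wQ. LINT y|lborel. g y * kd \<epsilon> (2 powr of_int m) x y) has_sum T) UNIV"
  proof (rule has_sum_Sigma')
    fix m
    have s: "(\<lambda>(\<epsilon>, n). coef g (\<epsilon>, m, n) * wpsi \<phi> \<psi> (\<epsilon>, m, n) x) summable_on (wQ \<times> UNIV)"
    proof -
      have "(\<lambda>lam. coef g lam * wpsi \<phi> \<psi> lam x) summable_on ((\<lambda>(\<epsilon>, n). (\<epsilon>, m, n)) ` (wQ \<times> UNIV))"
        by (rule summable_on_subset_banach[OF sm]) (auto simp: wLambda_def)
      thus ?thesis by (subst (asm) summable_on_reindex) (auto simp: inj_on_def o_def case_prod_unfold)
    qed
    then obtain b where b: "((\<lambda>(\<epsilon>, n). coef g (\<epsilon>, m, n) * wpsi \<phi> \<psi> (\<epsilon>, m, n) x) has_sum b) (wQ \<times> UNIV)"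
      by (auto simp: summable_on_def)
    have "((\<lambda>\<epsilon>. LINT y|lborel. g y * kd \<epsilon> (2 powr of_int m) x y) has_sum b) wQ"
      by (rule has_sum_Sigma'[OF b]) (use detail_series[OF g(1)] in simp)
    hence "b = (\<Sum>\<epsilon>\<in>wQ. LINT y|lborel. g y * kd \<epsilon> (2 powr of_int m) x y)"
      using has_sum_unique has_sum_finite finite by blast
    thus "((\<lambda>y. case (m, y) of (m, \<epsilon>, n) \<Rightarrow> coef g (\<epsilon>, m, n) * wpsi \<phi> \<psi> (\<epsilon>, m, n) x) has_sum
          (\<Sum>\<epsilon>\<in>wQ. LINT y|lborel. g y * kd \<epsilon> (2 powr of_int m) x y)) (wQ \<times> UNIV)"
      using b by simp
  qed
  hence "(\<lambda>M. \<Sum>m\<in>{-int M..<int M}. \<Sum>\<epsilon>\<in>wQ. LINT y|lborel. g y * kd \<epsilon> (2 powr of_int m) x y) \<longlonglongrightarrow> T"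
    unfolding has_sum_def by (rule filterlim_compose[OF _ symmetric_intervals_at_top])
  hence "(\<lambda>M. approx g (int M) x - approx g (- int M) x) \<longlonglongrightarrow> T" by (simp add: approx_telescope[OF g(1)])
  moreover have "(\<lambda>M. approx g (int M) x - approx g (- int M) x) \<longlonglongrightarrow> g x - 0"
    by (intro tendsto_diff approx_fine_tendsto[OF g] approx_coarse_tendsto[OF g(1)])
  ultimately have "T = g x" using LIMSEQ_unique by fastforce
  thus ?thesis using has_sum_infsum[OF sm, folded T_def] by (simp only:)
qed

end

subsection \<open>Gelfand-Shilov spaces as vector spaces\<close>

lemma dlist_add:
  assumes "schwartz f" "schwartz g" "set l \<subseteq> Basis"
  shows "dlist l (\<lambda>x. f x + g x) = (\<lambda>x. dlist l f x + dlist l g x)"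
  using assms(3)
proof (induction l)
  case (Cons b l)
  hence l: "set l \<subseteq> Basis" and b: "b \<in> Basis" by auto
  have "((\<lambda>u. dlist l f (x + u *\<^sub>R b) + dlist l g (x + u *\<^sub>R b)) has_vector_derivative dlist (b # l) f x + dlist (b # l) g x) (at 0)" for x
    using has_vector_derivative_add[OF dlist_has_vector_derivative[OF assms(1) l b, of x 0] dlist_has_vector_derivative[OF assms(2) l b, of x 0]] by simp
  thus ?case using Cons.IH[OF l] by (simp add: partial_def vector_derivative_at fun_eq_iff)
qed simp

lemma dlist_cmult:
  assumes "schwartz f" "set l \<subseteq> Basis"
  shows "dlist l (\<lambda>x. c * f x) = (\<lambda>x. c * dlist l f x)"
  using assms(2)
proof (induction l)
  case (Cons b l)
  hence l: "set l \<subseteq> Basis" and b: "b \<in> Basis" by auto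
  have "((\<lambda>u. c * dlist l f (x + u *\<^sub>R b)) has_vector_derivative c * dlist (b # l) f x) (at 0)" for x
    using has_vector_derivative_mult_right[OF dlist_has_vector_derivative[OF assms(1) l b, of x 0]] by simp
  thus ?case using Cons.IH[OF l] by (simp add: partial_def vector_derivative_at fun_eq_iff)
qed simp

lemma dlist_cnj:
  assumes "schwartz f" "set l \<subseteq> Basis"
  shows "dlist l (\<lambda>x. cnj (f x)) = (\<lambda>x. cnj (dlist l f x))"
  using assms(2)
proof (induction l)
  case (Cons b l)
  hence l: "set l \<subseteq> Basis" and b: "b \<in> Basis" by auto
  have "((\<lambda>u. cnj (dlist l f (x + u *\<^sub>R b))) has_vector_derivative cnj (dlist (b # l) f x)) (at 0)" for x
    using has_vector_derivative_cnj[OF dlist_has_vector_derivative[OF assms(1) l b, of x 0]] by simp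
  thus ?case using Cons.IH[OF l] by (simp add: partial_def vector_derivative_at fun_eq_iff)
qed simp

lemma schwartzI:
  assumes "\<And>l. set l \<subseteq> Basis \<Longrightarrow> continuous_on UNIV (dlist l f)"
    and "\<And>l b x. set l \<subseteq> Basis \<Longrightarrow> b \<in> Basis \<Longrightarrow> (\<lambda>t. dlist l f (x + t *\<^sub>R b)) differentiable (at 0)"
    and "\<And>l \<alpha>. set l \<subseteq> Basis \<Longrightarrow> \<exists>B. \<forall>x. cmod (of_real (xpow \<alpha> x) * dlist l f x) \<le> B"
  shows "schwartz f"
  unfolding schwartz_def bounded_iff using assms by (auto 4 4)

lemma schwartz_bound: "schwartz f \<Longrightarrow> set l \<subseteq> Basis \<Longrightarrow> \<exists>B. \<forall>x. cmod (of_real (xpow \<alpha> x) * dlist l f x) \<le> B"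
  unfolding schwartz_def bounded_iff by blast

lemma schwartz_differentiable:
  "schwartz f \<Longrightarrow> set l \<subseteq> Basis \<Longrightarrow> b \<in> Basis \<Longrightarrow> (\<lambda>t. dlist l f (x + t *\<^sub>R b)) differentiable (at (0::real))"
  unfolding schwartz_def by blast

lemma schwartz_add: assumes f: "schwartz f" and g: "schwartz g" shows "schwartz (\<lambda>x. f x + g x)"
proof (rule schwartzI)
  fix l :: "'a list" and b x :: 'a and \<alpha> :: "'a \<Rightarrow> nat" assume l: "set l \<subseteq> Basis"
  note eq = dlist_add[OF f g l]
  show "continuous_on UNIV (dlist l (\<lambda>x. f x + g x))" unfolding eq by (intro continuous_intros schwartz_dlist f g l)
  show "\<exists>B. \<forall>x. cmod (of_real (xpow \<alpha> x) * dlist l (\<lambda>x. f x + g x) x) \<le> B"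
  proof -
    obtain B1 B2 where B: "\<And>x. cmod (of_real (xpow \<alpha> x) * dlist l f x) \<le> B1" "\<And>x. cmod (of_real (xpow \<alpha> x) * dlist l g x) \<le> B2"
      using schwartz_bound[OF f l] schwartz_bound[OF g l] by metis
    show ?thesis unfolding eq distrib_left
      by (intro exI[of _ "B1 + B2"] allI order_trans[OF norm_triangle_ineq] add_mono B)
  qed
  assume b: "b \<in> Basis"
  show "(\<lambda>t. dlist l (\<lambda>x. f x + g x) (x + t *\<^sub>R b)) differentiable (at 0)"
    unfolding eq by (intro derivative_intros schwartz_differentiable f g l b)
qed

lemma schwartz_cmult: assumes f: "schwartz f" shows "schwartz (\<lambda>x. c * f x)"
proof (rule schwartzI)
  fix l :: "'a list" and b x :: 'a and \<alpha> :: "'a \<Rightarrow> nat" assume l: "set l \<subseteq> Basis"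
  note eq = dlist_cmult[OF f l]
  show "continuous_on UNIV (dlist l (\<lambda>x. c * f x))" unfolding eq by (intro continuous_intros schwartz_dlist f l)
  show "\<exists>B. \<forall>x. cmod (of_real (xpow \<alpha> x) * dlist l (\<lambda>x. c * f x) x) \<le> B"
  proof -
    obtain B1 where B: "\<And>x. cmod (of_real (xpow \<alpha> x) * dlist l f x) \<le> B1" using schwartz_bound[OF f l] by metis
    show ?thesis unfolding eq mult.left_commute[of _ c] norm_mult[of c]
      by (intro exI[of _ "cmod c * B1"] allI mult_left_mono B) auto
  qed
  assume b: "b \<in> Basis"
  have "(\<lambda>t. dlist l f (x + t *\<^sub>R b)) differentiable (at (0::real))" by (rule schwartz_differentiable[OF f l b])
  then obtain D where "((\<lambda>t. dlist l f (x + t *\<^sub>R b)) has_vector_derivative D) (at 0)"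
    using vector_derivative_works by blast
  thus "(\<lambda>t. dlist l (\<lambda>x. c * f x) (x + t *\<^sub>R b)) differentiable (at 0)"
    unfolding eq using differentiableI_vector has_vector_derivative_mult_right by blast
qed

lemma schwartz_cnj: assumes f: "schwartz f" shows "schwartz (\<lambda>x. cnj (f x))"
proof (rule schwartzI)
  fix l :: "'a list" and b x :: 'a and \<alpha> :: "'a \<Rightarrow> nat" assume l: "set l \<subseteq> Basis"
  note eq = dlist_cnj[OF f l]
  show "continuous_on UNIV (dlist l (\<lambda>x. cnj (f x)))" unfolding eq by (intro continuous_intros schwartz_dlist f l)
  show "\<exists>B. \<forall>x. cmod (of_real (xpow \<alpha> x) * dlist l (\<lambda>x. cnj (f x)) x) \<le> B"
    using schwartz_bound[OF f l, of \<alpha>] unfolding eq by (simp add: norm_mult)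
  assume b: "b \<in> Basis"
  have "(\<lambda>t. dlist l f (x + t *\<^sub>R b)) differentiable (at (0::real))" by (rule schwartz_differentiable[OF f l b])
  then obtain D where "((\<lambda>t. dlist l f (x + t *\<^sub>R b)) has_vector_derivative D) (at 0)"
    using vector_derivative_works by blast
  thus "(\<lambda>t. dlist l (\<lambda>x. cnj (f x)) (x + t *\<^sub>R b)) differentiable (at 0)"
    unfolding eq using differentiableI_vector has_vector_derivative_cnj by blast
qed

lemma gs_bdd_mono:
  fixes f :: "'a::euclidean_space \<Rightarrow> complex"
  assumes bd: "gs_bdd h r1 r2 f" and h: "0 < h'" "h' \<le> h" and r: "r1 \<le> r1'" "r2 \<le> r2'"
  shows "gs_bdd h' r1' r2' f"
proof (rule gs_bddI)
  fix \<alpha> \<beta> :: "'a \<Rightarrow> nat" and x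
  have "h' ^ (mabs \<alpha> + mabs \<beta>) / (mfact \<alpha> powr r2' * mfact \<beta> powr r1') \<le> h ^ (mabs \<alpha> + mabs \<beta>) / (mfact \<alpha> powr r2 * mfact \<beta> powr r1)"
    using h r mfact_pos[of \<alpha>] mfact_pos[of \<beta>] mfact_ge_1[of \<alpha>] mfact_ge_1[of \<beta>]
    by (intro frac_le mult_mono power_mono powr_mono mult_pos_pos) (auto simp: powr_gt_zero)
  hence "h' ^ (mabs \<alpha> + mabs \<beta>) / (mfact \<alpha> powr r2' * mfact \<beta> powr r1') * cmod (of_real (xpow \<alpha> x) * Dmulti \<beta> f x)
     \<le> h ^ (mabs \<alpha> + mabs \<beta>) / (mfact \<alpha> powr r2 * mfact \<beta> powr r1) * cmod (of_real (xpow \<alpha> x) * Dmulti \<beta> f x)"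
    by (rule mult_right_mono) simp
  also have "\<dots> \<le> gs_norm h r1 r2 f" by (rule gs_bdd_le[OF bd])
  finally show "h' ^ (mabs \<alpha> + mabs \<beta>) / (mfact \<alpha> powr r2' * mfact \<beta> powr r1') * cmod (of_real (xpow \<alpha> x) * Dmulti \<beta> f x) \<le> gs_norm h r1 r2 f" .
qed

lemma GS_mono: "f \<in> GS r1 r2 \<Longrightarrow> r1 \<le> r1' \<Longrightarrow> r2 \<le> r2' \<Longrightarrow> f \<in> GS r1' r2'"
  unfolding GS_def using gs_bdd_mono by blast

lemma Dmulti_add: "schwartz f \<Longrightarrow> schwartz g \<Longrightarrow> Dmulti \<beta> (\<lambda>x. f x + g x) x = Dmulti \<beta> f x + Dmulti \<beta> g x"
  by (simp add: Dmulti_eq dlist_add[OF _ _ mlist(1)])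
lemma Dmulti_cmult: "schwartz f \<Longrightarrow> Dmulti \<beta> (\<lambda>x. c * f x) x = c * Dmulti \<beta> f x"
  by (simp add: Dmulti_eq dlist_cmult[OF _ mlist(1)])
lemma Dmulti_cnj: "schwartz f \<Longrightarrow> Dmulti \<beta> (\<lambda>x. cnj (f x)) x = cnj (Dmulti \<beta> f x)"
  by (simp add: Dmulti_eq dlist_cnj[OF _ mlist(1)])

lemma gs_weight_nonneg: "h > 0 \<Longrightarrow> 0 \<le> h ^ k / (mfact \<alpha> powr r2 * mfact \<beta> powr r1)" by simp

lemma GS_add: fixes f g :: "'a::euclidean_space \<Rightarrow> complex" assumes "f \<in> GS r1 r2" "g \<in> GS r1 r2" shows "(\<lambda>x. f x + g x) \<in> GS r1 r2"
proof -
  obtain h1 h2 where h: "h1 > 0" "h2 > 0" "gs_bdd h1 r1 r2 f" "gs_bdd h2 r1 r2 g" and sf: "schwartz f" "schwartz g"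
    using assms by (auto simp: GS_def)
  define h where "h = min h1 h2"
  have h0: "h > 0" using h by (simp add: h_def)
  have b: "gs_bdd h r1 r2 f" "gs_bdd h r1 r2 g" using h by (auto simp: h_def intro: gs_bdd_mono[OF h(3)] gs_bdd_mono[OF h(4)])
  have "gs_bdd h r1 r2 (\<lambda>x. f x + g x)"
  proof (rule gs_bddI)
    fix \<alpha> \<beta> :: "'a \<Rightarrow> nat" and x
    let ?w = "h ^ (mabs \<alpha> + mabs \<beta>) / (mfact \<alpha> powr r2 * mfact \<beta> powr r1)"
    have "?w * cmod (of_real (xpow \<alpha> x) * Dmulti \<beta> (\<lambda>x. f x + g x) x) \<le>
       ?w * (cmod (of_real (xpow \<alpha> x) * Dmulti \<beta> f x) + cmod (of_real (xpow \<alpha> x) * Dmulti \<beta> g x))"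
      unfolding Dmulti_add[OF sf] distrib_left[of "complex_of_real (xpow \<alpha> x)"] by (intro mult_left_mono norm_triangle_ineq gs_weight_nonneg h0)
    also have "\<dots> \<le> gs_norm h r1 r2 f + gs_norm h r1 r2 g"
      unfolding distrib_left[of ?w] by (intro add_mono gs_bdd_le b)
    finally show "?w * cmod (of_real (xpow \<alpha> x) * Dmulti \<beta> (\<lambda>x. f x + g x) x) \<le> gs_norm h r1 r2 f + gs_norm h r1 r2 g" .
  qed
  thus ?thesis using h0 schwartz_add[OF sf] by (auto simp: GS_def)
qed

lemma GS_cmult: fixes f :: "'a::euclidean_space \<Rightarrow> complex" assumes "f \<in> GS r1 r2" shows "(\<lambda>x. c * f x) \<in> GS r1 r2"
proof -
  obtain h where h: "h > 0" "gs_bdd h r1 r2 f" and sf: "schwartz f" using assms by (auto simp: GS_def)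
  have "gs_bdd h r1 r2 (\<lambda>x. c * f x)"
  proof (rule gs_bddI)
    fix \<alpha> \<beta> :: "'a \<Rightarrow> nat" and x
    show "h ^ (mabs \<alpha> + mabs \<beta>) / (mfact \<alpha> powr r2 * mfact \<beta> powr r1) * cmod (of_real (xpow \<alpha> x) * Dmulti \<beta> (\<lambda>x. c * f x) x) \<le> cmod c * gs_norm h r1 r2 f"
      using mult_left_mono[OF gs_bdd_le[OF h(2), of \<alpha> \<beta> x], of "cmod c"] by (simp add: Dmulti_cmult[OF sf] norm_mult mult_ac)
  qed
  thus ?thesis using h schwartz_cmult[OF sf] by (auto simp: GS_def)
qed

lemma GS_cnj: assumes "f \<in> GS r1 r2" shows "(\<lambda>x. cnj (f x)) \<in> GS r1 r2"
proof -
  obtain h where h: "h > 0" "gs_bdd h r1 r2 f" and sf: "schwartz f" using assms by (auto simp: GS_def)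
  have "gs_bdd h r1 r2 (\<lambda>x. cnj (f x))"
    by (rule gs_bddI) (use gs_bdd_le[OF h(2)] in \<open>simp add: Dmulti_cnj[OF sf] norm_mult\<close>)
  thus ?thesis using h schwartz_cnj[OF sf] by (auto simp: GS_def)
qed

lemma GS0_cnj: assumes "f \<in> GS0 r1 r2" shows "(\<lambda>x. cnj (f x)) \<in> GS0 r1 r2"
proof -
  have "(LINT x|lborel. of_real (xpow \<alpha> x) * cnj (f x)) = cnj (LINT x|lborel. of_real (xpow \<alpha> x) * f x)" for \<alpha>
    unfolding Bochner_Integration.integral_cnj [symmetric] by simp
  thus ?thesis using assms GS_cnj[of f] by (auto simp: GS0_def)
qed

lemma GS_0: "(\<lambda>x. 0) \<in> GS r1 r2"
proof -
  have "(\<lambda>x. 0 :: complex) = partial b (\<lambda>x. 0)" for b :: 'a by (simp add: partial_def fun_eq_iff)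
  hence d: "dlist l (\<lambda>x::'a. 0) = (\<lambda>x. 0)" for l by (induction l) auto
  have "schwartz (\<lambda>x::'a. 0)" by (rule schwartzI) (auto simp: d)
  moreover have "gs_bdd 1 r1 r2 (\<lambda>x::'a. 0)" by (rule gs_bddI[where B = 0]) (simp add: Dmulti_eq d)
  ultimately show ?thesis by (auto simp: GS_def intro!: exI[of _ 1])
qed

lemma GS_sum: "finite F \<Longrightarrow> (\<And>i. i \<in> F \<Longrightarrow> f i \<in> GS r1 r2) \<Longrightarrow> (\<lambda>x. \<Sum>i\<in>F. c i * f i x) \<in> GS r1 r2"
proof (induction F rule: finite_induct)
  case (insert a F)
  have "(\<lambda>x. c a * f a x + (\<Sum>i\<in>F. c i * f i x)) \<in> GS r1 r2"
    by (rule GS_add[OF GS_cmult]) (use insert in auto)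
  thus ?case using insert by simp
qed (simp add: GS_0)

lemma dlist_sum:
  assumes "finite F" "\<And>i. i \<in> F \<Longrightarrow> schwartz (f i)" "set l \<subseteq> Basis"
  shows "schwartz (\<lambda>x. \<Sum>i\<in>F. c i * f i x) \<and> dlist l (\<lambda>x. \<Sum>i\<in>F. c i * f i x) = (\<lambda>x. \<Sum>i\<in>F. c i * dlist l (f i) x)"
  using assms(1,2)
proof (induction F rule: finite_induct)
  case empty
  have "schwartz (\<lambda>x::'b. 0)" using GS_0[of 0 0] by (auto simp: GS_def)
  thus ?case using dlist_cmult[of "\<lambda>x::'b. 0" l 0] assms(3) by simp
next
  case (insert a F)
  thus ?case using schwartz_add[OF schwartz_cmult[of "f a" "c a"], of "\<lambda>x. \<Sum>i\<in>F. c i * f i x"] dlist_add[OF schwartz_cmult _ assms(3), of "f a" "\<lambda>x. \<Sum>i\<in>F. c i * f i x" "c a"]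
    dlist_cmult[OF _ assms(3), of "f a" "c a"] by auto
qed

subsection \<open>Termwise differentiation\<close>

text \<open>By the mean value inequality the majorants of the derivatives also bound the difference
  quotients. The series of quotients thus converges uniformly in the increment, and the two limits
  may be exchanged.\<close>

lemma has_vector_derivative_infsum:
  fixes f :: "'i \<Rightarrow> real \<Rightarrow> complex"
  assumes f: "\<And>i u. i \<in> I \<Longrightarrow> (f i has_vector_derivative f' i u) (at u)"
    and M: "\<And>i u. i \<in> I \<Longrightarrow> norm (f' i u) \<le> M i" "M summable_on I"
    and s: "\<And>u. (\<lambda>i. f i u) summable_on I"
  shows "((\<lambda>u. \<Sum>\<^sub>\<infinity>i\<in>I. f i u) has_vector_derivative (\<Sum>\<^sub>\<infinity>i\<in>I. f' i u)) (at u)"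
proof -
  define q where "q i v = (f i (u + v) - f i u) /\<^sub>R v" for i v
  have M0: "M i \<ge> 0" if "i \<in> I" for i using order_trans[OF norm_ge_zero M(1)[OF that]] .
  have lip: "norm (f i x - f i y) \<le> M i * norm (x - y)" if "i \<in> I" for i x y
  proof (rule differentiable_bound[of UNIV])
    show "(f i has_derivative (\<lambda>h. h *\<^sub>R f' i z)) (at z within UNIV)" for z
      using f[OF that] by (simp add: has_vector_derivative_def)
    show "onorm (\<lambda>h. h *\<^sub>R f' i z) \<le> M i" for z
      by (rule onorm_bound[OF M0[OF that]]) (use M(1)[OF that, of z] in \<open>simp add: mult.commute[of "M i"] mult_left_mono\<close>)
  qed auto
  have qM: "norm (q i v) \<le> M i" if "i \<in> I" "v \<in> UNIV - {0}" for i v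
  proof -
    have "norm (q i v) = norm (f i (u + v) - f i u) / \<bar>v\<bar>" by (simp add: q_def divide_inverse mult.commute)
    also have "\<dots> \<le> M i" using lip[OF that(1), of "u + v" u] that(2) by (simp add: pos_divide_le_eq)
    finally show ?thesis .
  qed
  have lim: "((\<lambda>v. q i v) \<longlongrightarrow> f' i u) (at 0)" if "i \<in> I" for i
  proof -
    have "((\<lambda>v. norm (f i (u + v) - f i u - v *\<^sub>R f' i u) / norm v) \<longlongrightarrow> 0) (at 0)"
      using f[OF that, of u] by (simp add: has_vector_derivative_def has_derivative_at)
    hence "((\<lambda>v. norm (q i v - f' i u)) \<longlongrightarrow> 0) (at 0)"
    proof (rule Lim_transform_eventually)
      show "\<forall>\<^sub>F v in at 0. norm (f i (u + v) - f i u - v *\<^sub>R f' i u) / norm v = norm (q i v - f' i u)"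
        using eventually_at_ball'[OF zero_less_one]
      proof eventually_elim
        case (elim v)
        have "q i v - f' i u = (f i (u + v) - f i u - v *\<^sub>R f' i u) /\<^sub>R v" using elim by (simp add: q_def scaleR_diff_right)
        thus ?case by (simp add: divide_inverse mult.commute)
      qed
    qed
    thus ?thesis by (simp add: LIM_zero_iff tendsto_norm_zero_iff)
  qed
  have sum': "(\<lambda>i. f' i u) summable_on I"
    by (rule abs_summable_summable, rule Infinite_Sum.abs_summable_on_comparison_test'[OF M(2)]) (rule M(1))
  have "((\<lambda>v. \<Sum>\<^sub>\<infinity>i\<in>I. q i v) \<longlongrightarrow> (\<Sum>\<^sub>\<infinity>i\<in>I. f' i u)) (at 0 within (UNIV - {0}))"
  proof (rule swap_uniform_limit)
    show "\<forall>\<^sub>F F in finite_subsets_at_top I. ((\<lambda>v. \<Sum>i\<in>F. q i v) \<longlongrightarrow> (\<Sum>i\<in>F. f' i u)) (at 0 within (UNIV - {0}))"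
    proof (rule eventually_finite_subsets_at_top_weakI)
      fix F assume "finite F" "F \<subseteq> I"
      hence "((\<lambda>v. \<Sum>i\<in>F. q i v) \<longlongrightarrow> (\<Sum>i\<in>F. f' i u)) (at 0)" by (intro tendsto_sum lim) auto
      thus "((\<lambda>v. \<Sum>i\<in>F. q i v) \<longlongrightarrow> (\<Sum>i\<in>F. f' i u)) (at 0 within (UNIV - {0}))"
        by (rule filterlim_mono) (auto intro: at_le)
    qed
    show "((\<lambda>F. \<Sum>i\<in>F. f' i u) \<longlongrightarrow> (\<Sum>\<^sub>\<infinity>i\<in>I. f' i u)) (finite_subsets_at_top I)" by (rule infsum_tendsto[OF sum'])
    show "uniform_limit (UNIV - {0}) (\<lambda>F v. \<Sum>i\<in>F. q i v) (\<lambda>v. \<Sum>\<^sub>\<infinity>i\<in>I. q i v) (finite_subsets_at_top I)"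
      by (rule Weierstrass_m_test_general[OF qM M(2)])
  qed auto
  moreover have "at (0::real) within (UNIV - {0}) = at 0" by (simp add: at_within_def)
  ultimately have L: "((\<lambda>v. \<Sum>\<^sub>\<infinity>i\<in>I. q i v) \<longlongrightarrow> (\<Sum>\<^sub>\<infinity>i\<in>I. f' i u)) (at 0)" by simp
  define G where "G u = (\<Sum>\<^sub>\<infinity>i\<in>I. f i u)" for u
  have qG: "(\<Sum>\<^sub>\<infinity>i\<in>I. q i v) = (G (u + v) - G u) /\<^sub>R v" for v
  proof -
    have "((\<lambda>i. f i (u + v) + (- f i u)) has_sum (G (u + v) + (- G u))) I"
      unfolding G_def by (intro has_sum_add has_sum_uminusI has_sum_infsum s)
    hence "((\<lambda>i. (f i (u + v) - f i u) /\<^sub>R v) has_sum ((G (u + v) - G u) /\<^sub>R v)) I"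
      by (intro has_sum_scaleR) simp
    thus ?thesis unfolding q_def by (rule infsumI)
  qed
  have "((\<lambda>v. norm ((G (u + v) - G u) /\<^sub>R v - (\<Sum>\<^sub>\<infinity>i\<in>I. f' i u))) \<longlongrightarrow> 0) (at 0)"
    using L unfolding qG by (simp add: LIM_zero_iff tendsto_norm_zero_iff)
  hence "((\<lambda>v. norm (G (u + v) - G u - v *\<^sub>R (\<Sum>\<^sub>\<infinity>i\<in>I. f' i u)) / norm v) \<longlongrightarrow> 0) (at 0)"
  proof (rule Lim_transform_eventually)
    show "\<forall>\<^sub>F v in at 0. norm ((G (u + v) - G u) /\<^sub>R v - (\<Sum>\<^sub>\<infinity>i\<in>I. f' i u)) = norm (G (u + v) - G u - v *\<^sub>R (\<Sum>\<^sub>\<infinity>i\<in>I. f' i u)) / norm v"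
      using eventually_at_ball'[OF zero_less_one]
    proof eventually_elim
      case (elim v)
      have "(G (u + v) - G u) /\<^sub>R v - (\<Sum>\<^sub>\<infinity>i\<in>I. f' i u) = (G (u + v) - G u - v *\<^sub>R (\<Sum>\<^sub>\<infinity>i\<in>I. f' i u)) /\<^sub>R v"
        using elim by (simp add: scaleR_diff_right)
      thus ?case by (simp add: divide_inverse mult.commute)
    qed
  qed
  hence "(G has_vector_derivative (\<Sum>\<^sub>\<infinity>i\<in>I. f' i u)) (at u)"
    by (simp add: has_vector_derivative_def has_derivative_at bounded_linear_scaleR_left)
  thus ?thesis by (simp add: G_def [abs_def])
qed

section \<open>Functionals and seminorms on finite sums\<close>

lemma GS0_add:
  fixes f g :: "real^'d::finite \<Rightarrow> complex"
  assumes "f \<in> GS0 p r" "g \<in> GS0 p r" "r > 0" shows "(\<lambda>x. f x + g x) \<in> GS0 p r"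
proof -
  have G: "f \<in> GS p r" "g \<in> GS p r" using assms by (auto simp: GS0_def)
  have "(LINT x|lborel. of_real (xpow \<alpha> x) * (f x + g x)) = 0" for \<alpha>
    unfolding distrib_left
    by (subst Bochner_Integration.integral_add[OF integrable_xpow_GS[OF G(1) assms(3)] integrable_xpow_GS[OF G(2) assms(3)]])
       (use assms in \<open>simp add: GS0_def\<close>)
  thus ?thesis using GS_add[OF G] by (simp add: GS0_def)
qed

lemma GS0_cmult: "f \<in> GS0 p r \<Longrightarrow> (\<lambda>x. c * f x) \<in> GS0 p r"
  by (simp add: GS0_def GS_cmult mult.left_commute[of _ c])

lemma GS0_0: "(\<lambda>x. 0) \<in> GS0 p r" by (simp add: GS0_def GS_0)

lemma gs0_dual_add: "gs0_dual p r T \<Longrightarrow> f \<in> GS0 p r \<Longrightarrow> g \<in> GS0 p r \<Longrightarrow> T (\<lambda>x. f x + g x) = T f + T g"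
  and gs0_dual_cmult: "gs0_dual p r T \<Longrightarrow> f \<in> GS0 p r \<Longrightarrow> T (\<lambda>x. c * f x) = c * T f"
  by (simp_all add: gs0_dual_def)

lemma gs_cseminorm_add: "gs_cseminorm p r q \<Longrightarrow> f \<in> GS p r \<Longrightarrow> g \<in> GS p r \<Longrightarrow> q (\<lambda>x. f x + g x) \<le> q f + q g"
  and gs_cseminorm_cmult: "gs_cseminorm p r q \<Longrightarrow> f \<in> GS p r \<Longrightarrow> q (\<lambda>x. c * f x) = cmod c * q f"
  and gs_cseminorm_cont: "gs_cseminorm p r q \<Longrightarrow> h > 0 \<Longrightarrow> \<exists>C. \<forall>f\<in>GS p r. gs_bdd h p r f \<longrightarrow> q f \<le> C * gs_norm h p r f"
  by (simp_all add: gs_cseminorm_def)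

lemma dual_sum:
  fixes e :: "'i \<Rightarrow> real^'d::finite \<Rightarrow> complex"
  assumes T: "gs0_dual p r T" and r: "r > 0" and F: "finite F" "\<And>i. i \<in> F \<Longrightarrow> e i \<in> GS0 p r"
  shows "(\<lambda>x. \<Sum>i\<in>F. c i * e i x) \<in> GS0 p r \<and> T (\<lambda>x. \<Sum>i\<in>F. c i * e i x) = (\<Sum>i\<in>F. c i * T (e i))"
  using F
proof (induction F rule: finite_induct)
  case empty
  have "T (\<lambda>x. 0) = 0" using gs0_dual_cmult[OF T GS0_0, of 0] by simp
  thus ?case by (simp add: GS0_0)
next
  case (insert a F)
  have a: "(\<lambda>x. c a * e a x) \<in> GS0 p r" using insert by (intro GS0_cmult) auto
  have S: "(\<lambda>x. \<Sum>i\<in>F. c i * e i x) \<in> GS0 p r" using insert by auto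
  have "T (\<lambda>x. c a * e a x + (\<Sum>i\<in>F. c i * e i x)) = T (\<lambda>x. c a * e a x) + T (\<lambda>x. \<Sum>i\<in>F. c i * e i x)"
    by (rule gs0_dual_add[OF T a S])
  moreover have "T (\<lambda>x. c a * e a x) = c a * T (e a)" using gs0_dual_cmult[OF T] insert.prems[of a] by simp
  ultimately show ?case using insert GS0_add[OF a S r] by simp
qed

text \<open>Homogeneity gives value 0 at the zero function, and subadditivity for \<open>f\<close>
  and its negative gives 0 \<le> 2 q f.\<close>

lemma gs_cseminorm_nonneg:
  assumes q: "gs_cseminorm p r q" and f: "f \<in> GS p r" shows "q f \<ge> 0"
proof -
  have "q (\<lambda>x. f x + (-1) * f x) \<le> q f + q (\<lambda>x. (-1) * f x)"
    by (rule gs_cseminorm_add[OF q f GS_cmult[OF f]])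
  moreover have "q (\<lambda>x. (-1) * f x) = cmod (-1) * q f" "q (\<lambda>x. 0 * f x) = cmod 0 * q f"
    by (rule gs_cseminorm_cmult[OF q f])+
  ultimately show ?thesis by simp
qed

context wavelet_pair begin

text \<open>A functional is evaluated on conjugated wavelets while the test function is paired with
  the wavelets themselves. This is the ordinary expansion for the conjugate pair.\<close>

lemma wavelet_pair_cnj: "wavelet_pair (\<lambda>x. cnj (\<phi> x)) (\<lambda>x. cnj (\<psi> x)) r1 r2 s t"
proof
  have k: "kern (\<lambda>x. cnj (f x)) x y = cnj (kern f x y)" for f x y
    unfolding kern_def infsum_cnj [symmetric] by simp
  show "2 * kern (\<lambda>x. cnj (\<phi> x)) (2 * x) (2 * y) = kern (\<lambda>x. cnj (\<phi> x)) x y + kern (\<lambda>x. cnj (\<psi> x)) x y" for x y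
    using arg_cong[OF two_scale[of x y], of cnj] by (simp add: k)
  show "kint (\<lambda>x. cnj (\<phi> x)) x = 1" for x
    using kint_1[of x] unfolding kint_def k by (simp add: Bochner_Integration.integral_cnj)
qed (use r1 r2 s t phi psi in \<open>auto intro: GS_cnj GS0_cnj\<close>)

end

lemma wpsi_cnj: "wpsi (\<lambda>x. cnj (\<phi> x)) (\<lambda>x. cnj (\<psi> x)) lam x = cnj (wpsi \<phi> \<psi> lam x)"
proof -
  obtain \<epsilon> m n where lam: "lam = (\<epsilon>, m, n)" by (cases lam) auto
  show ?thesis by (simp add: wpsi_def lam) (intro disjI2 prod.cong; simp)
qed

section \<open>Error of the expansion in a single step\<close>

context wavelet_pair begin

text \<open>\<open>coef\<close> integrates against the conjugate of a wavelet, which is a wavelet of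
  the conjugate pair; the earlier bound is used there.\<close>

lemma coef_bound:
  assumes h: "h > 0"
  obtains C c where "C > 0" "c > 0" "\<And>(g :: real^'d::finite \<Rightarrow> complex) \<epsilon> m n.
    g \<in> GS0 s' t' \<Longrightarrow> gs_bdd h s' t' g \<Longrightarrow> \<epsilon> \<in> wQ \<Longrightarrow>
    cmod (coef g (\<epsilon>, m, n)) \<le>
      C * gs_norm h s' t' g * 2 powr (of_int m * real CARD('d) / 2) * exp (- c * wweight (s - r1) (t - r2) t m n)"
proof -
  interpret c: wavelet_pair "\<lambda>x. cnj (\<phi> x)" "\<lambda>x. cnj (\<psi> x)" r1 r2 s t by (rule wavelet_pair_cnj)
  obtain C c where 1: "C > 0" "c > 0" and 2: "\<And>(g :: real^'d \<Rightarrow> complex) \<epsilon> m n.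
    g \<in> GS0 s' t' \<Longrightarrow> gs_bdd h s' t' g \<Longrightarrow> \<epsilon> \<in> wQ \<Longrightarrow>
    cmod (LINT y|lborel. g y * wpsi (\<lambda>x. cnj (\<phi> x)) (\<lambda>x. cnj (\<psi> x)) (\<epsilon>, m, n) y) \<le>
      C * gs_norm h s' t' g * 2 powr (of_int m * real CARD('d) / 2) * exp (- c * wweight (s - r1) (t - r2) t m n)"
    using c.coefficient_bound[OF h, where 'd = 'd] by blast
  show ?thesis by (rule that[OF 1]) (use 2 in \<open>simp only: wpsi_cnj coef_def\<close>)
qed

text \<open>The central estimate. The target step \<open>k\<close> and the summable majorant
  \<open>K\<close> depend on \<open>h\<close> only, so the error is uniform over all test functions
  bounded in the step \<open>h\<close>. This uniformity gives convergence for the strong dual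
  topology as well as for a single function.\<close>

lemma expansion_error:
  assumes h: "h > 0"
  obtains k K where "k > 0" "K summable_on (wLambda :: (('d::finite \<Rightarrow> bool) \<times> int \<times> ('d \<Rightarrow> int)) set)" "\<And>lam. K lam \<ge> 0"
    "\<And>(g :: real^'d \<Rightarrow> complex) F. g \<in> GS0 s' t' \<Longrightarrow> gs_bdd h s' t' g \<Longrightarrow> finite F \<Longrightarrow> F \<subseteq> wLambda \<Longrightarrow>
       gs_bdd k s t (\<lambda>x. (\<Sum>lam\<in>F. coef g lam * wpsi \<phi> \<psi> lam x) - g x) \<and>
       gs_norm k s t (\<lambda>x. (\<Sum>lam\<in>F. coef g lam * wpsi \<phi> \<psi> lam x) - g x) \<le> gs_norm h s' t' g * infsum K (wLambda - F)"
proof -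
  obtain C c where C: "C > 0" "c > 0" "\<And>(g :: real^'d \<Rightarrow> complex) \<epsilon> m n.
    g \<in> GS0 s' t' \<Longrightarrow> gs_bdd h s' t' g \<Longrightarrow> \<epsilon> \<in> wQ \<Longrightarrow>
    cmod (coef g (\<epsilon>, m, n)) \<le>
      C * gs_norm h s' t' g * 2 powr (of_int m * real CARD('d) / 2) * exp (- c * wweight (s - r1) (t - r2) t m n)"
    using coef_bound[OF h, where 'd = 'd] by blast
  \<comment> \<open>The wavelets may grow at half the rate at which the coefficients decay; the
    remaining half makes \<open>K\<close> summable.\<close>
  have c2: "c / 2 > 0" using C by simp
  obtain C' k where C': "C' > 0" "k > 0"
    "\<And>h \<epsilon> m n (\<alpha> :: real^'d \<Rightarrow> nat) l (x::real^'d). 0 < h \<Longrightarrow> h \<le> k \<Longrightarrow> set l \<subseteq> Basis \<Longrightarrow>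
      h ^ (mabs \<alpha> + mabs (count_list l)) / (mfact \<alpha> powr t * mfact (count_list l) powr s) *
      cmod (of_real (xpow \<alpha> x) * dlist l (wpsi \<phi> \<psi> (\<epsilon>, m, n)) x) \<le>
      C' * 2 powr (of_int m * real CARD('d) / 2) * exp (c / 2 * wweight (s - r1) (t - r2) t m n)"
    using wpsi_derivative_bound[OF c2, where 'd = 'd] by blast
  define K where "K = (\<lambda>(\<epsilon>::'d \<Rightarrow> bool, m, n::'d \<Rightarrow> int). C * C' * (2 powr (of_int m * real CARD('d)) * exp (- (c/2) * wweight (s - r1) (t - r2) t m n)))"
  have K0: "K lam \<ge> 0" for lam using C C' by (auto simp: K_def split: prod.splits)
  have Ksum: "K summable_on wLambda"
    using summable_on_cmult_right[OF summable_on_wweight[OF c2 exps(5,6,7), where 'd = 'd], of "C * C'"]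
    unfolding K_def by (simp add: case_prod_unfold)
  show ?thesis
  proof (rule that[OF C'(2) Ksum K0])
    fix g :: "real^'d \<Rightarrow> complex" and F
    assume g: "g \<in> GS0 s' t'" and bd: "gs_bdd h s' t' g" and F: "finite F" "F \<subseteq> (wLambda :: (('d \<Rightarrow> bool) \<times> int \<times> ('d \<Rightarrow> int)) set)"
    have sg: "schwartz g" using g by (auto simp: GS0_def GS_def)
    define P where "P = gs_norm h s' t' g"
    have P: "P \<ge> 0" unfolding P_def by (rule gs_norm_nonneg[OF bd h])
    define w where "w \<alpha> l = k ^ (mabs \<alpha> + mabs (count_list l)) / (mfact \<alpha> powr t * mfact (count_list l) powr s)"
      for \<alpha> :: "real^'d \<Rightarrow> nat" and l :: "(real^'d) list"
    have w: "w \<alpha> l > 0" for \<alpha> l using C' mfact_pos[of \<alpha>] mfact_pos[of "count_list l"] by (simp add: w_def)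
    have term_le: "w \<alpha> l * (cmod (coef g lam) * cmod (of_real (xpow \<alpha> x) * dlist l (wpsi \<phi> \<psi> lam) x)) \<le> P * K lam"
      if l: "set l \<subseteq> Basis" and lam: "lam \<in> wLambda" for \<alpha> l x lam
    proof -
      obtain \<epsilon> m n where lm: "lam = (\<epsilon>, m, n)" "\<epsilon> \<in> wQ" using lam by (auto simp: wLambda_def)
      let ?W = "wweight (s - r1) (t - r2) t m n"
      let ?H = "2 powr (of_int m * real CARD('d) / 2)"
      have "w \<alpha> l * (cmod (coef g lam) * cmod (of_real (xpow \<alpha> x) * dlist l (wpsi \<phi> \<psi> lam) x)) =
          cmod (coef g lam) * (w \<alpha> l * cmod (of_real (xpow \<alpha> x) * dlist l (wpsi \<phi> \<psi> lam) x))" by simp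
      also have "\<dots> \<le> (C * P * ?H * exp (- c * ?W)) * (C' * ?H * exp (c / 2 * ?W))"
      proof (rule mult_mono)
        show "cmod (coef g lam) \<le> C * P * ?H * exp (- c * ?W)" unfolding lm(1) P_def by (rule C(3)[OF g bd lm(2)])
        show "w \<alpha> l * cmod (of_real (xpow \<alpha> x) * dlist l (wpsi \<phi> \<psi> lam) x) \<le> C' * ?H * exp (c / 2 * ?W)"
          unfolding lm(1) w_def by (rule C'(3)[OF C'(2) order_refl l])
      qed (use C P w[of \<alpha> l] in auto)
      also have "\<dots> = P * (C * C' * ((?H * ?H) * (exp (- c * ?W) * exp (c / 2 * ?W))))" by (simp only: mult_ac)
      also have "?H * ?H = 2 powr (of_int m * real CARD('d))" by (simp add: powr_add [symmetric])
      also have "exp (- c * ?W) * exp (c / 2 * ?W) = exp (- (c/2) * ?W)" by (simp add: exp_add [symmetric] field_simps)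
      finally show ?thesis by (simp add: K_def lm(1))
    qed
    have PK: "(\<lambda>lam. P * K lam) summable_on wLambda" by (rule summable_on_cmult_right[OF Ksum])
    \<comment> \<open>Taking the zero exponent for the power of \<open>x\<close> gives a majorant
      uniform in \<open>x\<close>, as the termwise differentiation requires.\<close>
    have coef_le: "cmod (coef g lam * dlist l (wpsi \<phi> \<psi> lam) x) \<le> (1 / w (\<lambda>_. 0) l) * (P * K lam)"
      if l: "set l \<subseteq> Basis" and lam: "lam \<in> wLambda" for l x lam
      using term_le[OF that, of "\<lambda>_. 0" x] w[of "\<lambda>_. 0" l] by (simp add: xpow_def norm_mult field_simps)
    have sl: "(\<lambda>lam. (1 / w (\<lambda>_. 0) l) * (P * K lam)) summable_on wLambda" for l by (rule summable_on_cmult_right[OF PK])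
    have abs: "(\<lambda>lam. cmod (coef g lam * dlist l (wpsi \<phi> \<psi> lam) x)) summable_on wLambda" if "set l \<subseteq> Basis" for l x
      by (rule Infinite_Sum.abs_summable_on_comparison_test'[OF sl]) (rule coef_le[OF that])
    note summ = abs_summable_summable[OF abs]
    \<comment> \<open>Induction on the list of directions: the pointwise expansion is the base case
      and each further direction is one termwise differentiation.\<close>
    have series: "dlist l g x = (\<Sum>\<^sub>\<infinity>lam\<in>wLambda. coef g lam * dlist l (wpsi \<phi> \<psi> lam) x)" if "set l \<subseteq> Basis" for l x
      using that
    proof (induction l arbitrary: x)
      case Nil
      have ig: "integrable lborel g" using integrable_xpow_gs[OF sg h bd, of "\<lambda>_. 0"] by (simp add: xpow_def)
      have cg: "continuous_on UNIV g" using schwartz_dlist[OF sg, of "[]"] by simp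
      obtain B where B: "\<And>x. cmod (g x) \<le> B" using schwartz_bound[OF sg, of "[]" "\<lambda>_. 0"] by (auto simp: xpow_def)
      show ?case using infsumI[OF wavelet_expansion_pointwise[OF ig cg B]] summ[of "[]" x] by simp
    next
      case (Cons b l)
      hence l: "set l \<subseteq> Basis" and b: "b \<in> Basis" by auto
      have "((\<lambda>u. \<Sum>\<^sub>\<infinity>lam\<in>wLambda. coef g lam * dlist l (wpsi \<phi> \<psi> lam) (x + u *\<^sub>R b)) has_vector_derivative
         (\<Sum>\<^sub>\<infinity>lam\<in>wLambda. coef g lam * dlist (b # l) (wpsi \<phi> \<psi> lam) (x + 0 *\<^sub>R b))) (at 0)"
      proof (rule has_vector_derivative_infsum)
        show "((\<lambda>u. coef g lam * dlist l (wpsi \<phi> \<psi> lam) (x + u *\<^sub>R b)) has_vector_derivative coef g lam * dlist (b # l) (wpsi \<phi> \<psi> lam) (x + u *\<^sub>R b)) (at u)"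
          for lam u by (intro has_vector_derivative_mult_right dlist_has_vector_derivative schwartz_wpsi l b)
        show "norm (coef g lam * dlist (b # l) (wpsi \<phi> \<psi> lam) (x + u *\<^sub>R b)) \<le> (1 / w (\<lambda>_. 0) (b # l)) * (P * K lam)" if "lam \<in> wLambda" for lam u
          by (rule coef_le[OF Cons.prems that])
        show "(\<lambda>lam. (1 / w (\<lambda>_. 0) (b # l)) * (P * K lam)) summable_on wLambda" by (rule sl)
        show "(\<lambda>lam. coef g lam * dlist l (wpsi \<phi> \<psi> lam) (x + u *\<^sub>R b)) summable_on wLambda" for u by (rule summ[OF l])
      qed
      thus ?case using Cons.IH[OF l] by (simp add: partial_def vector_derivative_at)
    qed
    let ?D = "\<lambda>x. (\<Sum>lam\<in>F. coef g lam * wpsi \<phi> \<psi> lam x) - g x"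
    \<comment> \<open>The error and all its derivatives are identified with tails of absolutely
      convergent series.\<close>
    have dD: "dlist l ?D x = - (\<Sum>\<^sub>\<infinity>lam\<in>wLambda - F. coef g lam * dlist l (wpsi \<phi> \<psi> lam) x)" if l: "set l \<subseteq> Basis" for l x
    proof -
      note S = dlist_sum[of F "\<lambda>lam. wpsi \<phi> \<psi> lam" l "coef g", OF F(1) schwartz_wpsi l]
      have "?D = (\<lambda>x. (\<Sum>lam\<in>F. coef g lam * wpsi \<phi> \<psi> lam x) + (-1) * g x)" by simp
      hence "dlist l ?D x = (\<Sum>lam\<in>F. coef g lam * dlist l (wpsi \<phi> \<psi> lam) x) + (-1) * dlist l g x"
        using dlist_add[OF conjunct1[OF S] schwartz_cmult[OF sg, of "-1"] l] dlist_cmult[OF sg l, of "-1"] conjunct2[OF S] by simp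
      also have "dlist l g x = (\<Sum>lam\<in>F. coef g lam * dlist l (wpsi \<phi> \<psi> lam) x) + (\<Sum>\<^sub>\<infinity>lam\<in>wLambda - F. coef g lam * dlist l (wpsi \<phi> \<psi> lam) x)"
        unfolding series[OF l] by (rule infsum_split_finite[OF summ[OF l] F])
      finally show ?thesis by simp
    qed
    have tail: "w \<alpha> l * cmod (of_real (xpow \<alpha> x) * dlist l ?D x) \<le> P * infsum K (wLambda - F)" if l: "set l \<subseteq> Basis" for \<alpha> l x
    proof -
      let ?f = "\<lambda>lam. coef g lam * dlist l (wpsi \<phi> \<psi> lam) x"
      have sF: "(\<lambda>lam. cmod (?f lam)) summable_on (wLambda - F)" by (rule summable_on_subset_banach[OF abs[OF l]]) auto
      have KF: "(\<lambda>lam. P * K lam) summable_on (wLambda - F)" by (rule summable_on_subset_banach[OF PK]) auto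
      have "w \<alpha> l * cmod (of_real (xpow \<alpha> x) * dlist l ?D x) = (w \<alpha> l * \<bar>xpow \<alpha> x\<bar>) * cmod (infsum ?f (wLambda - F))"
        by (simp add: dD[OF l] norm_mult)
      also have "\<dots> \<le> (w \<alpha> l * \<bar>xpow \<alpha> x\<bar>) * (\<Sum>\<^sub>\<infinity>lam\<in>wLambda - F. cmod (?f lam))"
        using w[of \<alpha> l] by (intro mult_left_mono norm_infsum_bound sF) auto
      also have "\<dots> = (\<Sum>\<^sub>\<infinity>lam\<in>wLambda - F. (w \<alpha> l * \<bar>xpow \<alpha> x\<bar>) * cmod (?f lam))" by (rule infsum_cmult_right' [symmetric])
      also have "\<dots> \<le> (\<Sum>\<^sub>\<infinity>lam\<in>wLambda - F. P * K lam)"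
      proof (rule infsum_mono[OF summable_on_cmult_right[OF sF] KF])
        fix lam assume "lam \<in> wLambda - F"
        thus "(w \<alpha> l * \<bar>xpow \<alpha> x\<bar>) * cmod (?f lam) \<le> P * K lam"
          using term_le[OF l, of lam \<alpha> x] by (simp add: norm_mult mult_ac)
      qed
      also have "\<dots> = P * infsum K (wLambda - F)" by (rule infsum_cmult_right')
      finally show ?thesis .
    qed
    have cnt: "mabs (count_list (mlist \<beta>)) = mabs \<beta>" "mfact (count_list (mlist \<beta>)) = mfact \<beta>" for \<beta> :: "real^'d \<Rightarrow> nat"
      by (simp_all add: mabs_def mfact_def mlist)
    have fin: "k ^ (mabs \<alpha> + mabs \<beta>) / (mfact \<alpha> powr t * mfact \<beta> powr s) * cmod (of_real (xpow \<alpha> x) * Dmulti \<beta> ?D x) \<le> P * infsum K (wLambda - F)" for \<alpha> \<beta> x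
      using tail[OF mlist(1), of \<alpha> \<beta> x] by (simp add: Dmulti_eq w_def cnt)
    show "gs_bdd k s t ?D \<and> gs_norm k s t ?D \<le> gs_norm h s' t' g * infsum K (wLambda - F)"
      using gs_bddI[of k t s ?D, OF fin] gs_norm_leI[of k t s ?D, OF fin] by (simp add: P_def)
  qed
qed

end

subsection \<open>Bounded sets of the inductive limit\<close>

text \<open>The second hypothesis on \<open>r\<close> says that \<open>r\<close> dominates every
  geometric sequence up to a constant. If \<open>a\<close> outgrew all geometric sequences, it would
  do so along a sparse subsequence; \<open>r\<close> is then built to exceed every geometric
  sequence while growing so slowly that \<open>a\<close> still beats it on this subsequence.\<close>

lemma geometric_bound_criterion:
  fixes a :: "nat \<Rightarrow> real"
  assumes a0: "\<And>k. a k \<ge> 0"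
    and bd: "\<And>r. (\<And>k. r k > 0) \<Longrightarrow> (\<And>h. h > 0 \<Longrightarrow> \<exists>C. \<forall>k. 1 \<le> C * (h ^ k * r k)) \<Longrightarrow> \<exists>M. \<forall>k. a k \<le> M * r k"
  shows "\<exists>C H. H > 0 \<and> (\<forall>k. a k \<le> C * H ^ k)"
proof (rule ccontr)
  assume "\<not> ?thesis"
  hence neg: "\<exists>k. a k > C * H ^ k" if "H > 0" for C H using that by (meson not_less)
  \<comment> \<open>Adding the sum of the first terms to the constant forces the violating index
    beyond \<open>K\<close>, so that a strictly increasing sequence of such indices can be
    chosen.\<close>
  have big: "\<exists>k>K. a k > (real n + 1) * (real n + 2) ^ k" for n K :: nat
  proof -
    obtain k where k: "a k > ((real n + 1) + (\<Sum>j\<le>K. a j)) * (real n + 2) ^ k" using neg[of "real n + 2"] by auto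
    have S: "(\<Sum>j\<le>K. a j) \<ge> 0" by (intro sum_nonneg a0)
    have p: "1 \<le> (real n + 2) ^ k" by (rule one_le_power) simp
    have "k > K"
    proof (rule ccontr)
      assume "\<not> k > K"
      hence "a k \<le> (\<Sum>j\<le>K. a j)" by (intro member_le_sum) (auto intro: a0)
      also have "\<dots> \<le> ((real n + 1) + (\<Sum>j\<le>K. a j)) * 1" by simp
      also have "\<dots> \<le> ((real n + 1) + (\<Sum>j\<le>K. a j)) * (real n + 2) ^ k" using S p by (intro mult_left_mono) auto
      finally show False using k by simp
    qed
    moreover have "(real n + 1) * (real n + 2) ^ k \<le> ((real n + 1) + (\<Sum>j\<le>K. a j)) * (real n + 2) ^ k"
      using S by (intro mult_right_mono) auto
    ultimately show ?thesis using order_le_less_trans[OF _ k] by blast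
  qed
  have "\<exists>f. \<forall>n. a (f n) > (real n + 1) * (real n + 2) ^ f n \<and> f n < f (Suc n)"
    by (rule dependent_nat_choice) (use big in blast)+
  then obtain \<kappa> :: "nat \<Rightarrow> nat" where \<kappa>: "\<And>n. a (\<kappa> n) > (real n + 1) * (real n + 2) ^ \<kappa> n" "\<And>n. \<kappa> n < \<kappa> (Suc n)" by blast
  have sm: "strict_mono \<kappa>" using \<kappa>(2) by (simp add: strict_mono_Suc_iff)
  \<comment> \<open>Counts the chosen indices up to \<open>k\<close>. It tends to infinity, and its
    value at \<open>\<kappa> n\<close> is exactly \<open>Suc n\<close>, which gives
    \<open>r (\<kappa> n) = (real n + 2) ^ \<kappa> n\<close>.\<close>
  define N where "N k = card {n. \<kappa> n \<le> k}" for k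
  have fin: "finite {n. \<kappa> n \<le> k}" for k
    by (rule finite_subset[of _ "{..k}"]) (use strict_mono_imp_increasing[OF sm] in \<open>auto intro: order_trans\<close>)
  have N\<kappa>: "N (\<kappa> n) = Suc n" for n
  proof -
    have "{j. \<kappa> j \<le> \<kappa> n} = {..n}" using sm by (auto simp: strict_mono_less_eq)
    thus ?thesis by (simp add: N_def)
  qed
  have Nmono: "N j \<le> N k" if "j \<le> k" for j k unfolding N_def by (rule card_mono[OF fin]) (use that in auto)
  define r where "r k = (1 + real (N k)) ^ k" for k
  have "\<exists>M. \<forall>k. a k \<le> M * r k"
  proof (rule bd)
    show "r k > 0" for k by (simp add: r_def add_pos_nonneg)
    fix h :: real assume h: "h > 0"
    obtain n :: nat where n: "1 / h \<le> real n" using real_arch_simple by blast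
    have ge: "1 \<le> h ^ k * r k" if "k \<ge> \<kappa> n" for k
    proof -
      have "real n \<le> 1 + real (N k)" using Nmono[OF that] by (simp add: N\<kappa>)
      hence "1 / h \<le> 1 + real (N k)" using n by linarith
      hence "1 \<le> h * (1 + real (N k))" using h by (simp add: field_simps)
      thus ?thesis unfolding r_def power_mult_distrib [symmetric] by (rule one_le_power)
    qed
    define C where "C = 1 + (\<Sum>k<\<kappa> n. 1 / (h ^ k * r k))"
    have pos: "h ^ k * r k > 0" for k using h by (simp add: r_def add_pos_nonneg)
    have C1: "C \<ge> 1" unfolding C_def using pos by (simp add: sum_nonneg less_imp_le)
    show "\<exists>C. \<forall>k. 1 \<le> C * (h ^ k * r k)"
    proof (intro exI[of _ C] allI)
      fix k
      show "1 \<le> C * (h ^ k * r k)"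
      proof (cases "k < \<kappa> n")
        case True
        have "1 / (h ^ k * r k) \<le> (\<Sum>k<\<kappa> n. 1 / (h ^ k * r k))"
          using True pos by (intro member_le_sum) (auto simp: less_imp_le)
        hence "1 / (h ^ k * r k) \<le> C" by (simp add: C_def)
        thus ?thesis using pos[of k] by (simp add: pos_divide_le_eq)
      next
        case False
        have "1 * 1 \<le> C * (h ^ k * r k)" using C1 ge[of k] False by (intro mult_mono) auto
        thus ?thesis by simp
      qed
    qed
  qed
  then obtain M where M: "\<And>k. a k \<le> M * r k" by blast
  obtain n :: nat where n: "M \<le> real n" using real_arch_simple by blast
  have rk: "r (\<kappa> n) = (real n + 2) ^ \<kappa> n" by (simp add: r_def N\<kappa> add_ac)
  have "(real n + 1) * r (\<kappa> n) < a (\<kappa> n)" unfolding rk by (rule \<kappa>(1))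
  also have "\<dots> \<le> M * r (\<kappa> n)" by (rule M)
  finally have "real n + 1 < M" by (rule mult_right_less_imp_less) (simp add: r_def)
  thus False using n by simp
qed

definition gs_ratio :: "real \<Rightarrow> real \<Rightarrow> ('a::euclidean_space \<Rightarrow> nat) \<Rightarrow> ('a \<Rightarrow> nat) \<Rightarrow> 'a \<Rightarrow> ('a \<Rightarrow> complex) \<Rightarrow> real" where
  "gs_ratio r1 r2 \<alpha> \<beta> x f = cmod (of_real (xpow \<alpha> x) * Dmulti \<beta> f x) / (mfact \<alpha> powr r2 * mfact \<beta> powr r1)"

text \<open>The norm \<open>gs_norm\<close> with the geometric weight \<open>h ^ k\<close> replaced
  by \<open>1 / r k\<close>, the order \<open>k\<close> being the total of both
  multi-indices.\<close>

definition gs_rsup :: "(nat \<Rightarrow> real) \<Rightarrow> real \<Rightarrow> real \<Rightarrow> ('a::euclidean_space \<Rightarrow> complex) \<Rightarrow> real" where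
  "gs_rsup r r1 r2 f = Sup {gs_ratio r1 r2 \<alpha> \<beta> x f / r (mabs \<alpha> + mabs \<beta>) | \<alpha> \<beta> x. True}"

lemma gs_ratio_nonneg: "gs_ratio r1 r2 \<alpha> \<beta> x f \<ge> 0" by (simp add: gs_ratio_def)

lemma gs_bdd_ratio: "gs_bdd h r1 r2 f \<Longrightarrow> h ^ (mabs \<alpha> + mabs \<beta>) * gs_ratio r1 r2 \<alpha> \<beta> x f \<le> gs_norm h r1 r2 f"
  using gs_bdd_le[of h r1 r2 f \<alpha> \<beta> x] by (simp add: gs_ratio_def)

text \<open>As \<open>r\<close> beats every geometric sequence, \<open>1 / r k\<close> is at most a
  multiple of \<open>h ^ k\<close> for each \<open>h\<close>; hence the supremum is finite on the
  whole space and continuous on each step.\<close>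

lemma gs_cseminorm_rsup:
  assumes r: "\<And>k. r k > 0" and se: "\<And>h. h > 0 \<Longrightarrow> \<exists>C. \<forall>k. 1 \<le> C * (h ^ k * r k)"
  shows "gs_cseminorm r1 r2 (gs_rsup r r1 r2 :: ('a::euclidean_space \<Rightarrow> complex) \<Rightarrow> real)"
    and "(f :: 'a \<Rightarrow> complex) \<in> GS r1 r2 \<Longrightarrow> gs_ratio r1 r2 \<alpha> \<beta> x f \<le> gs_rsup r r1 r2 f * r (mabs \<alpha> + mabs \<beta>)"
proof -
  let ?q = "gs_rsup r r1 r2 :: ('a \<Rightarrow> complex) \<Rightarrow> real"
  have bound: "\<exists>C. \<forall>f. gs_bdd h r1 r2 f \<longrightarrow> (\<forall>\<alpha> \<beta> x. gs_ratio r1 r2 \<alpha> \<beta> x (f :: 'a \<Rightarrow> complex) / r (mabs \<alpha> + mabs \<beta>) \<le> C * gs_norm h r1 r2 f)" if h: "h > 0" for h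
  proof -
    obtain C where C: "\<And>k. 1 \<le> C * (h ^ k * r k)" using se[OF h] by blast
    show ?thesis
    proof (intro exI[of _ C] allI impI)
      fix f :: "'a \<Rightarrow> complex" and \<alpha> \<beta> :: "'a \<Rightarrow> nat" and x assume bd: "gs_bdd h r1 r2 f"
      let ?k = "mabs \<alpha> + mabs \<beta>"
      have C0: "C \<ge> 0"
      proof (rule ccontr)
        assume "\<not> C \<ge> 0"
        hence "C * (h ^ 0 * r 0) \<le> 0" using r[of 0] by (intro mult_nonpos_nonneg) auto
        thus False using C[of 0] by simp
      qed
      have "gs_ratio r1 r2 \<alpha> \<beta> x f * 1 \<le> gs_ratio r1 r2 \<alpha> \<beta> x f * (C * (h ^ ?k * r ?k))"
        by (intro mult_left_mono C gs_ratio_nonneg)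
      also have "\<dots> = C * r ?k * (h ^ ?k * gs_ratio r1 r2 \<alpha> \<beta> x f)" by simp
      also have "\<dots> \<le> C * r ?k * gs_norm h r1 r2 f" using C0 r[of ?k] by (intro mult_left_mono gs_bdd_ratio bd) auto
      finally show "gs_ratio r1 r2 \<alpha> \<beta> x f / r ?k \<le> C * gs_norm h r1 r2 f" using r[of ?k] by (simp add: pos_divide_le_eq mult_ac)
    qed
  qed
  have up: "gs_ratio r1 r2 \<alpha> \<beta> x f / r (mabs \<alpha> + mabs \<beta>) \<le> ?q f" if f: "f \<in> GS r1 r2" for f :: "'a \<Rightarrow> complex" and \<alpha> \<beta> x
  proof -
    obtain h where h: "h > 0" "gs_bdd h r1 r2 f" using f by (auto simp: GS_def)
    obtain C where C: "\<And>\<alpha> \<beta> x. gs_ratio r1 r2 \<alpha> \<beta> x f / r (mabs \<alpha> + mabs \<beta>) \<le> C * gs_norm h r1 r2 f" using bound[OF h(1)] h(2) by blast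
    show ?thesis unfolding gs_rsup_def
      by (rule cSup_upper) (auto intro!: bdd_aboveI[of _ "C * gs_norm h r1 r2 f"] C)
  qed
  have least: "?q f \<le> B" if "\<And>\<alpha> \<beta> x. gs_ratio r1 r2 \<alpha> \<beta> x f / r (mabs \<alpha> + mabs \<beta>) \<le> B" for f :: "'a \<Rightarrow> complex" and B
    unfolding gs_rsup_def by (rule cSup_least) (use that in auto)
  show "(f :: 'a \<Rightarrow> complex) \<in> GS r1 r2 \<Longrightarrow> gs_ratio r1 r2 \<alpha> \<beta> x f \<le> ?q f * r (mabs \<alpha> + mabs \<beta>)"
    using up[of f \<alpha> \<beta> x] r[of "mabs \<alpha> + mabs \<beta>"] by (simp add: pos_divide_le_eq)
  have sw: "schwartz f" if "f \<in> GS r1 r2" for f :: "'a \<Rightarrow> complex" using that by (auto simp: GS_def)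
  have scale_le: "?q (\<lambda>x. c * f x) \<le> cmod c * ?q f" if f: "f \<in> GS r1 r2" for f :: "'a \<Rightarrow> complex" and c
  proof (rule least)
    fix \<alpha> \<beta> :: "'a \<Rightarrow> nat" and x
    have "gs_ratio r1 r2 \<alpha> \<beta> x (\<lambda>x. c * f x) = cmod c * gs_ratio r1 r2 \<alpha> \<beta> x f"
      by (simp add: gs_ratio_def Dmulti_cmult[OF sw[OF f]] norm_mult)
    thus "gs_ratio r1 r2 \<alpha> \<beta> x (\<lambda>x. c * f x) / r (mabs \<alpha> + mabs \<beta>) \<le> cmod c * ?q f"
      using mult_left_mono[OF up[OF f, of \<alpha> \<beta> x], of "cmod c"] by simp
  qed
  show "gs_cseminorm r1 r2 ?q"
    unfolding gs_cseminorm_def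
  proof (intro conjI ballI allI impI)
    fix f g :: "'a \<Rightarrow> complex" assume fg: "f \<in> GS r1 r2" "g \<in> GS r1 r2"
    show "?q (\<lambda>x. f x + g x) \<le> ?q f + ?q g"
    proof (rule least)
      fix \<alpha> \<beta> :: "'a \<Rightarrow> nat" and x
      have "gs_ratio r1 r2 \<alpha> \<beta> x (\<lambda>x. f x + g x) \<le> gs_ratio r1 r2 \<alpha> \<beta> x f + gs_ratio r1 r2 \<alpha> \<beta> x g"
        unfolding gs_ratio_def Dmulti_add[OF sw[OF fg(1)] sw[OF fg(2)]] distrib_left[of "complex_of_real (xpow \<alpha> x)"] add_divide_distrib [symmetric]
        by (intro divide_right_mono norm_triangle_ineq) auto
      hence "gs_ratio r1 r2 \<alpha> \<beta> x (\<lambda>x. f x + g x) / r (mabs \<alpha> + mabs \<beta>) \<le> (gs_ratio r1 r2 \<alpha> \<beta> x f + gs_ratio r1 r2 \<alpha> \<beta> x g) / r (mabs \<alpha> + mabs \<beta>)"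
        using r by (intro divide_right_mono) (auto simp: less_imp_le)
      thus "gs_ratio r1 r2 \<alpha> \<beta> x (\<lambda>x. f x + g x) / r (mabs \<alpha> + mabs \<beta>) \<le> ?q f + ?q g"
        using up[OF fg(1), of \<alpha> \<beta> x] up[OF fg(2), of \<alpha> \<beta> x] by (simp add: add_divide_distrib)
    qed
  next
    fix f :: "'a \<Rightarrow> complex" and c assume f: "f \<in> GS r1 r2"
    show "?q (\<lambda>x. c * f x) = cmod c * ?q f"
    proof (cases "c = 0")
      case True
      have "0 \<le> ?q (\<lambda>x. c * f x)"
        by (rule order_trans[OF _ up[OF GS_cmult[OF f], of "\<lambda>_. 0" "\<lambda>_. 0" undefined]])
           (use r in \<open>auto simp: gs_ratio_nonneg less_imp_le\<close>)
      thus ?thesis using scale_le[OF f, of c] True by simp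
    next
      case False
      have "?q (\<lambda>x. inverse c * (c * f x)) \<le> cmod (inverse c) * ?q (\<lambda>x. c * f x)" by (rule scale_le[OF GS_cmult[OF f]])
      hence "?q f \<le> cmod (inverse c) * ?q (\<lambda>x. c * f x)" using False by (simp add: mult.assoc [symmetric])
      hence "cmod c * ?q f \<le> cmod c * (cmod (inverse c) * ?q (\<lambda>x. c * f x))" by (rule mult_left_mono) simp
      also have "\<dots> = ?q (\<lambda>x. c * f x)" using False by (simp only: mult.assoc [symmetric] norm_mult [symmetric]) simp
      finally have "cmod c * ?q f \<le> ?q (\<lambda>x. c * f x)" .
      thus ?thesis using scale_le[OF f, of c] by simp
    qed
  next
    fix h :: real assume "h > 0"
    from bound[OF this] obtain C where C: "\<And>f \<alpha> \<beta> x. gs_bdd h r1 r2 f \<Longrightarrow> gs_ratio r1 r2 \<alpha> \<beta> x (f :: 'a \<Rightarrow> complex) / r (mabs \<alpha> + mabs \<beta>) \<le> C * gs_norm h r1 r2 f" by blast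
    show "\<exists>C. \<forall>f\<in>GS r1 r2. gs_bdd h r1 r2 f \<longrightarrow> ?q f \<le> C * gs_norm h r1 r2 f"
      by (intro exI[of _ C] ballI impI least C)
  qed
qed

text \<open>Boundedness is tested on the seminorms \<open>gs_rsup\<close>. The suprema over
  \<open>B\<close> of the ratios of total order \<open>k\<close> are then dominated by every
  admissible \<open>r\<close>, so by \<open>geometric_bound_criterion\<close> they grow
  geometrically, which is a bound in one step.\<close>

lemma gs_bounded_step:
  fixes B :: "('a::euclidean_space \<Rightarrow> complex) set"
  assumes B: "gs_bounded r1 r2 B"
  obtains h P where "h > 0" "\<And>f. f \<in> B \<Longrightarrow> gs_bdd h r1 r2 f" "\<And>f. f \<in> B \<Longrightarrow> gs_norm h r1 r2 f \<le> P"
proof -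
  have BG: "f \<in> GS r1 r2" if "f \<in> B" for f using B that by (auto simp: gs_bounded_def)
  \<comment> \<open>The inserted 0 makes the supremum meaningful and nonnegative even for an empty
    \<open>B\<close>.\<close>
  define A where "A k = insert 0 {gs_ratio r1 r2 \<alpha> \<beta> x f | \<alpha> \<beta> x f. f \<in> B \<and> mabs \<alpha> + mabs \<beta> = k}" for k
  have qb: "\<exists>M. \<forall>k. \<forall>v\<in>A k. v \<le> M * r k"
    if r: "\<And>k. r k > 0" "\<And>h. h > 0 \<Longrightarrow> \<exists>C. \<forall>k. 1 \<le> C * (h ^ k * r k)" for r
  proof -
    have "gs_cseminorm r1 r2 (gs_rsup r r1 r2 :: ('a \<Rightarrow> complex) \<Rightarrow> real)" by (rule gs_cseminorm_rsup(1)) (use r in auto)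
    hence "bdd_above (gs_rsup r r1 r2 ` B)" using B by (simp add: gs_bounded_def)
    then obtain M where M: "\<And>f. f \<in> B \<Longrightarrow> gs_rsup r r1 r2 f \<le> M" by (auto simp: bdd_above_def)
    have "v \<le> max 0 M * r k" if vA: "v \<in> A k" for v k
    proof (cases "v = 0")
      case True thus ?thesis using r(1)[of k] by simp
    next
      case False
      then obtain \<alpha> \<beta> x f where v: "v = gs_ratio r1 r2 \<alpha> \<beta> x f" "f \<in> B" "mabs \<alpha> + mabs \<beta> = k" using vA by (auto simp: A_def)
      have "v \<le> gs_rsup r r1 r2 f * r k" unfolding v(1) v(3)[symmetric] by (rule gs_cseminorm_rsup(2)) (use r BG[OF v(2)] in auto)
      also have "\<dots> \<le> max 0 M * r k" using M[OF v(2)] r(1)[of k] by (intro mult_right_mono) auto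
      finally show ?thesis .
    qed
    thus ?thesis by blast
  qed
  \<comment> \<open>The factorial is one admissible weight; it shows that all suprema are finite
    before the criterion is applied to them.\<close>
  have fact_growth: "\<exists>C. \<forall>k. 1 \<le> C * (h ^ k * fact k)" if h: "h > 0" for h :: real
  proof (intro exI[of _ "exp (1 / h)"] allI)
    fix k
    have "(1 / h) ^ k \<le> fact k * exp (1 / h)" by (rule power_le_fact_exp_real) (use h in auto)
    thus "1 \<le> exp (1 / h) * (h ^ k * fact k)" using h by (simp add: power_divide field_simps)
  qed
  have "\<exists>M. \<forall>k. \<forall>v\<in>A k. v \<le> M * fact k" by (rule qb) (use fact_growth in auto)
  then obtain M where M: "\<And>k v. v \<in> A k \<Longrightarrow> v \<le> M * fact k" by blast
  have bA: "bdd_above (A k)" for k using M by (auto simp: bdd_above_def)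
  define a where "a k = Sup (A k)" for k
  have aup: "v \<le> a k" if "v \<in> A k" for v k unfolding a_def by (rule cSup_upper[OF that bA])
  have "\<exists>C H. H > 0 \<and> (\<forall>k. a k \<le> C * H ^ k)"
  proof (rule geometric_bound_criterion)
    show "a k \<ge> 0" for k by (rule aup) (simp add: A_def)
    fix r :: "nat \<Rightarrow> real" assume r: "\<And>k. r k > 0" "\<And>h. h > 0 \<Longrightarrow> \<exists>C. \<forall>k. 1 \<le> C * (h ^ k * r k)"
    obtain M where M: "\<And>k v. v \<in> A k \<Longrightarrow> v \<le> M * r k" using qb[OF r] by blast
    have "a k \<le> M * r k" for k unfolding a_def by (rule cSup_least[OF _ M]) (simp add: A_def)
    thus "\<exists>M. \<forall>k. a k \<le> M * r k" by blast
  qed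
  then obtain C H where H: "H > 0" "\<And>k. a k \<le> C * H ^ k" by blast
  have bd: "(1/H) ^ (mabs \<alpha> + mabs \<beta>) / (mfact \<alpha> powr r2 * mfact \<beta> powr r1) * cmod (of_real (xpow \<alpha> x) * Dmulti \<beta> f x) \<le> C"
    if f: "f \<in> B" for f \<alpha> \<beta> x
  proof -
    let ?k = "mabs \<alpha> + mabs \<beta>"
    have "gs_ratio r1 r2 \<alpha> \<beta> x f \<le> a ?k" by (rule aup) (use f in \<open>auto simp: A_def\<close>)
    also have "\<dots> \<le> C * H ^ ?k" by (rule H)
    finally have "(1/H) ^ ?k * gs_ratio r1 r2 \<alpha> \<beta> x f \<le> (1/H) ^ ?k * (C * H ^ ?k)" using H by (intro mult_left_mono) auto
    thus ?thesis using H by (simp add: gs_ratio_def power_divide)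
  qed
  show ?thesis by (rule that[of "1/H" C]) (use H gs_bddI[OF bd] gs_norm_leI[OF bd] in auto)
qed

section \<open>Convergence of the wavelet series\<close>

context wavelet_pair begin

lemma GS0_subset:
  fixes g :: "real^'d::finite \<Rightarrow> complex"
  assumes "g \<in> GS0 s' t'" shows "g \<in> GS0 s t"
  using assms r1 r2 GS_mono[of g s' t' s t] by (auto simp: GS0_def s'_def t'_def)

lemma gs_tendsto_expansion:
  fixes g :: "real^'d::finite \<Rightarrow> complex"
  assumes g: "g \<in> GS0 s' t'"
  shows "gs_tendsto s t (\<lambda>F x. \<Sum>lam\<in>F. coef g lam * wpsi \<phi> \<psi> lam x) g (finite_subsets_at_top wLambda)"
  unfolding gs_tendsto_def
proof (intro allI impI)
  fix q :: "(real^'d \<Rightarrow> complex) \<Rightarrow> real" assume q: "gs_cseminorm s t q"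
  obtain h where h: "h > 0" "gs_bdd h s' t' g" using g by (auto simp: GS0_def GS_def)
  obtain k and K :: "('d \<Rightarrow> bool) \<times> int \<times> ('d \<Rightarrow> int) \<Rightarrow> real" where k: "k > 0" "K summable_on wLambda" "\<And>lam. K lam \<ge> 0"
    "\<And>(g :: real^'d \<Rightarrow> complex) F. g \<in> GS0 s' t' \<Longrightarrow> gs_bdd h s' t' g \<Longrightarrow> finite F \<Longrightarrow> F \<subseteq> wLambda \<Longrightarrow>
       gs_bdd k s t (\<lambda>x. (\<Sum>lam\<in>F. coef g lam * wpsi \<phi> \<psi> lam x) - g x) \<and>
       gs_norm k s t (\<lambda>x. (\<Sum>lam\<in>F. coef g lam * wpsi \<phi> \<psi> lam x) - g x) \<le> gs_norm h s' t' g * infsum K (wLambda - F)"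
    using expansion_error[OF h(1), where 'd = 'd] by blast
  obtain C where C: "\<And>f. f \<in> GS s t \<Longrightarrow> gs_bdd k s t f \<Longrightarrow> q f \<le> C * gs_norm k s t f"
    using gs_cseminorm_cont[OF q k(1)] by blast
  show "((\<lambda>F. q (\<lambda>x. (\<Sum>lam\<in>F. coef g lam * wpsi \<phi> \<psi> lam x) - g x)) \<longlongrightarrow> 0) (finite_subsets_at_top wLambda)"
  proof (rule Lim_null_comparison)
    show "((\<lambda>F. \<bar>C\<bar> * gs_norm h s' t' g * infsum K (wLambda - F)) \<longlongrightarrow> 0) (finite_subsets_at_top wLambda)"
      by (intro tendsto_mult_right_zero infsum_tail_tendsto_0 k(2))
    show "\<forall>\<^sub>F F in finite_subsets_at_top wLambda. norm (q (\<lambda>x. (\<Sum>lam\<in>F. coef g lam * wpsi \<phi> \<psi> lam x) - g x)) \<le>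
        \<bar>C\<bar> * gs_norm h s' t' g * infsum K (wLambda - F)"
    proof (rule eventually_finite_subsets_at_top_weakI)
      fix F assume F: "finite F" "F \<subseteq> (wLambda :: (('d \<Rightarrow> bool) \<times> int \<times> ('d \<Rightarrow> int)) set)"
      let ?D = "\<lambda>x. (\<Sum>lam\<in>F. coef g lam * wpsi \<phi> \<psi> lam x) - g x"
      have W: "wpsi \<phi> \<psi> lam \<in> GS s t" if "lam \<in> F" for lam using wpsi_GS0[OF subsetD[OF F(2) that]] unfolding GS0_def by blast
      have "(\<lambda>x. (\<Sum>lam\<in>F. coef g lam * wpsi \<phi> \<psi> lam x) + (-1) * g x) \<in> GS s t"
        using GS0_subset[OF g] by (intro GS_add GS_sum F(1) W GS_cmult) (auto simp: GS0_def)
      hence D: "?D \<in> GS s t" by simp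
      note E = k(4)[OF g h(2) F]
      have "norm (q ?D) = q ?D" using gs_cseminorm_nonneg[OF q D] by simp
      also have "\<dots> \<le> C * gs_norm k s t ?D" using C[OF D] E by blast
      also have "\<dots> \<le> \<bar>C\<bar> * gs_norm k s t ?D" using gs_norm_nonneg[of k s t ?D] E k(1) by (intro mult_right_mono) auto
      also have "\<dots> \<le> \<bar>C\<bar> * (gs_norm h s' t' g * infsum K (wLambda - F))" using E by (intro mult_left_mono) auto
      finally show "norm (q ?D) \<le> \<bar>C\<bar> * gs_norm h s' t' g * infsum K (wLambda - F)" by simp
    qed
  qed
qed

text \<open>A continuous functional is dominated by a seminorm continuous on the step
  \<open>k\<close>, so the error of the expansion passes to it. The majorant depends on
  \<open>T\<close> and \<open>h\<close> but not on the test function.\<close>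

lemma dual_expansion_error:
  fixes T :: "(real^'d::finite \<Rightarrow> complex) \<Rightarrow> complex"
  assumes T: "gs0_dual s t T" and h: "h > 0"
  obtains K where "K summable_on (wLambda :: (('d::finite \<Rightarrow> bool) \<times> int \<times> ('d \<Rightarrow> int)) set)" "\<And>lam. K lam \<ge> 0"
    "\<And>g F. g \<in> GS0 s' t' \<Longrightarrow> gs_bdd h s' t' g \<Longrightarrow> finite F \<Longrightarrow> F \<subseteq> wLambda \<Longrightarrow>
       cmod (T g - (\<Sum>lam\<in>F. T (wpsi \<phi> \<psi> lam) * coef g lam)) \<le> gs_norm h s' t' g * infsum K (wLambda - F)"
proof -
  obtain q where q: "gs_cseminorm s t q" "\<And>f. f \<in> GS0 s t \<Longrightarrow> cmod (T f) \<le> q f" using T by (auto simp: gs0_dual_def)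
  obtain k and K :: "('d \<Rightarrow> bool) \<times> int \<times> ('d \<Rightarrow> int) \<Rightarrow> real" where k: "k > 0" "K summable_on wLambda" "\<And>lam. K lam \<ge> 0"
    "\<And>(g :: real^'d \<Rightarrow> complex) F. g \<in> GS0 s' t' \<Longrightarrow> gs_bdd h s' t' g \<Longrightarrow> finite F \<Longrightarrow> F \<subseteq> wLambda \<Longrightarrow>
       gs_bdd k s t (\<lambda>x. (\<Sum>lam\<in>F. coef g lam * wpsi \<phi> \<psi> lam x) - g x) \<and>
       gs_norm k s t (\<lambda>x. (\<Sum>lam\<in>F. coef g lam * wpsi \<phi> \<psi> lam x) - g x) \<le> gs_norm h s' t' g * infsum K (wLambda - F)"
    using expansion_error[OF h, where 'd = 'd] by blast
  obtain C where C: "\<And>f. f \<in> GS s t \<Longrightarrow> gs_bdd k s t f \<Longrightarrow> q f \<le> C * gs_norm k s t f"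
    using gs_cseminorm_cont[OF q(1) k(1)] by blast
  have t0: "t > 0" by (rule exps)
  show ?thesis
  proof (rule that[of "\<lambda>lam. \<bar>C\<bar> * K lam"])
    show "(\<lambda>lam. \<bar>C\<bar> * K lam) summable_on wLambda" by (rule summable_on_cmult_right[OF k(2)])
    show "\<bar>C\<bar> * K lam \<ge> 0" for lam using k(3) by simp
    fix g :: "real^'d \<Rightarrow> complex" and F assume g: "g \<in> GS0 s' t'" "gs_bdd h s' t' g" and F: "finite F" "F \<subseteq> (wLambda :: (('d \<Rightarrow> bool) \<times> int \<times> ('d \<Rightarrow> int)) set)"
    let ?D = "\<lambda>x. (\<Sum>lam\<in>F. coef g lam * wpsi \<phi> \<psi> lam x) - g x"
    note E = k(4)[OF g F]
    have S: "(\<lambda>x. \<Sum>lam\<in>F. coef g lam * wpsi \<phi> \<psi> lam x) \<in> GS0 s t \<and>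
        T (\<lambda>x. \<Sum>lam\<in>F. coef g lam * wpsi \<phi> \<psi> lam x) = (\<Sum>lam\<in>F. coef g lam * T (wpsi \<phi> \<psi> lam))"
      by (rule dual_sum[OF T t0 F(1)]) (use F(2) in \<open>auto intro: wpsi_GS0\<close>)
    have g': "(\<lambda>x. (-1) * g x) \<in> GS0 s t" by (rule GS0_cmult[OF GS0_subset[OF g(1)]])
    have D: "?D \<in> GS0 s t" using GS0_add[OF conjunct1[OF S] g' t0] by simp
    have "T ?D = (\<Sum>lam\<in>F. coef g lam * T (wpsi \<phi> \<psi> lam)) - T g"
      using gs0_dual_add[OF T conjunct1[OF S] g'] gs0_dual_cmult[OF T GS0_subset[OF g(1)], of "-1"] S by simp
    hence "cmod (T g - (\<Sum>lam\<in>F. T (wpsi \<phi> \<psi> lam) * coef g lam)) = cmod (T ?D)"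
      by (simp add: norm_minus_commute mult.commute)
    also have "\<dots> \<le> q ?D" by (rule q(2)[OF D])
    also have "\<dots> \<le> C * gs_norm k s t ?D" using C[of ?D] D E by (auto simp: GS0_def)
    also have "\<dots> \<le> \<bar>C\<bar> * gs_norm k s t ?D" using gs_norm_nonneg[of k s t ?D] E k(1) by (intro mult_right_mono) auto
    also have "\<dots> \<le> \<bar>C\<bar> * (gs_norm h s' t' g * infsum K (wLambda - F))" using E by (intro mult_left_mono) auto
    also have "\<dots> = gs_norm h s' t' g * (\<Sum>\<^sub>\<infinity>lam\<in>wLambda - F. \<bar>C\<bar> * K lam)" by (simp add: infsum_cmult_right')
    finally show "cmod (T g - (\<Sum>lam\<in>F. T (wpsi \<phi> \<psi> lam) * coef g lam)) \<le> gs_norm h s' t' g * (\<Sum>\<^sub>\<infinity>lam\<in>wLambda - F. \<bar>C\<bar> * K lam)" .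
  qed
qed

lemma strong_dual_expansion:
  fixes T :: "(real^'d::finite \<Rightarrow> complex) \<Rightarrow> complex"
  assumes T: "gs0_dual s t T" and B: "B \<subseteq> GS0 s' t'" "gs_bounded s' t' B" and e: "e > 0"
  shows "\<forall>\<^sub>F F in finite_subsets_at_top wLambda. \<forall>g\<in>B. cmod (T g - (\<Sum>lam\<in>F. T (wpsi \<phi> \<psi> lam) * coef g lam)) < e"
proof -
  obtain h P where h: "h > 0" "\<And>f. f \<in> B \<Longrightarrow> gs_bdd h s' t' f" "\<And>f. f \<in> B \<Longrightarrow> gs_norm h s' t' f \<le> P"
    using gs_bounded_step[OF B(2)] by blast
  obtain K where K: "K summable_on (wLambda :: (('d::finite \<Rightarrow> bool) \<times> int \<times> ('d \<Rightarrow> int)) set)" "\<And>lam. K lam \<ge> 0"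
    "\<And>g F. g \<in> GS0 s' t' \<Longrightarrow> gs_bdd h s' t' g \<Longrightarrow> finite F \<Longrightarrow> F \<subseteq> wLambda \<Longrightarrow>
       cmod (T g - (\<Sum>lam\<in>F. T (wpsi \<phi> \<psi> lam) * coef g lam)) \<le> gs_norm h s' t' g * infsum K (wLambda - F)"
    using dual_expansion_error[OF T h(1)] by blast
  have "((\<lambda>F. P * infsum K (wLambda - F)) \<longlongrightarrow> 0) (finite_subsets_at_top wLambda)"
    by (intro tendsto_mult_right_zero infsum_tail_tendsto_0 K(1))
  hence "\<forall>\<^sub>F F in finite_subsets_at_top wLambda. P * infsum K (wLambda - F) < e" using e by (rule order_tendstoD)
  moreover have "\<forall>\<^sub>F F in finite_subsets_at_top wLambda. finite F \<and> F \<subseteq> wLambda"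
    by (rule eventually_finite_subsets_at_top_weakI) auto
  ultimately show ?thesis
  proof eventually_elim
    case (elim F)
    show ?case
    proof
      fix g assume g: "g \<in> B"
      have "cmod (T g - (\<Sum>lam\<in>F. T (wpsi \<phi> \<psi> lam) * coef g lam)) \<le> gs_norm h s' t' g * infsum K (wLambda - F)"
        using K(3)[of g F] g B(1) h(2) elim by blast
      also have "\<dots> \<le> P * infsum K (wLambda - F)" using h(3)[OF g] K(2) by (intro mult_right_mono infsum_nonneg)
      also have "\<dots> < e" using elim by simp
      finally show "cmod (T g - (\<Sum>lam\<in>F. T (wpsi \<phi> \<psi> lam) * coef g lam)) < e" .
    qed
  qed
qed

text \<open>A single test function is a bounded set, so convergence for the strong topology
  specialises to it.\<close>

lemma parseval:
  fixes T :: "(real^'d::finite \<Rightarrow> complex) \<Rightarrow> complex"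
  assumes T: "gs0_dual s t T" and g: "g \<in> GS0 s' t'"
  shows "((\<lambda>lam. T (wpsi \<phi> \<psi> lam) * coef g lam) has_sum T g) wLambda"
proof -
  have "gs_bounded s' t' {g}" using g by (auto simp: gs_bounded_def GS0_def)
  hence "\<forall>\<^sub>F F in finite_subsets_at_top wLambda. dist (\<Sum>lam\<in>F. T (wpsi \<phi> \<psi> lam) * coef g lam) (T g) < e" if "e > 0" for e
    using strong_dual_expansion[OF T _ _ that, of "{g}"] g by (simp add: dist_norm norm_minus_commute)
  thus ?thesis unfolding has_sum_def by (intro tendstoI) auto
qed

end

text \<open>The only place where the multiresolution approximation is handed over to the locale, in
  the form of its two kernel identities.\<close>

lemma regular_wavelet_pair:
  assumes "\<rho>1 \<ge> 0" and "\<rho>2 > 1" and "\<psi> \<in> GS0 \<rho>1 \<rho>2" and rw: "regular_wavelet \<rho>1 \<rho>2 \<phi> \<psi>"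
    and "s > \<rho>1 + \<rho>2 - 1" and "t > \<rho>1 + \<rho>2 - 1 + 1"
  shows "wavelet_pair \<phi> \<psi> \<rho>1 \<rho>2 s t"
proof
  have G: "\<phi> \<in> GS \<rho>1 \<rho>2" "\<psi> \<in> GS \<rho>1 \<rho>2" using rw by (auto simp: regular_wavelet_def)
  have r2: "\<rho>2 > 0" using assms by simp
  obtain V where V: "is_mra V \<phi>" "assoc_wavelet V \<psi>" using rw by (auto simp: regular_wavelet_def)
  obtain C C' where rp: "rapid \<phi> C" "rapid \<psi> C'" using GS_rapid[OF G(1) r2] GS_rapid[OF G(2) r2] by metis
  show "2 * kern \<phi> (2 * x) (2 * y) = kern \<phi> x y + kern \<psi> x y" for x y by (rule two_scale_kernel[OF V rp])
  show "kint \<phi> x = 1" for x by (rule kint_eq_1[OF V(1) rp(1)])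
  show "\<phi> \<in> GS \<rho>1 \<rho>2" by (rule G)
qed (use assms in auto)

theorem theorem5p1:
  fixes \<rho>1 \<rho>2 s t :: real
    and \<phi> \<psi> :: "real \<Rightarrow> complex"
  assumes "\<rho>1 \<ge> 0" and "\<rho>2 > 1"
    and "\<psi> \<in> GS0 \<rho>1 \<rho>2"
    and "regular_wavelet \<rho>1 \<rho>2 \<phi> \<psi>"
    and "s > \<rho>1 + \<rho>2 - 1" and "t > \<rho>1 + \<rho>2 - 1 + 1"
  shows
    "(\<forall>g :: real ^ 'd::finite \<Rightarrow> complex.
        g \<in> GS0 (s - (\<rho>1 + \<rho>2 - 1)) (t - (\<rho>1 + \<rho>2 - 1)) \<longrightarrow>
        gs_tendsto s t
          (\<lambda>F. \<lambda>x. \<Sum>lam\<in>F. (LINT y|lborel. g y * cnj (wpsi \<phi> \<psi> lam y)) * wpsi \<phi> \<psi> lam x)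
          g (finite_subsets_at_top wLambda))
   \<and> (\<forall>f :: (real ^ 'd \<Rightarrow> complex) \<Rightarrow> complex. gs0_dual s t f \<longrightarrow>
        (\<forall>B. B \<subseteq> GS0 (s - (\<rho>1 + \<rho>2 - 1)) (t - (\<rho>1 + \<rho>2 - 1)) \<and>
             gs_bounded (s - (\<rho>1 + \<rho>2 - 1)) (t - (\<rho>1 + \<rho>2 - 1)) B \<longrightarrow>
          (\<forall>e>0. eventually (\<lambda>F. \<forall>g\<in>B.
              cmod (f g - (\<Sum>lam\<in>F. f (\<lambda>y. cnj (wpsi \<phi> \<psi> lam y)) *
                              (LINT y|lborel. wpsi \<phi> \<psi> lam y * g y))) < e)
            (finite_subsets_at_top wLambda))))
   \<and> (\<forall>(f :: (real ^ 'd \<Rightarrow> complex) \<Rightarrow> complex) g. gs0_dual s t f \<longrightarrow>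
        g \<in> GS0 (s - (\<rho>1 + \<rho>2 - 1)) (t - (\<rho>1 + \<rho>2 - 1)) \<longrightarrow>
        ((\<lambda>lam. f (\<lambda>y. cnj (wpsi \<phi> \<psi> lam y)) * (LINT y|lborel. g y * wpsi \<phi> \<psi> lam y))
           has_sum f g) wLambda)"
proof -
  interpret w: wavelet_pair \<phi> \<psi> \<rho>1 \<rho>2 s t by (rule regular_wavelet_pair[OF assms])
  \<comment> \<open>The last two statements are the expansion for this pair: its wavelets are the
    functions on which \<open>f\<close> is evaluated, and its coefficients integrate the test
    function against the original wavelets.\<close>
  interpret c: wavelet_pair "\<lambda>x. cnj (\<phi> x)" "\<lambda>x. cnj (\<psi> x)" \<rho>1 \<rho>2 s t by (rule w.wavelet_pair_cnj)
  have W: "wpsi (\<lambda>x. cnj (\<phi> x)) (\<lambda>x. cnj (\<psi> x)) lam = (\<lambda>y. cnj (wpsi \<phi> \<psi> lam y))"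
    for lam :: "('d \<Rightarrow> bool) \<times> int \<times> ('d \<Rightarrow> int)" by (rule ext) (rule wpsi_cnj)
  have coef: "c.coef g lam = (LINT y|lborel. g y * wpsi \<phi> \<psi> lam y)" "c.coef g lam = (LINT y|lborel. wpsi \<phi> \<psi> lam y * g y)"
    for g :: "real^'d \<Rightarrow> complex" and lam by (simp_all add: c.coef_def W mult.commute)
  show ?thesis
  proof (intro conjI allI impI)
    fix g :: "real^'d \<Rightarrow> complex" assume "g \<in> GS0 (s - (\<rho>1 + \<rho>2 - 1)) (t - (\<rho>1 + \<rho>2 - 1))"
    thus "gs_tendsto s t (\<lambda>F x. \<Sum>lam\<in>F. (LINT y|lborel. g y * cnj (wpsi \<phi> \<psi> lam y)) * wpsi \<phi> \<psi> lam x) g (finite_subsets_at_top wLambda)"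
      using w.gs_tendsto_expansion[of g] by (simp only: w.coef_def w.s'_def w.t'_def)
  next
    fix f :: "(real^'d \<Rightarrow> complex) \<Rightarrow> complex" and B :: "(real^'d \<Rightarrow> complex) set" and e :: real
    assume "gs0_dual s t f" "B \<subseteq> GS0 (s - (\<rho>1 + \<rho>2 - 1)) (t - (\<rho>1 + \<rho>2 - 1)) \<and>
             gs_bounded (s - (\<rho>1 + \<rho>2 - 1)) (t - (\<rho>1 + \<rho>2 - 1)) B" "0 < e"
    thus "\<forall>\<^sub>F F in finite_subsets_at_top wLambda. \<forall>g\<in>B.
              cmod (f g - (\<Sum>lam\<in>F. f (\<lambda>y. cnj (wpsi \<phi> \<psi> lam y)) * (LINT y|lborel. wpsi \<phi> \<psi> lam y * g y))) < e"
      using c.strong_dual_expansion[of f B e] by (simp only: c.s'_def c.t'_def W coef(2))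
  next
    fix f :: "(real^'d \<Rightarrow> complex) \<Rightarrow> complex" and g :: "real^'d \<Rightarrow> complex"
    assume "gs0_dual s t f" "g \<in> GS0 (s - (\<rho>1 + \<rho>2 - 1)) (t - (\<rho>1 + \<rho>2 - 1))"
    thus "((\<lambda>lam. f (\<lambda>y. cnj (wpsi \<phi> \<psi> lam y)) * (LINT y|lborel. g y * wpsi \<phi> \<psi> lam y)) has_sum f g) wLambda"
      using c.parseval[of f g] by (simp only: c.s'_def c.t'_def W coef(1))
  qed
qed

end
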